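(* Let $\Omega\subset\mathbb{R}^d$ ($d\ge 1$) be a bounded domain with Lipschitz boundary, let $T>0$, and let $a:\mathbb{R}\to\mathbb{R}^+$ satisfy: (i) there exist constants $0<m\le M<\infty$ with $m\le a(s)\le M$ for all $s\in\mathbb{R}$; (ii) $a$ is Lipschitz continuous with Lipschitz constant $L_M$. For $v$ a function on $\Omega$ set $l(v)=\int_\Omega v\,d\Omega$. Let $f\in W^*=L^2(0,T;H^{-1}(\Omega))$. Then there exists a unique $u\in V$ such that $$\int_0^T\langle \partial_t u, v\rangle\,dt+\int_0^T\int_\Omega a(l(u(\cdot,t)))\,\nabla u\cdot\nabla v\,d\Omega\,dt=\int_0^T\langle f,v\rangle\,dt\qquad\forall v\in W.$$
   Context: $W=L^2(0,T;H^1_0(\Omega))$, with dual $W^*=L^2(0,T;H^{-1}(\Omega))$, where $H^{-1}(\Omega)$ is the dual of $H^1_0(\Omega)$ and $\langle\cdot,\cdot\rangle$ denotes the $H^{-1}$–$H^1_0$ duality pairing. $V=\{v\in L^2(0,T;H^1_0(\Omega)) : \partial_t v\in L^2(0,T;H^{-1}(\Omega)),\ v(\cdot,0)=0\}$ with norm $\|v\|_V^2=\|\partial_t v\|^2_{L^2(0,T;H^{-1}(\Omega))}+\|v\|^2_{L^2(0,T;H^1_0(\Omega))}$. This is the space-time weak formulation of $\partial_t u-a(l(u))\Delta u=f$ in $\Omega\times(0,T)$, $u=0$ on $\partial\Omega\times(0,T)$, $u(\cdot,0)=0$. *)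

theory Defs
  imports "HOL-Analysis.Analysis"
begin

coinductive smooth_fun :: "('a::euclidean_space \<Rightarrow> real) \<Rightarrow> bool" where
  "\<lbrakk> continuous_on UNIV f; \<forall>x. f differentiable (at x);
     \<forall>i\<in>Basis. smooth_fun (\<lambda>x. frechet_derivative f (at x) i) \<rbrakk> \<Longrightarrow> smooth_fun f"

definition tsupp :: "('a::euclidean_space \<Rightarrow> real) \<Rightarrow> 'a set" where
  "tsupp f = closure {x. f x \<noteq> 0}"

definition test_fun :: "'a::euclidean_space set \<Rightarrow> ('a \<Rightarrow> real) \<Rightarrow> bool" where
  "test_fun \<Omega> \<phi> \<longleftrightarrow> smooth_fun \<phi> \<and> compact (tsupp \<phi>) \<and> tsupp \<phi> \<subseteq> \<Omega>"

definition grad :: "('a::euclidean_space \<Rightarrow> real) \<Rightarrow> 'a \<Rightarrow> 'a" where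
  "grad \<phi> x = (\<Sum>i\<in>Basis. frechet_derivative \<phi> (at x) i *\<^sub>R i)"

text \<open>Bounded domain with Lipschitz boundary: locally near each boundary point, Omega is
  the region strictly below the graph of a Lipschitz function, in some Cartesian
  coordinate system (e is the unit vector of the last coordinate axis, the graph
  function is defined on the orthogonal hyperplane).\<close>
definition lipschitz_domain :: "'a::euclidean_space set \<Rightarrow> bool" where
  "lipschitz_domain \<Omega> \<longleftrightarrow> open \<Omega> \<and> connected \<Omega> \<and> bounded \<Omega> \<and> \<Omega> \<noteq> {} \<and>
     (\<forall>p\<in>frontier \<Omega>. \<exists>e r \<gamma> C. norm e = 1 \<and> r > 0 \<and>
        C-lipschitz_on {y. y \<bullet> e = 0} \<gamma> \<and>
        \<Omega> \<inter> ball p r = {x \<in> ball p r. x \<bullet> e < \<gamma> (x - (x \<bullet> e) *\<^sub>R e)})"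

definition L2 :: "'a::euclidean_space set \<Rightarrow> ('a \<Rightarrow> 'b::euclidean_space) \<Rightarrow> bool" where
  "L2 \<Omega> u \<longleftrightarrow> u \<in> borel_measurable (lebesgue_on \<Omega>) \<and>
     integrable (lebesgue_on \<Omega>) (\<lambda>x. (norm (u x))\<^sup>2)"

definition weak_grad :: "'a::euclidean_space set \<Rightarrow> ('a \<Rightarrow> real) \<Rightarrow> ('a \<Rightarrow> 'a) \<Rightarrow> bool" where
  "weak_grad \<Omega> u g \<longleftrightarrow> (\<forall>\<phi>. test_fun \<Omega> \<phi> \<longrightarrow> (\<forall>i\<in>Basis.
     integral\<^sup>L (lebesgue_on \<Omega>) (\<lambda>x. u x * frechet_derivative \<phi> (at x) i) =
     - integral\<^sup>L (lebesgue_on \<Omega>) (\<lambda>x. (g x \<bullet> i) * \<phi> x)))"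

definition H10 :: "'a::euclidean_space set \<Rightarrow> ('a \<Rightarrow> real) \<Rightarrow> ('a \<Rightarrow> 'a) \<Rightarrow> bool" where
  "H10 \<Omega> u g \<longleftrightarrow> L2 \<Omega> u \<and> L2 \<Omega> g \<and> weak_grad \<Omega> u g \<and>
     (\<exists>\<phi>::nat \<Rightarrow> 'a \<Rightarrow> real. (\<forall>n. test_fun \<Omega> (\<phi> n)) \<and>
        (\<lambda>n. integral\<^sup>L (lebesgue_on \<Omega>) (\<lambda>x. (u x - \<phi> n x)\<^sup>2)
            + integral\<^sup>L (lebesgue_on \<Omega>) (\<lambda>x. (norm (g x - grad (\<phi> n) x))\<^sup>2))
        \<longlonglongrightarrow> 0)"

abbreviation cyl :: "real \<Rightarrow> 'a set \<Rightarrow> (real \<times> 'a) set" where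
  "cyl T \<Omega> \<equiv> {0<..<T} \<times> \<Omega>"

text \<open>v belongs to W = L^2(0,T;H^1_0(Omega)), G being its (jointly measurable) spatial
  weak gradient.\<close>
definition W_grad :: "'a::euclidean_space set \<Rightarrow> real \<Rightarrow> (real \<Rightarrow> 'a \<Rightarrow> real)
    \<Rightarrow> (real \<Rightarrow> 'a \<Rightarrow> 'a) \<Rightarrow> bool" where
  "W_grad \<Omega> T v G \<longleftrightarrow>
     (\<lambda>(t,x). v t x) \<in> borel_measurable (lebesgue_on (cyl T \<Omega>)) \<and>
     (\<lambda>(t,x). G t x) \<in> borel_measurable (lebesgue_on (cyl T \<Omega>)) \<and>
     integrable (lebesgue_on (cyl T \<Omega>)) (\<lambda>(t,x). (v t x)\<^sup>2 + (norm (G t x))\<^sup>2) \<and>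
     (AE t in lebesgue_on {0<..<T}. H10 \<Omega> (v t) (G t))"

definition W_norm :: "'a::euclidean_space set \<Rightarrow> real \<Rightarrow> (real \<Rightarrow> 'a \<Rightarrow> real)
    \<Rightarrow> (real \<Rightarrow> 'a \<Rightarrow> 'a) \<Rightarrow> real" where
  "W_norm \<Omega> T v G = sqrt (integral\<^sup>L (lebesgue_on (cyl T \<Omega>))
      (\<lambda>(t,x). (v t x)\<^sup>2 + (norm (G t x))\<^sup>2))"

definition inW :: "'a::euclidean_space set \<Rightarrow> real \<Rightarrow> (real \<Rightarrow> 'a \<Rightarrow> real) \<Rightarrow> bool" where
  "inW \<Omega> T v \<longleftrightarrow> (\<exists>G. W_grad \<Omega> T v G)"

text \<open>F is an element of W* = L^2(0,T;H^{-1}(Omega)), represented as a bounded linear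
  functional on W; F v stands for the integral over (0,T) of the pairing of F with v.\<close>
definition in_Wdual :: "'a::euclidean_space set \<Rightarrow> real \<Rightarrow> ((real \<Rightarrow> 'a \<Rightarrow> real) \<Rightarrow> real) \<Rightarrow> bool" where
  "in_Wdual \<Omega> T F \<longleftrightarrow>
     (\<forall>v w \<alpha> \<beta>. inW \<Omega> T v \<longrightarrow> inW \<Omega> T w \<longrightarrow>
        F (\<lambda>t x. \<alpha> * v t x + \<beta> * w t x) = \<alpha> * F v + \<beta> * F w) \<and>
     (\<exists>C. \<forall>v G. W_grad \<Omega> T v G \<longrightarrow> \<bar>F v\<bar> \<le> C * W_norm \<Omega> T v G)"

text \<open>U in W* is the weak time derivative of u (in the sense of H^{-1}-valued distributions
  on (0,T), tested against products eta(t) phi(x)).\<close>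
definition time_deriv :: "'a::euclidean_space set \<Rightarrow> real \<Rightarrow> (real \<Rightarrow> 'a \<Rightarrow> real)
    \<Rightarrow> ((real \<Rightarrow> 'a \<Rightarrow> real) \<Rightarrow> real) \<Rightarrow> bool" where
  "time_deriv \<Omega> T u U \<longleftrightarrow> in_Wdual \<Omega> T U \<and>
     (\<forall>\<eta> \<phi>. test_fun {0<..<T} \<eta> \<longrightarrow> test_fun \<Omega> \<phi> \<longrightarrow>
        integral\<^sup>L (lebesgue_on (cyl T \<Omega>)) (\<lambda>(t,x). u t x * \<phi> x * deriv \<eta> t)
        = - U (\<lambda>t x. \<eta> t * \<phi> x))"

definition zero_initial :: "'a::euclidean_space set \<Rightarrow> real \<Rightarrow> (real \<Rightarrow> 'a \<Rightarrow> real) \<Rightarrow> bool" where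
  "zero_initial \<Omega> T u \<longleftrightarrow> (\<exists>w. (AE p in lebesgue_on (cyl T \<Omega>). w (fst p) (snd p) = u (fst p) (snd p)) \<and>
     (\<forall>t\<in>{0..T}. L2 \<Omega> (w t)) \<and>
     (\<forall>t0\<in>{0..T}. ((\<lambda>t. integral\<^sup>L (lebesgue_on \<Omega>) (\<lambda>x. (w t x - w t0 x)\<^sup>2)) \<longlongrightarrow> 0)
                     (at t0 within {0..T})) \<and>
     integral\<^sup>L (lebesgue_on \<Omega>) (\<lambda>x. (w 0 x)\<^sup>2) = 0)"

definition inV :: "'a::euclidean_space set \<Rightarrow> real \<Rightarrow> (real \<Rightarrow> 'a \<Rightarrow> real) \<Rightarrow> bool" where
  "inV \<Omega> T u \<longleftrightarrow> inW \<Omega> T u \<and> (\<exists>U. time_deriv \<Omega> T u U) \<and> zero_initial \<Omega> T u"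

definition l_int :: "'a::euclidean_space set \<Rightarrow> ('a \<Rightarrow> real) \<Rightarrow> real" where
  "l_int \<Omega> v = integral\<^sup>L (lebesgue_on \<Omega>) v"

definition weak_solution :: "'a::euclidean_space set \<Rightarrow> real \<Rightarrow> (real \<Rightarrow> real)
    \<Rightarrow> ((real \<Rightarrow> 'a \<Rightarrow> real) \<Rightarrow> real) \<Rightarrow> (real \<Rightarrow> 'a \<Rightarrow> real) \<Rightarrow> bool" where
  "weak_solution \<Omega> T a F u \<longleftrightarrow> inV \<Omega> T u \<and>
     (\<exists>Gu U. W_grad \<Omega> T u Gu \<and> time_deriv \<Omega> T u U \<and>
       (\<forall>v Gv. W_grad \<Omega> T v Gv \<longrightarrow>
          U v + integral\<^sup>L (lebesgue_on (cyl T \<Omega>))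
                  (\<lambda>(t,x). a (l_int \<Omega> (u t)) * (Gu t x \<bullet> Gv t x))
          = F v))"

end

theory Submission
  imports Defs
begin

text \<open>
  A function on space-time is treated together with its spatial gradient as one element \<open>h\<close> of a
  space of square integrable functions; \<open>P0\<close> and \<open>P1\<close> project to the two parts, \<open>J\<close> integrates
  from time \<open>0\<close>, and elements of \<open>W\<^sup>*\<close> become elements of the Hilbert space by Riesz' theorem.

  For a measurable coefficient \<open>\<alpha>(t)\<close> with values in \<open>[m, M]\<close> the linear problem asks for
  \<open>v = \<partial>\<^sub>t u\<close> with \<open>P0 v + \<alpha> P1 (J v) = f\<close> on \<open>W\<close>. The operator on the left has dense range, as one
  sees by testing an element \<open>z\<close> orthogonal to the range with \<open>v = \<alpha> z\<close>. The energy estimate bounds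
  \<open>J v\<close> in \<open>W\<close> and \<open>P0 (J v)\<close> uniformly in time, so the primitives of approximate solutions converge to a
  solution \<open>u\<close> with a representative \<open>w\<close> that is continuous in time.

  For the nonlocal problem put \<open>\<alpha>(t) = a(l(u(t - h)))\<close>. For \<open>h > 0\<close> this is solved in finitely many
  steps. The functions \<open>l(u\<^sub>h)\<close> are equicontinuous, because \<open>1\<close> is an \<open>L\<^sup>2\<close>-limit of functions in
  \<open>H\<^sup>1\<^sub>0\<close>, against which \<open>w\<close> is Hoelder continuous. The energy estimate for a difference
  contains \<open>\<integral> |\<alpha>\<^sub>1 - \<alpha>\<^sub>2|\<^sup>2 \<parallel>\<nabla>u\<^sub>2\<parallel>\<^sup>2\<close>, and Gronwall's inequality with the
  integrable weight \<open>\<parallel>\<nabla>u\<^sub>2\<parallel>\<^sup>2\<close> turns it into convergence as \<open>h\<close> tends to \<open>0\<close> and into uniqueness.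
\<close>

section \<open>Orthogonal projection and Riesz representation\<close>

text \<open>The residual of the equation controls the primitive \<open>J T v\<close> but not
  \<open>v\<close>, since the time derivative of a solution is only a functional on W. So dense
  range is all that is asked of the operator, and a solution is defined as a limit of primitives;
  H^{-1} is never built as a space, and the time derivative reappears at the end as the vector
  \<open>f - \<alpha> P1 u\<close> acting on W by the inner product. Testing with
  \<open>\<alpha> z\<close> works because integration in time is monotone: the product of
  \<open>y\<close> with its primitive over (0,T) is half the squared norm of the integral of
  \<open>y\<close>. The same device replaces the chain rule for weak solutions, for which no energy
  identity is at hand. The factor multiplying the difference of two coefficients is a squared
  gradient norm, integrable in time but not bounded, so a contraction argument has no step length
  uniform over solutions. The constant in Gronwall's inequality therefore has to depend on the mass
  of the weight alone; the energy estimate bounds that mass by the norm of the right-hand side,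
  uniformly in all coefficients and delays.\<close>

lemma orth_proj:
  fixes S :: "'h::{real_inner,complete_space} set"
  assumes S: "subspace S"
  obtains p where "p \<in> closure S" "\<And>s. s \<in> S \<Longrightarrow> inner (x - p) s = 0"
proof -
  define d where "d = infdist x S"
  have ne: "S \<noteq> {}" using subspace_0[OF S] by auto
  have d0: "d \<ge> 0" by (simp add: d_def infdist_nonneg)
  have dle: "d \<le> norm (x - s)" if "s \<in> S" for s
    using infdist_le[OF that, of x] by (simp add: d_def dist_norm)
  have "\<exists>s\<in>S. norm (x - s) < d + 1 / real (Suc n)" for n
  proof (rule ccontr)
    assume "\<not> ?thesis"
    then have "\<And>s. s \<in> S \<Longrightarrow> d + 1 / real (Suc n) \<le> dist x s" by (force simp: dist_norm not_less)
    then have "d + 1 / real (Suc n) \<le> infdist x S"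
      using ne by (auto simp: infdist_def intro!: cINF_greatest)
    then show False using d_def by (auto simp add: divide_simps split: if_splits)
  qed
  then obtain s where sS: "\<And>n. s n \<in> S" and s: "\<And>n. norm (x - s n) < d + 1 / real (Suc n)"
    by metis
  have lim: "(\<lambda>n. norm (x - s n)) \<longlonglongrightarrow> d"
  proof (rule tendsto_sandwich[of "\<lambda>_. d" _ _ "\<lambda>n. d + 1 / real (Suc n)"])
    show "(\<lambda>n. d + 1 / real (Suc n)) \<longlonglongrightarrow> d"
      using tendsto_add[OF tendsto_const LIMSEQ_inverse_real_of_nat, of d]
      by (simp add: field_simps)
  qed (use dle[OF sS] s in \<open>auto intro!: always_eventually less_imp_le\<close>)
  \<comment> \<open>Parallelogram law for \<open>x - s m\<close> and \<open>x - s n\<close>; their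
    mean is the vector from the midpoint, which lies in S, so its norm is at least
    \<open>d\<close>.\<close>
  have par: "(norm (s m - s n))\<^sup>2 \<le> 2 * (norm (x - s m))\<^sup>2 + 2 * (norm (x - s n))\<^sup>2 - 4 * d\<^sup>2" for m n
  proof -
    have "(1/2) *\<^sub>R (s m + s n) \<in> S" using S sS by (simp add: subspace_add subspace_scale)
    then have "d \<le> norm (x - (1/2) *\<^sub>R (s m + s n))" by (rule dle)
    then have "d\<^sup>2 \<le> (norm (x - (1/2) *\<^sub>R (s m + s n)))\<^sup>2" using d0 by (simp add: power_mono)
    moreover have "(norm (s m - s n))\<^sup>2 + 4 * (norm (x - (1/2) *\<^sub>R (s m + s n)))\<^sup>2
        = 2 * (norm (x - s m))\<^sup>2 + 2 * (norm (x - s n))\<^sup>2"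
      by (simp add: power2_norm_eq_inner inner_diff_left inner_diff_right inner_add_left inner_add_right
          inner_commute algebra_simps)
    ultimately show ?thesis by linarith
  qed
  have "Cauchy s"
  proof (rule metric_CauchyI)
    fix e :: real assume e: "e > 0"
    have "(\<lambda>n. (norm (x - s n))\<^sup>2) \<longlonglongrightarrow> d\<^sup>2" using lim by (intro tendsto_intros)
    then have "\<forall>\<^sub>F n in sequentially. (norm (x - s n))\<^sup>2 < d\<^sup>2 + e\<^sup>2 / 4"
      by (rule order_tendstoD) (use e in simp)
    then obtain N where N: "\<And>n. n \<ge> N \<Longrightarrow> (norm (x - s n))\<^sup>2 < d\<^sup>2 + e\<^sup>2 / 4"
      by (auto simp: eventually_sequentially)
    have "dist (s m) (s n) < e" if "m \<ge> N" "n \<ge> N" for m n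
    proof -
      have "(norm (s m - s n))\<^sup>2 < e\<^sup>2" using par[of m n] N[OF that(1)] N[OF that(2)] by linarith
      then show ?thesis using e by (simp add: dist_norm power2_less_imp_less)
    qed
    then show "\<exists>N. \<forall>m\<ge>N. \<forall>n\<ge>N. dist (s m) (s n) < e" by blast
  qed
  then obtain p where p: "s \<longlonglongrightarrow> p" using Cauchy_convergent convergent_def by blast
  have pc: "p \<in> closure S" using p sS closure_sequential by blast
  have np: "norm (x - p) = d"
    by (rule LIMSEQ_unique[OF _ lim]) (intro tendsto_intros p)
  have "inner (x - p) t = 0" if t: "t \<in> S" for t
  proof -
    \<comment> \<open>\<open>p\<close> is only in the closure of S, so minimality is inherited from
      the points \<open>s n + r t\<close> in the limit.\<close>
    have dp: "d \<le> norm (x - (p + r *\<^sub>R t))" for r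
    proof (rule LIMSEQ_le_const)
      show "(\<lambda>n. norm (x - (s n + r *\<^sub>R t))) \<longlonglongrightarrow> norm (x - (p + r *\<^sub>R t))"
        by (intro tendsto_intros p)
      show "\<exists>N. \<forall>n\<ge>N. d \<le> norm (x - (s n + r *\<^sub>R t))"
        using dle S sS t by (meson subspace_add subspace_scale)
    qed
    have q: "2 * r * inner (x - p) t \<le> r\<^sup>2 * (norm t)\<^sup>2" for r
    proof -
      have "d\<^sup>2 \<le> (norm (x - (p + r *\<^sub>R t)))\<^sup>2" using dp d0 by (simp add: power_mono)
      also have "\<dots> = (norm (x - p))\<^sup>2 - 2 * r * inner (x - p) t + r\<^sup>2 * (norm t)\<^sup>2"
        unfolding power2_norm_eq_inner
        by (simp add: inner_diff_left inner_diff_right inner_add_left inner_add_right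
          inner_commute algebra_simps power2_eq_square)
      finally show ?thesis using np by simp
    qed
    show ?thesis
    proof (cases "t = 0")
      case False
      then have nt: "(norm t)\<^sup>2 > 0" by simp
      define i where "i = inner (x - p) t"
      \<comment> \<open>This \<open>r\<close> minimises the quadratic in \<open>r\<close> and leaves
        a square that is at most zero.\<close>
      have "2 * (i / (norm t)\<^sup>2) * i \<le> (i / (norm t)\<^sup>2)\<^sup>2 * (norm t)\<^sup>2" unfolding i_def by (rule q)
      also have "\<dots> = i * i / (norm t)\<^sup>2" using nt by (simp add: power2_eq_square)
      finally have "i * i / (norm t)\<^sup>2 \<le> 0" by simp
      then have "i * i \<le> 0" using nt by (simp add: divide_le_0_iff)
      then show ?thesis by (metis i_def mult_eq_0_iff not_square_less_zero order_le_less)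
    qed simp
  qed
  then show ?thesis using that pc by blast
qed

lemma dense_if_perp_trivial:
  fixes S :: "'h::{real_inner,complete_space} set"
  assumes "subspace S" "\<And>z. (\<And>s. s \<in> S \<Longrightarrow> inner z s = 0) \<Longrightarrow> z = 0"
  shows "closure S = UNIV"
proof -
  have "x \<in> closure S" for x
  proof -
    obtain p where p: "p \<in> closure S" "\<And>s. s \<in> S \<Longrightarrow> inner (x - p) s = 0"
      using orth_proj[OF assms(1)] by blast
    then have "x - p = 0" using assms(2) by blast
    then show ?thesis using p by simp
  qed
  then show ?thesis by auto
qed

text \<open>The difference from the projection annihilates S, hence \<open>x\<close> as well as
  \<open>p\<close>, so it is orthogonal to itself. Time integrals are shown to stay in
  \<open>Hs\<close> this way, by pairing with the annihilator.\<close>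

lemma mem_if_perp_perp:
  fixes S :: "'h::{real_inner,complete_space} set"
  assumes "subspace S" "closed S" "\<And>k. (\<And>s. s \<in> S \<Longrightarrow> inner k s = 0) \<Longrightarrow> inner x k = 0"
  shows "x \<in> S"
proof -
  obtain p where p: "p \<in> S" "\<And>s. s \<in> S \<Longrightarrow> inner (x - p) s = 0"
    using orth_proj[OF assms(1), of x] assms(2) by (metis closure_closed)
  then have "inner x (x - p) = 0" "inner (x - p) p = 0" using assms(3) by blast+
  then have "inner (x - p) (x - p) = 0" by (simp add: inner_commute inner_diff_left inner_diff_right)
  then show ?thesis using p by simp
qed

text \<open>Linearity and boundedness are asked on S only, because the functionals met later act on
  arbitrary functions and are known to be linear just on W. The representer is a multiple of the
  part of \<open>h0\<close> orthogonal to the kernel.\<close>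

lemma riesz_subspace:
  fixes S :: "'h::{real_inner,complete_space} set" and \<phi> :: "'h \<Rightarrow> real"
  assumes S: "subspace S" "closed S"
    and lin: "\<And>a b x y. x \<in> S \<Longrightarrow> y \<in> S \<Longrightarrow> \<phi> (a *\<^sub>R x + b *\<^sub>R y) = a * \<phi> x + b * \<phi> y"
    and bd: "\<And>x. x \<in> S \<Longrightarrow> \<bar>\<phi> x\<bar> \<le> C * norm x"
  obtains f where "f \<in> S" "\<And>h. h \<in> S \<Longrightarrow> \<phi> h = inner f h"
proof (cases "\<forall>h\<in>S. \<phi> h = 0")
  case True
  then show ?thesis using that[of 0] subspace_0[OF S(1)] by simp
next
  case False
  then obtain h0 where h0: "h0 \<in> S" "\<phi> h0 \<noteq> 0" by blast
  define N where "N = {h\<in>S. \<phi> h = 0}"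
  have z: "\<phi> 0 = 0" using bd[OF subspace_0[OF S(1)]] by simp
  have lin1: "\<phi> (x + y) = \<phi> x + \<phi> y" if "x \<in> S" "y \<in> S" for x y
    using lin[OF that, of 1 1] by simp
  have lin2: "\<phi> (a *\<^sub>R x) = a * \<phi> x" if "x \<in> S" for x a
    using lin[OF that that, of a 0] by simp
  have lin3: "\<phi> (x - y) = \<phi> x - \<phi> y" if "x \<in> S" "y \<in> S" for x y
    using lin[OF that, of 1 "-1"] by simp
  have N: "subspace N" unfolding subspace_def N_def using S(1) z lin1 lin2
    by (auto simp: subspace_def)
  obtain p where p: "p \<in> closure N" "\<And>s. s \<in> N \<Longrightarrow> inner (h0 - p) s = 0"
    using orth_proj[OF N, of h0] by blast
  obtain s where s: "\<And>n. s n \<in> N" "s \<longlonglongrightarrow> p" using p(1) closure_sequential by blast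
  have sS: "s n \<in> S" for n using s(1) N_def by auto
  have pS: "p \<in> S" using S(2) s(2) sS closed_sequentially by blast
  \<comment> \<open>The projection lies only in the closure of the kernel; boundedness of \<phi> on
    S carries the zero over to it.\<close>
  have "\<bar>\<phi> p\<bar> \<le> 0"
  proof (rule LIMSEQ_le_const)
    have "(\<lambda>n. C * norm (p - s n)) \<longlonglongrightarrow> C * norm (p - p)" by (intro tendsto_intros s)
    then show "(\<lambda>n. C * norm (p - s n)) \<longlonglongrightarrow> 0" by simp
    show "\<exists>N. \<forall>n\<ge>N. \<bar>\<phi> p\<bar> \<le> C * norm (p - s n)"
    proof (intro exI allI impI)
      fix n
      have "\<phi> (p - s n) = \<phi> p" using lin3[OF pS sS] s(1) by (simp add: N_def)
      then show "\<bar>\<phi> p\<bar> \<le> C * norm (p - s n)" using bd[of "p - s n"] pS sS S(1) by (simp add: subspace_diff)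
    qed
  qed
  then have \<phi>p: "\<phi> p = 0" by simp
  define q where "q = h0 - p"
  have qS: "q \<in> S" using h0 pS S(1) by (simp add: q_def subspace_diff)
  have \<phi>q: "\<phi> q \<noteq> 0" using lin3[OF h0(1) pS] \<phi>p h0 by (simp add: q_def)
  then have qn: "inner q q > 0" using z by (metis inner_gt_zero_iff)
  define f where "f = (\<phi> q / inner q q) *\<^sub>R q"
  have "\<phi> h = inner f h" if h: "h \<in> S" for h
  proof -
    have hS: "(\<phi> h / \<phi> q) *\<^sub>R q \<in> S" using qS S(1) by (simp add: subspace_scale)
    have "h - (\<phi> h / \<phi> q) *\<^sub>R q \<in> N"
      unfolding N_def using lin3[OF h hS] lin2[OF qS] \<phi>q h hS S(1) by (simp add: subspace_diff)
    then have "inner q (h - (\<phi> h / \<phi> q) *\<^sub>R q) = 0" using p(2) by (simp add: q_def)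
    then have "inner q h = \<phi> h / \<phi> q * inner q q" by (simp add: inner_diff_right)
    then show ?thesis using \<phi>q qn by (simp add: f_def)
  qed
  moreover have "f \<in> S" using qS S(1) by (simp add: f_def subspace_scale)
  ultimately show ?thesis using that by blast
qed

section \<open>The Hilbert space of square integrable functions\<close>

text \<open>Borel functions on the whole space rather than Lebesgue functions on a domain: every
  section of a Borel function is Borel, and a function on \<Omega> is extended by zero.\<close>

definition sqi :: "('x::euclidean_space \<Rightarrow> 'e::euclidean_space) \<Rightarrow> bool" where
  "sqi f \<longleftrightarrow> f \<in> borel_measurable borel \<and> integrable lborel (\<lambda>x. (norm (f x))\<^sup>2)"

lemma sqi_meas: "sqi f \<Longrightarrow> f \<in> borel_measurable borel"
  by (simp add: sqi_def)

lemma sqi_bound: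
  assumes "g \<in> borel_measurable borel" "integrable lborel w" "AE x in lborel. (norm (g x))\<^sup>2 \<le> w x"
  shows "sqi g"
  unfolding sqi_def
proof
  show "integrable lborel (\<lambda>x. (norm (g x))\<^sup>2)"
    by (rule Bochner_Integration.integrable_bound[OF assms(2)]) (use assms in auto)
qed (use assms in auto)

lemma sqi_zero[simp]: "sqi (\<lambda>_. 0)" by (simp add: sqi_def)

lemma norm_add_sq_le: "(norm (a + b :: 'e::real_inner))\<^sup>2 \<le> 2 * (norm a)\<^sup>2 + 2 * (norm b)\<^sup>2"
proof -
  have "0 \<le> (norm (a - b))\<^sup>2" by simp
  then show ?thesis
    by (simp add: power2_norm_eq_inner inner_diff_left inner_diff_right inner_add_left inner_add_right inner_commute)
qed

lemma sqi_add: "sqi f \<Longrightarrow> sqi g \<Longrightarrow> sqi (\<lambda>x. f x + g x)"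
  by (rule sqi_bound[where w="\<lambda>x. 2 * (norm (f x))\<^sup>2 + 2 * (norm (g x))\<^sup>2"])
     (auto simp: sqi_def norm_add_sq_le)

lemma sqi_scaleR: "sqi f \<Longrightarrow> sqi (\<lambda>x. c *\<^sub>R f x)"
  by (auto simp: sqi_def power_mult_distrib)

lemma sqi_linear:
  assumes "sqi f" "bounded_linear A"
  shows "sqi (\<lambda>x. A (f x))"
proof -
  obtain K where K: "\<And>x. norm (A x) \<le> norm x * K" "K \<ge> 0"
    using bounded_linear.nonneg_bounded[OF assms(2)] by blast
  have [measurable]: "A \<in> borel_measurable borel"
    using assms(2) by (intro borel_measurable_continuous_onI linear_continuous_on)
  show ?thesis
  proof (rule sqi_bound[where w="\<lambda>x. K\<^sup>2 * (norm (f x))\<^sup>2"])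
    show "AE x in lborel. (norm (A (f x)))\<^sup>2 \<le> K\<^sup>2 * (norm (f x))\<^sup>2"
    proof (rule AE_I2)
      fix x
      have "(norm (A (f x)))\<^sup>2 \<le> (norm (f x) * K)\<^sup>2" using K by (intro power_mono) auto
      then show "(norm (A (f x)))\<^sup>2 \<le> K\<^sup>2 * (norm (f x))\<^sup>2" by (simp add: power_mult_distrib mult.commute)
    qed
    show "(\<lambda>x. A (f x)) \<in> borel_measurable borel" using sqi_meas[OF assms(1)] by measurable
  qed (use assms in \<open>auto simp: sqi_def\<close>)
qed

lemma sqi_inner_integrable:
  assumes "sqi f" "sqi g" shows "integrable lborel (\<lambda>x. inner (f x) (g x))"
proof (rule Bochner_Integration.integrable_bound)
  show "integrable lborel (\<lambda>x. (norm (f x))\<^sup>2 + (norm (g x))\<^sup>2)" using assms by (auto simp: sqi_def)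
  show "AE x in lborel. norm (inner (f x) (g x)) \<le> norm ((norm (f x))\<^sup>2 + (norm (g x))\<^sup>2)"
  proof (rule AE_I2)
    fix x
    have "\<bar>inner (f x) (g x)\<bar> \<le> norm (f x) * norm (g x)" by (rule Cauchy_Schwarz_ineq2)
    also have "\<dots> \<le> (norm (f x))\<^sup>2 + (norm (g x))\<^sup>2"
      using sum_squares_bound[of "norm (f x)" "norm (g x)"]
        mult_nonneg_nonneg[OF norm_ge_zero[of "f x"] norm_ge_zero[of "g x"]] by linarith
    finally show "norm (inner (f x) (g x)) \<le> norm ((norm (f x))\<^sup>2 + (norm (g x))\<^sup>2)" by simp
  qed
qed (use assms[THEN sqi_meas] in measurable)

lemma sqi_cong_AE:
  assumes "sqi f" "g \<in> borel_measurable borel" "AE x in lborel. g x = f x" shows "sqi g"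
  using assms by (intro sqi_bound[where w="\<lambda>x. (norm (f x))\<^sup>2"]) (auto simp: sqi_def)

text \<open>\<open>SOME\<close> sees only the predicate, which is the same for functions equal
  almost everywhere. The fixed points of \<open>canon\<close> are therefore one per class, and no
  quotient is formed.\<close>

definition canon :: "('x::euclidean_space \<Rightarrow> 'e::euclidean_space) \<Rightarrow> 'x \<Rightarrow> 'e" where
  "canon f = (SOME g. sqi g \<and> (AE x in lborel. g x = f x))"

lemma canon: assumes "sqi f" shows "sqi (canon f)" "AE x in lborel. canon f x = f x"
  using someI[of "\<lambda>g. sqi g \<and> (AE x in lborel. g x = f x)" f] assms unfolding canon_def by auto

lemma canon_eq: assumes "AE x in lborel. f x = g x" shows "canon f = canon g"
proof -
  have "(\<lambda>h. sqi h \<and> (AE x in lborel. h x = f x)) = (\<lambda>h. sqi h \<and> (AE x in lborel. h x = g x))"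
  proof (intro ext conj_cong refl iffI)
    fix h assume "AE x in lborel. h x = f x"
    with assms show "AE x in lborel. h x = g x" by eventually_elim simp
  next
    fix h assume "AE x in lborel. h x = g x"
    with assms show "AE x in lborel. h x = f x" by eventually_elim simp
  qed
  then show ?thesis unfolding canon_def by metis
qed

text \<open>An almost-everywhere class is represented by one chosen Borel function.\<close>

typedef (overloaded) ('x, 'e) l2 = "{f :: 'x::euclidean_space \<Rightarrow> 'e::euclidean_space. sqi f \<and> canon f = f}"
  morphisms rep Abs_l2
proof
  show "canon (\<lambda>_. 0) \<in> {f. sqi f \<and> canon f = f}"
    using canon(1)[OF sqi_zero] canon_eq[OF canon(2)[OF sqi_zero]] by simp
qed

text \<open>The default 0 for functions that are not square integrable gives a time slice a value at
  every time, also on the null set of bad times.\<close>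

definition mk :: "('x::euclidean_space \<Rightarrow> 'e::euclidean_space) \<Rightarrow> ('x, 'e) l2" where
  "mk f = Abs_l2 (canon (if sqi f then f else (\<lambda>_. 0)))"

lemma sqi_rep[simp]: "sqi (rep h)" using rep by auto

lemma rep_meas[measurable]: "rep h \<in> borel_measurable borel" using sqi_rep sqi_def by blast

lemma rep_mk: assumes "sqi f" shows "AE x in lborel. rep (mk f) x = f x"
proof -
  have "canon (canon f) = canon f" by (rule canon_eq) (rule canon[OF assms])
  then have "rep (mk f) = canon f" using assms canon(1)[OF assms]
    by (simp add: mk_def Abs_l2_inverse)
  then show ?thesis using canon[OF assms] by simp
qed

lemma l2_eqI: assumes "AE x in lborel. rep h x = rep k x" shows "h = k"
proof -
  have "canon (rep h) = canon (rep k)" by (rule canon_eq[OF assms])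
  then show ?thesis using rep[of h] rep[of k] by (simp add: rep_inject)
qed

lemma mk_eqI:
  assumes "sqi f" "AE x in lborel. rep h x = f x" shows "mk f = h"
  by (rule l2_eqI) (use rep_mk[OF assms(1)] assms(2) in eventually_elim, simp)

lemma mk_cong: assumes "sqi f" "sqi g" "AE x in lborel. f x = g x" shows "mk f = mk g"
  by (rule mk_eqI[OF assms(1)]) (use assms(3) rep_mk[OF assms(2)] in eventually_elim, simp)

lemma mk_rep[simp]: "mk (rep h) = h" by (rule mk_eqI) auto

instantiation l2 :: (euclidean_space, euclidean_space) real_inner
begin

definition "0 = mk (\<lambda>_. 0)"
definition "a + b = mk (\<lambda>x. rep a x + rep b x)"
definition "scaleR c a = mk (\<lambda>x. c *\<^sub>R rep a x)"
definition "- (a :: ('a, 'b) l2) = (-1) *\<^sub>R a"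
definition "a - (b :: ('a, 'b) l2) = a + - b"
definition "inner a b = (LINT x|lborel. inner (rep a x) (rep b x))"
definition "norm (a :: ('a, 'b) l2) = sqrt (inner a a)"
definition "sgn (a :: ('a, 'b) l2) = inverse (norm a) *\<^sub>R a"
definition "dist a (b :: ('a, 'b) l2) = norm (a - b)"
definition "uniformity = (INF e\<in>{0<..}. principal {(x :: ('a, 'b) l2, y). dist x y < e})"
definition "open (U :: ('a, 'b) l2 set) \<longleftrightarrow> (\<forall>x\<in>U. eventually (\<lambda>(x', y). x' = x \<longrightarrow> y \<in> U) uniformity)"

lemma rep_zero0: "AE x in lborel. rep (0 :: ('a, 'b) l2) x = 0"
  unfolding zero_l2_def by (rule rep_mk) simp

lemma rep_add0: "AE x in lborel. rep (a + b :: ('a, 'b) l2) x = rep a x + rep b x"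
  unfolding plus_l2_def by (rule rep_mk) (simp add: sqi_add)

lemma rep_scaleR0: "AE x in lborel. rep (c *\<^sub>R a :: ('a, 'b) l2) x = c *\<^sub>R rep a x"
  unfolding scaleR_l2_def by (rule rep_mk) (simp add: sqi_scaleR)

instance
proof
  fix a b c :: "('a, 'b) l2" and r s :: real
  show "a + b + c = a + (b + c)"
    by (rule l2_eqI) (use rep_add0[of "a+b" c] rep_add0[of a b] rep_add0[of a "b+c"] rep_add0[of b c] in eventually_elim, simp)
  show "a + b = b + a"
    by (rule l2_eqI) (use rep_add0[of "a" b] rep_add0[of b a] in eventually_elim, simp)
  show "0 + a = a"
    by (rule l2_eqI) (use rep_add0[of 0 a] rep_zero0 in eventually_elim, simp)
  show "- a + a = 0"
    unfolding uminus_l2_def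
    by (rule l2_eqI) (use rep_add0[of "-1 *\<^sub>R a" a] rep_zero0 rep_scaleR0[of "-1" a] in eventually_elim, simp)
  show "a - b = a + - b" by (simp add: minus_l2_def)
  show "r *\<^sub>R (a + b) = r *\<^sub>R a + r *\<^sub>R b"
    by (rule l2_eqI) (use rep_add0[of a b] rep_add0[of "r *\<^sub>R a" "r *\<^sub>R b"] rep_scaleR0[of r a] rep_scaleR0[of r b]
      rep_scaleR0[of r "a+b"] in eventually_elim, simp add: scaleR_add_right)
  show "(r + s) *\<^sub>R a = r *\<^sub>R a + s *\<^sub>R a"
    by (rule l2_eqI) (use rep_add0[of "r *\<^sub>R a" "s *\<^sub>R a"] rep_scaleR0[of r a] rep_scaleR0[of s a]
      rep_scaleR0[of "r+s" a] in eventually_elim, simp add: scaleR_add_left)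
  show "r *\<^sub>R s *\<^sub>R a = (r * s) *\<^sub>R a"
    by (rule l2_eqI) (use rep_scaleR0[of r "s *\<^sub>R a"] rep_scaleR0[of s a] rep_scaleR0[of "r * s" a] in eventually_elim, simp)
  show "1 *\<^sub>R a = a"
    by (rule l2_eqI) (use rep_scaleR0[of 1 a] in eventually_elim, simp)
  show "dist a b = norm (a - b)" by (simp add: dist_l2_def)
  show "sgn a = inverse (norm a) *\<^sub>R a" by (simp add: sgn_l2_def)
  show "inner a b = inner b a" by (simp add: inner_l2_def inner_commute)
  show "inner (a + b) c = inner a c + inner b c"
  proof -
    have "inner (a + b) c = (LINT x|lborel. inner (rep a x) (rep c x) + inner (rep b x) (rep c x))"
      unfolding inner_l2_def
      by (rule integral_cong_AE) (measurable, measurable, use rep_add0[of a b] in eventually_elim, simp add: inner_add_left)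
    also have "\<dots> = inner a c + inner b c"
      unfolding inner_l2_def by (rule Bochner_Integration.integral_add) (simp_all add: sqi_inner_integrable)
    finally show ?thesis .
  qed
  show "inner (r *\<^sub>R a) b = r * inner a b"
  proof -
    have "inner (r *\<^sub>R a) b = (LINT x|lborel. r * inner (rep a x) (rep b x))"
      unfolding inner_l2_def
      by (rule integral_cong_AE) (measurable, measurable, use rep_scaleR0[of r a] in eventually_elim, simp)
    then show ?thesis by (simp add: inner_l2_def)
  qed
  show "0 \<le> inner a a" unfolding inner_l2_def by simp
  show "(inner a a = 0) = (a = 0)"
  proof
    assume "inner a a = 0"
    then have z: "AE x in lborel. inner (rep a x) (rep a x) = 0"
      unfolding inner_l2_def by (subst (asm) integral_nonneg_eq_0_iff_AE) (simp_all add: sqi_inner_integrable)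
    show "a = 0"
      by (rule l2_eqI) (use z rep_zero0 in eventually_elim, simp)
  next
    assume "a = 0"
    have "inner a a = (LINT x|(lborel :: 'a measure). (0::real))" unfolding inner_l2_def \<open>a = 0\<close>
      by (rule integral_cong_AE) (measurable, measurable, use rep_zero0 in eventually_elim, simp)
    then show "inner a a = 0" by simp
  qed
  show "norm a = sqrt (inner a a)" by (simp add: norm_l2_def)
qed (rule uniformity_l2_def open_l2_def)+

end

lemmas rep_zero = rep_zero0
lemmas rep_add = rep_add0
lemmas rep_scaleR = rep_scaleR0

lemma rep_uminus: "AE x in lborel. rep (- a) x = - rep a x"
  using rep_scaleR[of "-1" a] by simp

lemma rep_diff: "AE x in lborel. rep (a - b) x = rep a x - rep b x"
  unfolding diff_conv_add_uminus using rep_add[of a "-b"] rep_uminus[of b] by eventually_elim simp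

lemma inner_l2: "inner a b = (LINT x|lborel. inner (rep a x) (rep b x))"
  by (rule inner_l2_def)

lemma norm_l2_sq: "(norm a)\<^sup>2 = (LINT x|lborel. (norm (rep a x))\<^sup>2)"
  by (simp add: power2_norm_eq_inner inner_l2)

lemma inner_mk: assumes "sqi f" "sqi g" shows "inner (mk f) (mk g) = (LINT x|lborel. inner (f x) (g x))"
  unfolding inner_l2 
  by (rule integral_cong_AE) (use assms[THEN sqi_meas] in measurable, use assms[THEN sqi_meas] in measurable, use rep_mk[OF assms(1)] rep_mk[OF assms(2)] in eventually_elim, simp)

lemma inner_mk_right: assumes "sqi g" shows "inner h (mk g) = (LINT x|lborel. inner (rep h x) (g x))"
  using inner_mk[OF sqi_rep assms, of h] by simp

lemma norm_mk_sq: "sqi f \<Longrightarrow> (norm (mk f))\<^sup>2 = (LINT x|lborel. (norm (f x))\<^sup>2)"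
  using inner_mk[of f f] by (simp add: power2_norm_eq_inner)

lemma mk_add: assumes "sqi f" "sqi g" shows "mk (\<lambda>x. f x + g x) = mk f + mk g"
  by (rule mk_eqI[OF sqi_add[OF assms]])
    (use rep_add[of "mk f" "mk g"] rep_mk[OF assms(1)] rep_mk[OF assms(2)] in eventually_elim, simp)

lemma mk_scaleR: assumes "sqi f" shows "mk (\<lambda>x. c *\<^sub>R f x) = c *\<^sub>R mk f"
  by (rule mk_eqI[OF sqi_scaleR[OF assms]])
    (use rep_scaleR[of c "mk f"] rep_mk[OF assms(1)] in eventually_elim, simp)

lemma mk_diff: assumes "sqi f" "sqi g" shows "mk (\<lambda>x. f x - g x) = mk f - mk g"
  using mk_add[OF assms(1) sqi_scaleR[OF assms(2), of "-1"]] mk_scaleR[OF assms(2), of "-1"] by simp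

lemma tendsto_LINT_zero_AE_subseq:
  fixes g :: "nat \<Rightarrow> 'x \<Rightarrow> real"
  assumes "\<And>n. integrable M (g n)" "\<And>n x. g n x \<ge> 0" "(\<lambda>n. LINT x|M. g n x) \<longlonglongrightarrow> 0"
  obtains r where "strict_mono (r :: nat \<Rightarrow> nat)" "AE x in M. (\<lambda>n. g (r n) x) \<longlonglongrightarrow> 0"
  using tendsto_L1_AE_subseq[of M g] assms by auto

text \<open>Riesz-Fischer: an almost everywhere convergent subsequence supplies the limit function,
  and Fatou's lemma upgrades the convergence to the norm.\<close>

instance l2 :: (euclidean_space, euclidean_space) complete_space
proof
  fix X :: "nat \<Rightarrow> ('a, 'b) l2" assume C: "Cauchy X"
  \<comment> \<open>An integrable weight with values in (0,1] is also square integrable. It turns an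
    L^2-Cauchy sequence into an L^1-Cauchy one, and being positive it can be divided out
    again.\<close>
  obtain w :: "'a \<Rightarrow> real" where w: "w \<in> borel_measurable lborel" "\<And>x. w x > 0" "\<And>x. w x \<le> 1" "integrable lborel w"
    using sigma_finite_measure.obtain_positive_integrable_function[OF lborel.sigma_finite_measure_axioms, of thesis] by blast
  have [measurable]: "w \<in> borel_measurable borel" using w(1) by simp
  have sw: "sqi w"
  proof (rule sqi_bound[where w=w])
    show "AE x in lborel. (norm (w x))\<^sup>2 \<le> w x"
      using w(2,3) by (intro AE_I2) (simp add: power2_eq_square mult_le_one less_imp_le)
  qed (use w in auto)
  define s where "s n x = w x *\<^sub>R rep (X n) x" for n x
  have sn: "sqi (\<lambda>x. norm (rep h x))" for h :: "('a, 'b) l2"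
    by (rule sqi_bound[where w="\<lambda>x. (norm (rep h x))\<^sup>2"]) (use sqi_rep[of h] in \<open>auto simp: sqi_def\<close>)
  have wl: "(LINT x|lborel. w x * norm (rep h x)) \<le> norm (mk w) * norm h" for h :: "('a, 'b) l2"
  proof -
    have "(LINT x|lborel. w x * norm (rep h x)) = inner (mk w) (mk (\<lambda>x. norm (rep h x)))"
      using inner_mk[OF sw sn] by simp
    also have "\<dots> \<le> norm (mk w) * norm (mk (\<lambda>x. norm (rep h x)))" by (rule norm_cauchy_schwarz)
    also have "(norm (mk (\<lambda>x. norm (rep h x))))\<^sup>2 = (norm h)\<^sup>2"
      using norm_mk_sq[OF sn, of h] norm_l2_sq[of h] by (simp only: real_norm_def abs_norm_cancel)
    then have "norm (mk (\<lambda>x. norm (rep h x))) = norm h"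
      by (rule power2_eq_imp_eq[OF _ norm_ge_zero norm_ge_zero])
    finally show ?thesis .
  qed
  have int: "integrable lborel (s n)" for n
  proof -
    have "integrable lborel (\<lambda>x. inner (w x) (norm (rep (X n) x)))"
      by (rule sqi_inner_integrable[OF sw sn])
    then show ?thesis unfolding s_def
      by (rule Bochner_Integration.integrable_bound) (use w in \<open>auto simp: abs_of_pos\<close>)
  qed
  have "\<exists>N. \<forall>i\<ge>N. \<forall>j\<ge>N. LINT x|lborel. norm (s i x - s j x) < e" if e: "e > 0" for e
  proof -
    define d where "d = e / (norm (mk w) + 1)"
    have d: "d > 0" using e by (simp add: d_def add_nonneg_pos)
    obtain N where N: "\<And>i j. i \<ge> N \<Longrightarrow> j \<ge> N \<Longrightarrow> norm (X i - X j) < d"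
      using C d unfolding Cauchy_def dist_norm by meson
    have "LINT x|lborel. norm (s i x - s j x) < e" if "i \<ge> N" "j \<ge> N" for i j
    proof -
      have "(LINT x|lborel. norm (s i x - s j x)) = (LINT x|lborel. w x * norm (rep (X i - X j) x))"
      proof (rule integral_cong_AE)
        show "AE x in lborel. norm (s i x - s j x) = w x * norm (rep (X i - X j) x)"
          using rep_diff[of "X i" "X j"]
        proof eventually_elim
          case (elim x)
          have "s i x - s j x = w x *\<^sub>R (rep (X i) x - rep (X j) x)"
            by (simp add: s_def scaleR_diff_right)
          then show ?case using w(2)[of x] elim by simp
        qed
      qed (use int in \<open>auto simp: s_def\<close>)
      also have "\<dots> \<le> norm (mk w) * norm (X i - X j)" by (rule wl)
      also have "\<dots> \<le> norm (mk w) * d" using N[OF that] by (intro mult_left_mono) auto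
      also have "\<dots> < (norm (mk w) + 1) * d" using d by simp
      also have "\<dots> = e" by (simp add: d_def add_nonneg_eq_0_iff)
      finally show ?thesis .
    qed
    then show ?thesis by blast
  qed
  then obtain r :: "nat \<Rightarrow> nat" where r: "strict_mono r" "AE x in lborel. Cauchy (\<lambda>i. s (r i) x)"
    using cauchy_L1_AE_cauchy_subseq[of lborel s] int by blast
  define f where "f x = lim (\<lambda>i. rep (X (r i)) x)" for x
  have fm[measurable]: "f \<in> borel_measurable borel" unfolding f_def by measurable
  have lim: "AE x in lborel. (\<lambda>i. rep (X (r i)) x) \<longlonglongrightarrow> f x"
    using r(2)
  proof eventually_elim
    case (elim x)
    then have "convergent (\<lambda>i. s (r i) x)" by (simp add: Cauchy_convergent)
    then obtain l where "(\<lambda>i. s (r i) x) \<longlonglongrightarrow> l" by (auto simp: convergent_def)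
    then have "(\<lambda>i. inverse (w x) *\<^sub>R s (r i) x) \<longlonglongrightarrow> inverse (w x) *\<^sub>R l" by (intro tendsto_intros)
    then have "(\<lambda>i. rep (X (r i)) x) \<longlonglongrightarrow> inverse (w x) *\<^sub>R l" using w(2)[of x] by (simp add: s_def)
    then have "convergent (\<lambda>i. rep (X (r i)) x)" by (auto simp: convergent_def)
    then show ?case by (simp add: f_def convergent_LIMSEQ_iff)
  qed
  \<comment> \<open>Fatou's lemma along the subsequence; it serves first to show that
    \<open>f\<close> is square integrable and then to bound the distance.\<close>
  have key: "(\<integral>\<^sup>+x. ennreal ((norm (rep (X n) x - f x))\<^sup>2) \<partial>lborel) \<le> ennreal (e\<^sup>2)"
    if e: "\<And>i. i \<ge> N \<Longrightarrow> norm (X n - X i) \<le> e" and e0: "e \<ge> 0" for n N e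
  proof -
    have "(\<integral>\<^sup>+x. ennreal ((norm (rep (X n) x - f x))\<^sup>2) \<partial>lborel)
       = (\<integral>\<^sup>+x. liminf (\<lambda>i. ennreal ((norm (rep (X n) x - rep (X (r i)) x))\<^sup>2)) \<partial>lborel)"
      by (rule nn_integral_cong_AE)
       (use lim in \<open>eventually_elim, auto intro!: lim_imp_Liminf[symmetric] tendsto_intros\<close>)
    also have "\<dots> \<le> liminf (\<lambda>i. \<integral>\<^sup>+x. ennreal ((norm (rep (X n) x - rep (X (r i)) x))\<^sup>2) \<partial>lborel)"
      by (rule nn_integral_liminf) measurable
    also have "\<dots> \<le> limsup (\<lambda>i. \<integral>\<^sup>+x. ennreal ((norm (rep (X n) x - rep (X (r i)) x))\<^sup>2) \<partial>lborel)"
      by (rule Liminf_le_Limsup) simp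
    also have "\<dots> \<le> ennreal (e\<^sup>2)"
    proof (rule Limsup_bounded)
      show "\<forall>\<^sub>F i in sequentially. (\<integral>\<^sup>+x. ennreal ((norm (rep (X n) x - rep (X (r i)) x))\<^sup>2) \<partial>lborel) \<le> ennreal (e\<^sup>2)"
        using eventually_ge_at_top[of N]
      proof eventually_elim
        case (elim i)
        then have ri: "r i \<ge> N" using seq_suble[OF r(1), of i] by linarith
        have "(\<integral>\<^sup>+x. ennreal ((norm (rep (X n) x - rep (X (r i)) x))\<^sup>2) \<partial>lborel)
          = (\<integral>\<^sup>+x. ennreal ((norm (rep (X n - X (r i)) x))\<^sup>2) \<partial>lborel)"
          by (rule nn_integral_cong_AE) (use rep_diff[of "X n" "X (r i)"] in \<open>eventually_elim, simp\<close>)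
        also have "\<dots> = ennreal ((norm (X n - X (r i)))\<^sup>2)"
          unfolding norm_l2_sq
          by (rule nn_integral_eq_integral) (use sqi_rep in \<open>auto simp: sqi_def\<close>)
        also have "\<dots> \<le> ennreal (e\<^sup>2)" using e[OF ri] by (intro ennreal_leI power_mono) auto
        finally show ?case .
      qed
    qed
    finally show ?thesis .
  qed
  have dsq: "sqi (\<lambda>x. rep (X n) x - f x)" if "\<And>i. i \<ge> N \<Longrightarrow> norm (X n - X i) \<le> e" "e \<ge> 0" for n N e
    unfolding sqi_def
  proof
    show "integrable lborel (\<lambda>x. (norm (rep (X n) x - f x))\<^sup>2)"
    proof (rule integrableI_bounded)
      have "(\<integral>\<^sup>+x. ennreal ((norm (rep (X n) x - f x))\<^sup>2) \<partial>lborel) < \<infinity>"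
        by (rule le_less_trans[OF key[OF that, of N]]) auto
      then show "(\<integral>\<^sup>+x. ennreal (norm ((norm (rep (X n) x - f x))\<^sup>2)) \<partial>lborel) < \<infinity>" by simp
    qed measurable
  qed measurable
  obtain N1 where N1: "\<And>n i. n \<ge> N1 \<Longrightarrow> i \<ge> N1 \<Longrightarrow> norm (X n - X i) < 1"
    using C unfolding Cauchy_def dist_norm by (meson zero_less_one)
  have sf: "sqi f"
  proof -
    have "sqi (\<lambda>x. rep (X N1) x - f x)" using N1 by (intro dsq[of N1 N1 1]) (auto intro: less_imp_le)
    from sqi_add[OF sqi_rep[of "X N1"] sqi_scaleR[OF this, of "-1"]] show ?thesis by simp
  qed
  have "X \<longlonglongrightarrow> mk f"
  proof (rule metric_LIMSEQ_I)
    fix e :: real assume e: "e > 0"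
    obtain N where N: "\<And>n i. n \<ge> N \<Longrightarrow> i \<ge> N \<Longrightarrow> norm (X n - X i) < e / 2"
      using C e unfolding Cauchy_def dist_norm by (meson half_gt_zero)
    have "dist (X n) (mk f) < e" if n: "n \<ge> N" for n
    proof -
      have a: "\<And>i. i \<ge> N \<Longrightarrow> norm (X n - X i) \<le> e / 2" using N[OF n] less_imp_le by blast
      have e2: "e / 2 \<ge> 0" using e by simp
      have sd: "sqi (\<lambda>x. rep (X n) x - f x)" by (rule dsq[OF a e2])
      have "ennreal ((norm (X n - mk f))\<^sup>2) = ennreal (LINT x|lborel. (norm (rep (X n) x - f x))\<^sup>2)"
        using mk_diff[OF sqi_rep sf, of "X n"] norm_mk_sq[OF sd] by simp
      also have "\<dots> = (\<integral>\<^sup>+x. ennreal ((norm (rep (X n) x - f x))\<^sup>2) \<partial>lborel)"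
        by (rule nn_integral_eq_integral[symmetric]) (use sd in \<open>auto simp: sqi_def\<close>)
      also have "\<dots> \<le> ennreal ((e / 2)\<^sup>2)" by (rule key[OF a e2])
      finally have "(norm (X n - mk f))\<^sup>2 \<le> (e / 2)\<^sup>2" by (simp add: ennreal_le_iff)
      then have "norm (X n - mk f) \<le> e / 2" using e2 by (rule power2_le_imp_le)
      then show ?thesis using e by (simp add: dist_norm)
    qed
    then show "\<exists>N. \<forall>n\<ge>N. dist (X n) (mk f) < e" by blast
  qed
  then show "convergent X" by (auto simp: convergent_def)
qed

section \<open>Time slices\<close>

text \<open>A function on space-time is an element of \<^typ>\<open>(real \<times> 'a, 'e) l2\<close>, and
  \<open>sec h t\<close> is its slice at time \<open>t\<close>.\<close>

lemma AE_slice: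
  fixes P :: "real \<times> 'a::euclidean_space \<Rightarrow> bool"
  assumes "AE p in lborel. P p" shows "AE t in lborel. AE x in lborel. P (t, x)"
  by (rule lborel_pair.AE_pair[of P, unfolded lborel_prod, OF assms])

lemma slice_meas:
  fixes f :: "real \<times> 'a::euclidean_space \<Rightarrow> 'e::euclidean_space"
  assumes "f \<in> borel_measurable borel"
  shows "(\<lambda>x. f (t, x)) \<in> borel_measurable borel" "(\<lambda>s. f (s, x)) \<in> borel_measurable borel"
  using assms by measurable

lemma sqi_slice:
  fixes f :: "real \<times> 'a::euclidean_space \<Rightarrow> 'e::euclidean_space"
  assumes "sqi f"
  shows "AE t in lborel. sqi (\<lambda>x. f (t, x))"
    and "AE x in lborel. sqi (\<lambda>t. f (t, x))"
    and "integrable lborel (\<lambda>x. LINT t|lborel. (norm (f (t, x)))\<^sup>2)"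
proof -
  have i: "integrable (lborel \<Otimes>\<^sub>M lborel) (\<lambda>(t, x). (norm (f (t, x)))\<^sup>2)"
    using assms by (simp add: sqi_def lborel_prod case_prod_beta')
  show "AE t in lborel. sqi (\<lambda>x. f (t, x))"
    using lborel_pair.AE_integrable_fst[OF i] slice_meas[OF sqi_meas[OF assms]] by (simp add: sqi_def)
  show "AE x in lborel. sqi (\<lambda>t. f (t, x))"
    using lborel_pair.AE_integrable_snd[OF i] slice_meas[OF sqi_meas[OF assms]] by (simp add: sqi_def)
  show "integrable lborel (\<lambda>x. LINT t|lborel. (norm (f (t, x)))\<^sup>2)"
    using lborel_pair.integrable_snd[OF i] by simp
qed

definition sec :: "(real \<times> 'a::euclidean_space, 'e::euclidean_space) l2 \<Rightarrow> real \<Rightarrow> ('a, 'e) l2" where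
  "sec h t = mk (\<lambda>x. rep h (t, x))"

lemma rep_sec: "AE t in lborel. AE x in lborel. rep (sec h t) x = rep h (t, x)"
  using sqi_slice(1)[OF sqi_rep[of h]] by eventually_elim (simp add: sec_def rep_mk)

lemma sec_eqI:
  fixes h :: "(real \<times> 'a::euclidean_space, 'e::euclidean_space) l2"
  assumes "AE p in lborel. rep h p = f p" and "f \<in> borel_measurable borel"
  shows "AE t in lborel. sqi (\<lambda>x. f (t, x)) \<and> sec h t = mk (\<lambda>x. f (t, x))"
  using AE_slice[OF assms(1)] sqi_slice(1)[OF sqi_rep[of h]]
proof eventually_elim
  case (elim t)
  have "AE x in lborel. f (t, x) = rep h (t, x)" using elim(1) by eventually_elim simp
  then have "sqi (\<lambda>x. f (t, x))"
    using elim(2) slice_meas[OF assms(2)] by (intro sqi_cong_AE[OF elim(2)])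
  then show ?case using elim by (auto simp: sec_def intro: mk_cong)
qed

lemma sec_mk:
  assumes "sqi f" shows "AE t in lborel. sqi (\<lambda>x. f (t, x)) \<and> sec (mk f) t = mk (\<lambda>x. f (t, x))"
  by (rule sec_eqI[OF rep_mk[OF assms] sqi_meas[OF assms]])

lemma sec_add: "AE t in lborel. sec (h + k) t = sec h t + sec k t"
proof -
  have m: "(\<lambda>p. rep h p + rep k p) \<in> borel_measurable borel" by measurable
  show ?thesis
    using sec_eqI[OF rep_add[of h k] m] sqi_slice(1)[OF sqi_rep[of h]] sqi_slice(1)[OF sqi_rep[of k]]
    by eventually_elim (simp add: sec_def mk_add)
qed

lemma sec_scaleR: "AE t in lborel. sec (c *\<^sub>R h) t = c *\<^sub>R sec h t"
proof -
  have m: "(\<lambda>p. c *\<^sub>R rep h p) \<in> borel_measurable borel" by measurable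
  show ?thesis
    using sec_eqI[OF rep_scaleR[of c h] m] sqi_slice(1)[OF sqi_rep[of h]]
    by eventually_elim (simp add: sec_def mk_scaleR)
qed

lemma sec_diff: "AE t in lborel. sec (h - k) t = sec h t - sec k t"
  using sec_add[of h "(-1) *\<^sub>R k"] sec_scaleR[of "-1" k] by eventually_elim simp

lemma sec_zero: "AE t in lborel. sec 0 t = 0"
  using sec_scaleR[of 0 0] by eventually_elim simp

text \<open>Holds at every time, not just at almost every time: Borel measurability of slice
  products needs an exact formula, with the default 0 where a slice is not square
  integrable.\<close>

lemma inner_sec_eq:
  "inner (sec h t) (sec k t) = (if integrable lborel (\<lambda>x. (norm (rep h (t, x)))\<^sup>2) \<and>
     integrable lborel (\<lambda>x. (norm (rep k (t, x)))\<^sup>2) then LINT x|lborel. inner (rep h (t, x)) (rep k (t, x)) else 0)"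
proof -
  have z: "mk (\<lambda>x. rep h (t, x)) = 0" if "\<not> integrable lborel (\<lambda>x. (norm (rep h (t, x)))\<^sup>2)"
    for h :: "(real \<times> 'a, 'b) l2"
    using that by (simp add: mk_def sqi_def zero_l2_def)
  have s: "sqi (\<lambda>x. rep h (t, x)) = integrable lborel (\<lambda>x. (norm (rep h (t, x)))\<^sup>2)" for h :: "(real \<times> 'a, 'b) l2"
    using slice_meas[OF rep_meas] by (simp add: sqi_def)
  show ?thesis by (auto simp: sec_def z s inner_mk)
qed

lemma sec_inner_meas[measurable]: "(\<lambda>t. inner (sec h t) (sec k t)) \<in> borel_measurable borel"
proof -
  have m: "(\<lambda>p. (norm (rep h p))\<^sup>2) \<in> borel_measurable (borel \<Otimes>\<^sub>M lborel)" for h :: "(real \<times> 'a, 'b) l2"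
    by (subst measurable_cong_sets[OF sets_pair_measure_cong[OF sets_lborel[symmetric] refl] refl]) (simp add: lborel_prod)
  have m2: "(\<lambda>p. inner (rep h p) (rep k p)) \<in> borel_measurable (borel \<Otimes>\<^sub>M lborel)" for h k :: "(real \<times> 'a, 'b) l2"
    by (subst measurable_cong_sets[OF sets_pair_measure_cong[OF sets_lborel[symmetric] refl] refl]) (simp add: lborel_prod)
  have [measurable]: "Measurable.pred borel (\<lambda>t. integrable lborel (\<lambda>x. (norm (rep h (t, x)))\<^sup>2))" for h :: "(real \<times> 'a, 'b) l2"
    by (rule lborel.borel_measurable_lebesgue_integrable) (use m[of h] in \<open>simp add: case_prod_beta'\<close>)
  have [measurable]: "(\<lambda>t. LINT x|lborel. inner (rep h (t, x)) (rep k (t, x))) \<in> borel_measurable borel"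
    by (rule lborel.borel_measurable_lebesgue_integral) (use m2[of h k] in \<open>simp add: case_prod_beta'\<close>)
  show ?thesis unfolding inner_sec_eq by measurable
qed

lemma norm_sec_meas[measurable]: "(\<lambda>t. norm (sec h t)) \<in> borel_measurable borel"
  unfolding norm_eq_sqrt_inner by measurable

text \<open>Fubini; it identifies the space-time space with L^2 in time with values in the spatial
  space, so identities can be checked slice by slice.\<close>

lemma inner_sec:
  shows "integrable lborel (\<lambda>t. inner (sec h t) (sec k t))"
    and "inner h k = (LINT t|lborel. inner (sec h t) (sec k t))"
proof -
  have i: "integrable (lborel \<Otimes>\<^sub>M lborel) (\<lambda>(t, x). inner (rep h (t, x)) (rep k (t, x)))"
    using sqi_inner_integrable[OF sqi_rep[of h] sqi_rep[of k]] by (simp add: lborel_prod case_prod_beta')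
  have ae: "AE t in lborel. (LINT x|lborel. inner (rep h (t, x)) (rep k (t, x))) = inner (sec h t) (sec k t)"
    using sqi_slice(1)[OF sqi_rep[of h]] sqi_slice(1)[OF sqi_rep[of k]]
    by eventually_elim (simp add: sec_def inner_mk)
  show int: "integrable lborel (\<lambda>t. inner (sec h t) (sec k t))"
    by (rule integrable_cong_AE_imp[OF lborel_pair.integrable_fst[OF i] _ ae]) simp
  have "inner h k = integral\<^sup>L (lborel \<Otimes>\<^sub>M lborel) (\<lambda>(t, x). inner (rep h (t, x)) (rep k (t, x)))"
    by (simp add: inner_l2 lborel_prod case_prod_beta')
  also have "\<dots> = (LINT t|lborel. LINT x|lborel. inner (rep h (t, x)) (rep k (t, x)))"
    by (rule lborel_pair.integral_fst[OF i, symmetric])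
  also have "\<dots> = (LINT t|lborel. inner (sec h t) (sec k t))"
    by (rule integral_cong_AE) (use borel_measurable_integrable[OF lborel_pair.integrable_fst[OF i]] ae in auto)
  finally show "inner h k = (LINT t|lborel. inner (sec h t) (sec k t))" .
qed

lemma norm_sec:
  shows "integrable lborel (\<lambda>t. (norm (sec h t))\<^sup>2)" "(norm h)\<^sup>2 = (LINT t|lborel. (norm (sec h t))\<^sup>2)"
  using inner_sec[of h h] by (simp_all add: power2_norm_eq_inner)

lemma sec_ext: assumes "AE t in lborel. sec h t = sec k t" shows "h = k"
proof -
  have "AE t in lborel. (norm (sec (h - k) t))\<^sup>2 = 0"
    using assms sec_diff[of h k] by eventually_elim simp
  then have "(LINT t|lborel. (norm (sec (h - k) t))\<^sup>2) = 0" by (simp add: integral_eq_zero_AE)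
  then show ?thesis using norm_sec(2)[of "h - k"] by simp
qed

text \<open>The squared slice distances tend to zero in L^1 of time, so along a subsequence they do
  so at almost every time. Closedness of W and the identification of limits rest on this.\<close>

lemma sec_tendsto_subseq:
  assumes "h \<longlonglongrightarrow> k"
  obtains r where "strict_mono (r :: nat \<Rightarrow> nat)" "AE t in lborel. (\<lambda>n. sec (h (r n)) t) \<longlonglongrightarrow> sec k t"
proof -
  have "(\<lambda>n. norm (h n - k)) \<longlonglongrightarrow> 0" using assms by (simp add: LIM_zero tendsto_norm_zero)
  then have "(\<lambda>n. (norm (h n - k))\<^sup>2) \<longlonglongrightarrow> 0\<^sup>2" by (intro tendsto_intros)
  then have "(\<lambda>n. LINT t|lborel. (norm (sec (h n - k) t))\<^sup>2) \<longlonglongrightarrow> 0" by (simp add: norm_sec(2))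
  then obtain r where r: "strict_mono (r :: nat \<Rightarrow> nat)" "AE t in lborel. (\<lambda>n. (norm (sec (h (r n) - k) t))\<^sup>2) \<longlonglongrightarrow> 0"
    using tendsto_LINT_zero_AE_subseq[of lborel "\<lambda>n t. (norm (sec (h n - k) t))\<^sup>2"] norm_sec(1) by auto
  have "AE t in lborel. \<forall>n. sec (h (r n) - k) t = sec (h (r n)) t - sec k t"
    unfolding AE_all_countable using sec_diff by blast
  with r(2) have "AE t in lborel. (\<lambda>n. sec (h (r n)) t) \<longlonglongrightarrow> sec k t"
  proof eventually_elim
    case (elim t)
    then have "(\<lambda>n. (norm (sec (h (r n)) t - sec k t))\<^sup>2) \<longlonglongrightarrow> 0" by simp
    then have "(\<lambda>n. sqrt ((norm (sec (h (r n)) t - sec k t))\<^sup>2)) \<longlonglongrightarrow> sqrt 0" by (intro tendsto_intros)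
    then have "(\<lambda>n. norm (sec (h (r n)) t - sec k t)) \<longlonglongrightarrow> 0" by simp
    then show ?case by (simp add: tendsto_norm_zero_iff LIM_zero_iff)
  qed
  then show ?thesis using that r(1) by blast
qed

section \<open>Products of a function of time and a function of space\<close>

lemma integrable_pair_mult:
  fixes u :: "real \<Rightarrow> real" and v :: "'a::euclidean_space \<Rightarrow> real"
  assumes "integrable lborel u" "integrable lborel v"
  shows "integrable lborel (\<lambda>p. u (fst p) * v (snd p))"
proof -
  have [measurable]: "u \<in> borel_measurable borel" "v \<in> borel_measurable borel" using assms by auto
  have "integrable (lborel \<Otimes>\<^sub>M lborel) (\<lambda>p. u (fst p) * v (snd p))"
  proof (rule lborel_pair.Fubini_integrable)
    show "integrable lborel (\<lambda>x. LINT y|lborel. norm (u (fst (x, y)) * v (snd (x, y))))"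
      using assms by (simp add: abs_mult)
  qed (use assms in auto)
  then show ?thesis by (simp add: lborel_prod)
qed

lemma meas_fst:
  fixes c :: "real \<Rightarrow> real"
  assumes "c \<in> borel_measurable borel"
  shows "(\<lambda>p :: real \<times> 'a::euclidean_space. c (fst p)) \<in> borel_measurable borel"
  by (rule measurable_compose[OF borel_measurable_continuous_onI assms]) (intro continuous_intros)

lemma meas_snd:
  assumes "f \<in> borel_measurable borel"
  shows "(\<lambda>p :: real \<times> 'a::euclidean_space. f (snd p)) \<in> borel_measurable borel"
  by (rule measurable_compose[OF borel_measurable_continuous_onI assms]) (intro continuous_intros)

lemma sqi_tens:
  fixes c :: "real \<Rightarrow> real" and f :: "'a::euclidean_space \<Rightarrow> 'e::euclidean_space"
  assumes "sqi c" "sqi f" shows "sqi (\<lambda>p. c (fst p) *\<^sub>R f (snd p))"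
proof (rule sqi_bound[where w="\<lambda>p. (norm (c (fst p)))\<^sup>2 * (norm (f (snd p)))\<^sup>2"])
  show "(\<lambda>p. c (fst p) *\<^sub>R f (snd p)) \<in> borel_measurable borel"
    by (intro borel_measurable_scaleR meas_fst meas_snd sqi_meas assms)
  show "integrable lborel (\<lambda>p. (norm (c (fst p)))\<^sup>2 * (norm (f (snd p)))\<^sup>2)"
    by (rule integrable_pair_mult) (use assms in \<open>auto simp: sqi_def\<close>)
qed (simp add: power_mult_distrib)

text \<open>With \<open>c\<close> the indicator of an interval these are the test elements that turn
  the space-time equation into one integrated up to a given time.\<close>

definition tens :: "(real \<Rightarrow> real) \<Rightarrow> ('a::euclidean_space, 'e::euclidean_space) l2 \<Rightarrow> (real \<times> 'a, 'e) l2" where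
  "tens c k = mk (\<lambda>p. c (fst p) *\<^sub>R rep k (snd p))"

lemma sec_tens: assumes "sqi c" shows "AE t in lborel. sec (tens c k) t = c t *\<^sub>R k"
  unfolding tens_def using sec_mk[OF sqi_tens[OF assms sqi_rep[of k]]]
  by eventually_elim (simp add: mk_scaleR)

text \<open>A constant \<open>k\<close> is in general not the slice of a space-time element, as it
  is not square integrable in time; so the measurability of slice products does not cover this
  case.\<close>

lemma sec_inner_const_meas[measurable]: "(\<lambda>t. inner (sec h t) k) \<in> borel_measurable borel"
proof -
  have m: "(\<lambda>p. (norm (rep h p))\<^sup>2) \<in> borel_measurable (borel \<Otimes>\<^sub>M lborel)"
    by (subst measurable_cong_sets[OF sets_pair_measure_cong[OF sets_lborel[symmetric] refl] refl]) (simp add: lborel_prod)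
  have m2: "(\<lambda>p. inner (rep h p) (rep k (snd p))) \<in> borel_measurable (borel \<Otimes>\<^sub>M lborel)"
    by (subst measurable_cong_sets[OF sets_pair_measure_cong[OF sets_lborel[symmetric] refl] refl])
      (simp add: lborel_prod borel_measurable_inner meas_snd rep_meas)
  have [measurable]: "Measurable.pred borel (\<lambda>t. integrable lborel (\<lambda>x. (norm (rep h (t, x)))\<^sup>2))"
    by (rule lborel.borel_measurable_lebesgue_integrable) (use m in \<open>simp add: case_prod_beta'\<close>)
  have [measurable]: "(\<lambda>t. LINT x|lborel. inner (rep h (t, x)) (rep k x)) \<in> borel_measurable borel"
    by (rule lborel.borel_measurable_lebesgue_integral) (use m2 in \<open>simp add: case_prod_beta'\<close>)
  have s: "sqi (\<lambda>x. rep h (t, x)) = integrable lborel (\<lambda>x. (norm (rep h (t, x)))\<^sup>2)" for t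
    using slice_meas[OF rep_meas] by (simp add: sqi_def)
  have "inner (sec h t) k = (if integrable lborel (\<lambda>x. (norm (rep h (t, x)))\<^sup>2)
      then LINT x|lborel. inner (rep h (t, x)) (rep k x) else 0)" for t
  proof (cases "sqi (\<lambda>x. rep h (t, x))")
    case True
    then have "inner (sec h t) (mk (rep k)) = (LINT x|lborel. inner (rep h (t, x)) (rep k x))"
      unfolding sec_def by (rule inner_mk) simp
    then show ?thesis using True s by simp
  next
    case False
    then have "sec h t = 0" by (simp add: sec_def mk_def zero_l2_def)
    then show ?thesis using False s by simp
  qed
  then show ?thesis by simp
qed

lemma inner_tens:
  assumes "sqi c" shows "inner h (tens c k) = (LINT t|lborel. c t * inner (sec h t) k)"
    and "integrable lborel (\<lambda>t. c t * inner (sec h t) k)"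
proof -
  have [measurable]: "c \<in> borel_measurable borel" using assms by (rule sqi_meas)
  have ae: "AE t in lborel. inner (sec h t) (sec (tens c k) t) = c t * inner (sec h t) k"
    using sec_tens[OF assms, of k] by eventually_elim simp
  show "inner h (tens c k) = (LINT t|lborel. c t * inner (sec h t) k)"
    unfolding inner_sec(2)[of h] by (rule integral_cong_AE) (use ae in auto)
  show "integrable lborel (\<lambda>t. c t * inner (sec h t) k)"
    by (rule integrable_cong_AE_imp[OF inner_sec(1) _ ae]) simp
qed

lemma norm_tens: assumes "sqi c" shows "(norm (tens c k))\<^sup>2 = (LINT t|lborel. (c t)\<^sup>2) * (norm k)\<^sup>2"
proof -
  have [measurable]: "c \<in> borel_measurable borel" using assms by (rule sqi_meas)
  have "(norm (tens c k))\<^sup>2 = (LINT t|lborel. (c t)\<^sup>2 * (norm k)\<^sup>2)"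
    unfolding norm_sec(2)
  proof (rule integral_cong_AE)
    show "(\<lambda>t. (norm (sec (tens c k) t))\<^sup>2) \<in> borel_measurable lborel"
      using borel_measurable_power[OF norm_sec_meas] by simp
    show "AE t in lborel. (norm (sec (tens c k) t))\<^sup>2 = (c t)\<^sup>2 * (norm k)\<^sup>2"
      using sec_tens[OF assms, of k] by eventually_elim (simp add: power_mult_distrib)
  qed measurable
  then show ?thesis by simp
qed

section \<open>Multiplication by bounded functions of time\<close>

definition bdm :: "(real \<Rightarrow> real) \<Rightarrow> bool" where
  "bdm c \<longleftrightarrow> c \<in> borel_measurable borel \<and> (\<exists>B. \<forall>t. \<bar>c t\<bar> \<le> B)"

definition tm :: "(real \<Rightarrow> real) \<Rightarrow> (real \<times> 'a::euclidean_space, 'e::euclidean_space) l2 \<Rightarrow> (real \<times> 'a, 'e) l2" where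
  "tm c h = mk (\<lambda>p. c (fst p) *\<^sub>R rep h p)"

lemma bdm_indicator[simp]: "A \<in> sets borel \<Longrightarrow> bdm (indicator A)"
  by (auto simp: bdm_def indicator_def intro!: exI[of _ 1])

lemma bdm_mult: "bdm c \<Longrightarrow> bdm d \<Longrightarrow> bdm (\<lambda>t. c t * d t)"
proof -
  assume a: "bdm c" "bdm d"
  then obtain B D where b: "\<And>t. \<bar>c t\<bar> \<le> B" "\<And>t. \<bar>d t\<bar> \<le> D" by (auto simp: bdm_def)
  have "\<bar>c t * d t\<bar> \<le> B * D" for t
    unfolding abs_mult using b[of t] abs_ge_zero[of "c t"] by (intro mult_mono) auto
  then show ?thesis using a by (auto simp: bdm_def)
qed

lemma bdm_diff: "bdm c \<Longrightarrow> bdm d \<Longrightarrow> bdm (\<lambda>t. c t - d t)"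
proof -
  assume a: "bdm c" "bdm d"
  then obtain B D where b: "\<And>t. \<bar>c t\<bar> \<le> B" "\<And>t. \<bar>d t\<bar> \<le> D" by (auto simp: bdm_def)
  have "\<bar>c t - d t\<bar> \<le> B + D" for t using b[of t] by linarith
  then show ?thesis using a by (auto simp: bdm_def)
qed

lemma sqi_tm:
  assumes "bdm c" "sqi f" shows "sqi (\<lambda>p. c (fst p) *\<^sub>R f p)"
proof -
  obtain B where B: "\<And>t. \<bar>c t\<bar> \<le> B" and cm: "c \<in> borel_measurable borel"
    using assms by (auto simp: bdm_def)
  show ?thesis
  proof (rule sqi_bound[where w="\<lambda>p. B\<^sup>2 * (norm (f p))\<^sup>2"])
    show "(\<lambda>p. c (fst p) *\<^sub>R f p) \<in> borel_measurable borel"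
      by (rule borel_measurable_scaleR[OF meas_fst[OF cm] sqi_meas[OF assms(2)]])
    show "AE p in lborel. (norm (c (fst p) *\<^sub>R f p))\<^sup>2 \<le> B\<^sup>2 * (norm (f p))\<^sup>2"
    proof (rule AE_I2)
      fix p
      have "(norm (c (fst p) *\<^sub>R f p))\<^sup>2 \<le> (B * norm (f p))\<^sup>2"
        using B[of "fst p"] by (intro power_mono) (auto intro!: mult_right_mono)
      then show "(norm (c (fst p) *\<^sub>R f p))\<^sup>2 \<le> B\<^sup>2 * (norm (f p))\<^sup>2" by (simp only: power_mult_distrib)
    qed
  qed (use assms in \<open>auto simp: sqi_def\<close>)
qed

lemma sec_tm: assumes "bdm c" shows "AE t in lborel. sec (tm c h) t = c t *\<^sub>R sec h t"
  unfolding tm_def using sec_mk[OF sqi_tm[OF assms sqi_rep[of h]]] sqi_slice(1)[OF sqi_rep[of h]]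
  by eventually_elim (simp add: sec_def mk_scaleR)

lemma tm_add: assumes "bdm c" shows "tm c (h + k) = tm c h + tm c k"
  by (rule sec_ext) (use sec_tm[OF assms, of h] sec_tm[OF assms, of k] sec_tm[OF assms, of "h + k"]
    sec_add[of h k] sec_add[of "tm c h" "tm c k"] in \<open>eventually_elim, simp add: scaleR_add_right\<close>)

lemma tm_scaleR: assumes "bdm c" shows "tm c (r *\<^sub>R h) = r *\<^sub>R tm c h"
  by (rule sec_ext) (use sec_tm[OF assms, of h] sec_tm[OF assms, of "r *\<^sub>R h"]
    sec_scaleR[of r h] sec_scaleR[of r "tm c h"] in \<open>eventually_elim, simp\<close>)

lemma tm_diff: assumes "bdm c" shows "tm c (h - k) = tm c h - tm c k"
  using tm_add[OF assms, of "h - k" k] by simp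

lemma tm_tm: assumes "bdm c" "bdm d" shows "tm c (tm d h) = tm (\<lambda>t. c t * d t) h"
  by (rule sec_ext) (use sec_tm[OF assms(1), of "tm d h"] sec_tm[OF assms(2), of h]
    sec_tm[OF bdm_mult[OF assms], of h] in \<open>eventually_elim, simp\<close>)

lemma tm_diff_left: assumes "bdm c" "bdm d" shows "tm (\<lambda>t. c t - d t) h = tm c h - tm d h"
  by (rule sec_ext) (use sec_tm[OF assms(1), of h] sec_tm[OF assms(2), of h] sec_diff[of "tm c h" "tm d h"]
    sec_tm[OF bdm_diff[OF assms], of h] in \<open>eventually_elim, simp add: scaleR_diff_left\<close>)

lemma inner_tm:
  assumes "bdm c" shows "inner (tm c h) k = (LINT t|lborel. c t * inner (sec h t) (sec k t))"
    and "integrable lborel (\<lambda>t. c t * inner (sec h t) (sec k t))"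
proof -
  have [measurable]: "c \<in> borel_measurable borel" using assms by (simp add: bdm_def)
  have ae: "AE t in lborel. inner (sec (tm c h) t) (sec k t) = c t * inner (sec h t) (sec k t)"
    using sec_tm[OF assms, of h] by eventually_elim simp
  show "inner (tm c h) k = (LINT t|lborel. c t * inner (sec h t) (sec k t))"
    unfolding inner_sec(2)[of _ k] by (rule integral_cong_AE) (use ae in auto)
  show "integrable lborel (\<lambda>t. c t * inner (sec h t) (sec k t))"
    by (rule integrable_cong_AE_imp[OF inner_sec(1) _ ae]) simp
qed

lemma tm_adj: assumes "bdm c" shows "inner (tm c h) k = inner h (tm c k)"
  using inner_tm(1)[OF assms, of h k] inner_tm(1)[OF assms, of k h] by (simp add: inner_commute)

lemma norm_tm: assumes "bdm c" "\<And>t. \<bar>c t\<bar> \<le> B" shows "norm (tm c h) \<le> B * norm h"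
proof -
  have B: "B \<ge> 0" using assms(2)[of 0] by linarith
  have "(norm (tm c h))\<^sup>2 \<le> (LINT t|lborel. B\<^sup>2 * (norm (sec h t))\<^sup>2)"
    unfolding norm_sec(2)[of "tm c h"]
  proof (rule integral_mono_AE)
    show "AE t in lborel. (norm (sec (tm c h) t))\<^sup>2 \<le> B\<^sup>2 * (norm (sec h t))\<^sup>2"
      using sec_tm[OF assms(1), of h]
    proof eventually_elim
      case (elim t)
      have "(norm (sec (tm c h) t))\<^sup>2 \<le> (B * norm (sec h t))\<^sup>2"
        unfolding elim using assms(2)[of t] by (intro power_mono) (auto intro!: mult_right_mono)
      then show ?case by (simp only: power_mult_distrib)
    qed
  qed (use norm_sec(1) in auto)
  also have "\<dots> = (B * norm h)\<^sup>2" using norm_sec(2)[of h] by (simp add: power_mult_distrib)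
  finally show ?thesis using B by (meson mult_nonneg_nonneg norm_ge_zero power2_le_imp_le)
qed

section \<open>The function part and the gradient part\<close>

text \<open>The pair \<open>(u, \<nabla>u)\<close> of a Sobolev function and its gradient is treated as one element of
  \<^typ>\<open>('x, real \<times> 'a) l2\<close>; \<open>P0\<close> and \<open>P1\<close> project to the function and to the gradient.\<close>

definition P0 :: "('x::euclidean_space, real \<times> 'a::euclidean_space) l2 \<Rightarrow> ('x, real \<times> 'a) l2" where
  "P0 h = mk (\<lambda>x. (fst (rep h x), 0))"

lemma bl_P0: "bounded_linear (\<lambda>e :: real \<times> 'a::euclidean_space. (fst e, 0 :: 'a))"
  by (intro bounded_linear_Pair bounded_linear_fst bounded_linear_zero)

lemma sqi_P0: "sqi f \<Longrightarrow> sqi (\<lambda>x. (fst (f x), 0 :: 'a))"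
  for f :: "'x::euclidean_space \<Rightarrow> real \<times> 'a::euclidean_space"
  using sqi_linear[OF _ bl_P0] by blast

lemma rep_P0: "AE x in lborel. rep (P0 h) x = (fst (rep h x), 0)"
  unfolding P0_def by (rule rep_mk) (simp add: sqi_P0)

lemma P0_add: "P0 (h + k) = P0 h + P0 k"
  by (rule l2_eqI) (use rep_P0[of h] rep_P0[of k] rep_P0[of "h+k"] rep_add[of h k] rep_add[of "P0 h" "P0 k"]
    in \<open>eventually_elim, simp\<close>)

lemma P0_scaleR: "P0 (r *\<^sub>R h) = r *\<^sub>R P0 h"
  by (rule l2_eqI) (use rep_P0[of h] rep_P0[of "r *\<^sub>R h"] rep_scaleR[of r h] rep_scaleR[of r "P0 h"]
    in \<open>eventually_elim, simp\<close>)

lemma P0_diff: "P0 (h - k) = P0 h - P0 k"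
  using P0_add[of "h - k" k] by simp

lemma P0_zero[simp]: "P0 0 = 0" using P0_scaleR[of 0 0] by simp

lemma P0_P0[simp]: "P0 (P0 h) = P0 h"
  by (rule l2_eqI) (use rep_P0[of h] rep_P0[of "P0 h"] in \<open>eventually_elim, simp\<close>)

lemma P0_adj: "inner (P0 h) k = inner h (P0 k)"
  unfolding inner_l2
  by (rule integral_cong_AE) (measurable, measurable, use rep_P0[of h] rep_P0[of k] in \<open>eventually_elim, simp add: inner_prod_def\<close>)

lemma norm_P0: "norm (P0 h) \<le> norm h"
proof -
  have "(norm (P0 h))\<^sup>2 = inner h (P0 h)" using P0_adj[of h "P0 h"] by (simp add: power2_norm_eq_inner)
  also have "\<dots> \<le> norm h * norm (P0 h)" by (rule norm_cauchy_schwarz)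
  finally show ?thesis
    by (cases "norm (P0 h) = 0") (auto simp: power2_eq_square)
qed

lemma bounded_linear_P0: "bounded_linear P0"
  by (rule bounded_linear_intro[where K=1]) (simp_all add: P0_add P0_scaleR norm_P0)

lemma sec_P0: "AE t in lborel. sec (P0 h) t = P0 (sec h t)"
proof -
  have m: "(\<lambda>p. (fst (rep h p), 0 :: 'b)) \<in> borel_measurable borel" by (rule sqi_meas[OF sqi_P0]) simp
  show ?thesis
    using sec_eqI[OF rep_P0[of h] m] rep_sec[of h]
  proof eventually_elim
    case (elim t)
    have "mk (\<lambda>x. (fst (rep h (t, x)), 0)) = P0 (sec h t)"
      by (rule mk_eqI) (use elim in simp, use elim(2) rep_P0[of "sec h t"] in eventually_elim, simp)
    then show ?case using elim by simp
  qed
qed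

lemma P0_tm: assumes "bdm c" shows "P0 (tm c h) = tm c (P0 h)"
  by (rule sec_ext) (use sec_tm[OF assms, of h] sec_tm[OF assms, of "P0 h"] sec_P0[of h] sec_P0[of "tm c h"]
    in \<open>eventually_elim, simp add: P0_scaleR\<close>)

lemma P0_tens: assumes "sqi c" shows "P0 (tens c k) = tens c (P0 k)"
  by (rule sec_ext) (use sec_tens[OF assms, of k] sec_tens[OF assms, of "P0 k"] sec_P0[of "tens c k"]
    in \<open>eventually_elim, simp add: P0_scaleR\<close>)

definition P1 :: "('x::euclidean_space, real \<times> 'a::euclidean_space) l2 \<Rightarrow> ('x, real \<times> 'a) l2" where
  "P1 h = h - P0 h"

lemma rep_P1: "AE x in lborel. rep (P1 h) x = (0, snd (rep h x))"
  unfolding P1_def using rep_diff[of h "P0 h"] rep_P0[of h]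
  by eventually_elim (simp add: prod_eq_iff)

lemma P1_add: "P1 (h + k) = P1 h + P1 k" by (simp add: P1_def P0_add)
lemma P1_scaleR: "P1 (r *\<^sub>R h) = r *\<^sub>R P1 h" by (simp add: P1_def P0_scaleR scaleR_diff_right)
lemma P1_diff: "P1 (h - k) = P1 h - P1 k" by (simp add: P1_def P0_diff)
lemma P0_P1[simp]: "P0 (P1 h) = 0" by (simp add: P1_def P0_diff)
lemma P1_P1[simp]: "P1 (P1 h) = P1 h" unfolding P1_def[of "P1 h"] by simp
lemma P1_adj: "inner (P1 h) k = inner h (P1 k)"
  by (simp add: P1_def inner_diff_left inner_diff_right P0_adj)
lemma P0_add_P1: "P0 h + P1 h = h" by (simp add: P1_def)

lemma norm_split: "(norm h)\<^sup>2 = (norm (P0 h))\<^sup>2 + (norm (P1 h))\<^sup>2"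
proof -
  have "inner (P0 h) (P1 h) = 0" using P0_adj[of h "P1 h"] by simp
  then have "(norm (P0 h + P1 h))\<^sup>2 = (norm (P0 h))\<^sup>2 + (norm (P1 h))\<^sup>2"
    by (simp add: power2_norm_eq_inner inner_add_left inner_add_right inner_commute)
  then show ?thesis by (simp add: P0_add_P1)
qed

lemma norm_P1: "norm (P1 h) \<le> norm h"
  using norm_split[of h] by (metis le_add_same_cancel2 norm_ge_zero power2_le_imp_le zero_le_power2)

lemma bounded_linear_P1: "bounded_linear P1"
  by (rule bounded_linear_intro[where K=1]) (simp_all add: P1_add P1_scaleR norm_P1)

lemma P1_tm: "bdm c \<Longrightarrow> P1 (tm c h) = tm c (P1 h)"
  by (simp add: P1_def P0_tm tm_diff)

section \<open>Integration in time\<close>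

text \<open>The plane of pairs (s, r) splits along the diagonal into two halves with equal
  integrals, by symmetry of the inner product; together they give the squared norm of the integral.
  This takes the place of differentiating a squared norm in time.\<close>

lemma integral_sym_primitive:
  fixes c :: "real \<Rightarrow> 'e::euclidean_space"
  assumes "integrable lborel c"
  shows "(LINT s|lborel. inner (c s) (LINT r|lborel. (if r < s then c r else 0))) = (norm (LINT s|lborel. c s))\<^sup>2 / 2"
proof -
  have [measurable]: "c \<in> borel_measurable borel" using assms by auto
  define g where "g p = inner (c (fst p)) (c (snd p))" for p
  define g1 where "g1 p = (if snd p < fst p then g p else 0)" for p :: "real \<times> real"
  define g2 where "g2 p = (if fst p < snd p then g p else 0)" for p :: "real \<times> real"
  have gm[measurable]: "g \<in> borel_measurable (lborel \<Otimes>\<^sub>M lborel)" unfolding g_def by measurable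
  have gi: "integrable (lborel \<Otimes>\<^sub>M lborel) g"
  proof (rule Bochner_Integration.integrable_bound)
    show "integrable (lborel \<Otimes>\<^sub>M lborel) (\<lambda>p. norm (c (fst p)) * norm (c (snd p)))"
      using integrable_pair_mult[OF integrable_norm[OF assms] integrable_norm[OF assms]] by (simp add: lborel_prod)
    show "AE p in lborel \<Otimes>\<^sub>M lborel. norm (g p) \<le> norm (norm (c (fst p)) * norm (c (snd p)))"
      by (rule AE_I2) (simp add: g_def Cauchy_Schwarz_ineq2)
  qed measurable
  have g1i: "integrable (lborel \<Otimes>\<^sub>M lborel) g1"
  proof (rule Bochner_Integration.integrable_bound[OF gi])
    show "g1 \<in> borel_measurable (lborel \<Otimes>\<^sub>M lborel)" unfolding g1_def by measurable
  qed (auto simp: g1_def)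
  have g2i: "integrable (lborel \<Otimes>\<^sub>M lborel) g2"
  proof (rule Bochner_Integration.integrable_bound[OF gi])
    show "g2 \<in> borel_measurable (lborel \<Otimes>\<^sub>M lborel)" unfolding g2_def by measurable
  qed (auto simp: g2_def)
  have A: "(LINT s|lborel. inner (c s) (LINT r|lborel. (if r < s then c r else 0))) = (LINT s|lborel. LINT r|lborel. g1 (s, r))"
  proof (rule Bochner_Integration.integral_cong[OF refl])
    fix s :: real
    have i: "integrable lborel (\<lambda>r. if r < s then c r else 0)"
      by (rule Bochner_Integration.integrable_bound[OF assms]) auto
    have "inner (c s) (LINT r|lborel. (if r < s then c r else 0)) = (LINT r|lborel. inner (c s) (if r < s then c r else 0))"
      by (rule integral_inner_right[symmetric]) (rule i)
    also have "\<dots> = (LINT r|lborel. g1 (s, r))"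
      by (rule Bochner_Integration.integral_cong) (auto simp: g1_def g_def)
    finally show "inner (c s) (LINT r|lborel. (if r < s then c r else 0)) = (LINT r|lborel. g1 (s, r))" .
  qed
  have B: "(LINT s|lborel. LINT r|lborel. g2 (s, r)) = (LINT s|lborel. LINT r|lborel. g1 (s, r))"
  proof -
    have "(LINT r|lborel. LINT s|lborel. g2 (s, r)) = (LINT s|lborel. LINT r|lborel. g2 (s, r))"
      by (rule lborel_pair.Fubini_integral) (use g2i in simp)
    moreover have "g2 (s, r) = g1 (r, s)" for s r by (simp add: g1_def g2_def g_def inner_commute)
    ultimately show ?thesis by simp
  qed
  have C: "(LINT s|lborel. LINT r|lborel. g1 (s, r)) + (LINT s|lborel. LINT r|lborel. g2 (s, r))
      = (norm (LINT s|lborel. c s))\<^sup>2"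
  proof -
    have "(LINT s|lborel. LINT r|lborel. g1 (s, r)) + (LINT s|lborel. LINT r|lborel. g2 (s, r))
      = integral\<^sup>L (lborel \<Otimes>\<^sub>M lborel) (\<lambda>p. g1 p + g2 p)"
      by (simp add: lborel_pair.integral_fst'[OF g1i] lborel_pair.integral_fst'[OF g2i] g1i g2i)
    also have "\<dots> = (LINT s|lborel. LINT r|lborel. g1 (s, r) + g2 (s, r))"
      by (rule lborel_pair.integral_fst'[symmetric]) (simp add: g1i g2i)
    also have "\<dots> = (LINT s|lborel. LINT r|lborel. inner (c s) (c r))"
    proof (rule Bochner_Integration.integral_cong[OF refl])
      fix s :: real
      show "(LINT r|lborel. g1 (s, r) + g2 (s, r)) = (LINT r|lborel. inner (c s) (c r))"
      proof (rule integral_cong_AE)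
        \<comment> \<open>The diagonal, which belongs to neither half, is a null set.\<close>
        show "AE r in lborel. g1 (s, r) + g2 (s, r) = inner (c s) (c r)"
          using AE_lborel_singleton[of s] by eventually_elim (auto simp: g1_def g2_def g_def)
      qed (auto simp: g1_def g2_def g_def)
    qed
    also have "\<dots> = (LINT s|lborel. inner (c s) (LINT r|lborel. c r))"
      using assms by simp
    also have "\<dots> = (norm (LINT s|lborel. c s))\<^sup>2"
      using assms by (simp add: power2_norm_eq_inner)
    finally show ?thesis .
  qed
  show ?thesis using A B C by simp
qed

lemma sqi_ind: "emeasure lborel A < \<infinity> \<Longrightarrow> A \<in> sets borel \<Longrightarrow> sqi (indicator A :: real \<Rightarrow> real)"
  unfolding sqi_def by (simp add: power2_eq_square indicator_times_eq_if(1)[symmetric] flip: indicator_inter_arith)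

lemma emeasure_Ioo_finite: "emeasure lborel {s<..<t :: real} < \<infinity>"
  by (rule emeasure_bounded_finite) simp

lemma sqi_Ioo[simp]: "sqi (indicator {s<..<t} :: real \<Rightarrow> real)"
  by (rule sqi_ind[OF emeasure_Ioo_finite]) simp

lemma LINT_Ioo_sq: "s \<le> t \<Longrightarrow> (LINT r|lborel. (indicator {s<..<t} r :: real)\<^sup>2) = t - s"
  by (simp add: power2_eq_square flip: indicator_inter_arith)

text \<open>Integrates the Borel representative at each fixed \<open>x\<close>. On the null set of
  \<open>x\<close> whose time section is not square integrable the value is arbitrary.\<close>

definition Jf :: "(real \<times> 'a::euclidean_space, 'e::euclidean_space) l2 \<Rightarrow> real \<Rightarrow> 'a \<Rightarrow> 'e" where
  "Jf h t x = (LINT s|lborel. (if 0 < s \<and> s < t then rep h (s, x) else 0))"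

lemma Jf_integrable:
  fixes h :: "(real \<times> 'a::euclidean_space, 'e::euclidean_space) l2"
  assumes "sqi (\<lambda>s. rep h (s, x))"
  shows "integrable lborel (\<lambda>s. if 0 < s \<and> s < t then rep h (s, x) else 0)"
proof (rule Bochner_Integration.integrable_bound)
  show "integrable lborel (\<lambda>s. (indicator {0<..<t} s)\<^sup>2 + (norm (rep h (s, x)))\<^sup>2)"
    using sqi_Ioo[of 0 t] assms by (auto simp: sqi_def)
  show "AE s in lborel. norm (if 0 < s \<and> s < t then rep h (s, x) else 0)
      \<le> norm ((indicator {0<..<t} s)\<^sup>2 + (norm (rep h (s, x)))\<^sup>2)"
  proof (rule AE_I2)
    fix s
    have "norm (rep h (s, x)) \<le> 1 + (norm (rep h (s, x)))\<^sup>2"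
    proof -
      have "2 * norm (rep h (s, x)) \<le> 1 + (norm (rep h (s, x)))\<^sup>2"
        using sum_squares_bound[of 1 "norm (rep h (s, x))"] by simp
      then show ?thesis using norm_ge_zero[of "rep h (s, x)"] by linarith
    qed
    then show "norm (if 0 < s \<and> s < t then rep h (s, x) else 0)
      \<le> norm ((indicator {0<..<t} s)\<^sup>2 + (norm (rep h (s, x)))\<^sup>2)" by (auto simp: indicator_def)
  qed
  show "(\<lambda>s. if 0 < s \<and> s < t then rep h (s, x) else 0) \<in> borel_measurable lborel"
    using sqi_meas[OF assms] by simp
qed

text \<open>Cauchy-Schwarz in time against the indicator of (0,t), whose squared norm is the factor
  \<open>t\<close>.\<close>

lemma Jf_bound:
  assumes "sqi (\<lambda>s. rep h (s, x))" "0 \<le> t"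
  shows "(norm (Jf h t x))\<^sup>2 \<le> t * (LINT s|lborel. (norm (rep h (s, x)))\<^sup>2)"
proof -
  let ?i = "indicator {0<..<t} :: real \<Rightarrow> real"
  have n: "sqi (\<lambda>s. norm (rep h (s, x)))"
    by (rule sqi_cong_AE[OF _ _ AE_I2]) (use assms sqi_meas[OF assms(1)] in \<open>auto simp: sqi_def\<close>)
  have "norm (Jf h t x) \<le> (LINT s|lborel. norm (if 0 < s \<and> s < t then rep h (s, x) else 0))"
    unfolding Jf_def by (rule integral_norm_bound)
  also have "\<dots> = (LINT s|lborel. inner (?i s) (norm (rep h (s, x))))"
    by (rule Bochner_Integration.integral_cong) (auto simp: indicator_def)
  also have "\<dots> = inner (mk ?i) (mk (\<lambda>s. norm (rep h (s, x))))"
    by (rule inner_mk[symmetric]) (use n in auto)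
  also have "\<dots> \<le> norm (mk ?i) * norm (mk (\<lambda>s. norm (rep h (s, x))))" by (rule norm_cauchy_schwarz)
  finally have "(norm (Jf h t x))\<^sup>2 \<le> (norm (mk ?i) * norm (mk (\<lambda>s. norm (rep h (s, x)))))\<^sup>2"
    by (rule power_mono) simp
  also have "\<dots> = t * (LINT s|lborel. (norm (rep h (s, x)))\<^sup>2)"
    using norm_mk_sq[OF sqi_Ioo, of 0 t] norm_mk_sq[OF n] assms(2) LINT_Ioo_sq[of 0 t]
    by (simp add: power_mult_distrib)
  finally show ?thesis .
qed

lemma Jf_meas: "(\<lambda>p. Jf h (fst p) (snd p)) \<in> borel_measurable borel"
  "Jf h t \<in> borel_measurable borel"
proof -
  have "(\<lambda>z. rep h (snd z, snd (fst z))) \<in> borel_measurable (borel :: ((real \<times> 'a) \<times> real) measure)"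
    by (rule measurable_compose[OF borel_measurable_continuous_onI rep_meas]) (intro continuous_intros)
  moreover have "{z :: (real \<times> 'a) \<times> real. 0 < snd z \<and> snd z < fst (fst z)} \<in> sets borel"
    by (intro borel_open open_Collect_conj open_Collect_less continuous_intros)
  ultimately have "(\<lambda>z. if 0 < snd z \<and> snd z < fst (fst z) then rep h (snd z, snd (fst z)) else 0)
      \<in> borel_measurable (borel :: ((real \<times> 'a) \<times> real) measure)"
    by (intro measurable_If) simp_all
  then have "(\<lambda>(p, s). if 0 < s \<and> s < fst p then rep h (s, snd p) else 0) \<in> borel_measurable (borel \<Otimes>\<^sub>M lborel)"
    by (subst measurable_cong_sets[OF sets_pair_measure_cong[OF sets_lborel[symmetric] refl] refl])
      (simp add: lborel_prod case_prod_beta')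
  then show m: "(\<lambda>p. Jf h (fst p) (snd p)) \<in> borel_measurable borel"
    unfolding Jf_def by (rule lborel.borel_measurable_lebesgue_integral)
  have "(\<lambda>x. Jf h (fst (t, x)) (snd (t, x))) \<in> borel_measurable borel"
    by (rule slice_meas(1)[OF m])
  then show "Jf h t \<in> borel_measurable borel" by simp
qed

lemma sqi_Jf: assumes "0 \<le> t" shows "sqi (Jf h t)"
proof (rule sqi_bound)
  show "integrable lborel (\<lambda>x. t * (LINT s|lborel. (norm (rep h (s, x)))\<^sup>2))"
    using sqi_slice(3)[OF sqi_rep[of h]] by simp
  show "AE x in lborel. (norm (Jf h t x))\<^sup>2 \<le> t * (LINT s|lborel. (norm (rep h (s, x)))\<^sup>2)"
    using sqi_slice(2)[OF sqi_rep[of h]] by eventually_elim (use Jf_bound assms in blast)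
qed (rule Jf_meas)

definition Jt :: "(real \<times> 'a::euclidean_space, 'e::euclidean_space) l2 \<Rightarrow> real \<Rightarrow> ('a, 'e) l2" where
  "Jt h t = mk (Jf h t)"

definition J :: "real \<Rightarrow> (real \<times> 'a::euclidean_space, 'e::euclidean_space) l2 \<Rightarrow> (real \<times> 'a, 'e) l2" where
  "J T h = mk (\<lambda>p. if 0 < fst p \<and> fst p < T then Jf h (fst p) (snd p) else 0)"

lemma sqi_J: "sqi (\<lambda>p. if 0 < fst p \<and> fst p < T then Jf h (fst p) (snd p) else 0)"
proof (rule sqi_bound)
  let ?v = "\<lambda>x. LINT s|lborel. (norm (rep h (s, x)))\<^sup>2"
  have "integrable lborel (\<lambda>s. T * (indicator {0<..<T} s :: real))" by (intro integrable_mult_right integrable_real_indicator emeasure_Ioo_finite) simp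
  then show "integrable lborel (\<lambda>p. (T * (indicator {0<..<T} (fst p))) * ?v (snd p))"
    using sqi_slice(3)[OF sqi_rep[of h]] by (rule integrable_pair_mult)
  have "AE p in lborel \<Otimes>\<^sub>M lborel. (norm (if 0 < fst p \<and> fst p < T then Jf h (fst p) (snd p) else 0))\<^sup>2
      \<le> (T * (indicator {0<..<T} (fst p))) * ?v (snd p)"
  proof -
    \<comment> \<open>The exceptional set in \<open>x\<close> is enlarged to a Borel null set, so
      that its cylinder is measurable in the product.\<close>
    obtain N where N: "{x \<in> space lborel. \<not> sqi (\<lambda>s. rep h (s, x))} \<subseteq> N" "N \<in> null_sets lborel"
      using sqi_slice(2)[OF sqi_rep[of h]] by (auto elim!: AE_E simp: null_sets_def)
    have "AE p in (lborel \<Otimes>\<^sub>M lborel :: (real \<times> 'a) measure). snd p \<notin> N"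
    proof (rule lborel_pair.AE_pair_measure)
      have "{p :: real \<times> 'a. snd p \<notin> N} = UNIV \<times> (- N)" by auto
      then show "{x \<in> space (lborel \<Otimes>\<^sub>M lborel). snd x \<notin> N} \<in> sets (lborel \<Otimes>\<^sub>M lborel :: (real \<times> 'a) measure)"
        using N(2) by (auto simp: space_pair_measure null_sets_def)
      show "AE x in lborel. AE y in lborel. snd (x, y) \<notin> N"
        using AE_not_in[OF N(2)] by simp
    qed
    then show ?thesis
    proof eventually_elim
      case (elim p)
      then have "sqi (\<lambda>s. rep h (s, snd p))" using N(1) by auto
      from Jf_bound[OF this, of "fst p"] have b: "0 \<le> fst p \<Longrightarrow> (norm (Jf h (fst p) (snd p)))\<^sup>2 \<le> fst p * ?v (snd p)" .
      have v: "?v (snd p) \<ge> 0" by simp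
      have "fst p \<le> T \<Longrightarrow> fst p * ?v (snd p) \<le> T * ?v (snd p)" by (rule mult_right_mono[OF _ v])
      then show ?case using b by (auto simp: indicator_def)
    qed
  qed
  then show "AE p in lborel. (norm (if 0 < fst p \<and> fst p < T then Jf h (fst p) (snd p) else 0))\<^sup>2
      \<le> (T * (indicator {0<..<T} (fst p))) * ?v (snd p)" unfolding lborel_prod .
  have "{p :: real \<times> 'a. 0 < fst p \<and> fst p < T} \<in> sets borel"
    by (intro borel_open open_Collect_conj open_Collect_less continuous_intros)
  then show "(\<lambda>p. if 0 < fst p \<and> fst p < T then Jf h (fst p) (snd p) else 0) \<in> borel_measurable borel"
    using Jf_meas(1)[of h]
    by (intro measurable_If) simp_all
qed

lemma sec_J: "AE t in lborel. sec (J T h) t = (if 0 < t \<and> t < T then Jt h t else 0)"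
  unfolding J_def using sec_mk[OF sqi_J[of T h]]
  by eventually_elim (auto simp: Jt_def zero_l2_def)

text \<open>Determines the primitive by pairings alone; linearity, commutation with
  \<open>P0\<close> and continuity in time then follow without touching representatives.\<close>

lemma inner_Jt: assumes "0 \<le> t" shows "inner (Jt h t) k = inner h (tens (indicator {0<..<t}) k)"
proof -
  let ?c = "indicator {0<..<t} :: real \<Rightarrow> real"
  have st: "sqi (\<lambda>p. ?c (fst p) *\<^sub>R rep k (snd p))" by (rule sqi_tens) simp_all
  have i: "integrable (lborel \<Otimes>\<^sub>M lborel) (\<lambda>(s, x). inner (rep h (s, x)) (?c s *\<^sub>R rep k x))"
    using sqi_inner_integrable[OF sqi_rep[of h] st] by (simp add: lborel_prod case_prod_beta')
  have "inner h (tens ?c k) = (LINT p|lborel. inner (rep h p) (?c (fst p) *\<^sub>R rep k (snd p)))"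
    unfolding tens_def by (rule inner_mk_right[OF st])
  also have "\<dots> = (LINT x|lborel. LINT s|lborel. inner (rep h (s, x)) (?c s *\<^sub>R rep k x))"
    by (subst lborel_pair.integral_snd[OF i]) (simp add: lborel_prod case_prod_beta')
  also have "\<dots> = (LINT x|lborel. inner (Jf h t x) (rep k x))"
  proof (rule integral_cong_AE)
    show "(\<lambda>x. LINT s|lborel. inner (rep h (s, x)) (?c s *\<^sub>R rep k x)) \<in> borel_measurable lborel"
      using lborel_pair.integrable_snd[OF i] by (rule borel_measurable_integrable)
    show "AE x in lborel. (LINT s|lborel. inner (rep h (s, x)) (?c s *\<^sub>R rep k x)) = inner (Jf h t x) (rep k x)"
      using sqi_slice(2)[OF sqi_rep[of h]]
    proof eventually_elim
      case (elim x)
      have "inner (Jf h t x) (rep k x) = (LINT s|lborel. inner (if 0 < s \<and> s < t then rep h (s, x) else 0) (rep k x))"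
        unfolding Jf_def using Jf_integrable[OF elim] by (intro integral_inner_left[symmetric])
      also have "\<dots> = (LINT s|lborel. inner (rep h (s, x)) (?c s *\<^sub>R rep k x))"
        by (rule Bochner_Integration.integral_cong) (auto simp: indicator_def)
      finally show ?case by simp
    qed
  qed (use Jf_meas(2)[of h t] in measurable)
  also have "\<dots> = inner (Jt h t) (mk (rep k))"
    unfolding Jt_def by (rule inner_mk[symmetric]) (simp_all add: sqi_Jf assms)
  finally show ?thesis by simp
qed

text \<open>Integrated form of the rule that half a squared norm has as derivative the product with
  the derivative. It is \<open>integral_sym_primitive\<close> for almost every \<open>x\<close>,
  applied to the time section cut to (0,t).\<close>

lemma J_sym:
  assumes "0 \<le> t" "t \<le> T"
  shows "inner h (tm (indicator {0<..<t}) (J T h)) = (norm (Jt h t))\<^sup>2 / 2"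
proof -
  let ?c = "indicator {0<..<t} :: real \<Rightarrow> real"
  let ?G = "\<lambda>p. if 0 < fst p \<and> fst p < T then Jf h (fst p) (snd p) else 0"
  have b: "bdm ?c" by simp
  have sG: "sqi (\<lambda>p. ?c (fst p) *\<^sub>R ?G p)" by (rule sqi_tm[OF b sqi_J])
  have tmG: "tm ?c (J T h) = mk (\<lambda>p. ?c (fst p) *\<^sub>R ?G p)"
    unfolding tm_def
    by (rule mk_cong[OF sqi_tm[OF b sqi_rep] sG], use rep_mk[OF sqi_J[of T h]] in \<open>eventually_elim\<close>) (simp add: J_def)
  have i: "integrable (lborel \<Otimes>\<^sub>M lborel) (\<lambda>(s, x). inner (rep h (s, x)) (?c s *\<^sub>R ?G (s, x)))"
    using sqi_inner_integrable[OF sqi_rep[of h] sG] by (simp add: lborel_prod case_prod_beta' cong: if_cong)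
  have "inner h (tm ?c (J T h)) = (LINT p|lborel. inner (rep h p) (?c (fst p) *\<^sub>R ?G p))"
    unfolding tmG by (rule inner_mk_right[OF sG])
  also have "\<dots> = (LINT x|lborel. LINT s|lborel. inner (rep h (s, x)) (?c s *\<^sub>R ?G (s, x)))"
    by (subst lborel_pair.integral_snd[OF i]) (simp add: lborel_prod case_prod_beta' cong: if_cong)
  also have "\<dots> = (LINT x|lborel. (norm (Jf h t x))\<^sup>2 / 2)"
  proof (rule integral_cong_AE)
    show "(\<lambda>x. LINT s|lborel. inner (rep h (s, x)) (?c s *\<^sub>R ?G (s, x))) \<in> borel_measurable lborel"
      using lborel_pair.integrable_snd[OF i] by (rule borel_measurable_integrable)
    show "AE x in lborel. (LINT s|lborel. inner (rep h (s, x)) (?c s *\<^sub>R ?G (s, x))) = (norm (Jf h t x))\<^sup>2 / 2"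
      using sqi_slice(2)[OF sqi_rep[of h]]
    proof eventually_elim
      case (elim x)
      define c where "c s = (if 0 < s \<and> s < t then rep h (s, x) else 0)" for s
      have ci: "integrable lborel c" unfolding c_def by (rule Jf_integrable[OF elim])
      have "inner (rep h (s, x)) (?c s *\<^sub>R ?G (s, x)) = inner (c s) (LINT r|lborel. (if r < s then c r else 0))" for s
      proof (cases "0 < s \<and> s < t")
        case True
        have "Jf h s x = (LINT r|lborel. (if r < s then c r else 0))"
          unfolding Jf_def by (rule Bochner_Integration.integral_cong) (use True in \<open>auto simp: c_def\<close>)
        then show ?thesis using True assms by (auto simp: c_def)
      qed (auto simp: c_def indicator_def)
      then have "(LINT s|lborel. inner (rep h (s, x)) (?c s *\<^sub>R ?G (s, x)))
         = (LINT s|lborel. inner (c s) (LINT r|lborel. (if r < s then c r else 0)))" by simp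
      also have "\<dots> = (norm (LINT s|lborel. c s))\<^sup>2 / 2" by (rule integral_sym_primitive[OF ci])
      also have "(LINT s|lborel. c s) = Jf h t x" by (simp add: Jf_def c_def)
      finally show ?case .
    qed
  qed (use Jf_meas(2)[of h t] in measurable)
  also have "\<dots> = (norm (Jt h t))\<^sup>2 / 2" unfolding Jt_def by (simp add: norm_mk_sq sqi_Jf assms)
  finally show ?thesis .
qed

lemma inner_ext: assumes "\<And>k. inner a k = inner b k" shows "a = (b :: 'h::real_inner)"
  using assms[of "a - b"] by (metis inner_diff_left inner_eq_zero_iff right_minus_eq)

lemma Jt_add: "0 \<le> t \<Longrightarrow> Jt (h + k) t = Jt h t + Jt k t"
  by (rule inner_ext) (simp add: inner_Jt inner_add_left)

lemma Jt_scaleR: "0 \<le> t \<Longrightarrow> Jt (r *\<^sub>R h) t = r *\<^sub>R Jt h t"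
  by (rule inner_ext) (simp add: inner_Jt)

lemma Jt_diff: "0 \<le> t \<Longrightarrow> Jt (h - k) t = Jt h t - Jt k t"
  by (rule inner_ext) (simp add: inner_Jt inner_diff_left)

lemma Jt_0: "Jt h 0 = 0"
proof -
  have "Jf h 0 = (\<lambda>_. 0)" unfolding Jf_def by (rule ext, rule integral_eq_zero_AE) auto
  then show ?thesis by (simp add: Jt_def zero_l2_def)
qed

lemma P0_Jt: "0 \<le> t \<Longrightarrow> P0 (Jt h t) = Jt (P0 h) t"
  by (rule inner_ext) (simp add: inner_Jt P0_adj P0_tens[symmetric])

lemma tens_diff: assumes "sqi c" "sqi d" shows "tens c k - tens d k = tens (\<lambda>t. c t - d t) k"
proof -
  have s: "sqi (\<lambda>t. c t - d t)" using sqi_add[OF assms(1) sqi_scaleR[OF assms(2), of "-1"]] by simp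
  show ?thesis
    by (rule sec_ext) (use sec_tens[OF assms(1), of k] sec_tens[OF assms(2), of k] sec_tens[OF s, of k]
      sec_diff[of "tens c k" "tens d k"] in \<open>eventually_elim, simp add: scaleR_diff_left\<close>)
qed

lemma tens_Ioo_diff:
  assumes "0 \<le> s" "s \<le> t"
  shows "tens (indicator {0<..<t}) k - tens (indicator {0<..<s}) k = tens (indicator {s<..<t}) k"
proof -
  have d: "sqi (\<lambda>r. indicator {0<..<t} r - indicator {0<..<s} r :: real)"
    using sqi_add[OF sqi_Ioo[of 0 t] sqi_scaleR[OF sqi_Ioo[of 0 s], of "-1"]] by simp
  have "AE r in lborel. sec (tens (\<lambda>r. indicator {0<..<t} r - indicator {0<..<s} r) k) r = sec (tens (indicator {s<..<t}) k) r"
    using sec_tens[OF d, of k] sec_tens[OF sqi_Ioo[of s t], of k] AE_lborel_singleton[of s]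
    by eventually_elim (use assms in \<open>auto simp: indicator_def\<close>)
  then show ?thesis unfolding tens_diff[OF sqi_Ioo sqi_Ioo] by (rule sec_ext)
qed

lemma norm_tens_Ioo: assumes "s \<le> t" shows "norm (tens (indicator {s<..<t}) k) = sqrt (t - s) * norm k"
  using norm_tens[OF sqi_Ioo[of s t], of k] LINT_Ioo_sq[OF assms] assms
  by (metis abs_norm_cancel real_sqrt_abs real_sqrt_mult)

lemma inner_Jt_diff:
  assumes "0 \<le> s" "s \<le> t" shows "inner (Jt h t - Jt h s) k = inner h (tens (indicator {s<..<t}) k)"
proof -
  have "inner (Jt h t - Jt h s) k = inner h (tens (indicator {0<..<t}) k - tens (indicator {0<..<s}) k)"
    using assms by (simp add: inner_diff_left inner_diff_right inner_Jt)
  then show ?thesis using tens_Ioo_diff[OF assms, of k] by simp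
qed

text \<open>Pair the difference with itself: the test element is then a tensor over (s,t) of norm
  \<open>sqrt (t - s)\<close> times the norm of the difference, and one factor cancels.\<close>

lemma norm_Jt_diff:
  assumes "0 \<le> s" "s \<le> t" shows "norm (Jt h t - Jt h s) \<le> sqrt (t - s) * norm h"
proof -
  define k where "k = Jt h t - Jt h s"
  have "(norm k)\<^sup>2 = inner h (tens (indicator {s<..<t}) k)"
    using inner_Jt_diff[OF assms, of h k] by (simp add: power2_norm_eq_inner k_def)
  also have "\<dots> \<le> norm h * norm (tens (indicator {s<..<t}) k)" by (rule norm_cauchy_schwarz)
  also have "\<dots> = (sqrt (t - s) * norm h) * norm k" by (simp add: norm_tens_Ioo assms)
  finally have "norm k * norm k \<le> (sqrt (t - s) * norm h) * norm k" by (simp only: power2_eq_square)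
  then show ?thesis
    using assms by (cases "norm k = 0") (auto simp: k_def)
qed

lemma J_add: "J T (h + k) = J T h + J T k"
  by (rule sec_ext) (use sec_J[of T h] sec_J[of T k] sec_J[of T "h+k"] sec_add[of "J T h" "J T k"]
    in \<open>eventually_elim, auto simp: Jt_add\<close>)

lemma J_scaleR: "J T (r *\<^sub>R h) = r *\<^sub>R J T h"
  by (rule sec_ext) (use sec_J[of T h] sec_J[of T "r *\<^sub>R h"] sec_scaleR[of r "J T h"]
    in \<open>eventually_elim, auto simp: Jt_scaleR\<close>)

lemma J_diff: "J T (h - k) = J T h - J T k"
  using J_add[of T "h - k" k] by simp

lemma P0_J: "P0 (J T h) = J T (P0 h)"
  by (rule sec_ext) (use sec_J[of T h] sec_J[of T "P0 h"] sec_P0[of "J T h"]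
    in \<open>eventually_elim, auto simp: P0_Jt\<close>)

lemma P1_J: "P1 (J T h) = J T (P1 h)"
  by (simp add: P1_def P0_J J_diff)

section \<open>The linear parabolic problem\<close>

abbreviation ind :: "real \<Rightarrow> real \<Rightarrow> real" where "ind t \<equiv> indicator {0<..<t}"

lemma inner_tm_P0: "bdm c \<Longrightarrow> inner h (P0 (tm c h)) = inner (tm c (P0 h)) (P0 h)"
  by (metis P0_P0 P0_adj P0_tm inner_commute)

lemma inner_tm_ge:
  assumes "bdm c" "\<And>t. m \<le> c t" shows "m * (norm h)\<^sup>2 \<le> inner (tm c h) h"
proof -
  have "m * (norm h)\<^sup>2 = (LINT t|lborel. m * inner (sec h t) (sec h t))"
    using norm_sec(2)[of h] by (simp add: power2_norm_eq_inner)
  also have "\<dots> \<le> (LINT t|lborel. c t * inner (sec h t) (sec h t))"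
    by (rule integral_mono) (use inner_tm(2)[OF assms(1)] inner_sec(1) assms(2) in \<open>auto intro: mult_right_mono\<close>)
  finally show ?thesis by (simp add: inner_tm(1)[OF assms(1)])
qed

lemma sec_tm_ind: "AE s in lborel. sec (tm (ind t) h) s = ind t s *\<^sub>R sec h s"
  by (rule sec_tm) simp

lemma tm_ind_J: "tm (ind T) (J T h) = J T h"
  by (rule sec_ext) (use sec_tm_ind[of T "J T h"] sec_J[of T h] in \<open>eventually_elim, auto simp: indicator_def\<close>)

text \<open>Integration in time is a monotone operator: this is \<open>J_sym\<close> at the final
  time.\<close>

lemma J_nonneg: "0 \<le> T \<Longrightarrow> 0 \<le> inner h (J T h)"
  using J_sym[of T T h] zero_le_power2[of "norm (Jt h T)"] unfolding tm_ind_J by linarith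

lemma norm_tm_ind: "norm (tm (ind t) h) \<le> norm h"
  using norm_tm[of "ind t" 1 h] by (simp add: indicator_def)

text \<open>\<open>Hs\<close> abstracts H^1_0 as a set of pairs (function, gradient). The link
  between the two components is \<open>P0_inj\<close>: a pair whose function part vanishes is
  zero.\<close>

locale parabolic =
  fixes Hs :: "('a::euclidean_space, real \<times> 'a) l2 set" and T m M :: real
  assumes Hs_subspace: "subspace Hs" and Hs_closed: "closed Hs"
    and P0_inj: "\<And>k. k \<in> Hs \<Longrightarrow> P0 k = 0 \<Longrightarrow> k = 0"
    and T: "T > 0" and m: "0 < m" and mM: "m \<le> M"
begin

text \<open>Slices vanish outside (0,T), so integrals over the whole line and over the interval
  agree, and W is a closed subspace of one fixed Hilbert space.\<close>

definition W :: "(real \<times> 'a, real \<times> 'a) l2 set" where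
  "W = {h. AE t in lborel. sec h t \<in> (if 0 < t \<and> t < T then Hs else {0})}"

lemma fiber_subspace: "subspace (if 0 < t \<and> t < T then Hs else {0})"
  using Hs_subspace by (simp add: subspace_single_0)

lemma fiber_closed: "closed (if 0 < t \<and> t < T then Hs else {0})"
  using Hs_closed by simp

lemma W_subspace: "subspace W"
  unfolding subspace_def
proof (intro conjI allI ballI)
  show "0 \<in> W" unfolding W_def mem_Collect_eq using sec_zero[where 'a='a and 'b="real \<times> 'a"]
    by eventually_elim (simp add: subspace_0[OF fiber_subspace] split del: if_split)
next
  fix x y assume "x \<in> W" "y \<in> W"
  then have "AE t in lborel. sec x t \<in> (if 0 < t \<and> t < T then Hs else {0})"
    "AE t in lborel. sec y t \<in> (if 0 < t \<and> t < T then Hs else {0})" by (simp_all add: W_def)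
  then show "x + y \<in> W" unfolding W_def mem_Collect_eq using sec_add[of x y]
    by eventually_elim (simp add: subspace_add[OF fiber_subspace] split del: if_split)
next
  fix c x assume "x \<in> W"
  then have "AE t in lborel. sec x t \<in> (if 0 < t \<and> t < T then Hs else {0})" by (simp add: W_def)
  then show "c *\<^sub>R x \<in> W" unfolding W_def mem_Collect_eq using sec_scaleR[of c x]
    by eventually_elim (simp add: subspace_scale[OF fiber_subspace] split del: if_split)
qed

lemma W_closed: "closed W"
  unfolding closed_sequential_limits
proof (intro allI impI)
  fix h k assume "(\<forall>n. h n \<in> W) \<and> h \<longlonglongrightarrow> k"
  then have hW: "\<And>n. h n \<in> W" and lim: "h \<longlonglongrightarrow> k" by auto
  obtain r where r: "strict_mono (r :: nat \<Rightarrow> nat)" "AE t in lborel. (\<lambda>n. sec (h (r n)) t) \<longlonglongrightarrow> sec k t"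
    by (rule sec_tendsto_subseq[OF lim])
  have "AE t in lborel. \<forall>n. sec (h (r n)) t \<in> (if 0 < t \<and> t < T then Hs else {0})"
    unfolding AE_all_countable using hW by (simp add: W_def)
  with r(2) have "AE t in lborel. sec k t \<in> (if 0 < t \<and> t < T then Hs else {0})"
  proof eventually_elim
    case (elim t)
    show ?case by (rule closed_sequentially[OF fiber_closed]) (use elim in auto)
  qed
  then show "k \<in> W" by (simp add: W_def)
qed

lemma W_tm: assumes "bdm c" "h \<in> W" shows "tm c h \<in> W"
proof -
  have "AE t in lborel. sec h t \<in> (if 0 < t \<and> t < T then Hs else {0})" using assms(2) by (simp add: W_def)
  then show ?thesis unfolding W_def mem_Collect_eq using sec_tm[OF assms(1), of h]
    by eventually_elim (simp add: subspace_scale[OF fiber_subspace] split del: if_split)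
qed

lemma W_tens: assumes "sqi c" "\<And>t. \<not> (0 < t \<and> t < T) \<Longrightarrow> c t = 0" "k \<in> Hs" shows "tens c k \<in> W"
  unfolding W_def mem_Collect_eq using sec_tens[OF assms(1), of k]
  by eventually_elim (use assms in \<open>auto simp: subspace_scale[OF Hs_subspace]\<close>)

lemma W_tens_Ioo: "0 \<le> s \<Longrightarrow> t \<le> T \<Longrightarrow> k \<in> Hs \<Longrightarrow> tens (indicator {s<..<t}) k \<in> W"
  by (rule W_tens) (auto simp: indicator_def)

lemma Jt_Hs: assumes "h \<in> W" "0 \<le> t" "t \<le> T" shows "Jt h t \<in> Hs"
proof (rule mem_if_perp_perp[OF Hs_subspace Hs_closed])
  fix k assume k: "\<And>s. s \<in> Hs \<Longrightarrow> inner k s = 0"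
  have "AE r in lborel. sec h r \<in> (if 0 < r \<and> r < T then Hs else {0})" using assms(1) by (simp add: W_def)
  then have "AE r in lborel. ind t r * inner (sec h r) k = 0"
    by eventually_elim (use k in \<open>auto simp: inner_commute[of _ k] split: if_splits\<close>)
  then have "(LINT r|lborel. ind t r * inner (sec h r) k) = 0" by (rule integral_eq_zero_AE)
  then show "inner (Jt h t) k = 0" by (simp add: inner_Jt assms inner_tens)
qed

lemma W_J: assumes "h \<in> W" shows "J T h \<in> W"
  unfolding W_def mem_Collect_eq using sec_J[of T h]
  by eventually_elim (use Jt_Hs[OF assms] in auto)

definition coef :: "(real \<Rightarrow> real) \<Rightarrow> bool" where
  "coef \<alpha> \<longleftrightarrow> \<alpha> \<in> borel_measurable borel \<and> (\<forall>t. m \<le> \<alpha> t \<and> \<alpha> t \<le> M)"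

lemma coef_abs: "coef \<alpha> \<Longrightarrow> \<bar>\<alpha> t\<bar> \<le> M"
  unfolding coef_def abs_le_iff using m by (metis minus_le_iff less_imp_le neg_le_0_iff_le order_trans)

lemma coef_bdm[simp]: "coef \<alpha> \<Longrightarrow> bdm \<alpha>"
  using coef_abs[of \<alpha>] by (auto simp: bdm_def coef_def)

lemma P0_inj_W: assumes "z \<in> W" "P0 z = 0" shows "z = 0"
proof (rule sec_ext)
  have "AE t in lborel. sec z t \<in> (if 0 < t \<and> t < T then Hs else {0})" using assms(1) by (simp add: W_def)
  then show "AE t in lborel. sec z t = sec 0 t"
    using sec_P0[of z] sec_zero[where 'a='a and 'b="real \<times> 'a"] unfolding assms(2)
    by eventually_elim (use P0_inj in \<open>auto split: if_splits\<close>)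
qed

definition opr :: "(real \<Rightarrow> real) \<Rightarrow> (real \<times> 'a, real \<times> 'a) l2 \<Rightarrow> (real \<times> 'a, real \<times> 'a) l2" where
  "opr \<alpha> v = P0 v + tm \<alpha> (P1 (J T v))"

lemma opr_add: "coef \<alpha> \<Longrightarrow> opr \<alpha> (v + w) = opr \<alpha> v + opr \<alpha> w"
  by (simp add: opr_def P0_add J_add P1_add tm_add)
lemma opr_scaleR: "coef \<alpha> \<Longrightarrow> opr \<alpha> (c *\<^sub>R v) = c *\<^sub>R opr \<alpha> v"
  by (simp add: opr_def P0_scaleR J_scaleR P1_scaleR tm_scaleR scaleR_add_right)
lemma opr_diff: "coef \<alpha> \<Longrightarrow> opr \<alpha> (v - w) = opr \<alpha> v - opr \<alpha> w"
  using opr_add[of \<alpha> "v - w" w] by simp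

text \<open>The factor \<alpha> placed on \<open>z\<close> makes the gradient term symmetric: with
  \<open>y = \<alpha> P1 z\<close> it is the product of \<open>y\<close> and \<open>J T y\<close>,
  which is nonnegative. The other term is bounded below through \<alpha> \<ge> m.\<close>

lemma opr_self:
  assumes "coef \<alpha>" shows "m * (norm (P0 z))\<^sup>2 \<le> inner z (opr \<alpha> (tm \<alpha> z))"
proof -
  have b: "bdm \<alpha>" using assms by simp
  define y where "y = tm \<alpha> (P1 z)"
  have "inner z (tm \<alpha> (P1 (J T (tm \<alpha> z)))) = inner y (J T (tm \<alpha> z))"
    by (metis b y_def tm_adj P1_adj P1_tm)
  also have "\<dots> = inner (P1 y) (J T (tm \<alpha> z))" by (simp add: y_def b P1_tm)
  also have "\<dots> = inner y (J T y)"
    using P1_adj[of y "J T (tm \<alpha> z)"] by (simp add: P1_J P1_tm b y_def)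
  finally have "0 \<le> inner z (tm \<alpha> (P1 (J T (tm \<alpha> z))))" using J_nonneg[of T y] T by simp
  moreover have "m * (norm (P0 z))\<^sup>2 \<le> inner z (P0 (tm \<alpha> z))"
    using inner_tm_ge[OF b, of m "P0 z"] inner_tm_P0[OF b, of z] assms by (simp add: coef_def)
  ultimately show ?thesis by (simp add: opr_def inner_add_right)
qed

text \<open>Density of the range by duality: a \<open>z\<close> orthogonal to the range is tested against
  \<open>v = \<alpha> z\<close>, for which both terms of the equation are nonnegative.\<close>

lemma opr_dense:
  assumes \<alpha>: "coef \<alpha>" and e: "e > 0"
  obtains v where "v \<in> W" "\<And>z. z \<in> W \<Longrightarrow> \<bar>inner (opr \<alpha> v - f) z\<bar> \<le> e * norm z"
proof -
  \<comment> \<open>Adding the annihilator Q of W to the range forces every vector orthogonal to S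
    into W, while pairings with elements of W do not see the added part.\<close>
  define Q where "Q = {q. \<forall>z\<in>W. inner q z = 0}"
  define S where "S = {opr \<alpha> v + q | v q. v \<in> W \<and> q \<in> Q}"
  have Q: "subspace Q" by (auto simp: subspace_def Q_def inner_add_left)
  have S: "subspace S"
    unfolding subspace_def
  proof (intro conjI allI ballI)
    have "opr \<alpha> 0 + 0 = 0" using opr_scaleR[OF \<alpha>, of 0 0] by simp
    then show "0 \<in> S" unfolding S_def using subspace_0[OF W_subspace] subspace_0[OF Q] by force
  next
    fix x y assume "x \<in> S" "y \<in> S"
    then obtain v q w p where *: "x = opr \<alpha> v + q" "y = opr \<alpha> w + p" "v \<in> W" "w \<in> W" "q \<in> Q" "p \<in> Q"
      by (auto simp: S_def)
    have "x + y = opr \<alpha> (v + w) + (q + p)" by (simp add: * opr_add[OF \<alpha>])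
    moreover have "v + w \<in> W" "q + p \<in> Q" using * W_subspace Q by (auto intro: subspace_add)
    ultimately show "x + y \<in> S" unfolding S_def by blast
  next
    fix c x assume "x \<in> S"
    then obtain v q where *: "x = opr \<alpha> v + q" "v \<in> W" "q \<in> Q" by (auto simp: S_def)
    have "c *\<^sub>R x = opr \<alpha> (c *\<^sub>R v) + c *\<^sub>R q" by (simp add: * opr_scaleR[OF \<alpha>] scaleR_add_right)
    then show "c *\<^sub>R x \<in> S" unfolding S_def
      using subspace_scale[OF W_subspace *(2), of c] subspace_scale[OF Q *(3), of c] by blast
  qed
  have "closure S = UNIV"
  proof (rule dense_if_perp_trivial[OF S])
    fix z assume z: "\<And>s. s \<in> S \<Longrightarrow> inner z s = 0"
    have zW: "z \<in> W"
    proof (rule mem_if_perp_perp[OF W_subspace W_closed])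
      fix k assume "\<And>s. s \<in> W \<Longrightarrow> inner k s = 0"
      then have "k \<in> Q" by (simp add: Q_def)
      moreover have "opr \<alpha> 0 = 0" using opr_scaleR[OF \<alpha>, of 0 0] by simp
      ultimately have "k \<in> S" unfolding S_def using subspace_0[OF W_subspace] by force
      then show "inner z k = 0" by (rule z)
    qed
    have "opr \<alpha> (tm \<alpha> z) + 0 \<in> S"
      unfolding S_def using W_tm[OF coef_bdm[OF \<alpha>] zW] subspace_0[OF Q] by blast
    then have "inner z (opr \<alpha> (tm \<alpha> z)) = 0" using z by simp
    then have "m * (norm (P0 z))\<^sup>2 \<le> 0" using opr_self[OF \<alpha>, of z] by simp
    then have "P0 z = 0" using m by (simp add: mult_le_0_iff)
    then show "z = 0" using P0_inj_W zW by blast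
  qed
  then have "f \<in> closure S" by simp
  then obtain s where s: "s \<in> S" "dist s f < e" using e by (auto simp: closure_approachable)
  then obtain v q where vq: "s = opr \<alpha> v + q" "v \<in> W" "q \<in> Q" by (auto simp: S_def)
  have "\<bar>inner (opr \<alpha> v - f) z\<bar> \<le> e * norm z" if "z \<in> W" for z
  proof -
    have "inner (opr \<alpha> v - f) z = inner (s - f) z" using vq that by (simp add: Q_def inner_diff_left inner_add_left)
    also have "\<bar>\<dots>\<bar> \<le> norm (s - f) * norm z" by (rule Cauchy_Schwarz_ineq2)
    also have "\<dots> \<le> e * norm z" using s(2) by (intro mult_right_mono) (auto simp: dist_norm)
    finally show ?thesis .
  qed
  then show ?thesis using that vq(2) by blast
qed

lemma opr_energy:
  assumes "coef \<alpha>" "0 \<le> t" "t \<le> T"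
  shows "inner (opr \<alpha> v) (tm (ind t) (J T v))
     = (norm (P0 (Jt v t)))\<^sup>2 / 2 + inner (tm \<alpha> (P1 (J T v))) (tm (ind t) (J T v))"
proof -
  have "inner (P0 v) (tm (ind t) (J T v)) = inner (P0 v) (tm (ind t) (J T (P0 v)))"
    using P0_adj[of "P0 v" "tm (ind t) (J T v)"] by (simp add: P0_tm P0_J)
  also have "\<dots> = (norm (P0 (Jt v t)))\<^sup>2 / 2" using J_sym[of t T "P0 v"] assms by (simp add: P0_Jt)
  finally show ?thesis by (simp add: opr_def inner_add_left)
qed

lemma tm_ind_form:
  assumes "coef \<alpha>"
  shows "inner (tm \<alpha> (P1 u)) (tm (ind t) u) = (LINT s|lborel. ind t s * \<alpha> s * (norm (sec (P1 u) s))\<^sup>2)"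
    and "integrable lborel (\<lambda>s. ind t s * \<alpha> s * (norm (sec (P1 u) s))\<^sup>2)"
proof -
  have "inner (tm \<alpha> (P1 u)) (tm (ind t) u) = inner (P1 (tm \<alpha> (P1 u))) (tm (ind t) u)"
    using assms by (simp add: P1_tm)
  also have "\<dots> = inner (tm \<alpha> (P1 u)) (tm (ind t) (P1 u))" by (simp add: P1_adj P1_tm)
  also have "\<dots> = inner (tm (\<lambda>s. ind t s * \<alpha> s) (P1 u)) (P1 u)"
    using assms by (simp add: tm_adj[symmetric] tm_tm)
  finally show "inner (tm \<alpha> (P1 u)) (tm (ind t) u) = (LINT s|lborel. ind t s * \<alpha> s * (norm (sec (P1 u) s))\<^sup>2)"
    using inner_tm(1)[OF bdm_mult[OF bdm_indicator coef_bdm[OF assms]], of "{0<..<t}" "P1 u" "P1 u"]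
    by (simp add: power2_norm_eq_inner)
  show "integrable lborel (\<lambda>s. ind t s * \<alpha> s * (norm (sec (P1 u) s))\<^sup>2)"
    using inner_tm(2)[OF bdm_mult[OF bdm_indicator coef_bdm[OF assms]], of "{0<..<t}" "P1 u" "P1 u"]
    by (simp add: power2_norm_eq_inner)
qed

lemma tm_ind_form_nonneg: assumes "coef \<alpha>" shows "0 \<le> inner (tm \<alpha> (P1 u)) (tm (ind t) u)"
  unfolding tm_ind_form(1)[OF assms]
proof (rule integral_nonneg_AE, rule AE_I2)
  fix s
  have "0 \<le> \<alpha> s" using assms m unfolding coef_def by (meson less_imp_le order_trans)
  then show "0 \<le> ind t s * \<alpha> s * (norm (sec (P1 u) s))\<^sup>2" by simp
qed

section \<open>A priori estimates\<close>

text \<open>\<open>2 * T\<close> comes from the bound of the function part, uniform in time and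
  integrated over (0,T); \<open>1 / m\<close> comes from the gradient part, by coercivity.\<close>

definition C0 :: real where "C0 = 2 * T + 1 / m"

lemma C0: "C0 > 0" using T m by (simp add: C0_def add_pos_pos)

text \<open>The energy inequality is assumed for an abstract pair \<open>u\<close>,
  \<open>w\<close>, so the same estimate serves approximate primitives and their limits. Its
  right-hand side is linear in the norm of \<open>u\<close>, which cancels one power of the square
  on the left.\<close>

lemma apriori:
  assumes \<alpha>: "coef \<alpha>" and B: "B \<ge> 0" and uW: "u \<in> W"
    and en: "\<And>t. 0 \<le> t \<Longrightarrow> t \<le> T \<Longrightarrow>
       (norm (w t))\<^sup>2 / 2 + inner (tm \<alpha> (P1 u)) (tm (ind t) u) \<le> B * norm (tm (ind t) u)"
    and ae: "AE t in lborel. 0 < t \<and> t < T \<longrightarrow> w t = P0 (sec u t)"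
  shows "norm u \<le> C0 * B" and "\<And>t. 0 \<le> t \<Longrightarrow> t \<le> T \<Longrightarrow> (norm (w t))\<^sup>2 \<le> 2 * C0 * B\<^sup>2"
proof -
  have en': "(norm (w t))\<^sup>2 / 2 + inner (tm \<alpha> (P1 u)) (tm (ind t) u) \<le> B * norm u" if "0 \<le> t" "t \<le> T" for t
    using en[OF that] mult_left_mono[OF norm_tm_ind[of t u] B] by linarith
  have w: "(norm (w t))\<^sup>2 \<le> 2 * B * norm u" if "0 \<le> t" "t \<le> T" for t
    using en'[OF that] tm_ind_form_nonneg[OF \<alpha>, of u t] by linarith
  have tu: "tm (ind T) u = u"
  proof (rule sec_ext)
    have "AE t in lborel. sec u t \<in> (if 0 < t \<and> t < T then Hs else {0})" using uW by (simp add: W_def)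
    then show "AE t in lborel. sec (tm (ind T) u) t = sec u t"
      using sec_tm_ind[of T u] by eventually_elim (auto simp: indicator_def split: if_splits)
  qed
  have "m * (norm (P1 u))\<^sup>2 \<le> inner (tm \<alpha> (P1 u)) (P1 u)"
    by (rule inner_tm_ge) (use \<alpha> in \<open>auto simp: coef_def bdm_def\<close>, use \<alpha> coef_abs in blast)
  also have "\<dots> = inner (tm \<alpha> (P1 u)) u" using P1_adj[of "tm \<alpha> (P1 u)" u] \<alpha> by (simp add: P1_tm)
  also have "\<dots> \<le> B * norm u" using en'[OF less_imp_le[OF T] order_refl] zero_le_power2[of "norm (w T)"] unfolding tu by linarith
  finally have p1: "(norm (P1 u))\<^sup>2 \<le> (1 / m) * (B * norm u)" using m by (simp add: field_simps)
  have "(norm (P0 u))\<^sup>2 = (LINT t|lborel. (norm (sec (P0 u) t))\<^sup>2)" by (rule norm_sec(2))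
  also have "\<dots> \<le> (LINT t|lborel. ind T t * (2 * B * norm u))"
  proof (rule integral_mono_AE)
    show "integrable lborel (\<lambda>t. ind T t * (2 * B * norm u))"
      by (intro integrable_mult_left integrable_real_indicator emeasure_Ioo_finite) simp
    have "AE t in lborel. sec u t \<in> (if 0 < t \<and> t < T then Hs else {0})" using uW by (simp add: W_def)
    then show "AE t in lborel. (norm (sec (P0 u) t))\<^sup>2 \<le> ind T t * (2 * B * norm u)"
      using ae sec_P0[of u]
    proof eventually_elim
      case (elim t)
      then show ?case using w[of t] by (cases "0 < t \<and> t < T") auto
    qed
  qed (rule norm_sec(1))
  also have "\<dots> = T * (2 * B * norm u)" using T by simp
  finally have p0: "(norm (P0 u))\<^sup>2 \<le> T * (2 * B * norm u)" .
  have "norm u * norm u \<le> (C0 * B) * norm u"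
    using p0 p1 norm_split[of u] by (simp add: C0_def algebra_simps power2_eq_square)
  then show u: "norm u \<le> C0 * B"
    using C0 B by (cases "norm u = 0") auto
  fix t assume t: "0 \<le> t" "t \<le> T"
  have "(norm (w t))\<^sup>2 \<le> 2 * B * norm u" by (rule w[OF t])
  also have "\<dots> \<le> 2 * B * (C0 * B)" using u B by (intro mult_left_mono) auto
  finally show "(norm (w t))\<^sup>2 \<le> 2 * C0 * B\<^sup>2" by (simp add: power2_eq_square algebra_simps)
qed

lemma apriori_J:
  assumes \<alpha>: "coef \<alpha>" and B: "B \<ge> 0" and v: "v \<in> W" and bd: "\<And>z. z \<in> W \<Longrightarrow> \<bar>inner (opr \<alpha> v) z\<bar> \<le> B * norm z"
  shows "norm (J T v) \<le> C0 * B" and "\<And>t. 0 \<le> t \<Longrightarrow> t \<le> T \<Longrightarrow> (norm (P0 (Jt v t)))\<^sup>2 \<le> 2 * C0 * B\<^sup>2"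
proof -
  have en: "(norm (P0 (Jt v t)))\<^sup>2 / 2 + inner (tm \<alpha> (P1 (J T v))) (tm (ind t) (J T v)) \<le> B * norm (tm (ind t) (J T v))"
    if "0 \<le> t" "t \<le> T" for t
  proof -
    have "tm (ind t) (J T v) \<in> W" using W_J[OF v] by (intro W_tm) auto
    from bd[OF this] show ?thesis using opr_energy[OF \<alpha> that, of v] by linarith
  qed
  have ae: "AE t in lborel. 0 < t \<and> t < T \<longrightarrow> P0 (Jt v t) = P0 (sec (J T v) t)"
    using sec_J[of T v] by eventually_elim auto
  note * = apriori[OF \<alpha> B W_J[OF v] en ae]
  show "norm (J T v) \<le> C0 * B" by (rule *(1))
  show "\<And>t. 0 \<le> t \<Longrightarrow> t \<le> T \<Longrightarrow> (norm (P0 (Jt v t)))\<^sup>2 \<le> 2 * C0 * B\<^sup>2" by (rule *(2))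
qed

end

section \<open>Solutions of the linear problem as limits of primitives\<close>

lemma bounded_linear_tm: assumes "bdm c" shows "bounded_linear (tm c)"
proof -
  obtain B where "\<And>t. \<bar>c t\<bar> \<le> B" using assms by (auto simp: bdm_def)
  then show ?thesis
    by (intro bounded_linear_intro[where K=B])
      (use norm_tm[OF assms, of B] in \<open>auto simp: tm_add[OF assms] tm_scaleR[OF assms] mult.commute\<close>)
qed

lemma inverse_Suc_pair_less:
  fixes K e :: real assumes "e > 0" "K \<ge> 0"
  obtains N where "\<And>n k. n \<ge> N \<Longrightarrow> k \<ge> N \<Longrightarrow> K * (1 / real (Suc n) + 1 / real (Suc k)) < e"
proof -
  obtain N where N: "real N > 2 * K / e" using reals_Archimedean2 by blast
  have "K * (1 / real (Suc n) + 1 / real (Suc k)) < e" if "n \<ge> N" "k \<ge> N" for n k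
  proof -
    have s: "1 / real (Suc j) \<le> 1 / real (Suc N)" if "j \<ge> N" for j
      using that by (intro divide_left_mono) auto
    have "K * (1 / real (Suc n) + 1 / real (Suc k)) \<le> K * (1 / real (Suc N) + 1 / real (Suc N))"
      using s[OF that(1)] s[OF that(2)] assms by (intro mult_left_mono) linarith+
    also have "\<dots> = 2 * K / real (Suc N)" by simp
    also have "\<dots> < e"
    proof -
      have "2 * K < real N * e" using N assms by (simp add: field_simps)
      also have "\<dots> \<le> real (Suc N) * e" using assms by (intro mult_right_mono) auto
      finally show ?thesis by (simp add: field_simps)
    qed
    finally show ?thesis .
  qed
  then show ?thesis using that by blast
qed

context parabolic begin

text \<open>\<open>u\<close> solves the linear problem with time-continuous representative \<open>w\<close>: both are limits of
  primitives \<open>J T v\<close>, whose residuals tend to zero in the dual norm.\<close>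

definition Sol :: "(real \<Rightarrow> real) \<Rightarrow> (real \<times> 'a, real \<times> 'a) l2 \<Rightarrow> (real \<times> 'a, real \<times> 'a) l2
    \<Rightarrow> (real \<Rightarrow> ('a, real \<times> 'a) l2) \<Rightarrow> bool" where
  "Sol \<alpha> f u w \<longleftrightarrow> (\<exists>v \<epsilon>. (\<forall>n::nat. v n \<in> W) \<and> (\<lambda>n. J T (v n)) \<longlonglongrightarrow> u \<and> \<epsilon> \<longlonglongrightarrow> (0::real) \<and>
     (\<forall>n. \<forall>z\<in>W. \<bar>inner (opr \<alpha> (v n) - f) z\<bar> \<le> \<epsilon> n * norm z) \<and>
     uniform_limit {0..T} (\<lambda>n t. P0 (Jt (v n) t)) w sequentially)"

text \<open>Density supplies residuals of size at most 1/(n+1). The a priori estimate applied to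
  differences makes the primitives Cauchy, and their function parts Cauchy uniformly in time;
  nothing is claimed about convergence of the \<open>v n\<close>.\<close>

lemma Sol_exists: assumes \<alpha>: "coef \<alpha>" obtains u w where "Sol \<alpha> f u w"
proof -
  have "\<exists>v. v \<in> W \<and> (\<forall>z\<in>W. \<bar>inner (opr \<alpha> v - f) z\<bar> \<le> 1 / real (Suc n) * norm z)" for n
    using opr_dense[OF \<alpha>, of "1 / real (Suc n)" f] by (metis of_nat_0_less_iff zero_less_Suc zero_less_divide_1_iff)
  then obtain v where v: "\<And>n. v n \<in> W" "\<And>n z. z \<in> W \<Longrightarrow> \<bar>inner (opr \<alpha> (v n) - f) z\<bar> \<le> 1 / real (Suc n) * norm z"
    by metis
  let ?B = "\<lambda>n k. 1 / real (Suc n) + 1 / real (Suc k)"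
  have vv: "v n - v k \<in> W" for n k using v(1) W_subspace by (simp add: subspace_diff)
  have bd: "\<bar>inner (opr \<alpha> (v n - v k)) z\<bar> \<le> ?B n k * norm z" if "z \<in> W" for n k z
  proof -
    have "inner (opr \<alpha> (v n - v k)) z = inner (opr \<alpha> (v n) - f) z - inner (opr \<alpha> (v k) - f) z"
      by (simp add: opr_diff[OF \<alpha>] inner_diff_left)
    then show ?thesis using v(2)[OF that, of n] v(2)[OF that, of k] unfolding distrib_right by linarith
  qed
  have B0: "0 \<le> ?B n k" for n k by simp
  have a1: "norm (J T (v n) - J T (v k)) \<le> C0 * ?B n k" for n k
    using apriori_J(1)[OF \<alpha> B0 vv bd] by (simp only: J_diff)
  have a2: "norm (P0 (Jt (v n) t) - P0 (Jt (v k) t)) \<le> sqrt (2 * C0) * ?B n k" if "0 \<le> t" "t \<le> T" for n k t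
  proof -
    have "(norm (P0 (Jt (v n - v k) t)))\<^sup>2 \<le> 2 * C0 * (?B n k)\<^sup>2"
      by (rule apriori_J(2)[OF \<alpha> B0 vv bd that])
    then have "norm (P0 (Jt (v n - v k) t)) \<le> sqrt (2 * C0 * (?B n k)\<^sup>2)" by (rule real_le_rsqrt)
    also have "\<dots> = sqrt (2 * C0) * ?B n k" by (subst real_sqrt_mult) simp
    finally show ?thesis using that by (simp only: Jt_diff P0_diff)
  qed
  have "Cauchy (\<lambda>n. J T (v n))"
  proof (rule metric_CauchyI)
    fix e :: real assume "e > 0"
    then obtain N where "\<And>n k. n \<ge> N \<Longrightarrow> k \<ge> N \<Longrightarrow> C0 * ?B n k < e"
      using inverse_Suc_pair_less[of e C0] C0 by (metis less_imp_le)
    then show "\<exists>N. \<forall>n\<ge>N. \<forall>k\<ge>N. dist (J T (v n)) (J T (v k)) < e"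
      unfolding dist_norm using a1 by (meson le_less_trans)
  qed
  then obtain u where u: "(\<lambda>n. J T (v n)) \<longlonglongrightarrow> u" using Cauchy_convergent convergent_def by blast
  have "uniformly_Cauchy_on {0..T} (\<lambda>n t. P0 (Jt (v n) t))"
    unfolding uniformly_Cauchy_on_def
  proof (intro allI impI)
    fix e :: real assume "e > 0"
    then obtain N where "\<And>n k. n \<ge> N \<Longrightarrow> k \<ge> N \<Longrightarrow> sqrt (2 * C0) * ?B n k < e"
      using inverse_Suc_pair_less[of e "sqrt (2 * C0)"] C0 by (metis less_imp_le mult_2 add_pos_pos real_sqrt_ge_zero)
    then show "\<exists>N. \<forall>t\<in>{0..T}. \<forall>n\<ge>N. \<forall>k\<ge>N. dist (P0 (Jt (v n) t)) (P0 (Jt (v k) t)) < e"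
      unfolding dist_norm using a2 by (meson atLeastAtMost_iff le_less_trans)
  qed
  then obtain w where w: "uniform_limit {0..T} (\<lambda>n t. P0 (Jt (v n) t)) w sequentially"
    using Cauchy_uniformly_convergent uniformly_convergent_on_def by blast
  have "(\<lambda>n. 1 / real (Suc n)) \<longlonglongrightarrow> 0" using LIMSEQ_inverse_real_of_nat by (simp add: inverse_eq_divide)
  then have "Sol \<alpha> f u w" unfolding Sol_def using v u w by blast
  then show ?thesis using that by blast
qed

lemma Sol_diff:
  assumes \<alpha>: "coef \<alpha>" and "Sol \<alpha> f1 u1 w1" "Sol \<alpha> f2 u2 w2"
  shows "Sol \<alpha> (f1 - f2) (u1 - u2) (\<lambda>t. w1 t - w2 t)"
proof -
  obtain v1 \<epsilon>1 where 1: "\<And>n. v1 n \<in> W" "(\<lambda>n. J T (v1 n)) \<longlonglongrightarrow> u1" "\<epsilon>1 \<longlonglongrightarrow> 0"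
     "\<And>n z. z \<in> W \<Longrightarrow> \<bar>inner (opr \<alpha> (v1 n) - f1) z\<bar> \<le> \<epsilon>1 n * norm z"
     "uniform_limit {0..T} (\<lambda>n t. P0 (Jt (v1 n) t)) w1 sequentially"
    using assms(2) unfolding Sol_def by blast
  obtain v2 \<epsilon>2 where 2: "\<And>n. v2 n \<in> W" "(\<lambda>n. J T (v2 n)) \<longlonglongrightarrow> u2" "\<epsilon>2 \<longlonglongrightarrow> 0"
     "\<And>n z. z \<in> W \<Longrightarrow> \<bar>inner (opr \<alpha> (v2 n) - f2) z\<bar> \<le> \<epsilon>2 n * norm z"
     "uniform_limit {0..T} (\<lambda>n t. P0 (Jt (v2 n) t)) w2 sequentially"
    using assms(3) unfolding Sol_def by blast
  show ?thesis unfolding Sol_def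
  proof (intro exI[of _ "\<lambda>n. v1 n - v2 n"] exI[of _ "\<lambda>n. \<epsilon>1 n + \<epsilon>2 n"] conjI allI ballI)
    show "v1 n - v2 n \<in> W" for n using 1(1) 2(1) W_subspace by (simp add: subspace_diff)
    show "(\<lambda>n. J T (v1 n - v2 n)) \<longlonglongrightarrow> u1 - u2" unfolding J_diff by (intro tendsto_intros 1 2)
    show "(\<lambda>n. \<epsilon>1 n + \<epsilon>2 n) \<longlonglongrightarrow> 0" using tendsto_add[OF 1(3) 2(3)] by simp
    fix n z assume z: "z \<in> W"
    have "inner (opr \<alpha> (v1 n - v2 n) - (f1 - f2)) z = inner (opr \<alpha> (v1 n) - f1) z - inner (opr \<alpha> (v2 n) - f2) z"
      by (simp add: opr_diff[OF \<alpha>] inner_diff_left)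
    then show "\<bar>inner (opr \<alpha> (v1 n - v2 n) - (f1 - f2)) z\<bar> \<le> (\<epsilon>1 n + \<epsilon>2 n) * norm z"
      using 1(4)[OF z, of n] 2(4)[OF z, of n] unfolding distrib_right by linarith
  next
    have "uniform_limit {0..T} (\<lambda>n t. P0 (Jt (v1 n) t) - P0 (Jt (v2 n) t)) (\<lambda>t. w1 t - w2 t) sequentially"
      by (intro uniform_limit_intros 1 2)
    then show "uniform_limit {0..T} (\<lambda>n t. P0 (Jt (v1 n - v2 n) t)) (\<lambda>t. w1 t - w2 t) sequentially"
      by (rule uniform_limit_cong'[THEN iffD1, rotated -1]) (simp_all add: Jt_diff P0_diff)
  qed
qed

lemma coef_diff_abs: "coef \<alpha> \<Longrightarrow> coef \<beta> \<Longrightarrow> \<bar>\<alpha> t - \<beta> t\<bar> \<le> M"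
proof -
  assume "coef \<alpha>" "coef \<beta>"
  then have "m \<le> \<alpha> t" "\<alpha> t \<le> M" "m \<le> \<beta> t" "\<beta> t \<le> M" by (auto simp: coef_def)
  then show ?thesis using m by linarith
qed

text \<open>The approximating sequence is kept and the difference of the coefficients moves to the
  right-hand side, so two solutions with different coefficients can be subtracted as solutions of
  one linear problem. The residual grows by at most \<open>M * norm (J T (v n) - u)\<close>.\<close>

lemma Sol_change:
  assumes \<alpha>: "coef \<alpha>" and \<beta>: "coef \<beta>" and S: "Sol \<beta> f u w"
  shows "Sol \<alpha> (f + tm (\<lambda>t. \<alpha> t - \<beta> t) (P1 u)) u w"
proof -
  obtain v \<epsilon> where 1: "\<And>n. v n \<in> W" "(\<lambda>n. J T (v n)) \<longlonglongrightarrow> u" "\<epsilon> \<longlonglongrightarrow> 0"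
     "\<And>n z. z \<in> W \<Longrightarrow> \<bar>inner (opr \<beta> (v n) - f) z\<bar> \<le> \<epsilon> n * norm z"
     "uniform_limit {0..T} (\<lambda>n t. P0 (Jt (v n) t)) w sequentially"
    using S unfolding Sol_def by blast
  let ?d = "\<lambda>t. \<alpha> t - \<beta> t"
  have b: "bdm \<alpha>" "bdm \<beta>" "bdm ?d" using \<alpha> \<beta> by (auto intro: bdm_diff)
  show ?thesis unfolding Sol_def
  proof (intro exI[of _ v] exI[of _ "\<lambda>n. \<epsilon> n + M * norm (J T (v n) - u)"] conjI allI ballI 1)
    have "(\<lambda>n. \<epsilon> n + M * norm (J T (v n) - u)) \<longlonglongrightarrow> 0 + M * norm (u - u)" by (intro tendsto_intros 1)
    then show "(\<lambda>n. \<epsilon> n + M * norm (J T (v n) - u)) \<longlonglongrightarrow> 0" by simp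
    fix n z assume z: "z \<in> W"
    have eq: "opr \<alpha> (v n) - (f + tm ?d (P1 u)) = (opr \<beta> (v n) - f) + tm ?d (P1 (J T (v n) - u))"
      by (simp add: opr_def tm_diff_left b P1_diff tm_diff)
    have "inner (opr \<alpha> (v n) - (f + tm ?d (P1 u))) z = inner (opr \<beta> (v n) - f) z + inner (tm ?d (P1 (J T (v n) - u))) z"
      unfolding eq by (rule inner_add_left)
    moreover have "\<bar>inner (tm ?d (P1 (J T (v n) - u))) z\<bar> \<le> (M * norm (J T (v n) - u)) * norm z"
    proof -
      have "\<bar>inner (tm ?d (P1 (J T (v n) - u))) z\<bar> \<le> norm (tm ?d (P1 (J T (v n) - u))) * norm z"
        by (rule Cauchy_Schwarz_ineq2)
      also have "norm (tm ?d (P1 (J T (v n) - u))) \<le> M * norm (P1 (J T (v n) - u))"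
        by (rule norm_tm[OF b(3) coef_diff_abs[OF \<alpha> \<beta>]])
      also have "\<dots> \<le> M * norm (J T (v n) - u)" using norm_P1 m mM by (intro mult_left_mono) auto
      finally show ?thesis by (simp add: mult_right_mono)
    qed
    ultimately show "\<bar>inner (opr \<alpha> (v n) - (f + tm ?d (P1 u))) z\<bar> \<le> (\<epsilon> n + M * norm (J T (v n) - u)) * norm z"
      using 1(4)[OF z, of n] unfolding distrib_right by linarith
  qed
qed

lemma
  assumes \<alpha>: "coef \<alpha>" and S: "Sol \<alpha> f u w"
  shows Sol_W: "u \<in> W"
    and Sol_energy: "\<And>t. 0 \<le> t \<Longrightarrow> t \<le> T \<Longrightarrow>
      (norm (w t))\<^sup>2 / 2 + inner (tm \<alpha> (P1 u)) (tm (ind t) u) = inner f (tm (ind t) u)"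
    and Sol_weak: "\<And>t k. 0 \<le> t \<Longrightarrow> t \<le> T \<Longrightarrow> k \<in> Hs \<Longrightarrow>
      inner (w t) k + inner (tm \<alpha> (P1 u)) (tens (ind t) k) = inner f (tens (ind t) k)"
    and Sol_P0: "\<And>t. 0 \<le> t \<Longrightarrow> t \<le> T \<Longrightarrow> P0 (w t) = w t"
    and Sol_0: "w 0 = 0"
    and Sol_cont: "continuous_on {0..T} w"
    and Sol_AE: "AE t in lborel. 0 < t \<and> t < T \<longrightarrow> w t = P0 (sec u t)"
proof -
  obtain v \<epsilon> where 1: "\<And>n. v n \<in> W" "(\<lambda>n. J T (v n)) \<longlonglongrightarrow> u" "\<epsilon> \<longlonglongrightarrow> 0"
     "\<And>n z. z \<in> W \<Longrightarrow> \<bar>inner (opr \<alpha> (v n) - f) z\<bar> \<le> \<epsilon> n * norm z"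
     "uniform_limit {0..T} (\<lambda>n t. P0 (Jt (v n) t)) w sequentially"
    using S unfolding Sol_def by blast
  have b: "bdm \<alpha>" using \<alpha> by simp
  have bi: "bdm (ind t)" for t by simp
  note tl = bounded_linear.tendsto[OF bounded_linear_tm[OF b]] bounded_linear.tendsto[OF bounded_linear_tm[OF bi]]
    bounded_linear.tendsto[OF bounded_linear_P1] bounded_linear.tendsto[OF bounded_linear_P0]
  show "u \<in> W" by (rule closed_sequentially[OF W_closed _ 1(2)]) (use 1(1) W_J in auto)
  have wl: "(\<lambda>n. P0 (Jt (v n) t)) \<longlonglongrightarrow> w t" if "0 \<le> t" "t \<le> T" for t
    by (rule tendsto_uniform_limitI[OF 1(5)]) (use that in auto)
  \<comment> \<open>Used with test elements that vary with \<open>n\<close>: convergence keeps their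
    norms bounded, so the vanishing residual factor wins.\<close>
  have res: "(\<lambda>n. inner (opr \<alpha> (v n) - f) (z n)) \<longlonglongrightarrow> 0" if "\<And>n. z n \<in> W" "z \<longlonglongrightarrow> z0" for z z0
  proof (rule tendsto_rabs_zero_cancel, rule tendsto_sandwich[OF _ _ tendsto_const])
    have "(\<lambda>n. \<epsilon> n * norm (z n)) \<longlonglongrightarrow> 0 * norm z0" by (intro tendsto_intros 1(3) that)
    then show "(\<lambda>n. \<epsilon> n * norm (z n)) \<longlonglongrightarrow> 0" by simp
  qed (use 1(4) that(1) in auto)
  show "(norm (w t))\<^sup>2 / 2 + inner (tm \<alpha> (P1 u)) (tm (ind t) u) = inner f (tm (ind t) u)"
    if t: "0 \<le> t" "t \<le> T" for t
  proof -
    \<comment> \<open>The energy identity is taken at the approximations, where it is the exact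
      \<open>opr_energy\<close>, and survives the limit; it is not derived from the weak
      equation.\<close>
    let ?z = "\<lambda>n. tm (ind t) (J T (v n))"
    have z: "?z n \<in> W" for n using W_J[OF 1(1)] by (intro W_tm) auto
    have zl: "?z \<longlonglongrightarrow> tm (ind t) u" by (intro tl 1)
    have "(\<lambda>n. inner (opr \<alpha> (v n) - f) (?z n) + inner f (?z n)) \<longlonglongrightarrow> 0 + inner f (tm (ind t) u)"
      by (intro tendsto_add res[OF z zl] tendsto_inner tendsto_const zl)
    then have "(\<lambda>n. (norm (P0 (Jt (v n) t)))\<^sup>2 / 2 + inner (tm \<alpha> (P1 (J T (v n)))) (?z n)) \<longlonglongrightarrow> inner f (tm (ind t) u)"
      using opr_energy[OF \<alpha> t] by (simp add: inner_diff_left)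
    moreover have "(\<lambda>n. (norm (P0 (Jt (v n) t)))\<^sup>2 / 2 + inner (tm \<alpha> (P1 (J T (v n)))) (?z n))
        \<longlonglongrightarrow> (norm (w t))\<^sup>2 / 2 + inner (tm \<alpha> (P1 u)) (tm (ind t) u)"
      by (intro tendsto_intros wl t tendsto_inner tl 1) auto
    ultimately show ?thesis by (rule LIMSEQ_unique[THEN sym])
  qed
  show "inner (w t) k + inner (tm \<alpha> (P1 u)) (tens (ind t) k) = inner f (tens (ind t) k)"
    if t: "0 \<le> t" "t \<le> T" "k \<in> Hs" for t k
  proof -
    have z: "tens (ind t) k \<in> W" using t by (intro W_tens_Ioo) auto
    have e: "inner (opr \<alpha> (v n)) (tens (ind t) k) = inner (P0 (Jt (v n) t)) k + inner (tm \<alpha> (P1 (J T (v n)))) (tens (ind t) k)" for n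
      using t by (simp add: opr_def inner_add_left P0_Jt inner_Jt)
    have "(\<lambda>n. inner (opr \<alpha> (v n) - f) (tens (ind t) k) + inner f (tens (ind t) k)) \<longlonglongrightarrow> 0 + inner f (tens (ind t) k)"
      by (intro tendsto_add res[of "\<lambda>_. tens (ind t) k" "tens (ind t) k"] z tendsto_const)
    then have "(\<lambda>n. inner (P0 (Jt (v n) t)) k + inner (tm \<alpha> (P1 (J T (v n)))) (tens (ind t) k)) \<longlonglongrightarrow> inner f (tens (ind t) k)"
      by (simp add: inner_diff_left e)
    moreover have "(\<lambda>n. inner (P0 (Jt (v n) t)) k + inner (tm \<alpha> (P1 (J T (v n)))) (tens (ind t) k))
        \<longlonglongrightarrow> inner (w t) k + inner (tm \<alpha> (P1 u)) (tens (ind t) k)"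
      by (intro tendsto_add tendsto_inner tendsto_const wl t tl 1)
    ultimately show ?thesis by (rule LIMSEQ_unique[THEN sym])
  qed
  show "P0 (w t) = w t" if t: "0 \<le> t" "t \<le> T" for t
  proof (rule LIMSEQ_unique[OF _ wl[OF t]])
    have "(\<lambda>n. P0 (P0 (Jt (v n) t))) \<longlonglongrightarrow> P0 (w t)" by (intro tl wl t)
    then show "(\<lambda>n. P0 (Jt (v n) t)) \<longlonglongrightarrow> P0 (w t)" by simp
  qed
  show "w 0 = 0"
    using LIMSEQ_unique[OF wl[of 0]] T by (simp add: Jt_0)
  show "continuous_on {0..T} w"
  proof (rule uniform_limit_theorem[OF _ 1(5)])
    have "continuous_on {0..T} (\<lambda>t. P0 (Jt (v n) t))" for n
      unfolding continuous_on_def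
    proof (intro ballI)
      fix t assume t: "t \<in> {0..T}"
      show "((\<lambda>t. P0 (Jt (v n) t)) \<longlongrightarrow> P0 (Jt (v n) t)) (at t within {0..T})"
      proof (rule LIM_zero_cancel, rule Lim_null_comparison)
        show "\<forall>\<^sub>F s in at t within {0..T}. norm (P0 (Jt (v n) s) - P0 (Jt (v n) t)) \<le> sqrt \<bar>s - t\<bar> * norm (v n)"
          unfolding eventually_at_filter
        proof (intro always_eventually allI impI)
          fix s assume s: "s \<noteq> t" "s \<in> {0..T}"
          have "norm (P0 (Jt (v n) s - Jt (v n) t)) \<le> norm (Jt (v n) s - Jt (v n) t)" by (rule norm_P0)
          also have "\<dots> \<le> sqrt \<bar>s - t\<bar> * norm (v n)"
            using norm_Jt_diff[of s t "v n"] norm_Jt_diff[of t s "v n"] s t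
            by (cases "s \<le> t") (auto simp: norm_minus_commute abs_if)
          finally show "norm (P0 (Jt (v n) s) - P0 (Jt (v n) t)) \<le> sqrt \<bar>s - t\<bar> * norm (v n)" by (simp add: P0_diff)
        qed
        have "((\<lambda>s. sqrt \<bar>s - t\<bar> * norm (v n)) \<longlongrightarrow> sqrt \<bar>t - t\<bar> * norm (v n)) (at t within {0..T})"
          by (intro tendsto_intros)
        then show "((\<lambda>s. sqrt \<bar>s - t\<bar> * norm (v n)) \<longlongrightarrow> 0) (at t within {0..T})" by simp
      qed
    qed
    then show "\<forall>\<^sub>F n in sequentially. continuous_on {0..T} (\<lambda>t. P0 (Jt (v n) t))" by simp
  qed simp
  \<comment> \<open>Norm convergence gives limits of slices at almost every time along a
    subsequence, uniform convergence gives \<open>w\<close> at every time; the two limits are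
    matched.\<close>
  obtain r where r: "strict_mono (r :: nat \<Rightarrow> nat)" "AE t in lborel. (\<lambda>n. sec (J T (v (r n))) t) \<longlonglongrightarrow> sec u t"
    by (rule sec_tendsto_subseq[OF 1(2)])
  have "AE t in lborel. \<forall>n. sec (J T (v (r n))) t = (if 0 < t \<and> t < T then Jt (v (r n)) t else 0)"
    unfolding AE_all_countable using sec_J by blast
  with r(2) show "AE t in lborel. 0 < t \<and> t < T \<longrightarrow> w t = P0 (sec u t)"
  proof eventually_elim
    case (elim t)
    show ?case
    proof
      assume t: "0 < t \<and> t < T"
      then have "(\<lambda>n. P0 (Jt (v (r n)) t)) \<longlonglongrightarrow> P0 (sec u t)" using tl(4)[OF elim(1)] elim(2) by simp
      moreover have "(\<lambda>n. P0 (Jt (v (r n)) t)) \<longlonglongrightarrow> w t"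
        using LIMSEQ_subseq_LIMSEQ[OF wl[of t] r(1)] t by (simp add: o_def)
      ultimately show "w t = P0 (sec u t)" by (rule LIMSEQ_unique[THEN sym])
    qed
  qed
qed

lemma Sol_bounds:
  assumes \<alpha>: "coef \<alpha>" and S: "Sol \<alpha> f u w"
  shows "norm u \<le> C0 * norm f" and "\<And>t. 0 \<le> t \<Longrightarrow> t \<le> T \<Longrightarrow> norm (w t) \<le> sqrt (2 * C0) * norm f"
proof -
  have en: "(norm (w t))\<^sup>2 / 2 + inner (tm \<alpha> (P1 u)) (tm (ind t) u) \<le> norm f * norm (tm (ind t) u)"
    if "0 \<le> t" "t \<le> T" for t
    unfolding Sol_energy[OF \<alpha> S that] by (rule norm_cauchy_schwarz)
  note * = apriori[OF \<alpha> norm_ge_zero Sol_W[OF \<alpha> S] en Sol_AE[OF \<alpha> S]]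
  show "norm u \<le> C0 * norm f" by (rule *(1))
  fix t assume "0 \<le> t" "t \<le> T"
  then have "norm (w t) \<le> sqrt (2 * C0 * (norm f)\<^sup>2)" by (intro real_le_rsqrt *(2))
  also have "\<dots> = sqrt (2 * C0) * norm f" by (subst real_sqrt_mult) simp
  finally show "norm (w t) \<le> sqrt (2 * C0) * norm f" .
qed

text \<open>The difference solves the problem with coefficient \<alpha> and right-hand side
  \<open>- (\<alpha> - \<beta>) P1 u2\<close>; Young's inequality absorbs the gradient of the
  difference into the coercive term.\<close>

lemma Sol_stable:
  assumes \<alpha>: "coef \<alpha>" and \<beta>: "coef \<beta>" and S1: "Sol \<alpha> f u1 w1" and S2: "Sol \<beta> f u2 w2"
    and t: "0 \<le> t" "t \<le> T"
  shows "(norm (w1 t - w2 t))\<^sup>2 \<le> 1 / (2 * m) * (LINT s|lborel. ind t s * ((\<alpha> s - \<beta> s)\<^sup>2 * (norm (sec (P1 u2) s))\<^sup>2))"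
    and "integrable lborel (\<lambda>s. ind t s * ((\<alpha> s - \<beta> s)\<^sup>2 * (norm (sec (P1 u2) s))\<^sup>2))"
proof -
  let ?\<delta> = "\<lambda>s. \<alpha> s - \<beta> s"
  have b: "bdm \<alpha>" "bdm \<beta>" "bdm ?\<delta>" "bdm (ind t)" using \<alpha> \<beta> by (auto intro: bdm_diff)
  define u where "u = u1 - u2"
  have "Sol \<alpha> (f - (f + tm ?\<delta> (P1 u2))) u (\<lambda>t. w1 t - w2 t)"
    unfolding u_def by (rule Sol_diff[OF \<alpha> S1 Sol_change[OF \<alpha> \<beta> S2]])
  from Sol_energy[OF \<alpha> this t]
  have en: "(norm (w1 t - w2 t))\<^sup>2 / 2 + inner (tm \<alpha> (P1 u)) (tm (ind t) u) = - inner (tm ?\<delta> (P1 u2)) (tm (ind t) u)"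
    by simp
  let ?A = "sec (P1 u2)" and ?B = "sec (P1 u)"
  have i1: "integrable lborel (\<lambda>s. ind t s * ?\<delta> s * inner (?A s) (?B s))"
    by (rule inner_tm(2)) (use b in \<open>auto intro: bdm_mult\<close>)
  have "inner (tm ?\<delta> (P1 u2)) (tm (ind t) u) = inner (tm ?\<delta> (P1 u2)) (tm (ind t) (P1 u))"
    using P1_adj[of "tm ?\<delta> (P1 u2)" "tm (ind t) u"] by (simp only: P1_tm[OF b(3)] P1_tm[OF b(4)] P1_P1)
  also have "\<dots> = inner (tm (\<lambda>s. ind t s * ?\<delta> s) (P1 u2)) (P1 u)" using b by (simp add: tm_adj[symmetric] tm_tm)
  also have "\<dots> = (LINT s|lborel. ind t s * ?\<delta> s * inner (?A s) (?B s))"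
    by (rule inner_tm(1)) (use b in \<open>auto intro: bdm_mult\<close>)
  finally have e1: "inner (tm ?\<delta> (P1 u2)) (tm (ind t) u) = (LINT s|lborel. ind t s * ?\<delta> s * inner (?A s) (?B s))" .
  note e2 = tm_ind_form[OF \<alpha>, where u=u and t=t]
  have i3: "integrable lborel (\<lambda>s. (ind t s * (?\<delta> s * ?\<delta> s)) * inner (?A s) (?A s))"
    by (rule inner_tm(2)) (use b in \<open>auto intro!: bdm_mult\<close>)
  then show i3': "integrable lborel (\<lambda>s. ind t s * ((\<alpha> s - \<beta> s)\<^sup>2 * (norm (?A s))\<^sup>2))"
    unfolding power2_norm_eq_inner power2_eq_square[of "\<alpha> _ - \<beta> _"] by (simp only: mult.assoc)
  have "- (LINT s|lborel. ind t s * ?\<delta> s * inner (?A s) (?B s)) - (LINT s|lborel. ind t s * \<alpha> s * (norm (?B s))\<^sup>2)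
      = (LINT s|lborel. - (ind t s * ?\<delta> s * inner (?A s) (?B s)) - ind t s * \<alpha> s * (norm (?B s))\<^sup>2)"
    using i1 e2(2) by simp
  also have "\<dots> \<le> (LINT s|lborel. 1 / (4 * m) * (ind t s * ((\<alpha> s - \<beta> s)\<^sup>2 * (norm (?A s))\<^sup>2)))"
  proof (rule integral_mono)
    fix s
    have pt: "- (?\<delta> s * inner (?A s) (?B s)) - \<alpha> s * (norm (?B s))\<^sup>2 \<le> 1 / (4 * m) * ((?\<delta> s)\<^sup>2 * (norm (?A s))\<^sup>2)"
    proof -
      define p where "p = \<bar>?\<delta> s\<bar> * norm (?A s)"
      define q where "q = norm (?B s)"
      have "- (?\<delta> s * inner (?A s) (?B s)) \<le> \<bar>?\<delta> s\<bar> * \<bar>inner (?A s) (?B s)\<bar>"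
        by (metis abs_ge_minus_self abs_mult)
      also have "\<dots> \<le> \<bar>?\<delta> s\<bar> * (norm (?A s) * norm (?B s))" by (intro mult_left_mono Cauchy_Schwarz_ineq2) simp
      finally have 1: "- (?\<delta> s * inner (?A s) (?B s)) \<le> p * q" by (simp add: p_def q_def)
      have 2: "m * q\<^sup>2 \<le> \<alpha> s * q\<^sup>2" using \<alpha> by (intro mult_right_mono) (auto simp: coef_def)
      \<comment> \<open>Young's inequality with the weight that uses up exactly
        \<open>m * q\<^sup>2\<close>, all that coercivity offers; hence the factor
        \<open>1 / (4 * m)\<close>.\<close>
      have "0 \<le> (p - 2 * m * q)\<^sup>2 / (4 * m)" using m by simp
      also have "\<dots> = p\<^sup>2 / (4 * m) - p * q + m * q\<^sup>2" using m by (simp add: power2_eq_square field_simps)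
      finally have "p * q - m * q\<^sup>2 \<le> p\<^sup>2 / (4 * m)" by linarith
      moreover have "p\<^sup>2 = (?\<delta> s)\<^sup>2 * (norm (?A s))\<^sup>2" by (simp add: p_def power_mult_distrib)
      ultimately show ?thesis using 1 2 by (simp add: q_def)
    qed
    then show "- (ind t s * ?\<delta> s * inner (?A s) (?B s)) - ind t s * \<alpha> s * (norm (?B s))\<^sup>2
        \<le> 1 / (4 * m) * (ind t s * ((\<alpha> s - \<beta> s)\<^sup>2 * (norm (?A s))\<^sup>2))"
      by (cases "s \<in> {0<..<t}") auto
  qed (use i1 e2(2) i3' in \<open>auto intro: integrable_mult_right\<close>)
  finally have "(norm (w1 t - w2 t))\<^sup>2 / 2 \<le> 1 / (4 * m) * (LINT s|lborel. ind t s * ((\<alpha> s - \<beta> s)\<^sup>2 * (norm (?A s))\<^sup>2))"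
    using en e1 e2(1) by simp
  then show "(norm (w1 t - w2 t))\<^sup>2 \<le> 1 / (2 * m) * (LINT s|lborel. ind t s * ((\<alpha> s - \<beta> s)\<^sup>2 * (norm (?A s))\<^sup>2))"
    by (simp add: field_simps)
qed

text \<open>Subtracting the integrated equations at \<open>s\<close> and \<open>t\<close> leaves a
  test element over (s,t), of norm \<open>sqrt (t - s) * norm k\<close>; the factor
  \<open>(1 + M * C0) * norm f\<close> bounds \<open>f - \<alpha> P1 u\<close>.\<close>

lemma Sol_holder:
  assumes \<alpha>: "coef \<alpha>" and S: "Sol \<alpha> f u w" and t: "0 \<le> s" "s \<le> t" "t \<le> T" and k: "k \<in> Hs"
  shows "\<bar>inner (w t - w s) k\<bar> \<le> (1 + M * C0) * norm f * sqrt (t - s) * norm k"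
proof -
  let ?z = "tens (indicator {s<..<t}) k"
  have b: "bdm \<alpha>" using \<alpha> by simp
  have "inner (w t - w s) k = inner (f - tm \<alpha> (P1 u)) (tens (ind t) k) - inner (f - tm \<alpha> (P1 u)) (tens (ind s) k)"
    using Sol_weak[OF \<alpha> S _ _ k, of t] Sol_weak[OF \<alpha> S _ _ k, of s] t by (simp add: inner_diff_left)
  also have "\<dots> = inner (f - tm \<alpha> (P1 u)) ?z" using tens_Ioo_diff[OF t(1,2), of k] by (simp add: inner_diff_right[symmetric])
  also have "\<bar>\<dots>\<bar> \<le> norm (f - tm \<alpha> (P1 u)) * norm ?z" by (rule Cauchy_Schwarz_ineq2)
  also have "\<dots> \<le> ((1 + M * C0) * norm f) * norm ?z"
  proof (rule mult_right_mono)
    have "norm (tm \<alpha> (P1 u)) \<le> M * norm (P1 u)" by (rule norm_tm[OF b coef_abs[OF \<alpha>]])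
    also have "\<dots> \<le> M * (C0 * norm f)"
      using norm_P1[of u] Sol_bounds(1)[OF \<alpha> S] m mM by (intro mult_left_mono) auto
    finally show "norm (f - tm \<alpha> (P1 u)) \<le> (1 + M * C0) * norm f"
      using norm_triangle_ineq4[of f "tm \<alpha> (P1 u)"] by (simp add: distrib_right)
  qed simp
  also have "norm ?z = sqrt (t - s) * norm k" by (rule norm_tens_Ioo[OF t(2)])
  finally show ?thesis by (simp add: mult.assoc)
qed

text \<open>No energy identity is available here, since \<open>u\<close> is not known to be a limit
  of primitives. Instead the equation at each time is tested with \<open>\<alpha>(t) u(t)\<close>
  and integrated: the result is a coercive term in \<open>P0 u\<close> plus the nonnegative product
  of \<open>y = \<alpha> P1 u\<close> with its primitive.\<close>

lemma weak_unique:
  assumes \<alpha>: "coef \<alpha>" and u: "u \<in> W"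
    and wk: "\<And>t k. 0 < t \<Longrightarrow> t < T \<Longrightarrow> k \<in> Hs \<Longrightarrow> inner (w t) k + inner (tm \<alpha> (P1 u)) (tens (ind t) k) = 0"
    and ae: "AE t in lborel. 0 < t \<and> t < T \<longrightarrow> w t = P0 (sec u t)"
  shows "u = 0"
proof -
  have b: "bdm \<alpha>" using \<alpha> by simp
  define y where "y = tm \<alpha> (P1 u)"
  have uW: "AE t in lborel. sec u t \<in> (if 0 < t \<and> t < T then Hs else {0})" using u by (simp add: W_def)
  have "AE t in lborel. \<alpha> t * inner (sec u t) (sec (P0 u) t) + inner (sec (J T y) t) (sec (tm \<alpha> u) t) = 0"
    using uW ae sec_J[of T y] sec_P0[of u] sec_tm[OF b, of u]
  proof eventually_elim
    case (elim t)
    show ?case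
    proof (cases "0 < t \<and> t < T")
      case True
      then have k: "sec u t \<in> Hs" using elim by simp
      have "inner (w t) (sec u t) + inner (Jt y t) (sec u t) = 0"
        using wk[OF _ _ k] True by (simp add: inner_Jt y_def)
      then have "\<alpha> t * (inner (w t) (sec u t) + inner (Jt y t) (sec u t)) = 0" by simp
      then show ?thesis using elim True by (simp add: algebra_simps inner_commute)
    qed (use elim in auto)
  qed
  then have "(LINT t|lborel. \<alpha> t * inner (sec u t) (sec (P0 u) t) + inner (sec (J T y) t) (sec (tm \<alpha> u) t)) = 0"
    by (rule integral_eq_zero_AE)
  then have "inner (tm \<alpha> u) (P0 u) + inner (J T y) (tm \<alpha> u) = 0"
    using inner_tm[OF b, of u "P0 u"] inner_sec[of "J T y" "tm \<alpha> u"] by simp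
  moreover have "inner (J T y) (tm \<alpha> u) = inner y (J T y)"
  proof -
    have "P1 y = y" using b by (simp add: y_def P1_tm)
    then have "P1 (J T y) = J T y" by (simp add: P1_J)
    then have "inner (J T y) (tm \<alpha> u) = inner (J T y) (P1 (tm \<alpha> u))" using P1_adj[of "J T y" "tm \<alpha> u"] by simp
    then show ?thesis using b by (simp add: y_def P1_tm inner_commute)
  qed
  moreover have "inner (tm \<alpha> u) (P0 u) = inner (tm \<alpha> (P0 u)) (P0 u)"
    using P0_adj[of "tm \<alpha> u" "P0 u"] b by (simp add: P0_tm)
  moreover have "m * (norm (P0 u))\<^sup>2 \<le> inner (tm \<alpha> (P0 u)) (P0 u)"
    by (rule inner_tm_ge[OF b]) (use \<alpha> in \<open>auto simp: coef_def\<close>)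
  ultimately have "m * (norm (P0 u))\<^sup>2 \<le> 0" using J_nonneg[of T y] T by simp
  then have "P0 u = 0" using m by (simp add: mult_le_0_iff)
  then show ?thesis using P0_inj_W u by blast
qed

end

section \<open>Gronwall's inequality with an integrable weight\<close>

lemma LINT_ind:
  assumes "integrable lborel q" "0 \<le> t"
  shows "(LINT s|lborel. ind t s * q s) = integral {0..t} q" and "q integrable_on {0..t}"
proof -
  have si: "set_integrable lborel {0..t} q"
    unfolding set_integrable_def by (rule integrable_mult_indicator) (use assms in auto)
  show "q integrable_on {0..t}" using set_borel_integral_eq_integral(1)[OF si] .
  have [measurable]: "q \<in> borel_measurable borel" using assms(1) by auto
  have "(LINT s|lborel. ind t s * q s) = (LINT s:{0..t}|lborel. q s)"
    unfolding set_lebesgue_integral_def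
  proof (rule integral_cong_AE)
    show "AE s in lborel. ind t s * q s = indicator {0..t} s *\<^sub>R q s"
      using AE_lborel_singleton[of 0] AE_lborel_singleton[of t]
      by eventually_elim (auto simp: indicator_def)
  qed measurable
  also have "\<dots> = integral {0..t} q" by (rule set_borel_integral_eq_integral(2)[OF si])
  finally show "(LINT s|lborel. ind t s * q s) = integral {0..t} q" .
qed

lemma integrable_cont_mult:
  fixes g D :: "real \<Rightarrow> real"
  assumes g: "integrable lborel g" and D: "continuous_on {0..T} D"
  shows "integrable lborel (\<lambda>s. indicator {0..T} s * (D s * g s))"
proof -
  obtain B where "\<forall>s\<in>{0..T}. \<bar>D s\<bar> \<le> B"
    using compact_continuous_image[OF D compact_Icc, THEN compact_imp_bounded] by (auto simp: bounded_iff)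
  then have B: "\<And>s. s \<in> {0..T} \<Longrightarrow> \<bar>D s\<bar> \<le> B" by blast
  have [measurable]: "g \<in> borel_measurable borel" using g by auto
  have [measurable]: "(\<lambda>s. indicator {0..T} s *\<^sub>R D s) \<in> borel_measurable borel"
    by (rule borel_measurable_continuous_on_indicator[OF _ D]) simp
  have e: "indicator {0..T} s * (D s * g s) = (indicator {0..T} s *\<^sub>R D s) * g s" for s by simp
  show ?thesis
  proof (rule Bochner_Integration.integrable_bound[where f="\<lambda>s. B * g s"])
    show "(\<lambda>s. indicator {0..T} s * (D s * g s)) \<in> borel_measurable lborel" unfolding e by measurable
    show "AE s in lborel. norm (indicator {0..T} s * (D s * g s)) \<le> norm (B * g s)"
    proof (rule AE_I2)
      fix s
      show "norm (indicator {0..T} s * (D s * g s)) \<le> norm (B * g s)"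
      proof (cases "s \<in> {0..T}")
        case True
        then have "\<bar>D s\<bar> * \<bar>g s\<bar> \<le> \<bar>B\<bar> * \<bar>g s\<bar>" using B[OF True] by (intro mult_right_mono) auto
        then show ?thesis using True by (simp add: abs_mult)
      qed simp
    qed
  qed (use g in simp)
qed

text \<open>Given the bound \<open>gron j * A\<close> on the first \<open>j\<close> pieces, each of
  mass one half, the supremum S up to the end of the next piece satisfies
  \<open>S \<le> A + gron j * A * (j / 2) + S / 2\<close>; the recursion solves this for S.\<close>

primrec gron :: "nat \<Rightarrow> real" where
  "gron 0 = 1" | "gron (Suc j) = 2 + real j * gron j"

lemma gron_pos: "gron j \<ge> 1"
  by (induction j) (auto intro: add_increasing2)

text \<open>Gronwall's inequality for a merely integrable weight \<open>g\<close>, with a constant depending only on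
  its mass: the interval is cut into pieces on which \<open>c * g\<close> has mass at most one half.\<close>

lemma gronwall_L1:
  fixes g D :: "real \<Rightarrow> real"
  assumes g: "integrable lborel g" "\<And>s. 0 \<le> g s"
    and D: "continuous_on {0..T} D" and c: "0 \<le> c" and A: "0 \<le> A" and T: "0 < T"
    and D0: "\<And>t. t \<in> {0..T} \<Longrightarrow> 0 \<le> D t"
    and bd': "\<And>t. t \<in> {0..T} \<Longrightarrow> D t \<le> A + c * (LINT s|lborel. ind t s * (D s * g s))"
    and G: "c * (LINT s|lborel. g s) \<le> real N / 2"
    and t: "t \<in> {0..T}"
  shows "D t \<le> gron N * A"
proof -
  \<comment> \<open>The running mass serves as a clock: pieces of the interval are counted in half
    units of \<Gamma>, not in length.\<close>
  define \<Gamma> where "\<Gamma> t = c * integral {0..t} g" for t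
  have gi: "g integrable_on {0..t}" if "0 \<le> t" for t using LINT_ind(2)[OF g(1) that] .
  have gi2: "g integrable_on {s..t}" if "0 \<le> s" "s \<le> t" for s t
    using integrable_subinterval_real[OF gi, of t s t] that by auto
  have Dg: "(\<lambda>s. D s * g s) integrable_on {0..t}" if "t \<in> {0..T}" for t
  proof -
    have "(\<lambda>s. indicator {0..T} s * (D s * g s)) integrable_on {0..t}"
      using LINT_ind(2)[OF integrable_cont_mult[OF g(1) D]] that by simp
    then show ?thesis by (rule integrable_eq) (use that in auto)
  qed
  have bd: "D t \<le> A + c * integral {0..t} (\<lambda>s. D s * g s)" if t: "t \<in> {0..T}" for t
  proof -
    have "(LINT s|lborel. ind t s * (D s * g s)) = (LINT s|lborel. ind t s * (indicator {0..T} s * (D s * g s)))"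
      by (rule Bochner_Integration.integral_cong) (use t in \<open>auto simp: indicator_def\<close>)
    also have "\<dots> = integral {0..t} (\<lambda>s. indicator {0..T} s * (D s * g s))"
      by (rule LINT_ind(1)[OF integrable_cont_mult[OF g(1) D]]) (use t in simp)
    also have "\<dots> = integral {0..t} (\<lambda>s. D s * g s)"
      by (rule Henstock_Kurzweil_Integration.integral_cong) (use t in auto)
    finally show ?thesis using bd'[OF t] by simp
  qed
  have Dg2: "(\<lambda>s. D s * g s) integrable_on {s..t}" if "0 \<le> s" "s \<le> t" "t \<le> T" for s t
    using integrable_subinterval_real[OF Dg, of t s t] that by auto
  have gadd: "integral {0..s} g + integral {s..t} g = integral {0..t} g" if "0 \<le> s" "s \<le> t" for s t
    by (rule Henstock_Kurzweil_Integration.integral_combine[OF that gi]) (use that in auto)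
  have Dadd: "integral {0..s} (\<lambda>s. D s * g s) + integral {s..t} (\<lambda>s. D s * g s) = integral {0..t} (\<lambda>s. D s * g s)"
    if "0 \<le> s" "s \<le> t" "t \<le> T" for s t
    by (rule Henstock_Kurzweil_Integration.integral_combine[OF that(1,2) Dg]) (use that in auto)
  have \<Gamma>mono: "\<Gamma> s \<le> \<Gamma> t" if "0 \<le> s" "s \<le> t" for s t
    unfolding \<Gamma>_def using gadd[OF that] Henstock_Kurzweil_Integration.integral_nonneg[OF gi2[OF that] g(2)] c
    by (intro mult_left_mono) auto
  have \<Gamma>cont: "continuous_on {0..t} \<Gamma>" if "0 \<le> t" for t
    unfolding \<Gamma>_def by (intro continuous_intros indefinite_integral_continuous_1 gi that)
  have claim: "t \<in> {0..T} \<Longrightarrow> \<Gamma> t \<le> real j / 2 \<Longrightarrow> D t \<le> gron j * A" for j t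
  proof (induction j arbitrary: t)
    case 0
    obtain S where "\<forall>s\<in>{0..T}. D s \<le> S"
      using compact_continuous_image[OF D compact_Icc, THEN compact_imp_bounded, THEN bounded_imp_bdd_above]
      by (auto simp: bdd_above_def)
    then have S: "\<And>s. s \<in> {0..T} \<Longrightarrow> D s \<le> S" by blast
    have "integral {0..t} (\<lambda>s. D s * g s) \<le> integral {0..t} (\<lambda>s. S * g s)"
      by (rule integral_le[OF Dg]) (use 0 gi S g(2) in \<open>auto intro!: mult_right_mono integrable_on_mult_right\<close>)
    also have "\<dots> = S * integral {0..t} g" by simp
    finally have "c * integral {0..t} (\<lambda>s. D s * g s) \<le> S * \<Gamma> t"
      using mult_left_mono[OF _ c] by (fastforce simp: \<Gamma>_def mult.left_commute)
    moreover have "S \<ge> 0" using D0[of 0] S[of 0] T by simp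
    then have "S * \<Gamma> t \<le> 0" using 0 by (simp add: mult_nonneg_nonpos)
    ultimately show ?case using bd[OF 0(1)] by simp
  next
    case (Suc j)
    \<comment> \<open>All times reached within \<open>j + 1\<close> half units. The supremum S of
      \<open>D\<close> over them is finite because \<open>D\<close> is continuous on a compact
      interval, so the term \<open>S / 2\<close> produced below can be absorbed.\<close>
    define R where "R = {r\<in>{0..T}. \<Gamma> r \<le> real (Suc j) / 2}"
    define S where "S = Sup (D ` R)"
    have tR: "t \<in> R" using Suc by (simp add: R_def)
    have bdd: "bdd_above (D ` R)"
      using compact_continuous_image[OF D compact_Icc, THEN compact_imp_bounded, THEN bounded_imp_bdd_above]
      by (rule bdd_above_mono) (auto simp: R_def)
    have DS: "D r \<le> S" if "r \<in> R" for r unfolding S_def using that bdd by (intro cSup_upper) auto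
    have S0: "0 \<le> S" using DS[OF tR] D0 Suc.prems(1) by force
    have key: "D r \<le> A + gron j * A * (real j / 2) + S / 2" if r: "r \<in> R" for r
    proof (cases "\<Gamma> r \<le> real j / 2")
      case True
      have "D r \<le> gron j * A" by (rule Suc.IH) (use r True in \<open>auto simp: R_def\<close>)
      also have "\<dots> \<le> A + gron j * A * (real j / 2) + S / 2"
      \<comment> \<open>For \<open>j\<close> at most 1 the factor \<open>j / 2\<close> is below one;
        there the values \<open>gron 0 = 1\<close> and \<open>gron 1 = 2\<close> are just
        enough.\<close>
      proof (cases "j \<le> 1")
        case True
        then consider "j = 0" | "j = 1" by linarith
        then show ?thesis using S0 A by cases (auto simp: field_simps)
      next
        case False
        then have "gron j * A * 1 \<le> gron j * A * (real j / 2)"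
          using A gron_pos[of j] by (intro mult_left_mono) auto
        then show ?thesis using A S0 by simp
      qed
      finally show ?thesis .
    next
      case False
      have rT: "0 \<le> r" "r \<le> T" "\<Gamma> r \<le> real (Suc j) / 2" using r by (auto simp: R_def)
      \<comment> \<open>The end of the \<open>j\<close>-th piece: up to it the induction hypothesis
        applies, and beyond it at most half a unit of mass is left.\<close>
      have "\<exists>\<tau>\<ge>0. \<tau> \<le> r \<and> \<Gamma> \<tau> = real j / 2"
        by (rule IVT') (use False rT \<Gamma>cont in \<open>auto simp: \<Gamma>_def\<close>)
      then obtain \<tau> where \<tau>: "0 \<le> \<tau>" "\<tau> \<le> r" "\<Gamma> \<tau> = real j / 2" by blast
      have "integral {0..\<tau>} (\<lambda>s. D s * g s) \<le> integral {0..\<tau>} (\<lambda>s. gron j * A * g s)"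
      proof (rule integral_le)
        fix s assume s: "s \<in> {0..\<tau>}"
        have "D s \<le> gron j * A" by (rule Suc.IH) (use s \<tau> rT \<Gamma>mono[of s \<tau>] in auto)
        then show "D s * g s \<le> gron j * A * g s" using g(2) by (intro mult_right_mono)
      qed (use Dg gi \<tau> rT in \<open>auto intro!: integrable_on_mult_right\<close>)
      also have "\<dots> = gron j * A * integral {0..\<tau>} g" by simp
      finally have "c * integral {0..\<tau>} (\<lambda>s. D s * g s) \<le> c * (gron j * A * integral {0..\<tau>} g)"
        using c by (rule mult_left_mono)
      also have "\<dots> = gron j * A * (real j / 2)" using \<tau>(3) by (simp add: \<Gamma>_def mult.left_commute)
      finally have 1: "c * integral {0..\<tau>} (\<lambda>s. D s * g s) \<le> gron j * A * (real j / 2)" .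
      have "integral {\<tau>..r} (\<lambda>s. D s * g s) \<le> integral {\<tau>..r} (\<lambda>s. S * g s)"
      proof (rule integral_le)
        fix s assume s: "s \<in> {\<tau>..r}"
        have "s \<in> R" using s \<tau> rT \<Gamma>mono[of s r] by (auto simp: R_def)
        then show "D s * g s \<le> S * g s" using g(2) DS by (intro mult_right_mono)
      qed (use Dg2 gi2 \<tau> rT in \<open>auto intro!: integrable_on_mult_right\<close>)
      also have "\<dots> = S * integral {\<tau>..r} g" by simp
      finally have "c * integral {\<tau>..r} (\<lambda>s. D s * g s) \<le> c * (S * integral {\<tau>..r} g)"
        using c by (rule mult_left_mono)
      also have "\<dots> = S * (\<Gamma> r - \<Gamma> \<tau>)" using gadd[OF \<tau>(1,2)] by (simp add: \<Gamma>_def algebra_simps flip: gadd[OF \<tau>(1,2)])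
      also have "\<dots> \<le> S * (1 / 2)" using \<tau>(3) rT(3) S0 by (intro mult_left_mono) (auto simp: field_simps)
      finally have 2: "c * integral {\<tau>..r} (\<lambda>s. D s * g s) \<le> S / 2" by simp
      have "c * integral {0..r} (\<lambda>s. D s * g s) = c * integral {0..\<tau>} (\<lambda>s. D s * g s) + c * integral {\<tau>..r} (\<lambda>s. D s * g s)"
        using Dadd[OF \<tau>(1,2) rT(2)] by (simp add: distrib_left[symmetric])
      then show ?thesis using bd[of r] rT 1 2 by simp
    qed
    have "S \<le> A + gron j * A * (real j / 2) + S / 2"
      unfolding S_def by (rule cSup_least) (use tR key in \<open>auto simp: S_def\<close>)
    then have "S \<le> gron (Suc j) * A" by (simp add: algebra_simps)
    then show ?case using DS[OF tR] by linarith
  qed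
  have "\<Gamma> t \<le> real N / 2"
  proof -
    have "integral {0..t} g = (LINT s|lborel. ind t s * g s)" using LINT_ind(1)[OF g(1)] t by simp
    also have "\<dots> \<le> (LINT s|lborel. g s)"
    proof (rule integral_mono)
      show "integrable lborel (\<lambda>s. ind t s * g s)"
        using integrable_mult_indicator[OF _ g(1), of "{0<..<t}"] by simp
    qed (use g in \<open>auto simp: indicator_def\<close>)
    finally have "\<Gamma> t \<le> c * (LINT s|lborel. g s)" unfolding \<Gamma>_def using c by (rule mult_left_mono)
    then show ?thesis using G by linarith
  qed
  then show ?thesis using claim[OF t] by blast
qed

section \<open>The nonlocal problem\<close>

locale nonlinear = parabolic Hs T m M
  for Hs :: "('a::euclidean_space, real \<times> 'a) l2 set" and T m M :: real +
  fixes a :: "real \<Rightarrow> real" and L :: real and e :: "('a, real \<times> 'a) l2"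
  assumes a_bd: "\<And>s. m \<le> a s \<and> a s \<le> M"
    and a_lip: "\<And>x y. \<bar>a x - a y\<bar> \<le> L * \<bar>x - y\<bar>" and L0: "0 \<le> L"
    and P0_e: "P0 e = e"
    and e_dense: "\<And>\<epsilon>. \<epsilon> > 0 \<Longrightarrow> \<exists>\<phi>\<in>Hs. norm (P0 \<phi> - e) < \<epsilon>"
begin

text \<open>Clamping makes the delayed argument meaningful at every real time, as
  \<open>coef\<close> asks for a coefficient on the whole line; before time 0 the history is frozen
  at its initial value.\<close>

definition cl :: "real \<Rightarrow> real" where "cl t = max 0 (min T t)"

text \<open>With the delay \<open>h > 0\<close> the nonlinear problem can be solved step by step on intervals of
  length \<open>h\<close>. The observable \<open>obs w t\<close> stands for \<open>l(u(t))\<close>, since \<open>e\<close> is the indicator of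
  the domain; approximating \<open>e\<close> by elements of \<open>Hs\<close> makes the observables equicontinuous.\<close>

definition lag :: "real \<Rightarrow> (real \<Rightarrow> real) \<Rightarrow> real \<Rightarrow> real" where "lag h \<sigma> t = a (\<sigma> (cl (t - h)))"

definition obs :: "(real \<Rightarrow> ('a, real \<times> 'a) l2) \<Rightarrow> real \<Rightarrow> real" where "obs w t = inner (w t) e"

lemma cl_range: "cl t \<in> {0..T}" using T by (auto simp: cl_def)
lemma cl_id: "t \<in> {0..T} \<Longrightarrow> cl t = t" by (auto simp: cl_def)

lemma coef_lag: assumes "continuous_on {0..T} \<sigma>" shows "coef (lag h \<sigma>)"
proof -
  have "continuous_on UNIV a"
    by (rule lipschitz_on_continuous_on[of L]) (use a_lip L0 in \<open>auto simp: lipschitz_on_def dist_real_def\<close>)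
  moreover have "continuous_on UNIV (\<lambda>t. \<sigma> (cl (t - h)))"
  proof (rule continuous_on_compose2[OF assms])
    show "continuous_on UNIV (\<lambda>t. cl (t - h))" unfolding cl_def by (intro continuous_intros)
  qed (use cl_range in blast)
  ultimately have "continuous_on UNIV (lag h \<sigma>)"
    unfolding lag_def by (rule continuous_on_compose2) auto
  then show ?thesis using a_bd by (auto simp: coef_def lag_def intro: borel_measurable_continuous_onI)
qed

lemma obs_cont: "coef \<alpha> \<Longrightarrow> Sol \<alpha> f u w \<Longrightarrow> continuous_on {0..T} (obs w)"
  unfolding obs_def by (intro continuous_intros Sol_cont)

lemma obs_diff_le: "\<bar>obs w1 t - obs w2 s\<bar> \<le> norm e * norm (w1 t - w2 s)"
  unfolding obs_def inner_diff_left[symmetric] using Cauchy_Schwarz_ineq2[of "w1 t - w2 s" e] by (simp add: mult.commute)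

text \<open>The bound of \<open>gronwall_L1\<close> for a unit perturbation:
  \<open>(C0 * norm f)\<^sup>2\<close> bounds the mass of the weight, and the ceiling counts its
  half units. Neither coefficient enters, so the constant is the same for all delays.\<close>

definition Kc :: "(real \<times> 'a, real \<times> 'a) l2 \<Rightarrow> real" where
  "Kc f = gron (nat \<lceil>2 * ((L\<^sup>2 * (norm e)\<^sup>2 / m) * (C0 * norm f)\<^sup>2)\<rceil>) * (L\<^sup>2 * (C0 * norm f)\<^sup>2 / m)"

lemma Kc_nonneg: "0 \<le> Kc f"
  unfolding Kc_def using gron_pos[of "nat \<lceil>2 * ((L\<^sup>2 * (norm e)\<^sup>2 / m) * (C0 * norm f)\<^sup>2)\<rceil>"] m
  by (intro mult_nonneg_nonneg) auto

text \<open>The perturbation \<eta> collects the errors of delay and approximation, while the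
  difference of the observables is fed back through Gronwall's inequality. With \<eta> = 0 this
  yields uniqueness, with \<eta> tending to 0 convergence.\<close>

lemma compare:
  assumes \<alpha>: "coef \<alpha>" "Sol \<alpha> f u1 w1" and \<beta>: "coef \<beta>" "Sol \<beta> f u2 w2" and \<eta>: "0 \<le> \<eta>"
    and d: "\<And>s. 0 < s \<Longrightarrow> s < T \<Longrightarrow> \<bar>\<alpha> s - \<beta> s\<bar> \<le> L * (\<eta> + \<bar>obs w1 s - obs w2 s\<bar>)"
    and t: "t \<in> {0..T}"
  shows "norm (w1 t - w2 t) \<le> sqrt (Kc f) * \<eta>"
proof -
  define g where "g s = (norm (sec (P1 u2) s))\<^sup>2" for s
  define D where "D s = (norm (w1 s - w2 s))\<^sup>2" for s
  define c where "c = L\<^sup>2 * (norm e)\<^sup>2 / m"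
  define G where "G = (C0 * norm f)\<^sup>2"
  define A where "A = L\<^sup>2 * G / m * \<eta>\<^sup>2"
  have gi: "integrable lborel g" unfolding g_def by (rule norm_sec(1))
  have g0: "0 \<le> g s" for s by (simp add: g_def)
  have gG: "(LINT s|lborel. g s) \<le> G"
  proof -
    have "(LINT s|lborel. g s) = (norm (P1 u2))\<^sup>2" unfolding g_def by (rule norm_sec(2)[symmetric])
    also have "\<dots> \<le> (C0 * norm f)\<^sup>2"
      using norm_P1[of u2] Sol_bounds(1)[OF \<beta>] by (intro power_mono) auto
    finally show ?thesis by (simp add: G_def)
  qed
  have Dc: "continuous_on {0..T} D"
    unfolding D_def by (intro continuous_intros Sol_cont[OF \<alpha>] Sol_cont[OF \<beta>])
  have c0: "0 \<le> c" using m by (simp add: c_def)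
  have A0: "0 \<le> A" using m by (simp add: A_def G_def)
  have bd: "D t \<le> A + c * (LINT s|lborel. ind t s * (D s * g s))" if t: "t \<in> {0..T}" for t
  proof -
    have i1: "integrable lborel (\<lambda>s. ind t s * (D s * g s))"
    proof -
      have "integrable lborel (\<lambda>s. indicator {0<..<t} s *\<^sub>R (indicator {0..T} s * (D s * g s)))"
        by (intro integrable_mult_indicator integrable_cont_mult gi Dc) simp
      moreover have "indicator {0<..<t} s *\<^sub>R (indicator {0..T} s * (D s * g s)) = ind t s * (D s * g s)" for s
        using t by (auto simp: indicator_def)
      ultimately show ?thesis by (simp only:)
    qed
    have "D t \<le> 1 / (2 * m) * (LINT s|lborel. ind t s * ((\<alpha> s - \<beta> s)\<^sup>2 * g s))"
      unfolding D_def g_def using t by (intro Sol_stable(1)[OF \<alpha>(1) \<beta>(1) \<alpha>(2) \<beta>(2)]) auto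
    \<comment> \<open>The square of the sum is split, and in the \<eta> term the cutoff to (0,t) is
      dropped so that \<open>A\<close> does not depend on \<open>t\<close>.\<close>
    also have "\<dots> \<le> 1 / (2 * m) * (LINT s|lborel. 2 * L\<^sup>2 * \<eta>\<^sup>2 * g s + 2 * L\<^sup>2 * (norm e)\<^sup>2 * (ind t s * (D s * g s)))"
    proof (rule mult_left_mono, rule integral_mono)
      show "integrable lborel (\<lambda>s. ind t s * ((\<alpha> s - \<beta> s)\<^sup>2 * g s))"
        unfolding g_def using t by (intro Sol_stable(2)[OF \<alpha>(1) \<beta>(1) \<alpha>(2) \<beta>(2)]) auto
      show "integrable lborel (\<lambda>s. 2 * L\<^sup>2 * \<eta>\<^sup>2 * g s + 2 * L\<^sup>2 * (norm e)\<^sup>2 * (ind t s * (D s * g s)))"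
        using gi i1 by simp
      fix s
      show "ind t s * ((\<alpha> s - \<beta> s)\<^sup>2 * g s) \<le> 2 * L\<^sup>2 * \<eta>\<^sup>2 * g s + 2 * L\<^sup>2 * (norm e)\<^sup>2 * (ind t s * (D s * g s))"
      proof (cases "s \<in> {0<..<t}")
        case True
        have "\<bar>\<alpha> s - \<beta> s\<bar> \<le> L * (\<eta> + norm e * norm (w1 s - w2 s))"
          using d[of s] True t obs_diff_le[of w1 s w2 s] L0 by (smt (verit) atLeastAtMost_iff greaterThanLessThan_iff mult_left_mono)
        then have "\<bar>\<alpha> s - \<beta> s\<bar>\<^sup>2 \<le> (L * (\<eta> + norm e * norm (w1 s - w2 s)))\<^sup>2" by (rule power_mono) simp
        also have "\<dots> = L\<^sup>2 * (norm (\<eta> + norm e * norm (w1 s - w2 s)))\<^sup>2" by (simp add: power_mult_distrib)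
        also have "\<dots> \<le> L\<^sup>2 * (2 * (norm \<eta>)\<^sup>2 + 2 * (norm (norm e * norm (w1 s - w2 s)))\<^sup>2)"
          by (intro mult_left_mono norm_add_sq_le) simp
        also have "\<dots> = 2 * L\<^sup>2 * \<eta>\<^sup>2 + 2 * L\<^sup>2 * (norm e)\<^sup>2 * D s"
          by (simp add: D_def power_mult_distrib algebra_simps)
        finally have "(\<alpha> s - \<beta> s)\<^sup>2 * g s \<le> (2 * L\<^sup>2 * \<eta>\<^sup>2 + 2 * L\<^sup>2 * (norm e)\<^sup>2 * D s) * g s"
          using g0 by (intro mult_right_mono) auto
        then show ?thesis using True by (simp add: algebra_simps)
      qed (simp add: g0)
    qed (use m in simp)
    also have "\<dots> = 1 / (2 * m) * (2 * L\<^sup>2 * \<eta>\<^sup>2 * (LINT s|lborel. g s) + 2 * L\<^sup>2 * (norm e)\<^sup>2 * (LINT s|lborel. ind t s * (D s * g s)))"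
      using gi i1 by simp
    also have "\<dots> \<le> 1 / (2 * m) * (2 * L\<^sup>2 * \<eta>\<^sup>2 * G + 2 * L\<^sup>2 * (norm e)\<^sup>2 * (LINT s|lborel. ind t s * (D s * g s)))"
      using m by (intro mult_left_mono add_right_mono gG) auto
    also have "\<dots> = A + c * (LINT s|lborel. ind t s * (D s * g s))"
      using m by (simp add: A_def c_def field_simps)
    finally show ?thesis .
  qed
  have "c * (LINT s|lborel. g s) \<le> real (nat \<lceil>2 * (c * G)\<rceil>) / 2"
  proof -
    have "c * (LINT s|lborel. g s) \<le> c * G" using c0 gG by (rule mult_left_mono[rotated])
    then show ?thesis using real_nat_ceiling_ge[of "2 * (c * G)"] by linarith
  qed
  then have "D t \<le> gron (nat \<lceil>2 * (c * G)\<rceil>) * A"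
    by (intro gronwall_L1[OF gi g0 Dc c0 A0 T _ bd]) (use t in \<open>auto simp: D_def\<close>)
  also have "\<dots> = Kc f * \<eta>\<^sup>2" by (simp add: Kc_def A_def c_def G_def)
  finally have "norm (w1 t - w2 t) \<le> sqrt (Kc f * \<eta>\<^sup>2)" unfolding D_def by (rule real_le_rsqrt)
  also have "\<dots> = sqrt (Kc f) * \<eta>" using \<eta> by (simp add: real_sqrt_mult)
  finally show ?thesis .
qed

text \<open>Split \<open>e\<close> into \<open>P0 \<phi>\<close> with \<phi> in \<open>Hs\<close>
  and a small remainder. The remainder is handled by the uniform bound of \<open>w\<close>, the rest
  by \<open>Sol_holder\<close>; both bounds are uniform in the coefficient, so \<delta> can be fixed
  first.\<close>

lemma modulus:
  assumes "\<epsilon> > 0"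
  shows "\<exists>\<delta>>0. \<forall>\<alpha> u w. coef \<alpha> \<longrightarrow> Sol \<alpha> f u w \<longrightarrow>
    (\<forall>s\<in>{0..T}. \<forall>t\<in>{0..T}. \<bar>t - s\<bar> < \<delta> \<longrightarrow> \<bar>obs w t - obs w s\<bar> \<le> \<epsilon>)"
proof -
  define B where "B = sqrt (2 * C0) * norm f"
  have B: "B \<ge> 0" using C0 by (simp add: B_def)
  \<comment> \<open>\<open>2 * B\<close> bounds the norm of a difference of two values of
    \<open>w\<close>; the added 1 keeps the divisor positive.\<close>
  obtain \<phi> where \<phi>: "\<phi> \<in> Hs" "norm (P0 \<phi> - e) < \<epsilon> / (2 * (2 * B + 1))"
    using e_dense[of "\<epsilon> / (2 * (2 * B + 1))"] assms B by auto
  define Q where "Q = (1 + M * C0) * norm f * norm \<phi>"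
  have Q: "Q \<ge> 0" using m mM C0 by (simp add: Q_def)
  define \<delta> where "\<delta> = (\<epsilon> / (2 * (Q + 1)))\<^sup>2"
  have \<delta>: "\<delta> > 0" using assms Q by (simp add: \<delta>_def)
  have main: "\<bar>obs w t - obs w s\<bar> \<le> \<epsilon>"
    if S: "coef \<alpha>" "Sol \<alpha> f u w" and st: "0 \<le> s" "s \<le> t" "t \<le> T" "t - s < \<delta>" for \<alpha> u w s t
  proof -
    let ?d = "w t - w s"
    have Pd: "P0 ?d = ?d" using Sol_P0[OF S] st by (simp add: P0_diff)
    have "norm ?d \<le> 2 * B"
      using Sol_bounds(2)[OF S, of t] Sol_bounds(2)[OF S, of s] st norm_triangle_ineq4[of "w t" "w s"]
      unfolding B_def by linarith
    then have "norm ?d * norm (e - P0 \<phi>) \<le> (2 * B + 1) * (\<epsilon> / (2 * (2 * B + 1)))"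
      using \<phi>(2) B by (intro mult_mono) (auto simp: norm_minus_commute)
    also have "\<dots> = \<epsilon> / 2" using B by (simp add: field_simps)
    finally have 1: "\<bar>inner ?d (e - P0 \<phi>)\<bar> \<le> \<epsilon> / 2"
      using Cauchy_Schwarz_ineq2[of ?d "e - P0 \<phi>"] by linarith
    have "sqrt (t - s) \<le> \<epsilon> / (2 * (Q + 1))"
      using st(4) assms Q unfolding \<delta>_def by (intro real_le_lsqrt) auto
    then have "Q * sqrt (t - s) \<le> (Q + 1) * (\<epsilon> / (2 * (Q + 1)))"
      using Q st by (intro mult_mono) auto
    also have "\<dots> = \<epsilon> / 2" using Q by (simp add: field_simps)
    finally have "Q * sqrt (t - s) \<le> \<epsilon> / 2" .
    then have 2: "\<bar>inner ?d \<phi>\<bar> \<le> \<epsilon> / 2"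
      using Sol_holder[OF S st(1-3) \<phi>(1)] by (simp add: Q_def mult_ac)
    have P: "inner ?d (P0 \<phi>) = inner ?d \<phi>" using P0_adj[of ?d \<phi>] Pd by simp
    have "obs w t - obs w s = inner ?d e" by (simp add: obs_def inner_diff_left)
    also have "\<dots> = inner ?d (e - P0 \<phi>) + inner ?d \<phi>" unfolding inner_diff_right P by simp
    finally show ?thesis using 1 2 by linarith
  qed
  show ?thesis
  proof (intro exI[of _ \<delta>] conjI \<delta> allI impI ballI)
    fix \<alpha> u w s t
    assume "coef \<alpha>" "Sol \<alpha> f u w" "s \<in> {0..T}" "t \<in> {0..T}" "\<bar>t - s\<bar> < \<delta>"
    then show "\<bar>obs w t - obs w s\<bar> \<le> \<epsilon>"
      using main[of \<alpha> u w s t] main[of \<alpha> u w t s] by (cases "s \<le> t") (auto simp: abs_minus_commute)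
  qed
qed

section \<open>Existence by vanishing delay, and uniqueness\<close>

text \<open>Up to time \<open>(k + 1) * h\<close> the delayed argument stays below
  \<open>k * h\<close>, where \<sigma> already equals the observable. Replacing \<sigma> by the
  observable of its own solution thus changes no coefficient up to that time, and by
  \<open>Sol_stable\<close> the solution there is unchanged too.\<close>

lemma delayed:
  assumes h: "h > 0"
  obtains \<sigma> u w where "continuous_on {0..T} \<sigma>" "Sol (lag h \<sigma>) f u w" "\<And>t. t \<in> {0..T} \<Longrightarrow> obs w t = \<sigma> t"
proof -
  have "\<exists>\<sigma> u w. continuous_on {0..T} \<sigma> \<and> Sol (lag h \<sigma>) f u w \<and> (\<forall>t\<in>{0..T}. t \<le> real k * h \<longrightarrow> obs w t = \<sigma> t)" for k
  proof (induction k)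
    case 0
    have c: "continuous_on {0..T} (\<lambda>_. 0 :: real)" by simp
    obtain u w where S: "Sol (lag h (\<lambda>_. 0)) f u w" using Sol_exists[OF coef_lag[OF c]] by blast
    have "obs w t = 0" if "t \<in> {0..T}" "t \<le> real 0 * h" for t
    proof -
      have "t = 0" using that by simp
      then show ?thesis using Sol_0[OF coef_lag[OF c] S] by (simp add: obs_def)
    qed
    then show ?case using c S by blast
  next
    case (Suc k)
    then obtain \<sigma> u w where *: "continuous_on {0..T} \<sigma>" "Sol (lag h \<sigma>) f u w"
      "\<And>t. t \<in> {0..T} \<Longrightarrow> t \<le> real k * h \<Longrightarrow> obs w t = \<sigma> t" by blast
    have c: "continuous_on {0..T} (obs w)" by (rule obs_cont[OF coef_lag[OF *(1)] *(2)])
    obtain u' w' where S: "Sol (lag h (obs w)) f u' w'" using Sol_exists[OF coef_lag[OF c]] by blast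
    have eq: "lag h (obs w) s = lag h \<sigma> s" if "s \<le> real (Suc k) * h" for s
    proof -
      have "cl (s - h) \<le> real k * h" using that h T by (auto simp: cl_def algebra_simps)
      then show ?thesis using *(3)[OF cl_range] by (simp add: lag_def)
    qed
    have "obs w' t = obs w t" if t: "t \<in> {0..T}" "t \<le> real (Suc k) * h" for t
    proof -
      have "(LINT s|lborel. ind t s * ((lag h (obs w) s - lag h \<sigma> s)\<^sup>2 * (norm (sec (P1 u) s))\<^sup>2)) = 0"
        by (rule integral_eq_zero_AE, rule AE_I2) (use eq t in \<open>auto simp: indicator_def\<close>)
      then have "(norm (w' t - w t))\<^sup>2 \<le> 0"
        using Sol_stable(1)[OF coef_lag[OF c] coef_lag[OF *(1)] S *(2), of t] t by (simp del: power2_less_eq_zero_iff)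
      then show ?thesis by (simp add: obs_def)
    qed
    then show ?case using c S by blast
  qed
  moreover obtain k where "T < real k * h" using ex_less_of_nat_mult[OF h] by blast
  ultimately show ?thesis using that by (metis atLeastAtMost_iff less_imp_le order_trans)
qed

lemma lag_diff:
  assumes "s \<in> {0..T}" "\<And>r. r \<in> {0..T} \<Longrightarrow> \<bar>r - s\<bar> \<le> h \<Longrightarrow> \<bar>\<sigma> r - \<sigma> s\<bar> \<le> \<epsilon>" "0 \<le> h"
  shows "\<bar>\<sigma> (cl (s - h)) - \<sigma> s\<bar> \<le> \<epsilon>"
  by (rule assms(2)[OF cl_range]) (use assms in \<open>auto simp: cl_def\<close>)

text \<open>By equicontinuity a small delay shifts the observables by a small error, uniformly in
  time; \<open>compare\<close> with this error as perturbation makes them a uniform Cauchy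
  sequence.\<close>

lemma fixed_point_exists:
  obtains \<sigma> u w where "continuous_on {0..T} \<sigma>" "Sol (lag 0 \<sigma>) f u w" "\<And>t. t \<in> {0..T} \<Longrightarrow> obs w t = \<sigma> t"
proof -
  let ?h = "\<lambda>n. 1 / real (Suc n)"
  have "\<exists>\<sigma> u w. continuous_on {0..T} \<sigma> \<and> Sol (lag (?h n) \<sigma>) f u w \<and> (\<forall>t\<in>{0..T}. obs w t = \<sigma> t)" for n
    using delayed[of "?h n" f] by (metis of_nat_0_less_iff zero_less_Suc zero_less_divide_1_iff)
  then obtain \<sigma> u w where s: "\<And>n. continuous_on {0..T} (\<sigma> n)" "\<And>n. Sol (lag (?h n) (\<sigma> n)) f (u n) (w n)"
     "\<And>n t. t \<in> {0..T} \<Longrightarrow> obs (w n) t = \<sigma> n t" by metis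
  note cf = coef_lag[OF s(1)]
  have lagm: "\<exists>N. \<forall>n\<ge>N. \<forall>s\<in>{0..T}. \<bar>\<sigma> n (cl (s - ?h n)) - \<sigma> n s\<bar> \<le> \<epsilon>" if \<epsilon>: "\<epsilon> > 0" for \<epsilon>
  proof -
    obtain \<delta> where \<delta>: "\<delta> > 0" "\<And>n s t. s \<in> {0..T} \<Longrightarrow> t \<in> {0..T} \<Longrightarrow>
        \<bar>t - s\<bar> < \<delta> \<Longrightarrow> \<bar>obs (w n) t - obs (w n) s\<bar> \<le> \<epsilon>"
      using modulus[OF \<epsilon>, of f] cf s(2) by blast
    obtain N where N: "\<And>n k. n \<ge> N \<Longrightarrow> k \<ge> N \<Longrightarrow> 1 * (?h n + ?h k) < \<delta>"
      using inverse_Suc_pair_less[OF \<delta>(1), of 1] by (metis zero_le_one)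
    have "\<bar>\<sigma> n (cl (s - ?h n)) - \<sigma> n s\<bar> \<le> \<epsilon>" if n: "n \<ge> N" and st: "s \<in> {0..T}" for n s
    proof (rule lag_diff[OF st])
      fix r assume r: "r \<in> {0..T}" "\<bar>r - s\<bar> \<le> ?h n"
      have "?h n \<ge> 0" by simp
      then have "\<bar>r - s\<bar> < \<delta>" using N[OF n n] r(2) unfolding mult_1 by linarith
      then have "\<bar>obs (w n) r - obs (w n) s\<bar> \<le> \<epsilon>" by (intro \<delta>(2)[OF st r(1)])
      then show "\<bar>\<sigma> n r - \<sigma> n s\<bar> \<le> \<epsilon>" using s(3) st r(1) by simp
    qed simp
    then show ?thesis by blast
  qed
  \<comment> \<open>The 2 adds the delay errors of the two members compared; \<open>norm e\<close>
    passes from solutions to observables.\<close>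
  define R where "R = norm e * (sqrt (Kc f) * 2)"
  have R: "R \<ge> 0" using Kc_nonneg[of f] by (simp add: R_def)
  have "uniformly_Cauchy_on {0..T} \<sigma>"
    unfolding uniformly_Cauchy_on_def
  proof (intro allI impI)
    fix d :: real assume d: "d > 0"
    define \<epsilon> where "\<epsilon> = d / (R + 1)"
    have \<epsilon>: "\<epsilon> > 0" "R * \<epsilon> < d" using d R by (auto simp: \<epsilon>_def field_simps add_nonneg_pos)
    obtain N where N: "\<And>n s. n \<ge> N \<Longrightarrow> s \<in> {0..T} \<Longrightarrow> \<bar>\<sigma> n (cl (s - ?h n)) - \<sigma> n s\<bar> \<le> \<epsilon>" using lagm[OF \<epsilon>(1)] by blast
    have "dist (\<sigma> n t) (\<sigma> k t) < d" if t: "t \<in> {0..T}" and nk: "n \<ge> N" "k \<ge> N" for t n k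
    proof -
      have "norm (w n t - w k t) \<le> sqrt (Kc f) * (2 * \<epsilon>)"
      proof (rule compare[OF cf s(2) cf s(2) _ _ t])
        fix s assume st: "0 < s" "s < T"
        then have st': "s \<in> {0..T}" by simp
        have "\<bar>\<sigma> n (cl (s - ?h n)) - \<sigma> k (cl (s - ?h k))\<bar> \<le> 2 * \<epsilon> + \<bar>\<sigma> n s - \<sigma> k s\<bar>"
          using N[OF nk(1) st'] N[OF nk(2) st'] by linarith
        then have "L * \<bar>\<sigma> n (cl (s - ?h n)) - \<sigma> k (cl (s - ?h k))\<bar> \<le> L * (2 * \<epsilon> + \<bar>obs (w n) s - obs (w k) s\<bar>)"
          using L0 s(3)[OF st'] by (intro mult_left_mono) auto
        then show "\<bar>lag (?h n) (\<sigma> n) s - lag (?h k) (\<sigma> k) s\<bar> \<le> L * (2 * \<epsilon> + \<bar>obs (w n) s - obs (w k) s\<bar>)"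
          unfolding lag_def using a_lip order_trans by blast
      qed (use \<epsilon> in auto)
      then have "norm e * norm (w n t - w k t) \<le> norm e * (sqrt (Kc f) * (2 * \<epsilon>))" by (intro mult_left_mono) auto
      also have "\<dots> = R * \<epsilon>" by (simp add: R_def)
      finally show ?thesis
        using obs_diff_le[of "w n" t "w k" t] s(3)[OF t] \<epsilon>(2) by (simp add: dist_real_def)
    qed
    then show "\<exists>N. \<forall>t\<in>{0..T}. \<forall>n\<ge>N. \<forall>k\<ge>N. dist (\<sigma> n t) (\<sigma> k t) < d" by blast
  qed
  then obtain \<sigma>0 where ul: "uniform_limit {0..T} \<sigma> \<sigma>0 sequentially"
    using Cauchy_uniformly_convergent uniformly_convergent_on_def by blast
  have c0: "continuous_on {0..T} \<sigma>0"
    by (rule uniform_limit_theorem[OF _ ul]) (use s(1) in auto)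
  \<comment> \<open>The limit is not taken in the solutions: the linear problem is solved afresh
    with the limit coefficient, and \<open>compare\<close> shows that its observable is the limit of
    the observables.\<close>
  obtain u0 w0 where S0: "Sol (lag 0 \<sigma>0) f u0 w0" using Sol_exists[OF coef_lag[OF c0]] by blast
  have "obs w0 t = \<sigma>0 t" if t: "t \<in> {0..T}" for t
  proof (rule LIMSEQ_unique)
    show "(\<lambda>n. obs (w n) t) \<longlonglongrightarrow> \<sigma>0 t" using tendsto_uniform_limitI[OF ul t] s(3)[OF t] by simp
    show "(\<lambda>n. obs (w n) t) \<longlonglongrightarrow> obs w0 t"
    proof (rule metric_LIMSEQ_I)
      fix d :: real assume d: "d > 0"
      define \<epsilon> where "\<epsilon> = d / (R + 1)"
      have \<epsilon>: "\<epsilon> > 0" "R * \<epsilon> < d" using d R by (auto simp: \<epsilon>_def field_simps add_nonneg_pos)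
      obtain N where N: "\<And>n s. n \<ge> N \<Longrightarrow> s \<in> {0..T} \<Longrightarrow> \<bar>\<sigma> n (cl (s - ?h n)) - \<sigma> n s\<bar> \<le> \<epsilon>" using lagm[OF \<epsilon>(1)] by blast
      obtain N' where N': "\<And>n s. n \<ge> N' \<Longrightarrow> s \<in> {0..T} \<Longrightarrow> dist (\<sigma> n s) (\<sigma>0 s) < \<epsilon>"
        using uniform_limitD[OF ul \<epsilon>(1)] unfolding eventually_sequentially by blast
      have "dist (obs (w n) t) (obs w0 t) < d" if n: "n \<ge> max N N'" for n
      proof -
        have "norm (w n t - w0 t) \<le> sqrt (Kc f) * (2 * \<epsilon>)"
        proof (rule compare[OF cf s(2) coef_lag[OF c0] S0 _ _ t])
          fix s assume st: "0 < s" "s < T"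
          then have st': "s \<in> {0..T}" by simp
          have "\<bar>\<sigma> n (cl (s - ?h n)) - \<sigma>0 (cl (s - 0))\<bar> \<le> 2 * \<epsilon>"
            using N[OF _ st', of n] N'[OF _ st', of n] n cl_id[OF st'] by (simp add: dist_real_def)
          then have "L * \<bar>\<sigma> n (cl (s - ?h n)) - \<sigma>0 (cl (s - 0))\<bar> \<le> L * (2 * \<epsilon> + \<bar>obs (w n) s - obs w0 s\<bar>)"
            using L0 by (intro mult_left_mono) auto
          then show "\<bar>lag (?h n) (\<sigma> n) s - lag 0 \<sigma>0 s\<bar> \<le> L * (2 * \<epsilon> + \<bar>obs (w n) s - obs w0 s\<bar>)"
            unfolding lag_def using a_lip order_trans by blast
        qed (use \<epsilon> in auto)
        then have "norm e * norm (w n t - w0 t) \<le> norm e * (sqrt (Kc f) * (2 * \<epsilon>))" by (intro mult_left_mono) auto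
        also have "\<dots> = R * \<epsilon>" by (simp add: R_def)
        finally show ?thesis using obs_diff_le[of "w n" t w0 t] \<epsilon>(2) by (simp add: dist_real_def)
      qed
      then show "\<exists>N. \<forall>n\<ge>N. dist (obs (w n) t) (obs w0 t) < d" by blast
    qed
  qed
  then show ?thesis using that c0 S0 by blast
qed

lemma Sol_u_eq:
  assumes \<alpha>: "coef \<alpha>" "Sol \<alpha> f u1 w1" and \<beta>: "coef \<beta>" "Sol \<beta> f' u2 w2"
    and "\<And>t. t \<in> {0..T} \<Longrightarrow> w1 t = w2 t"
  shows "u1 = u2"
proof -
  have W: "u1 - u2 \<in> W" using Sol_W[OF \<alpha>] Sol_W[OF \<beta>] W_subspace by (rule subspace_diff[rotated])
  have "P0 (u1 - u2) = 0"
  proof (rule sec_ext)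
    have "AE t in lborel. sec (u1 - u2) t \<in> (if 0 < t \<and> t < T then Hs else {0})" using W by (simp add: W_def)
    then show "AE t in lborel. sec (P0 (u1 - u2)) t = sec 0 t"
      using Sol_AE[OF \<alpha>] Sol_AE[OF \<beta>] sec_P0[of "u1 - u2"] sec_diff[of u1 u2] sec_zero[where 'a='a and 'b="real \<times> 'a"]
      by eventually_elim (use assms(5) in \<open>auto simp: P0_diff split: if_splits\<close>)
  qed
  then have "u1 - u2 = 0" by (rule P0_inj_W[OF W])
  then show ?thesis by simp
qed

lemma fixed_point_unique:
  assumes "continuous_on {0..T} \<sigma>1" "Sol (lag 0 \<sigma>1) f u1 w1" "\<And>t. t \<in> {0..T} \<Longrightarrow> obs w1 t = \<sigma>1 t"
    and "continuous_on {0..T} \<sigma>2" "Sol (lag 0 \<sigma>2) f u2 w2" "\<And>t. t \<in> {0..T} \<Longrightarrow> obs w2 t = \<sigma>2 t"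
  shows "u1 = u2"
proof (rule Sol_u_eq[OF coef_lag[OF assms(1)] assms(2) coef_lag[OF assms(4)] assms(5)])
  fix t assume t: "t \<in> {0..T}"
  have "norm (w1 t - w2 t) \<le> sqrt (Kc f) * 0"
  proof (rule compare[OF coef_lag[OF assms(1)] assms(2) coef_lag[OF assms(4)] assms(5) _ _ t])
    fix s assume "0 < s" "s < T"
    then have s: "s \<in> {0..T}" by simp
    show "\<bar>lag 0 \<sigma>1 s - lag 0 \<sigma>2 s\<bar> \<le> L * (0 + \<bar>obs w1 s - obs w2 s\<bar>)"
      using a_lip[of "\<sigma>1 s" "\<sigma>2 s"] assms(3,6)[OF s] by (simp add: lag_def cl_id[OF s])
  qed simp
  then show "w1 t = w2 t" by simp
qed

text \<open>By \<open>weak_unique\<close> a weak solution coincides with the constructed one, and so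
  inherits the energy estimates on which uniqueness for the nonlocal problem rests.\<close>

lemma weak_imp_Sol:
  assumes \<alpha>: "coef \<alpha>" and u: "u \<in> W"
    and wk: "\<And>t k. t \<in> {0..T} \<Longrightarrow> k \<in> Hs \<Longrightarrow> inner (w t) k + inner (tm \<alpha> (P1 u)) (tens (ind t) k) = inner f (tens (ind t) k)"
    and ae: "AE t in lborel. 0 < t \<and> t < T \<longrightarrow> w t = P0 (sec u t)"
  obtains w' where "Sol \<alpha> f u w'" "AE t in lborel. 0 < t \<and> t < T \<longrightarrow> w' t = w t"
proof -
  obtain u' w' where S: "Sol \<alpha> f u' w'" using Sol_exists[OF \<alpha>] by blast
  have "u - u' = 0"
  proof (rule weak_unique[OF \<alpha>])
    show "u - u' \<in> W" using u Sol_W[OF \<alpha> S] W_subspace by (rule subspace_diff[rotated])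
    show "inner (w t - w' t) k + inner (tm \<alpha> (P1 (u - u'))) (tens (ind t) k) = 0"
      if "0 < t" "t < T" "k \<in> Hs" for t k
      using wk[of t k] Sol_weak[OF \<alpha> S, of t k] that \<alpha> by (simp add: P1_diff tm_diff inner_diff_left)
    show "AE t in lborel. 0 < t \<and> t < T \<longrightarrow> w t - w' t = P0 (sec (u - u') t)"
      using ae Sol_AE[OF \<alpha> S] sec_diff[of u u'] by eventually_elim (simp add: P0_diff)
  qed
  then have e: "u' = u" by simp
  have "AE t in lborel. 0 < t \<and> t < T \<longrightarrow> w' t = w t"
    using ae Sol_AE[OF \<alpha> S] unfolding e by eventually_elim simp
  then show ?thesis using that S unfolding e by blast
qed

end

section \<open>Test functions\<close>

text \<open>The derivatives of \<open>exp (- 1 / x)\<close> are linear combinations of the functions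
  \<open>x powi (- k) * exp (- 1 / x)\<close>; this makes the closure of \<open>sm\<close> under partial derivatives
  a routine induction.\<close>

definition hk :: "nat \<Rightarrow> real \<Rightarrow> real" where
  "hk k x = (if x > 0 then inverse x ^ k * exp (- inverse x) else 0)"

lemma power_div_fact_le_exp: "0 \<le> x \<Longrightarrow> x ^ n / fact n \<le> exp (x :: real)"
proof -
  assume x: "0 \<le> x"
  have "(\<Sum>i\<in>{n}. x ^ i /\<^sub>R fact i) \<le> (\<Sum>i. x ^ i /\<^sub>R fact i)"
    by (rule sum_le_suminf) (use x exp_converges[of x] in \<open>auto simp: sums_iff\<close>)
  then show ?thesis using exp_converges[of x] by (simp add: sums_iff divide_inverse mult.commute)
qed

text \<open>For positive \<open>x\<close> this is one term of the exponential series,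
  \<open>z ^ Suc k / fact (Suc k) \<le> exp z\<close> at \<open>z = inverse x\<close>.\<close>

lemma hk_bound: "\<bar>hk k x\<bar> \<le> fact (Suc k) * \<bar>x\<bar>"
proof (cases "x > 0")
  case True
  define z where "z = inverse x"
  have z: "z > 0" using True by (simp add: z_def)
  have "z ^ Suc k / fact (Suc k) \<le> exp z" using z by (intro power_div_fact_le_exp) simp
  then have "z ^ Suc k \<le> exp z * fact (Suc k)" by (simp only: pos_divide_le_eq[OF fact_gt_zero])
  then have "z * z ^ k \<le> fact (Suc k) * exp z" by (simp only: power_Suc mult.commute)
  then have "z ^ k * exp (- z) \<le> fact (Suc k) / z" using z by (simp add: exp_minus field_simps)
  then show ?thesis using True z by (simp add: hk_def z_def divide_inverse)
next
  case False
  have "0 \<le> fact (Suc k) * \<bar>x\<bar>" by (intro mult_nonneg_nonneg) simp_all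
  then show ?thesis using False by (simp only: hk_def if_False abs_zero)
qed

lemma DERIV_hk: "(hk k has_real_derivative (hk (k + 2) x - real k * hk (k + 1) x)) (at x)"
proof -
  consider "x > 0" | "x < 0" | "x = 0" by linarith
  then show ?thesis
  proof cases
    case 1
    have "((\<lambda>x. inverse x ^ k * exp (- inverse x)) has_real_derivative
        (hk (k + 2) x - real k * hk (k + 1) x)) (at x)"
    proof -
      have d1: "(inverse has_real_derivative - (inverse x * inverse x)) (at x)"
        using 1 by (auto intro!: derivative_eq_intros)
      have d2: "((\<lambda>x. exp (- inverse x)) has_real_derivative exp (- inverse x) * (inverse x * inverse x)) (at x)"
        using 1 by (auto intro!: derivative_eq_intros)
      show ?thesis
        by (rule DERIV_cong[OF DERIV_mult[OF DERIV_power[OF d1, of k] d2]])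
          (use 1 in \<open>cases k; simp add: hk_def algebra_simps\<close>)
    qed
    then show ?thesis
      by (rule has_field_derivative_transform_within_open[where S="{0<..}"]) (use 1 in \<open>auto simp: hk_def\<close>)
  next
    case 2
    have "((\<lambda>_. 0) has_real_derivative 0) (at x)" by simp
    then have "(hk k has_real_derivative 0) (at x)"
      by (rule has_field_derivative_transform_within_open[where S="{..<0}"]) (use 2 in \<open>auto simp: hk_def\<close>)
    then show ?thesis using 2 by (simp add: hk_def)
  next
    case 3
    have "(\<lambda>h. (hk k (0 + h) - hk k 0) / h) \<midarrow>0\<rightarrow> 0"
    proof (rule Lim_null_comparison)
      \<comment> \<open>The quotient by \<open>h\<close> is \<open>hk (Suc k) h\<close>, so the
        linear bound at the next index forces the derivative to be zero.\<close>
      have "norm ((hk k (0 + h) - hk k 0) / h) \<le> fact (Suc (Suc k)) * \<bar>h\<bar>" for h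
        using hk_bound[of "Suc k" h] by (auto simp: hk_def divide_inverse mult_ac)
      then show "\<forall>\<^sub>F h in at 0. norm ((hk k (0 + h) - hk k 0) / h) \<le> fact (Suc (Suc k)) * \<bar>h\<bar>" by simp
      have "((\<lambda>h::real. fact (Suc (Suc k)) * \<bar>h\<bar>) \<longlongrightarrow> fact (Suc (Suc k)) * \<bar>0\<bar>) (at 0)"
        by (intro tendsto_intros)
      then show "((\<lambda>h::real. fact (Suc (Suc k)) * \<bar>h\<bar>) \<longlongrightarrow> 0) (at 0)" by simp
    qed
    then have "(hk k has_real_derivative 0) (at 0)" by (simp add: DERIV_def)
    then show ?thesis using 3 by (simp add: hk_def)
  qed
qed

text \<open>An explicit class that serves as the invariant for the coinductive
  \<open>smooth_fun\<close>. \<open>base\<close> provides the factors of box-shaped bumps,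
  \<open>expo\<close> the plateau functions built from them.\<close>

inductive sm :: "('a::euclidean_space \<Rightarrow> real) \<Rightarrow> bool" where
  const: "sm (\<lambda>_. c)"
| base: "sm (\<lambda>x. hk k (s * (x \<bullet> i) + d))"
| add: "sm f \<Longrightarrow> sm g \<Longrightarrow> sm (\<lambda>x. f x + g x)"
| mult: "sm f \<Longrightarrow> sm g \<Longrightarrow> sm (\<lambda>x. f x * g x)"
| expo: "sm f \<Longrightarrow> sm (\<lambda>x. exp (f x))"

lemma sm_deriv:
  assumes "sm f"
  shows "\<exists>D. (\<forall>x. (f has_derivative D x) (at x)) \<and> (\<forall>v. sm (\<lambda>x. D x v))"
  using assms
proof induction
  case (const c)
  show ?case by (rule exI[of _ "\<lambda>_ _. 0"]) (auto intro: sm.const)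
next
  case (base k s i d)
  let ?h = "\<lambda>x. hk (k + 2) (s * (x \<bullet> i) + d) - real k * hk (k + 1) (s * (x \<bullet> i) + d)"
  show ?case
  proof (intro exI[of _ "\<lambda>x v. (s * (v \<bullet> i)) * ?h x"] conjI allI)
    fix x v
    have "((\<lambda>x. s * (x \<bullet> i) + d) has_derivative (\<lambda>v. s * (v \<bullet> i))) (at x)"
      by (auto intro!: derivative_eq_intros)
    from DERIV_compose_FDERIV[OF DERIV_hk this]
    show "((\<lambda>x. hk k (s * (x \<bullet> i) + d)) has_derivative (\<lambda>v. (s * (v \<bullet> i)) * ?h x)) (at x)" .
    have "sm (\<lambda>x. (s * (v \<bullet> i)) * (hk (k + 2) (s * (x \<bullet> i) + d) + (- real k) * hk (k + 1) (s * (x \<bullet> i) + d)))"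
      by (intro sm.intros)
    then show "sm (\<lambda>x. (s * (v \<bullet> i)) * ?h x)" by simp
  qed
next
  case (add f g)
  then obtain D E where "\<forall>x. (f has_derivative D x) (at x)" "\<forall>v. sm (\<lambda>x. D x v)"
    "\<forall>x. (g has_derivative E x) (at x)" "\<forall>v. sm (\<lambda>x. E x v)" by blast
  then show ?case
    by (intro exI[of _ "\<lambda>x v. D x v + E x v"]) (auto intro: sm.intros has_derivative_add)
next
  case (mult f g)
  then obtain D E where "\<forall>x. (f has_derivative D x) (at x)" "\<forall>v. sm (\<lambda>x. D x v)"
    "\<forall>x. (g has_derivative E x) (at x)" "\<forall>v. sm (\<lambda>x. E x v)" by blast
  then have "\<forall>x. ((\<lambda>x. f x * g x) has_derivative (\<lambda>v. f x * E x v + D x v * g x)) (at x)"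
    "\<forall>v. sm (\<lambda>x. f x * E x v + D x v * g x)"
    using mult.hyps by (auto intro!: sm.add sm.mult has_derivative_mult)
  then show ?case by (intro exI[of _ "\<lambda>x v. f x * E x v + D x v * g x"]) blast
next
  case (expo f)
  then obtain D where D: "\<forall>x. (f has_derivative D x) (at x)" "\<forall>v. sm (\<lambda>x. D x v)" by blast
  show ?case
  proof (intro exI[of _ "\<lambda>x v. D x v * exp (f x)"] conjI allI)
    show "((\<lambda>x. exp (f x)) has_derivative (\<lambda>v. D x v * exp (f x))) (at x)" for x
      by (rule DERIV_compose_FDERIV[OF DERIV_exp]) (use D in blast)
    show "sm (\<lambda>x. D x v * exp (f x))" for v using D expo.hyps by (intro sm.intros) auto
  qed
qed

lemma smooth_fun_sm: "sm f \<Longrightarrow> smooth_fun f"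
proof (coinduction arbitrary: f)
  case smooth_fun
  then obtain D where D: "\<And>x. (f has_derivative D x) (at x)" "\<And>v. sm (\<lambda>x. D x v)"
    using sm_deriv by metis
  have "frechet_derivative f (at x) = D x" for x
    using frechet_derivative_at[OF D(1)] by simp
  moreover have "continuous_on UNIV f"
    by (rule has_derivative_continuous_on) (use D(1) in \<open>auto intro: has_derivative_at_withinI\<close>)
  moreover have "f differentiable (at x)" for x using D(1) by (auto simp: differentiable_def)
  ultimately show ?case using D(2) by auto
qed

lemma smooth_funD:
  assumes "smooth_fun f"
  shows "continuous_on UNIV f" "f differentiable (at x)" "i \<in> Basis \<Longrightarrow> smooth_fun (\<lambda>x. frechet_derivative f (at x) i)"
    "(f has_derivative frechet_derivative f (at x)) (at x)"
  using assms by (auto elim: smooth_fun.cases simp: frechet_derivative_works)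

lemma frechet_derivative_lincomb:
  fixes f g :: "'a::euclidean_space \<Rightarrow> real"
  assumes "smooth_fun f" "smooth_fun g"
  shows "((\<lambda>x. c * f x + d * g x) has_derivative
      (\<lambda>v. c * frechet_derivative f (at x) v + d * frechet_derivative g (at x) v)) (at x)"
    and "frechet_derivative (\<lambda>x. c * f x + d * g x) (at x)
      = (\<lambda>v. c * frechet_derivative f (at x) v + d * frechet_derivative g (at x) v)"
proof -
  show *: "((\<lambda>x. c * f x + d * g x) has_derivative
      (\<lambda>v. c * frechet_derivative f (at x) v + d * frechet_derivative g (at x) v)) (at x)"
    by (intro has_derivative_add has_derivative_mult_right smooth_funD(4) assms)
  show "frechet_derivative (\<lambda>x. c * f x + d * g x) (at x)
      = (\<lambda>v. c * frechet_derivative f (at x) v + d * frechet_derivative g (at x) v)"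
    using frechet_derivative_at[OF *] by simp
qed

lemma smooth_fun_lincomb:
  assumes "smooth_fun f" "smooth_fun g" shows "smooth_fun (\<lambda>x. c * f x + d * g x)"
  using assms
proof (coinduction arbitrary: f g)
  case smooth_fun
  have "continuous_on UNIV (\<lambda>x. c * f x + d * g x)"
    by (intro continuous_intros smooth_funD(1) smooth_fun)
  moreover have "(\<lambda>x. c * f x + d * g x) differentiable (at x)" for x
    using frechet_derivative_lincomb(1)[OF smooth_fun] by (auto simp: differentiable_def)
  moreover have "\<exists>f' g'. (\<lambda>x. frechet_derivative (\<lambda>x. c * f x + d * g x) (at x) i) = (\<lambda>x. c * f' x + d * g' x)
      \<and> smooth_fun f' \<and> smooth_fun g'" if "i \<in> Basis" for i
    by (intro exI[of _ "\<lambda>x. frechet_derivative f (at x) i"] exI[of _ "\<lambda>x. frechet_derivative g (at x) i"] conjI)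
      (simp_all add: frechet_derivative_lincomb(2)[OF smooth_fun] smooth_funD(3) smooth_fun that)
  ultimately show ?case by blast
qed

lemma supp_subset_tsupp: "f x \<noteq> 0 \<Longrightarrow> x \<in> tsupp f"
  unfolding tsupp_def using closure_subset by fastforce

lemma test_fun_lincomb:
  assumes "test_fun \<Omega> f" "test_fun \<Omega> g" shows "test_fun \<Omega> (\<lambda>x. c * f x + d * g x)"
proof -
  have "tsupp (\<lambda>x. c * f x + d * g x) \<subseteq> tsupp f \<union> tsupp g"
    unfolding tsupp_def closure_Un[symmetric] by (rule closure_mono) auto
  moreover have "compact (tsupp f \<union> tsupp g)" "tsupp f \<union> tsupp g \<subseteq> \<Omega>"
    using assms by (auto simp: test_fun_def)
  ultimately have "compact (tsupp (\<lambda>x. c * f x + d * g x))" "tsupp (\<lambda>x. c * f x + d * g x) \<subseteq> \<Omega>"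
    using compact_Int_closed[of "tsupp f \<union> tsupp g" "tsupp (\<lambda>x. c * f x + d * g x)"]
    by (auto simp: Int_absorb1 tsupp_def)
  then show ?thesis using assms by (simp add: test_fun_def smooth_fun_lincomb)
qed

lemma grad_lincomb:
  assumes "smooth_fun f" "smooth_fun g"
  shows "grad (\<lambda>x. c * f x + d * g x) x = c *\<^sub>R grad f x + d *\<^sub>R grad g x"
  by (simp add: grad_def frechet_derivative_lincomb(2)[OF assms] scaleR_add_left sum.distrib scaleR_sum_right)

section \<open>Bumps, plateaus and the fundamental lemma of the calculus of variations\<close>

definition bump :: "'a::euclidean_space \<Rightarrow> 'a \<Rightarrow> 'a \<Rightarrow> real" where
  "bump a b x = (\<Prod>i\<in>Basis. hk 0 (x \<bullet> i - a \<bullet> i) * hk 0 (b \<bullet> i - x \<bullet> i))"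

lemma sm_bump: "sm (bump a b)"
proof -
  have "sm (\<lambda>x. \<Prod>i\<in>I. hk 0 (x \<bullet> i - a \<bullet> i) * hk 0 (b \<bullet> i - x \<bullet> i))" if "finite I" for I :: "'a set"
    using that
  proof induction
    case (insert i I)
    have "sm (\<lambda>x. (hk 0 (1 * (x \<bullet> i) + (- (a \<bullet> i))) * hk 0 ((- 1) * (x \<bullet> i) + b \<bullet> i)) *
        (\<Prod>i\<in>I. hk 0 (x \<bullet> i - a \<bullet> i) * hk 0 (b \<bullet> i - x \<bullet> i)))"
      by (intro sm.mult sm.base insert.IH)
    then show ?case using insert.hyps by simp
  qed (simp add: sm.const)
  from this[of Basis] show ?thesis unfolding bump_def by simp
qed

lemma hk_pos_iff: "hk k x > 0 \<longleftrightarrow> x > 0" and hk_nonneg: "hk k x \<ge> 0"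
  by (auto simp: hk_def)

lemma bump_nonneg: "bump a b x \<ge> 0"
  unfolding bump_def by (intro prod_nonneg mult_nonneg_nonneg hk_nonneg ballI)

lemma bump_pos_iff: "bump a b x > 0 \<longleftrightarrow> x \<in> box a b"
proof
  assume p: "bump a b x > 0"
  show "x \<in> box a b"
  proof (rule ccontr)
    assume "x \<notin> box a b"
    then obtain i where i: "i \<in> Basis" "\<not> (a \<bullet> i < x \<bullet> i \<and> x \<bullet> i < b \<bullet> i)" by (auto simp: mem_box)
    then have "hk 0 (x \<bullet> i - a \<bullet> i) * hk 0 (b \<bullet> i - x \<bullet> i) = 0" by (auto simp: hk_def)
    then have "bump a b x = 0" unfolding bump_def using i by (intro prod_zero) auto
    then show False using p by simp
  qed
next
  assume "x \<in> box a b"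
  then show "bump a b x > 0" unfolding bump_def
    by (intro prod_pos mult_pos_pos) (auto simp: hk_pos_iff mem_box)
qed

text \<open>In the open box, where \<open>bump\<close> is positive, the exponential dies as
  \<open>n\<close> grows; elsewhere the value is 0. So indicators of boxes are bounded pointwise
  limits of test functions.\<close>

definition plateau :: "'a::euclidean_space \<Rightarrow> 'a \<Rightarrow> nat \<Rightarrow> 'a \<Rightarrow> real" where
  "plateau a b n x = 1 - exp (- (real n * bump a b x))"

lemma test_fun_plateau: assumes "cbox a b \<subseteq> \<Omega>" shows "test_fun \<Omega> (plateau a b n)"
proof -
  have "sm (\<lambda>x. 1 + (- 1) * exp (- real n * bump a b x))" by (intro sm.intros sm_bump)
  then have "smooth_fun (plateau a b n)" by (intro smooth_fun_sm) (simp add: plateau_def[abs_def])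
  moreover have "{x. plateau a b n x \<noteq> 0} \<subseteq> box a b"
  proof
    fix x assume "x \<in> {x. plateau a b n x \<noteq> 0}"
    then have "bump a b x \<noteq> 0" by (auto simp: plateau_def)
    then show "x \<in> box a b" using bump_pos_iff[of a b x] bump_nonneg[of a b x] by linarith
  qed
  then have "tsupp (plateau a b n) \<subseteq> cbox a b"
    unfolding tsupp_def by (intro closure_minimal) (use box_subset_cbox in auto)
  moreover from this have "compact (tsupp (plateau a b n))"
    using compact_Int_closed[of "cbox a b" "tsupp (plateau a b n)"] by (auto simp: Int_absorb1 tsupp_def)
  ultimately show ?thesis using assms by (auto simp: test_fun_def)
qed

lemma plateau_bound: "\<bar>plateau a b n x\<bar> \<le> 1"
  using bump_nonneg[of a b x] by (simp add: plateau_def)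

lemma plateau_tendsto: "(\<lambda>n. plateau a b n x) \<longlonglongrightarrow> indicator (box a b) x"
proof (cases "x \<in> box a b")
  case True
  then have p: "bump a b x > 0" using bump_pos_iff by blast
  have "(\<lambda>n. exp (- bump a b x) ^ n) \<longlonglongrightarrow> 0" by (rule LIMSEQ_realpow_zero) (use p in auto)
  then have "(\<lambda>n. 1 - exp (- bump a b x) ^ n) \<longlonglongrightarrow> 1 - 0" by (rule tendsto_diff[OF tendsto_const])
  moreover have "plateau a b n x = 1 - exp (- bump a b x) ^ n" for n
    by (simp add: plateau_def exp_of_nat_mult[symmetric])
  ultimately show ?thesis using True by simp
next
  case False
  then have "bump a b x = 0" using bump_pos_iff[of a b x] bump_nonneg[of a b x] by linarith
  then show ?thesis using False by (simp add: plateau_def)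
qed

lemma test_fun_meas: "test_fun \<Omega> \<psi> \<Longrightarrow> \<psi> \<in> borel_measurable borel"
  using smooth_funD(1) borel_measurable_continuous_onI test_fun_def by blast

text \<open>Open boxes are an intersection-stable generator of the Borel sets, so the vanishing
  spreads to all Borel subsets of the fixed box; the sets where \<open>f\<close> is positive and
  where it is negative are then inserted.\<close>

lemma AE_zero_if_set_integrals_zero:
  fixes f :: "'a::euclidean_space \<Rightarrow> real"
  assumes f: "integrable lborel f" and z: "\<And>u v. (LINT x|lborel. indicator (box u v \<inter> box a b) x * f x) = 0"
  shows "AE x in lborel. x \<in> box a b \<longrightarrow> f x = 0"
proof -
  have [measurable]: "f \<in> borel_measurable borel" using f by auto
  have int: "integrable lborel (\<lambda>x. indicator A x * f x)" if "A \<in> sets borel" for A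
    using integrable_mult_indicator[OF _ f, of A] that by simp
  have key: "(LINT x|lborel. indicator (A \<inter> box a b) x * f x) = 0" if "A \<in> sets borel" for A
  proof -
    have A: "A \<in> sigma_sets UNIV (range (\<lambda>(u, v). box u v :: 'a set))"
      using that unfolding borel_eq_box by simp
    have st: "Int_stable (range (\<lambda>(u, v). box u v :: 'a set))"
      by (force simp: Int_stable_def box_Int_box)
    have pw: "range (\<lambda>(u, v). box u v :: 'a set) \<subseteq> Pow UNIV" by auto
    show ?thesis
      using st pw A
    proof (induction rule: sigma_sets_induct_disjoint)
      case (basic A)
      then show ?case using z by auto
    next
      case empty
      show ?case by simp
    next
      case (compl A)
      then have Ab: "A \<in> sets borel" unfolding borel_eq_box by simp
      have "(LINT x|lborel. indicator ((UNIV - A) \<inter> box a b) x * f x)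
         = (LINT x|lborel. indicator (box a b \<inter> box a b) x * f x - indicator (A \<inter> box a b) x * f x)"
        by (rule Bochner_Integration.integral_cong) (auto simp: indicator_def)
      also have "\<dots> = 0" using z[of a b] compl.IH int Ab by simp
      finally show ?case .
    next
      case (union A)
      then have Ab: "A i \<in> sets borel" for i unfolding borel_eq_box by auto
      have si: "set_integrable lborel (\<Union>i. A i \<inter> box a b) f"
        unfolding set_integrable_def by (rule integrable_mult_indicator) (use Ab f in auto)
      have "(LINT x:(\<Union>i. A i \<inter> box a b)|lborel. f x) = (\<Sum>i. LINT x:(A i \<inter> box a b)|lborel. f x)"
        by (rule lebesgue_integral_countable_add) (use Ab union si in \<open>auto simp: disjoint_family_on_def\<close>)
      moreover have "(\<Union>i. A i \<inter> box a b) = (\<Union>i. A i) \<inter> box a b" by auto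
      ultimately show ?case using union.IH by (simp add: set_lebesgue_integral_def)
    qed
  qed
  have half: "AE x in lborel. x \<in> box a b \<longrightarrow> s * f x \<le> 0" if "s = 1 \<or> s = -1" for s :: real
  proof -
    define A where "A = {x. s * f x > 0}"
    have Ab: "A \<in> sets borel" unfolding A_def by measurable
    have "(LINT x|lborel. s * (indicator (A \<inter> box a b) x * f x)) = 0"
      using key[OF Ab] by simp
    moreover have "integrable lborel (\<lambda>x. s * (indicator (A \<inter> box a b) x * f x))"
      using int[of "A \<inter> box a b"] Ab by simp
    moreover have "AE x in lborel. 0 \<le> s * (indicator (A \<inter> box a b) x * f x)"
      by (rule AE_I2) (auto simp: A_def indicator_def)
    ultimately have "AE x in lborel. s * (indicator (A \<inter> box a b) x * f x) = 0"
      by (subst (asm) integral_nonneg_eq_0_iff_AE) auto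
    then show ?thesis by eventually_elim (auto simp: A_def indicator_def split: if_splits)
  qed
  have "AE x in lborel. x \<in> box a b \<longrightarrow> 1 * f x \<le> 0" "AE x in lborel. x \<in> box a b \<longrightarrow> - 1 * f x \<le> 0"
    by (rule half, simp)+
  then show ?thesis by eventually_elim auto
qed

text \<open>Dominated convergence along plateaus gives zero integrals over the boxes whose closure
  lies in \<Omega>. Countably many closed boxes cover \<Omega>, and their faces are null
  sets.\<close>

lemma fundamental_lemma:
  fixes f :: "'a::euclidean_space \<Rightarrow> real"
  assumes \<Omega>: "open \<Omega>" and f: "integrable lborel f"
    and z: "\<And>\<psi>. test_fun \<Omega> \<psi> \<Longrightarrow> (LINT x|lborel. f x * \<psi> x) = 0"
  shows "AE x in lborel. x \<in> \<Omega> \<longrightarrow> f x = 0"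
proof -
  have [measurable]: "f \<in> borel_measurable borel" using f by auto
  have zb: "(LINT x|lborel. indicator (box u v) x * f x) = 0" if uv: "cbox u v \<subseteq> \<Omega>" for u v
  proof (rule LIMSEQ_unique)
    show "(\<lambda>n. LINT x|lborel. f x * plateau u v n x) \<longlonglongrightarrow> (LINT x|lborel. indicator (box u v) x * f x)"
    proof (rule integral_dominated_convergence[where w="\<lambda>x. norm (f x)"])
      show "AE x in lborel. (\<lambda>n. f x * plateau u v n x) \<longlonglongrightarrow> indicator (box u v) x * f x"
        by (rule AE_I2, subst mult.commute) (intro tendsto_mult tendsto_const plateau_tendsto)
      show "AE x in lborel. norm (f x * plateau u v n x) \<le> norm (f x)" for n
        using plateau_bound[of u v n] by (simp add: abs_mult mult_left_le)
      show "(\<lambda>x. f x * plateau u v n x) \<in> borel_measurable lborel" for n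
        using test_fun_meas[OF test_fun_plateau[OF uv]] by simp
    qed (use f in auto)
    show "(\<lambda>n. LINT x|lborel. f x * plateau u v n x) \<longlonglongrightarrow> 0"
      using z[OF test_fun_plateau[OF uv]] by simp
  qed
  obtain \<D> where \<D>: "countable \<D>" "\<D> \<subseteq> Pow \<Omega>" "\<forall>X\<in>\<D>. \<exists>a b. X = cbox a b" "\<Union>\<D> = \<Omega>"
  proof (rule open_countable_Union_open_cbox[OF \<Omega>])
    fix \<D> assume a: "countable \<D>" "\<D> \<subseteq> Pow \<Omega>" "\<And>X. X \<in> \<D> \<Longrightarrow> \<exists>a b. X = cbox a b" "\<Union>\<D> = \<Omega>"
    show thesis by (rule that[OF a(1,2) _ a(4)]) (intro ballI, rule a(3))
  qed
  have "AE x in lborel. x \<in> X \<longrightarrow> f x = 0" if X: "X \<in> \<D>" for X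
  proof -
    obtain a b where X': "X = cbox a b" using \<D>(3) X by blast
    have "X \<in> Pow \<Omega>" using \<D>(2) X by (rule subsetD)
    then have ab: "X = cbox a b" "cbox a b \<subseteq> \<Omega>" using X' by simp_all
    have "AE x in lborel. x \<in> box a b \<longrightarrow> f x = 0"
    proof (rule AE_zero_if_set_integrals_zero[OF f])
      fix u v
      show "(LINT x|lborel. indicator (box u v \<inter> box a b) x * f x) = 0"
      proof (cases "box u v \<inter> box a b = {}")
        case False
        obtain c d where cd: "box u v \<inter> box a b = box c d" by (rule that[OF box_Int_box])
        have "box c d \<subseteq> box a b" "box c d \<noteq> {}" using False unfolding cd[symmetric] by simp_all
        \<comment> \<open>The closed box of the intersection has to lie in \<Omega> as well; the
          closure of an open box is the closed box only if the box is nonempty.\<close>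
        then have "closure (box c d) \<subseteq> closure (box a b)" "box a b \<noteq> {}"
          using closure_mono[of "box c d" "box a b"] by blast+
        then have "cbox c d \<subseteq> cbox a b" using \<open>box c d \<noteq> {}\<close> by (simp add: closure_box)
        then have "cbox c d \<subseteq> \<Omega>" using ab(2) by (rule order_trans)
        then show ?thesis unfolding cd by (rule zb)
      qed simp
    qed
    moreover have "AE x in lborel. x \<notin> cbox a b - box a b"
      by (rule AE_not_in) (simp add: null_sets_cbox_Diff_box)
    ultimately show ?thesis unfolding ab by eventually_elim auto
  qed
  then have "AE x in lborel. \<forall>X\<in>\<D>. x \<in> X \<longrightarrow> f x = 0"
    unfolding AE_ball_countable[OF \<D>(1)] by blast
  then show ?thesis by eventually_elim (use \<D>(4) in auto)
qed

section \<open>The space of Sobolev functions vanishing on the boundary\<close>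

lemma subspace_closure:
  fixes S :: "'h::real_normed_vector set"
  assumes "subspace S" shows "subspace (closure S)"
  unfolding subspace_def
proof (intro conjI allI ballI)
  show "0 \<in> closure S" using subspace_0[OF assms] closure_subset by blast
next
  fix x y assume "x \<in> closure S" "y \<in> closure S"
  then obtain f g where "\<And>n. f n \<in> S" "f \<longlonglongrightarrow> x" "\<And>n. g n \<in> S" "g \<longlonglongrightarrow> y"
    unfolding closure_sequential by blast
  then have "\<And>n. f n + g n \<in> S" "(\<lambda>n. f n + g n) \<longlonglongrightarrow> x + y"
    using assms by (auto intro: subspace_add tendsto_add)
  then show "x + y \<in> closure S" unfolding closure_sequential by (intro exI[of _ "\<lambda>n. f n + g n"]) blast
next
  fix c x assume "x \<in> closure S"
  then obtain f where "\<And>n. f n \<in> S" "f \<longlonglongrightarrow> x" unfolding closure_sequential by blast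
  then have "\<And>n. c *\<^sub>R f n \<in> S" "(\<lambda>n. c *\<^sub>R f n) \<longlonglongrightarrow> c *\<^sub>R x"
    using assms by (auto intro: subspace_scale tendsto_scaleR)
  then show "c *\<^sub>R x \<in> closure S" unfolding closure_sequential by (intro exI[of _ "\<lambda>n. c *\<^sub>R f n"]) blast
qed

lemma integrable_compact_support:
  fixes f :: "'a::euclidean_space \<Rightarrow> 'b::euclidean_space"
  assumes "continuous_on UNIV f" "compact K" "\<And>x. x \<notin> K \<Longrightarrow> f x = 0"
  shows "integrable lborel f"
proof -
  have "integrable lborel (\<lambda>x. indicator K x *\<^sub>R f x)"
    by (rule borel_integrable_compact[OF assms(2) continuous_on_subset[OF assms(1)]]) simp
  moreover have "(\<lambda>x. indicator K x *\<^sub>R f x) = f" using assms(3) by (auto simp: fun_eq_iff indicator_def)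
  ultimately show ?thesis by simp
qed

lemma sqi_compact_support:
  fixes f :: "'a::euclidean_space \<Rightarrow> 'b::euclidean_space"
  assumes "continuous_on UNIV f" "compact K" "\<And>x. x \<notin> K \<Longrightarrow> f x = 0"
  shows "sqi f"
  unfolding sqi_def
proof
  show "f \<in> borel_measurable borel" by (rule borel_measurable_continuous_onI[OF assms(1)])
  show "integrable lborel (\<lambda>x. (norm (f x))\<^sup>2)"
    by (rule integrable_compact_support[where K=K]) (use assms in \<open>auto intro!: continuous_intros\<close>)
qed

lemma frechet_zero_outside:
  assumes "x \<notin> tsupp f" shows "frechet_derivative f (at x) = (\<lambda>_. 0)"
proof -
  have "((\<lambda>_. 0) has_derivative (\<lambda>_. 0)) (at x)" by simp
  then have "(f has_derivative (\<lambda>_. 0)) (at x)"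
    by (rule has_derivative_transform_within_open[where s="- tsupp f"])
      (use assms supp_subset_tsupp in \<open>auto simp: tsupp_def\<close>)
  from frechet_derivative_at[OF this] show ?thesis by simp
qed

text \<open>The integral of a partial derivative vanishes since Lebesgue measure is translation invariant:
  difference quotients have integral zero.\<close>

lemma integral_partial_zero:
  fixes g :: "'a::euclidean_space \<Rightarrow> real"
  assumes D: "\<And>x. (g has_derivative D x) (at x)" and Dc: "continuous_on UNIV (\<lambda>x. D x i)"
    and K: "compact K" "\<And>x. x \<notin> K \<Longrightarrow> g x = 0" and i: "i \<in> Basis"
  shows "(LINT x|lborel. D x i) = 0"
proof -
  have gc: "continuous_on UNIV g" by (rule has_derivative_continuous_on) (use D in \<open>auto intro: has_derivative_at_withinI\<close>)
  obtain R where "R > 0" "\<forall>x\<in>K. norm x \<le> R" using compact_imp_bounded[OF K(1)] by (auto simp: bounded_pos)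
  then have R: "R > 0" "K \<subseteq> cball 0 R" by auto
  have g0: "g x = 0" if "norm x > R" for x
  proof (rule K(2))
    show "x \<notin> K" using that R(2) by auto
  qed
  have D0: "D x i = 0" if "norm x > R" for x
  proof -
    have "((\<lambda>_. 0) has_derivative (\<lambda>_. 0)) (at x)" by simp
    then have "(g has_derivative (\<lambda>_. 0)) (at x)"
      by (rule has_derivative_transform_within_open[where s="- cball 0 R"]) (use that g0 in auto)
    from has_derivative_unique[OF D this] show ?thesis by simp
  qed
  obtain C where C: "\<forall>x\<in>cball 0 R. \<bar>D x i\<bar> \<le> C"
    using compact_continuous_image[OF continuous_on_subset[OF Dc] compact_cball, of 0 R, THEN compact_imp_bounded]
    by (auto simp: bounded_iff)
  have C0: "C \<ge> 0" using C R(1) by (metis abs_ge_zero centre_in_cball less_imp_le order_trans)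
  have DC: "\<bar>D x i\<bar> \<le> C" for x using C D0[of x] C0 by (cases "norm x > R") auto
  define h where "h n = 1 / real (Suc n)" for n
  define q where "q n x = (g (h n *\<^sub>R i + x) - g x) / h n" for n x
  have h: "h n > 0" "h n \<le> 1" for n by (auto simp: h_def)
  have hl: "h \<longlonglongrightarrow> 0" using LIMSEQ_inverse_real_of_nat by (simp add: h_def[abs_def] inverse_eq_divide)
  have line: "((\<lambda>t. g (t *\<^sub>R i + x)) has_real_derivative D (t *\<^sub>R i + x) i) (at t)" for x t
  proof -
    have "((\<lambda>t. t *\<^sub>R i + x) has_derivative (\<lambda>s. s *\<^sub>R i)) (at t)" by (auto intro!: derivative_eq_intros)
    from has_derivative_compose[OF this D]
    have "((\<lambda>t. g (t *\<^sub>R i + x)) has_derivative (\<lambda>s. D (t *\<^sub>R i + x) (s *\<^sub>R i))) (at t)" .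
    moreover have "D (t *\<^sub>R i + x) (s *\<^sub>R i) = D (t *\<^sub>R i + x) i * s" for s
      using linear_scale[OF has_derivative_linear[OF D]] by simp
    ultimately show ?thesis by (simp add: has_field_derivative_def)
  qed
  have gi: "integrable lborel g" by (rule integrable_compact_support[OF gc K])
  have [measurable]: "g \<in> borel_measurable borel" using gi by auto
  have tr: "(LINT x|lborel. g (c + x)) = (LINT x|lborel. g x)" "integrable lborel (\<lambda>x. g (c + x))" for c
    using integral_distr[of "(+) c" lborel borel g] integrable_distr_eq[of "(+) c" lborel borel g] gi
    by (simp_all add: lborel_distr_plus)
  have q0: "(LINT x|lborel. q n x) = 0" for n
    using tr[of "h n *\<^sub>R i"] gi by (simp add: q_def)
  have "(\<lambda>n. LINT x|lborel. q n x) \<longlonglongrightarrow> (LINT x|lborel. D x i)"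
  \<comment> \<open>By the mean value theorem the bound C of the derivative dominates the quotients;
    the radius \<open>R + 1\<close> leaves room for shifts by \<open>h n \<le> 1\<close>.\<close>
  proof (rule integral_dominated_convergence[where w="\<lambda>x. indicator (cball 0 (R + 1)) x *\<^sub>R C"])
    show "integrable lborel (\<lambda>x. indicator (cball 0 (R + 1)) x *\<^sub>R C)"
      by (rule borel_integrable_compact) auto
    show "(\<lambda>x. D x i) \<in> borel_measurable lborel" using borel_measurable_continuous_onI[OF Dc] by simp
    show "q n \<in> borel_measurable lborel" for n unfolding q_def by measurable
    show "AE x in lborel. (\<lambda>n. q n x) \<longlonglongrightarrow> D x i"
    proof (rule AE_I2)
      fix x
      have "(\<lambda>s. (g ((0 + s) *\<^sub>R i + x) - g (0 *\<^sub>R i + x)) / s) \<midarrow>0\<rightarrow> D (0 *\<^sub>R i + x) i"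
        using line[of x 0] unfolding DERIV_def .
      moreover have "filterlim h (at 0) sequentially"
        by (rule filterlim_atI[OF hl]) (use h(1) in \<open>simp add: less_imp_neq[symmetric]\<close>)
      ultimately have "(\<lambda>n. (g ((0 + h n) *\<^sub>R i + x) - g (0 *\<^sub>R i + x)) / h n) \<longlonglongrightarrow> D (0 *\<^sub>R i + x) i"
        by (rule filterlim_compose)
      then show "(\<lambda>n. q n x) \<longlonglongrightarrow> D x i" by (simp add: q_def)
    qed
    show "AE x in lborel. norm (q n x) \<le> indicator (cball 0 (R + 1)) x *\<^sub>R C" for n
    proof (rule AE_I2)
      fix x
      show "norm (q n x) \<le> indicator (cball 0 (R + 1)) x *\<^sub>R C"
      proof (cases "x \<in> cball 0 (R + 1)")
        case True
        obtain t where "g (h n *\<^sub>R i + x) - g (0 *\<^sub>R i + x) = (h n - 0) * D (t *\<^sub>R i + x) i"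
          using MVT2[of 0 "h n" "\<lambda>t. g (t *\<^sub>R i + x)" "\<lambda>t. D (t *\<^sub>R i + x) i"] line h(1) by blast
        then have "q n x = D (t *\<^sub>R i + x) i" using h(1)[of n] by (simp add: q_def)
        then show ?thesis using True DC by simp
      next
        case False
        have "norm x \<le> norm (h n *\<^sub>R i + x) + norm (h n *\<^sub>R i)"
          using norm_triangle_ineq4[of "h n *\<^sub>R i + x" "h n *\<^sub>R i"] by simp
        then have "norm (h n *\<^sub>R i + x) > R" "norm x > R" using False h[of n] i by auto
        then show ?thesis by (simp add: q_def g0 C0)
      qed
    qed
  qed
  then show ?thesis unfolding q0 by (simp add: LIMSEQ_const_iff)
qed

lemma test_ibp:
  assumes \<phi>: "test_fun \<Omega> \<phi>" and \<psi>: "test_fun \<Omega> \<psi>" and i: "i \<in> Basis"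
  shows "(LINT x|lborel. \<phi> x * frechet_derivative \<psi> (at x) i) = - (LINT x|lborel. frechet_derivative \<phi> (at x) i * \<psi> x)"
proof -
  have s: "smooth_fun \<phi>" "smooth_fun \<psi>" and K: "compact (tsupp \<phi>)" using \<phi> \<psi> by (auto simp: test_fun_def)
  note c = smooth_funD(1)[OF s(1)] smooth_funD(1)[OF s(2)]
    smooth_funD(1)[OF smooth_funD(3)[OF s(1) i]] smooth_funD(1)[OF smooth_funD(3)[OF s(2) i]]
  have z: "\<phi> x = 0" "frechet_derivative \<phi> (at x) i = 0" if "x \<notin> tsupp \<phi>" for x
    using that supp_subset_tsupp[of \<phi> x] frechet_zero_outside[OF that] by auto
  have "(LINT x|lborel. \<phi> x * frechet_derivative \<psi> (at x) i + frechet_derivative \<phi> (at x) i * \<psi> x) = 0"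
  proof (rule integral_partial_zero[where g="\<lambda>x. \<phi> x * \<psi> x" and K="tsupp \<phi>"
      and D="\<lambda>x v. \<phi> x * frechet_derivative \<psi> (at x) v + frechet_derivative \<phi> (at x) v * \<psi> x" and i=i])
    show "((\<lambda>x. \<phi> x * \<psi> x) has_derivative (\<lambda>v. \<phi> x * frechet_derivative \<psi> (at x) v + frechet_derivative \<phi> (at x) v * \<psi> x)) (at x)" for x
      by (rule has_derivative_mult) (intro smooth_funD(4) s)+
    show "continuous_on UNIV (\<lambda>x. \<phi> x * frechet_derivative \<psi> (at x) i + frechet_derivative \<phi> (at x) i * \<psi> x)"
      by (intro continuous_intros c)
  qed (use K z i in auto)
  moreover have "integrable lborel (\<lambda>x. \<phi> x * frechet_derivative \<psi> (at x) i)"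
    by (rule integrable_compact_support[OF _ K]) (use z in \<open>auto intro!: continuous_intros c\<close>)
  moreover have "integrable lborel (\<lambda>x. frechet_derivative \<phi> (at x) i * \<psi> x)"
    by (rule integrable_compact_support[OF _ K]) (use z in \<open>auto intro!: continuous_intros c\<close>)
  ultimately show ?thesis by simp
qed

lemma inner_grad: "i \<in> Basis \<Longrightarrow> inner (grad \<phi> x) i = frechet_derivative \<phi> (at x) i"
  by (simp add: grad_def)

definition tpair :: "('a::euclidean_space \<Rightarrow> real) \<Rightarrow> 'a \<Rightarrow> real \<times> 'a" where
  "tpair \<phi> x = (\<phi> x, grad \<phi> x)"

lemma tpair_zero: "x \<notin> tsupp \<phi> \<Longrightarrow> tpair \<phi> x = 0"
  using supp_subset_tsupp[of \<phi> x] by (auto simp: tpair_def grad_def frechet_zero_outside zero_prod_def)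

lemma continuous_tpair: "smooth_fun \<phi> \<Longrightarrow> continuous_on UNIV (tpair \<phi>)"
  unfolding tpair_def[abs_def] grad_def
  by (intro continuous_intros smooth_funD(1) smooth_funD(3)) auto

lemma sqi_tpair: "test_fun \<Omega> \<phi> \<Longrightarrow> sqi (tpair \<phi>)"
  by (rule sqi_compact_support[of _ "tsupp \<phi>"]) (auto simp: test_fun_def continuous_tpair tpair_zero)

definition TF :: "'a::euclidean_space set \<Rightarrow> ('a, real \<times> 'a) l2 set" where
  "TF \<Omega> = {mk (tpair \<phi>) | \<phi>. test_fun \<Omega> \<phi>}"

text \<open>H^1_0 as the closure of the graph of the gradient on test functions; it is a closed
  subspace by construction, and each element carries its weak gradient.\<close>

definition H10s :: "'a::euclidean_space set \<Rightarrow> ('a, real \<times> 'a) l2 set" where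
  "H10s \<Omega> = closure (TF \<Omega>)"

lemma TF_subspace: "subspace (TF \<Omega>)"
proof -
  have lc: "c *\<^sub>R mk (tpair f) + d *\<^sub>R mk (tpair g) \<in> TF \<Omega>" if fg: "test_fun \<Omega> f" "test_fun \<Omega> g" for f g c d
  proof -
    have sm: "smooth_fun f" "smooth_fun g" using fg by (auto simp: test_fun_def)
    have "tpair (\<lambda>x. c * f x + d * g x) = (\<lambda>x. c *\<^sub>R tpair f x + d *\<^sub>R tpair g x)"
      by (simp add: fun_eq_iff tpair_def grad_lincomb[OF sm])
    then have "mk (tpair (\<lambda>x. c * f x + d * g x)) = c *\<^sub>R mk (tpair f) + d *\<^sub>R mk (tpair g)"
      using fg by (simp add: mk_add mk_scaleR sqi_scaleR sqi_tpair)
    then show ?thesis unfolding TF_def using test_fun_lincomb[OF fg] by (metis (mono_tags, lifting) mem_Collect_eq)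
  qed
  have t0: "test_fun \<Omega> (\<lambda>_. 0)" by (auto simp: test_fun_def tsupp_def intro: smooth_fun_sm sm.const)
  show ?thesis
    unfolding subspace_def
  proof (intro conjI allI ballI)
    show "0 \<in> TF \<Omega>" using lc[OF t0 t0, of 0 0] by simp
    show "x + y \<in> TF \<Omega>" if "x \<in> TF \<Omega>" "y \<in> TF \<Omega>" for x y
      using that lc[of _ _ 1 1] by (auto simp: TF_def)
    show "c *\<^sub>R x \<in> TF \<Omega>" if "x \<in> TF \<Omega>" for c x
      using that lc[of _ _ c 0] by (auto simp: TF_def)
  qed
qed

lemma H10s_subspace: "subspace (H10s \<Omega>)" unfolding H10s_def by (rule subspace_closure[OF TF_subspace])
lemma H10s_closed: "closed (H10s \<Omega>)" by (simp add: H10s_def)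

lemma inner_closure_eq:
  assumes "k \<in> closure S" "\<And>s. s \<in> S \<Longrightarrow> inner s a = inner s b"
  shows "inner k a = inner k b"
proof -
  have "closed {k. inner k a = inner k b}" by (intro closed_Collect_eq continuous_intros)
  moreover have "S \<subseteq> {k. inner k a = inner k b}" using assms(2) by auto
  ultimately show ?thesis using closure_minimal assms(1) by blast
qed

text \<open>Vanishing outside \<Omega> is an orthogonality relation and so passes to the closure; it
  is tested with the part of \<open>k\<close> itself outside \<Omega>.\<close>

lemma zero_outside_closure:
  fixes S :: "('a::euclidean_space, 'e::euclidean_space) l2 set"
  assumes \<Omega>: "\<Omega> \<in> sets borel" and S: "\<And>s. s \<in> S \<Longrightarrow> AE x in lborel. x \<notin> \<Omega> \<longrightarrow> rep s x = 0" and k: "k \<in> closure S"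
  shows "AE x in lborel. x \<notin> \<Omega> \<longrightarrow> rep k x = 0"
proof -
  let ?f = "\<lambda>x. indicator (- \<Omega>) x *\<^sub>R rep k x"
  have sf: "sqi ?f"
    by (rule sqi_bound[where w="\<lambda>x. (norm (rep k x))\<^sup>2"]) (use \<Omega> sqi_rep[of k] in \<open>auto simp: sqi_def indicator_def\<close>)
  have "inner k (mk ?f) = inner k 0"
  proof (rule inner_closure_eq[OF k])
    fix s assume s: "s \<in> S"
    have "AE x in lborel. inner (rep s x) (?f x) = 0" using S[OF s] by eventually_elim (auto simp: indicator_def)
    then show "inner s (mk ?f) = inner s 0" by (simp add: inner_mk_right[OF sf] integral_eq_zero_AE)
  qed
  then have "(LINT x|lborel. inner (rep k x) (?f x)) = 0" by (simp add: inner_mk_right[OF sf])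
  moreover have "integrable lborel (\<lambda>x. inner (rep k x) (?f x))" by (rule sqi_inner_integrable[OF sqi_rep sf])
  ultimately have "AE x in lborel. inner (rep k x) (?f x) = 0"
    by (subst (asm) integral_nonneg_eq_0_iff_AE) (auto simp: indicator_def)
  then show ?thesis by eventually_elim (auto simp: indicator_def)
qed

lemma H10s_zero_outside:
  assumes "\<Omega> \<in> sets borel" "k \<in> H10s \<Omega>" shows "AE x in lborel. x \<notin> \<Omega> \<longrightarrow> rep k x = 0"
proof (rule zero_outside_closure[OF assms(1) _ assms(2)[unfolded H10s_def]])
  fix s assume "s \<in> TF \<Omega>"
  then obtain \<phi> where \<phi>: "s = mk (tpair \<phi>)" "test_fun \<Omega> \<phi>" by (auto simp: TF_def)
  show "AE x in lborel. x \<notin> \<Omega> \<longrightarrow> rep s x = 0"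
    unfolding \<phi>(1) using rep_mk[OF sqi_tpair[OF \<phi>(2)]]
    by eventually_elim (use \<phi>(2) tpair_zero[of _ \<phi>] in \<open>auto simp: test_fun_def\<close>)
qed

lemma sqi_pair_partial:
  assumes \<psi>: "test_fun \<Omega> \<psi>" and i: "i \<in> Basis"
  shows "sqi (\<lambda>x. (frechet_derivative \<psi> (at x) i, 0 :: 'a::euclidean_space))" "sqi (\<lambda>x. (0 :: real, \<psi> x *\<^sub>R i))"
proof -
  have s: "smooth_fun \<psi>" "compact (tsupp \<psi>)" using \<psi> by (auto simp: test_fun_def)
  show "sqi (\<lambda>x. (frechet_derivative \<psi> (at x) i, 0 :: 'a))"
    by (rule sqi_compact_support[OF _ s(2)])
      (use s i in \<open>auto intro!: continuous_intros smooth_funD(1)[OF smooth_funD(3)] simp: frechet_zero_outside zero_prod_def\<close>)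
  show "sqi (\<lambda>x. (0 :: real, \<psi> x *\<^sub>R i))"
    by (rule sqi_compact_support[OF _ s(2)])
      (use s i supp_subset_tsupp[of \<psi>] in \<open>auto intro!: continuous_intros smooth_funD(1) simp: zero_prod_def\<close>)
qed

lemma H10s_weak_grad:
  assumes k: "k \<in> H10s \<Omega>" and \<psi>: "test_fun \<Omega> \<psi>" and i: "i \<in> Basis"
  shows "(LINT x|lborel. fst (rep k x) * frechet_derivative \<psi> (at x) i) = - (LINT x|lborel. inner (snd (rep k x)) i * \<psi> x)"
proof -
  note sq = sqi_pair_partial[OF \<psi> i]
  have "inner k (mk (\<lambda>x. (frechet_derivative \<psi> (at x) i, 0))) = inner k (- mk (\<lambda>x. (0, \<psi> x *\<^sub>R i)))"
  proof (rule inner_closure_eq[OF k[unfolded H10s_def]])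
    fix s assume "s \<in> TF \<Omega>"
    then obtain \<phi> where \<phi>: "s = mk (tpair \<phi>)" "test_fun \<Omega> \<phi>" by (auto simp: TF_def)
    show "inner s (mk (\<lambda>x. (frechet_derivative \<psi> (at x) i, 0))) = inner s (- mk (\<lambda>x. (0, \<psi> x *\<^sub>R i)))"
      unfolding \<phi>(1) inner_minus_right inner_mk[OF sqi_tpair[OF \<phi>(2)] sq(1)] inner_mk[OF sqi_tpair[OF \<phi>(2)] sq(2)]
      using test_ibp[OF \<phi>(2) \<psi> i] by (simp add: tpair_def inner_grad[OF i] mult.commute)
  qed
  then show ?thesis
    unfolding inner_minus_right inner_mk_right[OF sq(1)] inner_mk_right[OF sq(2)]
    by (simp add: inner_prod_def mult.commute)
qed

lemma integrable_indicator_part: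
  fixes k :: "('a::euclidean_space, 'e::euclidean_space) l2" and c :: 'e
  assumes "\<Omega> \<in> sets borel" "emeasure lborel \<Omega> < \<infinity>"
  shows "integrable lborel (\<lambda>x. inner (rep k x) (indicator \<Omega> x *\<^sub>R c))"
proof -
  have "sqi (\<lambda>x. indicator \<Omega> x *\<^sub>R c)"
  proof (rule sqi_bound[where w="\<lambda>x. (norm c)\<^sup>2 * indicator \<Omega> x"])
    show "integrable lborel (\<lambda>x. (norm c)\<^sup>2 * indicator \<Omega> x)"
      using assms by (intro integrable_mult_right integrable_real_indicator) auto
  qed (use assms in \<open>auto simp: indicator_def\<close>)
  then show ?thesis by (intro sqi_inner_integrable sqi_rep)
qed

lemma rep_fst_snd_meas:
  fixes k :: "('x::euclidean_space, real \<times> 'a::euclidean_space) l2"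
  shows "(\<lambda>x. fst (rep k x)) \<in> borel_measurable borel" "(\<lambda>x. snd (rep k x)) \<in> borel_measurable borel"
  by (rule measurable_compose[OF rep_meas borel_measurable_continuous_onI]; intro continuous_intros)+

text \<open>Integration by parts passes to the closure, so a zero function part makes the gradient
  orthogonal to all test functions. Finite measure of \<Omega> turns square integrable components
  into integrable ones, as \<open>fundamental_lemma\<close> requires.\<close>

lemma H10s_P0_inj:
  assumes \<Omega>: "open \<Omega>" "emeasure lborel \<Omega> < \<infinity>" and k: "k \<in> H10s \<Omega>" and z: "P0 k = 0"
  shows "k = 0"
proof -
  have \<Omega>b: "\<Omega> \<in> sets borel" using \<Omega>(1) by simp
  have out: "AE x in lborel. x \<notin> \<Omega> \<longrightarrow> rep k x = 0" by (rule H10s_zero_outside[OF \<Omega>b k])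
  have f0: "AE x in lborel. fst (rep k x) = 0"
    using rep_P0[of k] rep_zero[where 'a='a and 'b="real \<times> 'a"] unfolding z by eventually_elim (simp add: zero_prod_def)
  have "AE x in lborel. inner (snd (rep k x)) i = 0" if i: "i \<in> Basis" for i
  proof -
    have e: "AE x in lborel. inner (rep k x) (indicator \<Omega> x *\<^sub>R (0, i)) = inner (snd (rep k x)) i"
      using out by eventually_elim (auto simp: indicator_def inner_prod_def)
    have "integrable lborel (\<lambda>x. inner (snd (rep k x)) i)"
      by (rule integrable_cong_AE_imp[OF integrable_indicator_part[OF \<Omega>b \<Omega>(2)] _ e])
        (simp add: borel_measurable_inner rep_fst_snd_meas)
    then have "AE x in lborel. x \<in> \<Omega> \<longrightarrow> inner (snd (rep k x)) i = 0"
    proof (rule fundamental_lemma[OF \<Omega>(1)])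
      fix \<psi> assume \<psi>: "test_fun \<Omega> \<psi>"
      have "(LINT x|lborel. fst (rep k x) * frechet_derivative \<psi> (at x) i) = 0"
        by (rule integral_eq_zero_AE) (use f0 in eventually_elim, simp)
      then show "(LINT x|lborel. inner (snd (rep k x)) i * \<psi> x) = 0"
        using H10s_weak_grad[OF k \<psi> i] by simp
    qed
    with out show ?thesis by eventually_elim auto
  qed
  then have s0: "AE x in lborel. \<forall>i\<in>Basis. inner (snd (rep k x)) i = 0" by (subst AE_finite_all) auto
  show ?thesis
    by (rule l2_eqI) (use s0 f0 rep_zero[where 'a='a and 'b="real \<times> 'a"] in \<open>eventually_elim, simp add: prod_eq_iff euclidean_all_zero_iff\<close>)
qed

definition e1 :: "'a::euclidean_space set \<Rightarrow> ('a, real \<times> 'a) l2" where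
  "e1 \<Omega> = mk (\<lambda>x. (indicator \<Omega> x, 0))"

lemma sqi_e1:
  fixes \<Omega> :: "'a::euclidean_space set"
  assumes "\<Omega> \<in> sets borel" "emeasure lborel \<Omega> < \<infinity>"
  shows "sqi (\<lambda>x. (indicator \<Omega> x :: real, 0 :: 'a))"
proof (rule sqi_bound[where w="\<lambda>x. indicator \<Omega> x"])
  have [measurable]: "\<Omega> \<in> sets borel" by (rule assms(1))
  show "(\<lambda>x. (indicator \<Omega> x :: real, 0 :: 'a)) \<in> borel_measurable borel" by measurable
  show "integrable lborel (indicator \<Omega> :: 'a \<Rightarrow> real)"
    using assms by (intro integrable_real_indicator) auto
qed (auto simp: indicator_def norm_Pair)

lemma rep_e1:
  assumes "\<Omega> \<in> sets borel" "emeasure lborel \<Omega> < \<infinity>"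
  shows "AE x in lborel. rep (e1 \<Omega>) x = (indicator \<Omega> x, 0)"
  unfolding e1_def by (rule rep_mk[OF sqi_e1[OF assms]])

lemma P0_e1: assumes "\<Omega> \<in> sets borel" "emeasure lborel \<Omega> < \<infinity>" shows "P0 (e1 \<Omega>) = e1 \<Omega>"
  by (rule l2_eqI) (use rep_P0[of "e1 \<Omega>"] rep_e1[OF assms] in \<open>eventually_elim, simp\<close>)

text \<open>By duality instead of cut-off functions near the boundary: what remains of
  \<open>e1 \<Omega>\<close> after projection onto the closure of the function parts is orthogonal
  to every test function, hence zero.\<close>

lemma e1_dense:
  assumes \<Omega>: "open \<Omega>" "emeasure lborel \<Omega> < \<infinity>" and \<epsilon>: "\<epsilon> > 0"
  shows "\<exists>\<phi>\<in>H10s \<Omega>. norm (P0 \<phi> - e1 \<Omega>) < \<epsilon>"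
proof -
  have \<Omega>b: "\<Omega> \<in> sets borel" using \<Omega>(1) by simp
  define S where "S = P0 ` TF \<Omega>"
  have S: "subspace S" unfolding S_def
    by (rule linear_subspace_image[OF bounded_linear.linear[OF bounded_linear_P0] TF_subspace])
  obtain p where p: "p \<in> closure S" "\<And>s. s \<in> S \<Longrightarrow> inner (e1 \<Omega> - p) s = 0" using orth_proj[OF S] by blast
  define r where "r = e1 \<Omega> - p"
  have "closed {k :: ('a, real \<times> 'a) l2. P0 k = k}"
    by (intro closed_Collect_eq bounded_linear.continuous_on[OF bounded_linear_P0] continuous_intros)
  moreover have "S \<subseteq> {k. P0 k = k}" by (auto simp: S_def)
  ultimately have "closure S \<subseteq> {k. P0 k = k}" by (intro closure_minimal)
  then have "P0 p = p" using p(1) by auto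
  then have Pr: "P0 r = r" by (simp add: r_def P0_diff P0_e1[OF \<Omega>b \<Omega>(2)])
  have "AE x in lborel. x \<notin> \<Omega> \<longrightarrow> rep p x = 0"
  proof (rule zero_outside_closure[OF \<Omega>b _ p(1)])
    fix s assume "s \<in> S"
    then obtain k where k: "k \<in> TF \<Omega>" "s = P0 k" by (auto simp: S_def)
    have "k \<in> H10s \<Omega>" unfolding H10s_def using k(1) closure_subset by blast
    from H10s_zero_outside[OF \<Omega>b this] show "AE x in lborel. x \<notin> \<Omega> \<longrightarrow> rep s x = 0"
      unfolding k(2) using rep_P0[of k] by eventually_elim (auto simp: zero_prod_def)
  qed
  then have out: "AE x in lborel. x \<notin> \<Omega> \<longrightarrow> rep r x = 0"
    using rep_diff[of "e1 \<Omega>" p] rep_e1[OF \<Omega>b \<Omega>(2)] unfolding r_def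
    by eventually_elim (auto simp: zero_prod_def)
  have e: "AE x in lborel. inner (rep r x) (indicator \<Omega> x *\<^sub>R (1, 0)) = fst (rep r x)"
    using out by eventually_elim (auto simp: indicator_def inner_prod_def)
  have "integrable lborel (\<lambda>x. fst (rep r x))"
    by (rule integrable_cong_AE_imp[OF integrable_indicator_part[OF \<Omega>b \<Omega>(2)] _ e]) (simp add: rep_fst_snd_meas)
  then have inn: "AE x in lborel. x \<in> \<Omega> \<longrightarrow> fst (rep r x) = 0"
  proof (rule fundamental_lemma[OF \<Omega>(1)])
    fix \<psi> assume \<psi>: "test_fun \<Omega> \<psi>"
    have "inner r (P0 (mk (tpair \<psi>))) = 0" unfolding r_def
      by (rule p(2)) (use \<psi> in \<open>auto simp: S_def TF_def\<close>)
    moreover have "P0 (mk (tpair \<psi>)) = mk (\<lambda>x. (\<psi> x, 0))"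
      by (rule mk_eqI[symmetric], use sqi_P0[OF sqi_tpair[OF \<psi>]] in \<open>simp add: tpair_def\<close>,
        use rep_P0[of "mk (tpair \<psi>)"] rep_mk[OF sqi_tpair[OF \<psi>]] in \<open>eventually_elim, simp add: tpair_def\<close>)
    moreover have "sqi (\<lambda>x. (\<psi> x, 0 :: 'a))" using sqi_P0[OF sqi_tpair[OF \<psi>]] by (simp add: tpair_def)
    ultimately show "(LINT x|lborel. fst (rep r x) * \<psi> x) = 0"
      by (simp add: inner_mk_right inner_prod_def)
  qed
  have sn: "AE x in lborel. snd (rep r x) = 0" using rep_P0[of r] unfolding Pr by eventually_elim (simp add: prod_eq_iff)
  have "r = 0"
    by (rule l2_eqI) (use out inn sn rep_zero[where 'a='a and 'b="real \<times> 'a"] in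
      \<open>eventually_elim, auto simp: prod_eq_iff\<close>)
  then have "e1 \<Omega> \<in> closure S" using p(1) by (simp add: r_def)
  then obtain s where "s \<in> S" "dist s (e1 \<Omega>) < \<epsilon>" using \<epsilon> by (auto simp: closure_approachable)
  then show ?thesis unfolding S_def H10s_def dist_norm using closure_subset by blast
qed

section \<open>Lebesgue measurable functions and their Borel representatives\<close>

lemma borel_rep:
  fixes f :: "'x::euclidean_space \<Rightarrow> 'e::euclidean_space"
  assumes "f \<in> borel_measurable lebesgue"
  obtains g where "g \<in> borel_measurable borel" "AE x in lborel. f x = g x"
proof -
  have "\<exists>g. g \<in> borel_measurable lborel \<and> (AE x in lborel. inner (f x) i = g x)" for i
  proof -
    have "(\<lambda>x. inner (f x) i) \<in> borel_measurable lebesgue" using assms by measurable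
    from completion_ex_borel_measurable_real[OF this] show ?thesis by blast
  qed
  then obtain g where g: "\<And>i. g i \<in> borel_measurable lborel" "\<And>i. AE x in lborel. inner (f x) i = g i x" by metis
  show ?thesis
  proof (rule that[of "\<lambda>x. \<Sum>i\<in>Basis. g i x *\<^sub>R i"])
    show "(\<lambda>x. \<Sum>i\<in>Basis. g i x *\<^sub>R i) \<in> borel_measurable borel"
      using g(1) by (intro borel_measurable_sum borel_measurable_scaleR) auto
    have "AE x in lborel. \<forall>i\<in>Basis. inner (f x) i = g i x" by (subst AE_finite_all) (use g(2) in auto)
    then show "AE x in lborel. f x = (\<Sum>i\<in>Basis. g i x *\<^sub>R i)"
    proof eventually_elim
      case (elim x)
      have "f x = (\<Sum>i\<in>Basis. inner (f x) i *\<^sub>R i)" by (simp add: euclidean_representation)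
      then show ?case using elim by simp
    qed
  qed
qed

text \<open>Translates between Lebesgue measure restricted to \<open>A\<close> and
  \<open>lborel\<close> with an indicator, for an \<open>f\<close> that is merely almost everywhere
  equal on \<open>A\<close> to a Borel function.\<close>

lemma
  fixes f g :: "'x::euclidean_space \<Rightarrow> 'e::euclidean_space"
  assumes A: "A \<in> sets borel" and g: "g \<in> borel_measurable borel" and ae: "AE x in lborel. x \<in> A \<longrightarrow> f x = g x"
  shows leb_on_meas: "f \<in> borel_measurable (lebesgue_on A)"
    and leb_on_integral: "integral\<^sup>L (lebesgue_on A) f = (LINT x|lborel. indicator A x *\<^sub>R g x)"
    and leb_on_integrable: "integrable (lebesgue_on A) f \<longleftrightarrow> integrable lborel (\<lambda>x. indicator A x *\<^sub>R g x)"
proof -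
  have [measurable]: "A \<in> sets borel" "g \<in> borel_measurable borel" by fact+
  have Al: "A \<inter> space lebesgue \<in> sets lebesgue" using A by simp
  have Gb: "(\<lambda>x. indicator A x *\<^sub>R g x) \<in> borel_measurable borel" by measurable
  then have G: "(\<lambda>x. indicator A x *\<^sub>R g x) \<in> borel_measurable lebesgue"
    by (intro measurable_completion) simp
  have "AE x in lborel. indicator A x *\<^sub>R g x = indicator A x *\<^sub>R f x"
    using ae by eventually_elim (auto simp: indicator_def)
  then have e: "AE x in lebesgue. indicator A x *\<^sub>R g x = indicator A x *\<^sub>R f x" by (simp add: AE_completion_iff)
  have F: "(\<lambda>x. indicator A x *\<^sub>R f x) \<in> borel_measurable lebesgue"
    by (rule borel_measurable_AE[OF G e])
  show "f \<in> borel_measurable (lebesgue_on A)"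
    using F borel_measurable_restrict_space_iff[OF Al, of f] by simp
  have "integral\<^sup>L (lebesgue_on A) f = integral\<^sup>L lebesgue (\<lambda>x. indicator A x *\<^sub>R f x)"
    by (rule integral_restrict_space[OF Al])
  also have "\<dots> = integral\<^sup>L lebesgue (\<lambda>x. indicator A x *\<^sub>R g x)"
    by (rule integral_cong_AE[OF F G]) (use e in \<open>eventually_elim, metis\<close>)
  also have "\<dots> = (LINT x|lborel. indicator A x *\<^sub>R g x)" by (rule integral_completion) (use Gb in simp)
  finally show "integral\<^sup>L (lebesgue_on A) f = (LINT x|lborel. indicator A x *\<^sub>R g x)" .
  have "integrable (lebesgue_on A) f \<longleftrightarrow> integrable lebesgue (\<lambda>x. indicator A x *\<^sub>R f x)"
    by (rule integrable_restrict_space[OF Al])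
  also have "\<dots> \<longleftrightarrow> integrable lebesgue (\<lambda>x. indicator A x *\<^sub>R g x)"
    by (rule integrable_cong_AE[OF F G]) (use e in \<open>eventually_elim, metis\<close>)
  also have "\<dots> \<longleftrightarrow> integrable lborel (\<lambda>x. indicator A x *\<^sub>R g x)" by (rule integrable_completion) (use Gb in simp)
  finally show "integrable (lebesgue_on A) f \<longleftrightarrow> integrable lborel (\<lambda>x. indicator A x *\<^sub>R g x)" .
qed

lemma L2_rep:
  fixes f :: "'x::euclidean_space \<Rightarrow> 'e::euclidean_space"
  assumes A: "A \<in> sets borel" and f: "f \<in> borel_measurable (lebesgue_on A)" "integrable (lebesgue_on A) (\<lambda>x. (norm (f x))\<^sup>2)"
  obtains k where "AE x in lborel. rep k x = (if x \<in> A then f x else 0)"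
proof -
  have Al: "A \<inter> space lebesgue \<in> sets lebesgue" using A by simp
  have "(\<lambda>x. indicator A x *\<^sub>R f x) \<in> borel_measurable lebesgue"
    using f(1) borel_measurable_restrict_space_iff[OF Al, of f] by simp
  then obtain g where g: "g \<in> borel_measurable borel" "AE x in lborel. indicator A x *\<^sub>R f x = g x"
    by (rule borel_rep)
  have g': "AE x in lborel. g x = (if x \<in> A then f x else 0)" using g(2) by eventually_elim auto
  have e: "AE x in lborel. x \<in> A \<longrightarrow> (norm (f x))\<^sup>2 = (norm (g x))\<^sup>2" using g' by eventually_elim auto
  have gm: "(\<lambda>x. (norm (g x))\<^sup>2) \<in> borel_measurable borel" using g(1) by measurable
  have i: "integrable lborel (\<lambda>x. indicator A x *\<^sub>R (norm (g x))\<^sup>2)"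
    using leb_on_integrable[OF A gm e] f(2) by blast
  have ae: "AE x in lborel. indicator A x *\<^sub>R (norm (g x))\<^sup>2 = (norm (g x))\<^sup>2"
    using g' by eventually_elim (auto simp: indicator_def)
  have "integrable lborel (\<lambda>x. (norm (g x))\<^sup>2)"
    by (rule integrable_cong_AE_imp[OF i _ ae]) (use gm in simp)
  then have "sqi g" using g(1) by (simp add: sqi_def)
  show ?thesis
    by (rule that[of "mk g"]) (use rep_mk[OF \<open>sqi g\<close>] g' in eventually_elim, simp)
qed

lemma norm_Pair_sq: "(norm (a, b))\<^sup>2 = (norm a)\<^sup>2 + (norm b)\<^sup>2"
  by (simp add: norm_Pair)

lemma integrable_le_norm_rep:
  fixes k :: "('x::euclidean_space, 'e::euclidean_space) l2" and q :: "'x \<Rightarrow> real"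
  assumes "q \<in> borel_measurable borel" "AE x in lborel. \<bar>q x\<bar> \<le> (norm (rep k x))\<^sup>2"
  shows "integrable lborel q"
  by (rule Bochner_Integration.integrable_bound[where f="\<lambda>x. (norm (rep k x))\<^sup>2"])
    (use assms sqi_rep[of k] in \<open>auto simp: sqi_def\<close>)

lemma H10_approx_norm:
  assumes \<Omega>: "\<Omega> \<in> sets borel" and k: "AE x in lborel. rep k x = (if x \<in> \<Omega> then (u x, g x) else 0)"
    and \<phi>: "test_fun \<Omega> \<phi>"
  shows "integral\<^sup>L (lebesgue_on \<Omega>) (\<lambda>x. (u x - \<phi> x)\<^sup>2) + integral\<^sup>L (lebesgue_on \<Omega>) (\<lambda>x. (norm (g x - grad \<phi> x))\<^sup>2)
     = (norm (k - mk (tpair \<phi>)))\<^sup>2"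
proof -
  let ?d = "k - mk (tpair \<phi>)"
  have d: "AE x in lborel. rep ?d x = (if x \<in> \<Omega> then (u x - \<phi> x, g x - grad \<phi> x) else 0)"
    using k rep_diff[of k "mk (tpair \<phi>)"] rep_mk[OF sqi_tpair[OF \<phi>]]
  proof eventually_elim
    case (elim x)
    show ?case
    proof (cases "x \<in> \<Omega>")
      case False
      then have "tpair \<phi> x = 0" using \<phi> by (intro tpair_zero) (auto simp: test_fun_def)
      then show ?thesis using elim False by simp
    qed (use elim in \<open>simp add: tpair_def\<close>)
  qed
  note m = rep_fst_snd_meas[of ?d]
  have 1: "integral\<^sup>L (lebesgue_on \<Omega>) (\<lambda>x. (u x - \<phi> x)\<^sup>2) = (LINT x|lborel. indicator \<Omega> x *\<^sub>R (fst (rep ?d x))\<^sup>2)"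
    by (rule leb_on_integral[OF \<Omega>]) (use m in simp, use d in eventually_elim, simp)
  have 2: "integral\<^sup>L (lebesgue_on \<Omega>) (\<lambda>x. (norm (g x - grad \<phi> x))\<^sup>2) = (LINT x|lborel. indicator \<Omega> x *\<^sub>R (norm (snd (rep ?d x)))\<^sup>2)"
    by (rule leb_on_integral[OF \<Omega>]) (use m in simp, use d in eventually_elim, simp)
  have n: "(norm p)\<^sup>2 = (fst p)\<^sup>2 + (norm (snd p))\<^sup>2" for p :: "real \<times> 'a"
    using norm_Pair_sq[of "fst p" "snd p"] by simp
  have i1: "integrable lborel (\<lambda>x. indicator \<Omega> x *\<^sub>R (fst (rep ?d x))\<^sup>2)"
    by (rule integrable_le_norm_rep[where k="?d"]) (use \<Omega> m n in \<open>auto simp: indicator_def\<close>)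
  have i2: "integrable lborel (\<lambda>x. indicator \<Omega> x *\<^sub>R (norm (snd (rep ?d x)))\<^sup>2)"
    by (rule integrable_le_norm_rep[where k="?d"]) (use \<Omega> m n in \<open>auto simp: indicator_def\<close>)
  have "(norm ?d)\<^sup>2 = (LINT x|lborel. indicator \<Omega> x *\<^sub>R (fst (rep ?d x))\<^sup>2 + indicator \<Omega> x *\<^sub>R (norm (snd (rep ?d x)))\<^sup>2)"
    unfolding norm_l2_sq
  proof (rule integral_cong_AE)
    show "AE x in lborel. (norm (rep ?d x))\<^sup>2 = indicator \<Omega> x *\<^sub>R (fst (rep ?d x))\<^sup>2 + indicator \<Omega> x *\<^sub>R (norm (snd (rep ?d x)))\<^sup>2"
      using d by eventually_elim (auto simp: n indicator_def)
  qed (use i1 i2 in auto)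
  then show ?thesis using 1 2 i1 i2 by simp
qed

lemma H10_imp_H10s:
  assumes \<Omega>: "\<Omega> \<in> sets borel" and H: "H10 \<Omega> u g"
  obtains k where "k \<in> H10s \<Omega>" "AE x in lborel. rep k x = (if x \<in> \<Omega> then (u x, g x) else 0)"
proof -
  have L: "u \<in> borel_measurable (lebesgue_on \<Omega>)" "integrable (lebesgue_on \<Omega>) (\<lambda>x. (norm (u x))\<^sup>2)"
    "g \<in> borel_measurable (lebesgue_on \<Omega>)" "integrable (lebesgue_on \<Omega>) (\<lambda>x. (norm (g x))\<^sup>2)"
    using H by (auto simp: H10_def L2_def)
  obtain k where k: "AE x in lborel. rep k x = (if x \<in> \<Omega> then (u x, g x) else 0)"
    by (rule L2_rep[OF \<Omega>, of "\<lambda>x. (u x, g x)"]) (use L in \<open>auto simp: norm_Pair\<close>)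
  obtain \<phi> where \<phi>: "\<And>n::nat. test_fun \<Omega> (\<phi> n)" "(\<lambda>n. integral\<^sup>L (lebesgue_on \<Omega>) (\<lambda>x. (u x - \<phi> n x)\<^sup>2)
            + integral\<^sup>L (lebesgue_on \<Omega>) (\<lambda>x. (norm (g x - grad (\<phi> n) x))\<^sup>2)) \<longlonglongrightarrow> 0"
    using H by (auto simp: H10_def)
  have "(\<lambda>n. (norm (k - mk (tpair (\<phi> n))))\<^sup>2) \<longlonglongrightarrow> 0"
    using \<phi>(2) unfolding H10_approx_norm[OF \<Omega> k \<phi>(1)] .
  then have "(\<lambda>n. sqrt ((norm (k - mk (tpair (\<phi> n))))\<^sup>2)) \<longlonglongrightarrow> sqrt 0" by (rule tendsto_real_sqrt)
  then have "(\<lambda>n. k - mk (tpair (\<phi> n))) \<longlonglongrightarrow> 0" by (simp add: tendsto_norm_zero_iff)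
  then have "(\<lambda>n. k - (k - mk (tpair (\<phi> n)))) \<longlonglongrightarrow> k - 0" by (intro tendsto_diff tendsto_const)
  then have "(\<lambda>n. mk (tpair (\<phi> n))) \<longlonglongrightarrow> k" by simp
  moreover have "mk (tpair (\<phi> n)) \<in> TF \<Omega>" for n using \<phi>(1) by (auto simp: TF_def)
  ultimately have "k \<in> H10s \<Omega>" unfolding H10s_def closure_sequential
    by (intro exI[of _ "\<lambda>n. mk (tpair (\<phi> n))"]) simp
  then show ?thesis using that k by blast
qed

lemma H10s_imp_H10:
  assumes \<Omega>: "\<Omega> \<in> sets borel" and k: "k \<in> H10s \<Omega>" and ae: "AE x in lborel. x \<in> \<Omega> \<longrightarrow> rep k x = (u x, g x)"
  shows "H10 \<Omega> u g"
proof -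
  have out: "AE x in lborel. x \<notin> \<Omega> \<longrightarrow> rep k x = 0" by (rule H10s_zero_outside[OF \<Omega> k])
  have full: "AE x in lborel. rep k x = (if x \<in> \<Omega> then (u x, g x) else 0)"
    using ae out by eventually_elim auto
  note m = rep_fst_snd_meas[of k]
  have au: "AE x in lborel. x \<in> \<Omega> \<longrightarrow> u x = fst (rep k x)" using ae by eventually_elim auto
  have ag: "AE x in lborel. x \<in> \<Omega> \<longrightarrow> g x = snd (rep k x)" using ae by eventually_elim auto
  have n: "(norm p)\<^sup>2 = (fst p)\<^sup>2 + (norm (snd p))\<^sup>2" for p :: "real \<times> 'a"
    using norm_Pair_sq[of "fst p" "snd p"] by simp
  have "integrable lborel (\<lambda>x. indicator \<Omega> x *\<^sub>R (norm (fst (rep k x)))\<^sup>2)"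
    by (rule integrable_le_norm_rep[where k=k]) (use \<Omega> m n in \<open>auto simp: indicator_def\<close>)
  then have "integrable (lebesgue_on \<Omega>) (\<lambda>x. (norm (u x))\<^sup>2)"
    by (subst leb_on_integrable[OF \<Omega>, where g="\<lambda>x. (norm (fst (rep k x)))\<^sup>2"])
      (use m in simp, use au in \<open>eventually_elim, simp\<close>, simp)
  then have Lu: "L2 \<Omega> u" using leb_on_meas[OF \<Omega> m(1) au] by (simp add: L2_def)
  have "integrable lborel (\<lambda>x. indicator \<Omega> x *\<^sub>R (norm (snd (rep k x)))\<^sup>2)"
    by (rule integrable_le_norm_rep[where k=k]) (use \<Omega> m n in \<open>auto simp: indicator_def\<close>)
  then have "integrable (lebesgue_on \<Omega>) (\<lambda>x. (norm (g x))\<^sup>2)"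
    by (subst leb_on_integrable[OF \<Omega>, where g="\<lambda>x. (norm (snd (rep k x)))\<^sup>2"])
      (use m in simp, use ag in \<open>eventually_elim, simp\<close>, simp)
  then have Lg: "L2 \<Omega> g" using leb_on_meas[OF \<Omega> m(2) ag] by (simp add: L2_def)
  have "weak_grad \<Omega> u g"
    unfolding weak_grad_def
  proof (intro allI impI ballI)
    fix \<psi> :: "'a \<Rightarrow> real" and i :: 'a assume \<psi>: "test_fun \<Omega> \<psi>" and i: "i \<in> Basis"
    have mp: "(\<lambda>x. frechet_derivative \<psi> (at x) i) \<in> borel_measurable borel" "\<psi> \<in> borel_measurable borel"
      using smooth_funD(1)[OF smooth_funD(3)[OF _ i, of \<psi>]] test_fun_meas[OF \<psi>] \<psi> borel_measurable_continuous_onI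
      by (auto simp: test_fun_def)
    have "integral\<^sup>L (lebesgue_on \<Omega>) (\<lambda>x. u x * frechet_derivative \<psi> (at x) i)
        = (LINT x|lborel. indicator \<Omega> x *\<^sub>R (fst (rep k x) * frechet_derivative \<psi> (at x) i))"
      by (rule leb_on_integral[OF \<Omega>]) (use m mp in simp, use au in \<open>eventually_elim, simp\<close>)
    also have "\<dots> = (LINT x|lborel. fst (rep k x) * frechet_derivative \<psi> (at x) i)"
      by (rule integral_cong_AE) (use \<Omega> m mp in simp, use m mp in simp, use out in \<open>eventually_elim, auto simp: indicator_def\<close>)
    also have "\<dots> = - (LINT x|lborel. inner (snd (rep k x)) i * \<psi> x)" by (rule H10s_weak_grad[OF k \<psi> i])
    also have "(LINT x|lborel. inner (snd (rep k x)) i * \<psi> x) = (LINT x|lborel. indicator \<Omega> x *\<^sub>R (inner (snd (rep k x)) i * \<psi> x))"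
      by (rule integral_cong_AE) (use m mp in simp, use \<Omega> m mp in simp, use out in \<open>eventually_elim, auto simp: indicator_def\<close>)
    also have "\<dots> = integral\<^sup>L (lebesgue_on \<Omega>) (\<lambda>x. inner (g x) i * \<psi> x)"
      by (rule leb_on_integral[OF \<Omega>, symmetric]) (use m mp in simp, use ag in \<open>eventually_elim, simp\<close>)
    finally show "integral\<^sup>L (lebesgue_on \<Omega>) (\<lambda>x. u x * frechet_derivative \<psi> (at x) i)
        = - integral\<^sup>L (lebesgue_on \<Omega>) (\<lambda>x. inner (g x) i * \<psi> x)" .
  qed
  moreover obtain s where s: "\<And>n. s n \<in> TF \<Omega>" "s \<longlonglongrightarrow> k"
    using k unfolding H10s_def closure_sequential by blast
  then have "\<forall>n. \<exists>\<phi>. test_fun \<Omega> \<phi> \<and> s n = mk (tpair \<phi>)" by (auto simp: TF_def)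
  then obtain \<phi> where \<phi>: "\<And>n. test_fun \<Omega> (\<phi> n)" "\<And>n. s n = mk (tpair (\<phi> n))" by metis
  have "(\<lambda>n. (norm (k - s n))\<^sup>2) \<longlonglongrightarrow> (norm (k - k))\<^sup>2" by (intro tendsto_intros s)
  then have "(\<lambda>n. integral\<^sup>L (lebesgue_on \<Omega>) (\<lambda>x. (u x - \<phi> n x)\<^sup>2)
            + integral\<^sup>L (lebesgue_on \<Omega>) (\<lambda>x. (norm (g x - grad (\<phi> n) x))\<^sup>2)) \<longlonglongrightarrow> 0"
    unfolding H10_approx_norm[OF \<Omega> full \<phi>(1)] by (simp add: \<phi>(2))
  ultimately show ?thesis using Lu Lg \<phi>(1) unfolding H10_def by blast
qed

section \<open>Scalar test functions in time\<close>

lemma AE_interval_witness: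
  fixes a b :: real
  assumes "a < b" "AE x in lborel. P x" shows "\<exists>x. a < x \<and> x < b \<and> P x"
proof (rule ccontr)
  assume n: "\<not> ?thesis"
  have "AE x in lborel. x \<notin> {a<..<b}" using assms(2) by eventually_elim (use n in auto)
  then have "{a<..<b} \<in> null_sets lborel" by (subst AE_iff_null_sets) auto
  then have "emeasure lborel {a<..<b} = 0" by (simp add: null_sets_def)
  then show False using assms(1) by simp
qed

text \<open>A set of full measure meets every interval; the intervals around \<open>t\<close> are
  clipped to (0,T), so that the endpoints are approached too.\<close>

lemma continuous_AE_eq:
  fixes f g :: "real \<Rightarrow> 'h::metric_space"
  assumes T: "0 < T" and f: "continuous_on {0..T} f" and g: "continuous_on {0..T} g"
    and ae: "AE t in lborel. 0 < t \<and> t < T \<longrightarrow> f t = g t" and t: "t \<in> {0..T}"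
  shows "f t = g t"
proof -
  have "\<exists>s. max 0 (t - 1 / real (Suc n)) < s \<and> s < min T (t + 1 / real (Suc n)) \<and> (0 < s \<and> s < T \<longrightarrow> f s = g s)" for n
  proof (rule AE_interval_witness[OF _ ae])
    have "1 / real (Suc n) > 0" by simp
    moreover have "0 \<le> t" "t \<le> T" using t by auto
    ultimately show "max 0 (t - 1 / real (Suc n)) < min T (t + 1 / real (Suc n))" using T
      unfolding max_less_iff_conj min_less_iff_conj by linarith
  qed
  then obtain s where s: "\<And>n. max 0 (t - 1 / real (Suc n)) < s n" "\<And>n. s n < min T (t + 1 / real (Suc n))"
    "\<And>n. 0 < s n \<and> s n < T \<longrightarrow> f (s n) = g (s n)" by metis
  have sT: "s n \<in> {0..T}" "f (s n) = g (s n)" for n using s(1)[of n] s(2)[of n] s(3)[of n] by auto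
  have "s \<longlonglongrightarrow> t"
  proof (rule LIM_zero_cancel, rule Lim_null_comparison)
    have "norm (s n - t) \<le> 1 / real (Suc n)" for n
      using s(1)[of n] s(2)[of n] unfolding real_norm_def by linarith
    then show "\<forall>\<^sub>F n in sequentially. norm (s n - t) \<le> 1 / real (Suc n)" by simp
    show "(\<lambda>n. 1 / real (Suc n)) \<longlonglongrightarrow> 0" using LIMSEQ_inverse_real_of_nat by (simp add: inverse_eq_divide)
  qed
  then have "(\<lambda>n. f (s n)) \<longlonglongrightarrow> f t" "(\<lambda>n. g (s n)) \<longlonglongrightarrow> g t"
    using f g t sT(1) unfolding continuous_on_sequentially by (auto simp: o_def)
  then show ?thesis using sT(2) LIMSEQ_unique by simp
qed

lemma real_test_fun:
  assumes "smooth_fun (\<eta> :: real \<Rightarrow> real)"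
  shows "(\<eta> has_real_derivative deriv \<eta> t) (at t)" "deriv \<eta> = (\<lambda>t. frechet_derivative \<eta> (at t) 1)"
    "continuous_on UNIV (deriv \<eta>)"
proof -
  have d: "(\<eta> has_real_derivative frechet_derivative \<eta> (at t) 1) (at t)" for t
  proof -
    note D = smooth_funD(4)[OF assms, of t]
    have "frechet_derivative \<eta> (at t) h = frechet_derivative \<eta> (at t) 1 * h" for h
      using linear_scale[OF has_derivative_linear[OF D], of h 1] by simp
    then have "frechet_derivative \<eta> (at t) = (*) (frechet_derivative \<eta> (at t) 1)" by (rule ext)
    then show ?thesis using D unfolding has_field_derivative_def by metis
  qed
  show e: "deriv \<eta> = (\<lambda>t. frechet_derivative \<eta> (at t) 1)" using DERIV_imp_deriv[OF d] by (rule ext)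
  show "(\<eta> has_real_derivative deriv \<eta> t) (at t)" unfolding e by (rule d)
  show "continuous_on UNIV (deriv \<eta>)" unfolding e by (rule smooth_funD(1)[OF smooth_funD(3)[OF assms]]) simp
qed

lemma deriv_zero_outside: "smooth_fun \<eta> \<Longrightarrow> t \<notin> tsupp \<eta> \<Longrightarrow> deriv \<eta> t = (0 :: real)"
  by (simp add: real_test_fun(2) frechet_zero_outside)

lemma sqi_test:
  assumes "test_fun S (\<eta> :: real \<Rightarrow> real)"
  shows "sqi \<eta>" "sqi (deriv \<eta>)" "integrable lborel (deriv \<eta>)" "integrable lborel \<eta>"
proof -
  have s: "smooth_fun \<eta>" "compact (tsupp \<eta>)" using assms by (auto simp: test_fun_def)
  note z = supp_subset_tsupp[of \<eta>] deriv_zero_outside[OF s(1)]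
  show "sqi \<eta>" by (rule sqi_compact_support[OF smooth_funD(1)[OF s(1)] s(2)]) (use z in blast)
  show "sqi (deriv \<eta>)" by (rule sqi_compact_support[OF real_test_fun(3)[OF s(1)] s(2)]) (use z in blast)
  show "integrable lborel (deriv \<eta>)" by (rule integrable_compact_support[OF real_test_fun(3)[OF s(1)] s(2)]) (use z in blast)
  show "integrable lborel \<eta>" by (rule integrable_compact_support[OF smooth_funD(1)[OF s(1)] s(2)]) (use z in blast)
qed

text \<open>Fubini on the triangle \<open>0 < s < t\<close>: the integral of the derivative from
  \<open>s\<close> to \<open>T\<close> is \<open>- \<eta> s\<close>, since \<eta> vanishes at
  \<open>T\<close>.\<close>

lemma ibp_primitive:
  assumes \<eta>: "test_fun {0<..<T} \<eta>" and c: "integrable lborel c"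
  shows "(LINT t|lborel. deriv \<eta> t * (LINT s|lborel. ind t s * c s)) = - (LINT s|lborel. \<eta> s * c s)"
proof -
  have s: "smooth_fun \<eta>" "tsupp \<eta> \<subseteq> {0<..<T}" using \<eta> by (auto simp: test_fun_def)
  have [measurable]: "c \<in> borel_measurable borel" "deriv \<eta> \<in> borel_measurable borel"
    using c sqi_test(3)[OF \<eta>] by auto
  have z: "\<eta> t = 0" "deriv \<eta> t = 0" if "\<not> (0 < t \<and> t < T)" for t
  proof -
    have n: "t \<notin> tsupp \<eta>" using s(2) that by auto
    then show "\<eta> t = 0" using supp_subset_tsupp[of \<eta> t] by blast
    show "deriv \<eta> t = 0" by (rule deriv_zero_outside[OF s(1) n])
  qed
  define \<Phi> where "\<Phi> t s = deriv \<eta> t * (if 0 < s \<and> s < t then c s else 0)" for t s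
  have i: "integrable (lborel \<Otimes>\<^sub>M lborel) (\<lambda>(t, s). \<Phi> t s)"
  proof (rule Bochner_Integration.integrable_bound)
    show "integrable (lborel \<Otimes>\<^sub>M lborel) (\<lambda>p. deriv \<eta> (fst p) * c (snd p))"
      using integrable_pair_mult[OF sqi_test(3)[OF \<eta>] c] by (simp add: lborel_prod)
    show "(\<lambda>(t, s). \<Phi> t s) \<in> borel_measurable (lborel \<Otimes>\<^sub>M lborel)" unfolding \<Phi>_def by measurable
  qed (auto simp: \<Phi>_def)
  have inner: "(LINT t|lborel. \<Phi> t s) = - (\<eta> s * c s)" for s
  proof (cases "0 < s \<and> s < T")
    case True
    have "(LINT t|lborel. \<Phi> t s) = (LINT t|lborel. c s * (deriv \<eta> t * indicator {s..T} t))"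
    proof (rule integral_cong_AE)
      show "AE t in lborel. \<Phi> t s = c s * (deriv \<eta> t * indicator {s..T} t)"
        using AE_lborel_singleton[of s]
        by eventually_elim (use True z(2) in \<open>auto simp: \<Phi>_def indicator_def\<close>)
    qed (auto simp: \<Phi>_def)
    also have "\<dots> = c s * (LINT t|lborel. deriv \<eta> t * indicator {s..T} t)" by simp
    also have "(LINT t|lborel. deriv \<eta> t * indicator {s..T} t) = \<eta> T - \<eta> s"
      using integral_FTC_Icc_real[of s T \<eta> "deriv \<eta>"] True real_test_fun[OF s(1)]
      by (simp add: continuous_on_eq_continuous_at)
    also have "\<eta> T = 0" using z(1) by simp
    finally show ?thesis by simp
  next
    case False
    have "\<Phi> t s = 0" for t using False z(2)[of t] by (auto simp: \<Phi>_def)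
    then show ?thesis using z(1)[OF False] by simp
  qed
  have "(LINT t|lborel. deriv \<eta> t * (LINT s|lborel. ind t s * c s)) = (LINT t|lborel. LINT s|lborel. \<Phi> t s)"
  proof (rule Bochner_Integration.integral_cong[OF refl])
    fix t
    have "(LINT s|lborel. \<Phi> t s) = (LINT s|lborel. deriv \<eta> t * (ind t s * c s))"
      by (rule Bochner_Integration.integral_cong) (auto simp: \<Phi>_def indicator_def)
    then show "deriv \<eta> t * (LINT s|lborel. ind t s * c s) = (LINT s|lborel. \<Phi> t s)" by simp
  qed
  also have "\<dots> = (LINT s|lborel. LINT t|lborel. \<Phi> t s)" by (rule lborel_pair.Fubini_integral[OF i, symmetric])
  also have "\<dots> = - (LINT s|lborel. \<eta> s * c s)" by (simp add: inner)
  finally show ?thesis .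
qed

text \<open>The vanishing integral is what makes the primitive return to zero to the right of the
  support.\<close>

lemma test_fun_primitive:
  fixes \<zeta> :: "real \<Rightarrow> real"
  assumes \<zeta>: "test_fun {0<..<T} \<zeta>" and T: "0 < T" and z: "(LINT t|lborel. \<zeta> t) = 0"
  obtains \<eta> where "test_fun {0<..<T} \<eta>" "deriv \<eta> = \<zeta>"
proof -
  have s: "smooth_fun \<zeta>" "compact (tsupp \<zeta>)" "tsupp \<zeta> \<subseteq> {0<..<T}" using \<zeta> by (auto simp: test_fun_def)
  \<comment> \<open>Inserting the midpoint keeps the set nonempty when \<zeta> is zero.\<close>
  let ?K = "insert (T / 2) (tsupp \<zeta>)"
  have K: "compact ?K" "?K \<noteq> {}" "?K \<subseteq> {0<..<T}" using s T by auto
  obtain a where a: "a \<in> ?K" "\<And>t. t \<in> ?K \<Longrightarrow> a \<le> t" using compact_attains_inf[OF K(1,2)] by blast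
  obtain b where b: "b \<in> ?K" "\<And>t. t \<in> ?K \<Longrightarrow> t \<le> b" using compact_attains_sup[OF K(1,2)] by blast
  have ab: "0 < a" "b < T" using a(1) b(1) K(3) by auto
  have out: "\<zeta> t = 0" if "t < a \<or> b < t" for t
    using that a(2)[of t] b(2)[of t] supp_subset_tsupp[of \<zeta> t] by force
  \<comment> \<open>Starting at -1, left of the whole interval, makes every \<open>t \<ge> a\<close>
    an interior point for the fundamental theorem of calculus.\<close>
  define \<eta> where "\<eta> t = integral {-1..t} \<zeta>" for t
  have lo: "\<eta> t = 0" if "t < a" for t
  proof -
    have "integral {-1..t} \<zeta> = integral {-1..t} (\<lambda>_. 0)"
      by (rule Henstock_Kurzweil_Integration.integral_cong) (use that out in auto)
    then show ?thesis by (simp add: \<eta>_def)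
  qed
  have zi: "set_integrable lborel {-1..t} \<zeta>" for t
    unfolding set_integrable_def by (rule integrable_mult_indicator) (use sqi_test(4)[OF \<zeta>] in auto)
  have hi: "\<eta> t = 0" if "b < t" for t
  proof -
    have "\<eta> t = (LINT s:{-1..t}|lborel. \<zeta> s)" unfolding \<eta>_def by (rule set_borel_integral_eq_integral(2)[OF zi, symmetric])
    also have "\<dots> = (LINT s|lborel. \<zeta> s)"
      unfolding set_lebesgue_integral_def
    proof (rule Bochner_Integration.integral_cong[OF refl])
      fix s
      show "indicator {-1..t} s *\<^sub>R \<zeta> s = \<zeta> s"
        by (cases "s \<in> {-1..t}") (use that out[of s] ab in auto)
    qed
    finally show ?thesis using z by simp
  qed
  have der: "(\<eta> has_real_derivative \<zeta> t) (at t)" for t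
  proof (cases "t < a")
    case True
    have "((\<lambda>_. 0) has_real_derivative 0) (at t)" by simp
    then have "(\<eta> has_real_derivative 0) (at t)"
      by (rule has_field_derivative_transform_within_open[where S="{..<a}"]) (use True lo in auto)
    then show ?thesis using out True by simp
  next
    case False
    have "(\<eta> has_real_derivative \<zeta> t) (at t within {-1..t + 1})"
      unfolding \<eta>_def using False ab
      by (intro integral_has_real_derivative continuous_on_subset[OF smooth_funD(1)[OF s(1)]]) auto
    moreover have "at t within {-1..t + 1} = at t" using False ab by (intro at_within_Icc_at) auto
    ultimately show ?thesis by simp
  qed
  have fd: "frechet_derivative \<eta> (at t) = (*) (\<zeta> t)" for t
    using frechet_derivative_at[OF der[unfolded has_field_derivative_def]] by simp
  have "smooth_fun \<eta>"
  proof (rule smooth_fun.intros)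
    show "continuous_on UNIV \<eta>" using DERIV_isCont[OF der] by (simp add: continuous_on_eq_continuous_at)
    show "\<forall>x. \<eta> differentiable at x" using der by (auto simp: differentiable_def has_field_derivative_def)
    show "\<forall>i\<in>Basis. smooth_fun (\<lambda>x. frechet_derivative \<eta> (at x) i)" using s(1) by (simp add: fd)
  qed
  moreover have sub: "tsupp \<eta> \<subseteq> {a..b}"
    unfolding tsupp_def by (rule closure_minimal) (use lo hi in force, simp)
  moreover have "compact (tsupp \<eta>)"
    using compact_Int_closed[of "{a..b}" "tsupp \<eta>"] sub by (simp add: Int_absorb1 tsupp_def)
  ultimately have "test_fun {0<..<T} \<eta>" using ab by (auto simp: test_fun_def)
  moreover have "deriv \<eta> = \<zeta>" using DERIV_imp_deriv[OF der] by (rule ext)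
  ultimately show ?thesis using that by blast
qed

text \<open>Any test function becomes the derivative of a test function once the multiple of a fixed
  \<open>\<psi>0\<close> that cancels its integral is subtracted. Hence \<open>B\<close> minus a
  constant is orthogonal to all test functions.\<close>

lemma du_bois_reymond:
  fixes B :: "real \<Rightarrow> real"
  assumes T: "0 < T" and B: "continuous_on {0..T} B"
    and z: "\<And>\<eta>. test_fun {0<..<T} \<eta> \<Longrightarrow> (LINT t|lborel. deriv \<eta> t * (indicator {0..T} t * B t)) = 0"
    and t: "t \<in> {0..T}"
  shows "B t = B 0"
proof -
  define \<psi>0 where "\<psi>0 = plateau (T / 3) (2 * T / 3) 1"
  have \<psi>0: "test_fun {0<..<T} \<psi>0" unfolding \<psi>0_def by (rule test_fun_plateau) (use T in auto)
  define I0 where "I0 = (LINT t|lborel. \<psi>0 t)"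
  have \<psi>nn: "0 \<le> \<psi>0 t" for t using bump_nonneg[of "T / 3" "2 * T / 3" t] by (simp add: \<psi>0_def plateau_def)
  have I0: "I0 \<noteq> 0"
  proof
    assume "I0 = 0"
    then have "AE t in lborel. \<psi>0 t = 0"
      unfolding I0_def by (subst (asm) integral_nonneg_eq_0_iff_AE) (use sqi_test(4)[OF \<psi>0] \<psi>nn in auto)
    then obtain t where t: "T / 3 < t" "t < 2 * T / 3" "\<psi>0 t = 0"
      using AE_interval_witness[of "T / 3" "2 * T / 3"] T by force
    have "bump (T / 3) (2 * T / 3) t > 0" using t by (subst bump_pos_iff) simp
    then show False using t(3) by (simp add: \<psi>0_def plateau_def)
  qed
  define B1 where "B1 t = indicator {0..T} t * B t" for t
  have Bi: "integrable lborel (\<lambda>t. indicator {0..T} t *\<^sub>R B t)" by (rule borel_integrable_compact[OF compact_Icc B])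
  have B1m: "B1 \<in> borel_measurable borel" using borel_measurable_integrable[OF Bi] by (simp add: B1_def[abs_def])
  have B1i: "integrable lborel (\<lambda>t. \<psi> t * B1 t)" if "test_fun {0<..<T} \<psi>" for \<psi>
  proof -
    obtain C where C: "\<forall>s\<in>{0..T}. \<bar>B s\<bar> \<le> C"
      using compact_continuous_image[OF B compact_Icc, THEN compact_imp_bounded] by (auto simp: bounded_iff)
    show ?thesis
    proof (rule Bochner_Integration.integrable_bound[where f="\<lambda>t. C * \<psi> t"])
      show "AE t in lborel. norm (\<psi> t * B1 t) \<le> norm (C * \<psi> t)"
      proof (rule AE_I2)
        fix t
        show "norm (\<psi> t * B1 t) \<le> norm (C * \<psi> t)"
        proof (cases "t \<in> {0..T}")
          case True
          then have "\<bar>B t\<bar> * \<bar>\<psi> t\<bar> \<le> \<bar>C\<bar> * \<bar>\<psi> t\<bar>" using C by (intro mult_right_mono) force+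
          then show ?thesis using True by (simp add: B1_def abs_mult mult.commute)
        qed (simp add: B1_def)
      qed
      show "(\<lambda>t. \<psi> t * B1 t) \<in> borel_measurable lborel" using test_fun_meas[OF that] B1m by simp
    qed (use sqi_test(4)[OF that] in simp)
  qed
  define b0 where "b0 = (LINT t|lborel. \<psi>0 t * B1 t) / I0"
  have "AE t in lborel. t \<in> {0<..<T} \<longrightarrow> indicator {0..T} t *\<^sub>R (B t - b0) = 0"
  proof (rule fundamental_lemma)
    show "integrable lborel (\<lambda>t. indicator {0..T} t *\<^sub>R (B t - b0))"
      by (rule borel_integrable_compact) (use B in \<open>auto intro!: continuous_intros\<close>)
    fix \<psi> :: "real \<Rightarrow> real" assume \<psi>: "test_fun {0<..<T} \<psi>"
    define \<kappa> where "\<kappa> = (LINT t|lborel. \<psi> t) / I0"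
    have \<zeta>: "test_fun {0<..<T} (\<lambda>t. 1 * \<psi> t + (- \<kappa>) * \<psi>0 t)" by (rule test_fun_lincomb[OF \<psi> \<psi>0])
    have "(LINT t|lborel. 1 * \<psi> t + (- \<kappa>) * \<psi>0 t) = 0"
      using sqi_test(4)[OF \<psi>] sqi_test(4)[OF \<psi>0] I0 by (simp add: \<kappa>_def I0_def[symmetric])
    then obtain \<eta> where \<eta>: "test_fun {0<..<T} \<eta>" "deriv \<eta> = (\<lambda>t. 1 * \<psi> t + (- \<kappa>) * \<psi>0 t)"
      by (rule test_fun_primitive[OF \<zeta> T])
    have "(LINT t|lborel. \<psi> t * B1 t - \<kappa> * (\<psi>0 t * B1 t)) = 0"
      using z[OF \<eta>(1)] unfolding \<eta>(2) B1_def[symmetric] by (simp add: algebra_simps)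
    then have e: "(LINT t|lborel. \<psi> t * B1 t) = \<kappa> * (LINT t|lborel. \<psi>0 t * B1 t)"
      using B1i[OF \<psi>] B1i[OF \<psi>0] by simp
    have "(LINT t|lborel. (indicator {0..T} t *\<^sub>R (B t - b0)) * \<psi> t) = (LINT t|lborel. \<psi> t * B1 t - b0 * \<psi> t)"
    proof (rule Bochner_Integration.integral_cong[OF refl])
      fix t
      have "\<psi> t = 0" if "t \<notin> {0..T}"
        using \<psi> that supp_subset_tsupp[of \<psi> t] by (force simp: test_fun_def)
      then show "(indicator {0..T} t *\<^sub>R (B t - b0)) * \<psi> t = \<psi> t * B1 t - b0 * \<psi> t"
        by (cases "t \<in> {0..T}") (auto simp: B1_def algebra_simps)
    qed
    also have "\<dots> = (LINT t|lborel. \<psi> t * B1 t) - b0 * (LINT t|lborel. \<psi> t)"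
      using B1i[OF \<psi>] sqi_test(4)[OF \<psi>] by simp
    also have "\<dots> = 0" unfolding e by (simp add: \<kappa>_def b0_def)
    finally show "(LINT t|lborel. (indicator {0..T} t *\<^sub>R (B t - b0)) * \<psi> t) = 0" .
  qed simp
  then have ae: "AE t in lborel. 0 < t \<and> t < T \<longrightarrow> B t = b0" by eventually_elim auto
  have "B s = b0" if "s \<in> {0..T}" for s
    by (rule continuous_AE_eq[OF T B continuous_on_const ae that])
  then show ?thesis using t T by simp
qed

section \<open>Translation of the weak formulation\<close>

lemma AE_leb_on: "A \<in> sets borel \<Longrightarrow> (AE x in lebesgue_on A. P x) \<longleftrightarrow> (AE x in lborel. x \<in> A \<longrightarrow> P x)"
  by (simp add: AE_restrict_space_iff AE_completion_iff)

lemma AE_pairI: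
  fixes P :: "real \<times> 'a::euclidean_space \<Rightarrow> bool"
  assumes "{p. P p} \<in> sets borel" "AE t in lborel. AE x in lborel. P (t, x)" shows "AE p in lborel. P p"
proof -
  have "sets (lborel \<Otimes>\<^sub>M lborel) = sets (borel :: (real \<times> 'a) measure)" unfolding lborel_prod by simp
  then have "AE p in (lborel \<Otimes>\<^sub>M lborel :: (real \<times> 'a) measure). P p"
    using assms by (intro lborel_pair.AE_pair_measure) (simp_all add: space_pair_measure del: sets_pair_measure_cong)
  then show ?thesis unfolding lborel_prod .
qed

locale heat =
  fixes \<Omega> :: "'a::euclidean_space set" and T m M L :: real and a :: "real \<Rightarrow> real"
  assumes \<Omega>_open: "open \<Omega>" and \<Omega>_bounded: "bounded \<Omega>"
    and T_pos: "0 < T" and m_pos: "0 < m" and m_le_M: "m \<le> M"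
    and a_bounds: "\<And>s. m \<le> a s \<and> a s \<le> M" and a_lipschitz: "L-lipschitz_on UNIV a"
begin

lemma \<Omega>_borel: "\<Omega> \<in> sets borel" using \<Omega>_open by simp
lemma \<Omega>_finite: "emeasure lborel \<Omega> < \<infinity>" by (rule emeasure_bounded_finite[OF \<Omega>_bounded])
lemma cyl_borel: "cyl T \<Omega> \<in> sets borel" using \<Omega>_open by (intro borel_open open_Times) auto

end

sublocale heat \<subseteq> nonlinear "H10s \<Omega>" T m M a L "e1 \<Omega>"
proof
  show "\<bar>a x - a y\<bar> \<le> L * \<bar>x - y\<bar>" for x y
    using lipschitz_onD[OF a_lipschitz, of x y] by (simp add: dist_real_def)
  show "0 \<le> L" by (rule lipschitz_on_nonneg[OF a_lipschitz])
qed (use H10s_subspace H10s_closed H10s_P0_inj[OF \<Omega>_open \<Omega>_finite] T_pos m_pos m_le_M a_bounds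
    P0_e1[OF \<Omega>_borel \<Omega>_finite] e1_dense[OF \<Omega>_open \<Omega>_finite] in auto)

context heat
begin

text \<open>Only the function part is compared with \<open>v\<close>: it determines the gradient
  part of an element of W, so \<open>h\<close> is unique although \<open>v\<close> is free on null
  sets.\<close>

definition rel :: "(real \<times> 'a, real \<times> 'a) l2 \<Rightarrow> (real \<Rightarrow> 'a \<Rightarrow> real) \<Rightarrow> bool" where
  "rel h v \<longleftrightarrow> h \<in> W \<and> (AE p in lborel. p \<in> cyl T \<Omega> \<longrightarrow> fst (rep h p) = v (fst p) (snd p))"

lemma relI: "h \<in> W \<Longrightarrow> rel h (\<lambda>t x. fst (rep h (t, x)))"
  by (simp add: rel_def)

lemma W_zero_outside: assumes "h \<in> W" shows "AE p in lborel. p \<notin> cyl T \<Omega> \<longrightarrow> rep h p = 0"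
proof (rule AE_pairI)
  have "{p. rep h p = 0} \<in> sets borel" using measurable_sets[OF rep_meas[of h], of "{0}"] by (simp add: vimage_def)
  moreover have "{p. p \<notin> cyl T \<Omega> \<longrightarrow> rep h p = 0} = cyl T \<Omega> \<union> {p. rep h p = 0}" by auto
  ultimately show "{p. p \<notin> cyl T \<Omega> \<longrightarrow> rep h p = 0} \<in> sets borel" using cyl_borel by (metis sets.Un)
  have "AE t in lborel. sec h t \<in> (if 0 < t \<and> t < T then H10s \<Omega> else {0})" using assms by (simp add: W_def)
  then show "AE t in lborel. AE x in lborel. (t, x) \<notin> cyl T \<Omega> \<longrightarrow> rep h (t, x) = 0" using rep_sec[of h]
  proof eventually_elim
    case (elim t)
    show ?case
    proof (cases "0 < t \<and> t < T")
      case True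
      then have "sec h t \<in> H10s \<Omega>" using elim(1) by simp
      from H10s_zero_outside[OF \<Omega>_borel this] elim(2) show ?thesis by eventually_elim (use True in auto)
    next
      case False
      then have z: "sec h t = 0" using elim(1) by (simp split: if_splits)
      show ?thesis using elim(2) rep_zero[where 'a='a and 'b="real \<times> 'a"] unfolding z by eventually_elim simp
    qed
  qed
qed

lemma rel_inj: assumes "rel h v" "rel k v" shows "h = k"
proof -
  have W: "h \<in> W" "k \<in> W" using assms by (auto simp: rel_def)
  have "P0 (h - k) = 0"
  proof (rule l2_eqI)
    have "AE p in lborel. p \<in> cyl T \<Omega> \<longrightarrow> fst (rep h p) = v (fst p) (snd p)"
      "AE p in lborel. p \<in> cyl T \<Omega> \<longrightarrow> fst (rep k p) = v (fst p) (snd p)" using assms by (auto simp: rel_def)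
    then show "AE p in lborel. rep (P0 (h - k)) p = rep 0 p"
      using rep_P0[of "h - k"] rep_diff[of h k] W_zero_outside[OF W(1)] W_zero_outside[OF W(2)]
        rep_zero[where 'a="real \<times> 'a" and 'b="real \<times> 'a"]
    proof eventually_elim
      case (elim p)
      then show ?case by (cases "p \<in> cyl T \<Omega>") (auto simp: zero_prod_def)
    qed
  qed
  then have "h - k = 0" by (rule P0_inj_W[OF subspace_diff[OF W_subspace W]])
  then show ?thesis by simp
qed

lemma rel_lincomb:
  assumes "rel h v" "rel k w"
  shows "rel (\<alpha> *\<^sub>R h + \<beta> *\<^sub>R k) (\<lambda>t x. \<alpha> * v t x + \<beta> * w t x)"
proof -
  have "AE p in lborel. p \<in> cyl T \<Omega> \<longrightarrow> fst (rep h p) = v (fst p) (snd p)"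
    "AE p in lborel. p \<in> cyl T \<Omega> \<longrightarrow> fst (rep k p) = w (fst p) (snd p)" using assms by (auto simp: rel_def)
  then have "AE p in lborel. p \<in> cyl T \<Omega> \<longrightarrow>
      fst (rep (\<alpha> *\<^sub>R h + \<beta> *\<^sub>R k) p) = \<alpha> * v (fst p) (snd p) + \<beta> * w (fst p) (snd p)"
    using rep_add[of "\<alpha> *\<^sub>R h" "\<beta> *\<^sub>R k"] rep_scaleR[of \<alpha> h] rep_scaleR[of \<beta> k]
    by eventually_elim auto
  moreover have "\<alpha> *\<^sub>R h + \<beta> *\<^sub>R k \<in> W"
    using assms by (auto simp: rel_def intro!: subspace_add[OF W_subspace] subspace_scale[OF W_subspace])
  ultimately show ?thesis by (simp add: rel_def)
qed

lemma W_grad_rel: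
  assumes "W_grad \<Omega> T v G"
  obtains h where "rel h v" "AE p in lborel. p \<in> cyl T \<Omega> \<longrightarrow> snd (rep h p) = G (fst p) (snd p)"
proof -
  have w: "(\<lambda>(t, x). v t x) \<in> borel_measurable (lebesgue_on (cyl T \<Omega>))"
     "(\<lambda>(t, x). G t x) \<in> borel_measurable (lebesgue_on (cyl T \<Omega>))"
     "integrable (lebesgue_on (cyl T \<Omega>)) (\<lambda>(t, x). (v t x)\<^sup>2 + (norm (G t x))\<^sup>2)"
     "AE t in lborel. t \<in> {0<..<T} \<longrightarrow> H10 \<Omega> (v t) (G t)"
    using assms by (auto simp: W_grad_def AE_leb_on)
  obtain h where h: "AE p in lborel. rep h p = (if p \<in> cyl T \<Omega> then (v (fst p) (snd p), G (fst p) (snd p)) else 0)"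
  proof (rule L2_rep[OF cyl_borel])
    show "(\<lambda>p. (v (fst p) (snd p), G (fst p) (snd p))) \<in> borel_measurable (lebesgue_on (cyl T \<Omega>))"
      using w(1,2) by (intro borel_measurable_Pair) (simp_all add: case_prod_beta')
    show "integrable (lebesgue_on (cyl T \<Omega>)) (\<lambda>p. (norm (v (fst p) (snd p), G (fst p) (snd p)))\<^sup>2)"
      using w(3) by (simp add: norm_Pair_sq case_prod_beta')
  qed blast
  have "h \<in> W" unfolding W_def mem_Collect_eq using AE_slice[OF h] rep_sec[of h] w(4)
  proof eventually_elim
    case (elim t)
    show ?case
    proof (cases "0 < t \<and> t < T")
      case True
      then obtain k where k: "k \<in> H10s \<Omega>" "AE x in lborel. rep k x = (if x \<in> \<Omega> then (v t x, G t x) else 0)"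
        using H10_imp_H10s[OF \<Omega>_borel, of "v t" "G t"] elim(3) by auto
      have "sec h t = k"
        by (rule l2_eqI) (use elim(1,2) k(2) in \<open>eventually_elim, use True in simp\<close>)
      then show ?thesis using k(1) True by simp
    next
      case False
      have "sec h t = 0"
        by (rule l2_eqI) (use elim(1,2) rep_zero[where 'a='a and 'b="real \<times> 'a"] in \<open>eventually_elim, use False in auto\<close>)
      then show ?thesis using False by auto
    qed
  qed
  then have "rel h v" unfolding rel_def using h by (auto elim: eventually_mono)
  moreover have "AE p in lborel. p \<in> cyl T \<Omega> \<longrightarrow> snd (rep h p) = G (fst p) (snd p)"
    using h by eventually_elim simp
  ultimately show ?thesis using that by blast
qed

lemma rel_imp_W_grad:
  assumes "rel h v" and G: "AE p in lborel. p \<in> cyl T \<Omega> \<longrightarrow> snd (rep h p) = G (fst p) (snd p)"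
  shows "W_grad \<Omega> T v G" "W_norm \<Omega> T v G = norm h"
proof -
  have hW: "h \<in> W" and v: "AE p in lborel. p \<in> cyl T \<Omega> \<longrightarrow> fst (rep h p) = v (fst p) (snd p)"
    using assms by (auto simp: rel_def)
  have nm: "(\<lambda>p. (norm (rep h p))\<^sup>2) \<in> borel_measurable borel" by measurable
  have n: "AE p in lborel. p \<in> cyl T \<Omega> \<longrightarrow> (\<lambda>(t, x). (v t x)\<^sup>2 + (norm (G t x))\<^sup>2) p = (norm (rep h p))\<^sup>2"
    using v G
  proof eventually_elim
    case (elim p)
    show ?case
    proof
      assume "p \<in> cyl T \<Omega>"
      then have "rep h p = (v (fst p) (snd p), G (fst p) (snd p))" using elim by (simp add: prod_eq_iff)
      then show "(\<lambda>(t, x). (v t x)\<^sup>2 + (norm (G t x))\<^sup>2) p = (norm (rep h p))\<^sup>2"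
        by (simp add: norm_Pair_sq case_prod_beta')
    qed
  qed
  have i: "integrable lborel (\<lambda>p. indicator (cyl T \<Omega>) p *\<^sub>R (norm (rep h p))\<^sup>2)"
    by (rule integrable_le_norm_rep[where k=h]) (use cyl_borel nm in \<open>auto simp: indicator_def\<close>)
  have "AE t in lborel. sec h t \<in> (if 0 < t \<and> t < T then H10s \<Omega> else {0})" using hW by (simp add: W_def)
  then have "AE t in lborel. t \<in> {0<..<T} \<longrightarrow> H10 \<Omega> (v t) (G t)"
    using AE_slice[OF v] AE_slice[OF G] rep_sec[of h]
  proof eventually_elim
    case (elim t)
    show ?case
    proof
      assume t: "t \<in> {0<..<T}"
      have "AE x in lborel. x \<in> \<Omega> \<longrightarrow> rep (sec h t) x = (v t x, G t x)"
        using elim(2-4) by eventually_elim (use t in \<open>auto simp: prod_eq_iff\<close>)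
      then show "H10 \<Omega> (v t) (G t)" using H10s_imp_H10[OF \<Omega>_borel] elim(1) t by auto
    qed
  qed
  moreover have "(\<lambda>(t, x). v t x) \<in> borel_measurable (lebesgue_on (cyl T \<Omega>))"
    by (rule leb_on_meas[OF cyl_borel rep_fst_snd_meas(1)[of h]]) (use v in \<open>eventually_elim, simp add: case_prod_beta'\<close>)
  moreover have "(\<lambda>(t, x). G t x) \<in> borel_measurable (lebesgue_on (cyl T \<Omega>))"
    by (rule leb_on_meas[OF cyl_borel rep_fst_snd_meas(2)[of h]]) (use G in \<open>eventually_elim, simp add: case_prod_beta'\<close>)
  ultimately show "W_grad \<Omega> T v G"
    using leb_on_integrable[OF cyl_borel nm n] i unfolding W_grad_def by (simp add: AE_leb_on)
  have "(norm h)\<^sup>2 = (LINT p|lborel. indicator (cyl T \<Omega>) p *\<^sub>R (norm (rep h p))\<^sup>2)"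
    unfolding norm_l2_sq
    by (rule integral_cong_AE) (use i nm W_zero_outside[OF hW] in \<open>auto elim!: eventually_mono simp: indicator_def\<close>)
  then have "W_norm \<Omega> T v G = sqrt ((norm h)\<^sup>2)"
    unfolding W_norm_def leb_on_integral[OF cyl_borel nm n] by simp
  then show "W_norm \<Omega> T v G = norm h" by simp
qed

lemma rel_W_grad:
  assumes "rel h v"
  shows "W_grad \<Omega> T v (\<lambda>t x. snd (rep h (t, x)))" "W_norm \<Omega> T v (\<lambda>t x. snd (rep h (t, x))) = norm h"
  by (rule rel_imp_W_grad[OF assms]; simp)+

lemma inW_iff: "inW \<Omega> T v \<longleftrightarrow> (\<exists>h. rel h v)"
  unfolding inW_def using W_grad_rel rel_W_grad(1) by metis

section \<open>Functionals on W as vectors\<close>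

text \<open>A functional of the dual acts on functions, not on classes. Its bound, applied to the
  difference of two functions with the same \<open>h\<close>, shows that it takes one value on a
  class; then Riesz' theorem applies on W.\<close>

lemma Wdual_riesz:
  assumes F: "in_Wdual \<Omega> T F"
  obtains f where "\<And>h v. rel h v \<Longrightarrow> F v = inner f h"
proof -
  obtain C where C: "\<And>v G. W_grad \<Omega> T v G \<Longrightarrow> \<bar>F v\<bar> \<le> C * W_norm \<Omega> T v G" using F by (auto simp: in_Wdual_def)
  have lin: "F (\<lambda>t x. \<alpha> * v t x + \<beta> * w t x) = \<alpha> * F v + \<beta> * F w" if "rel h v" "rel k w" for h k v w \<alpha> \<beta>
    using F that inW_iff unfolding in_Wdual_def by blast
  have bd: "\<bar>F v\<bar> \<le> C * norm h" if "rel h v" for h v using C[OF rel_W_grad(1)[OF that]] rel_W_grad(2)[OF that] by simp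
  have cong: "F v = F w" if "rel h v" "rel h w" for h v w
  proof -
    have "rel (1 *\<^sub>R h + (-1) *\<^sub>R h) (\<lambda>t x. 1 * v t x + (-1) * w t x)" by (rule rel_lincomb[OF that])
    from bd[OF this] lin[OF that, of 1 "-1"] show ?thesis by simp
  qed
  obtain f where f: "\<And>h. h \<in> W \<Longrightarrow> F (\<lambda>t x. fst (rep h (t, x))) = inner f h"
  proof (rule riesz_subspace[OF W_subspace W_closed, of "\<lambda>h. F (\<lambda>t x. fst (rep h (t, x)))" C])
    fix \<alpha> \<beta> h k assume hk: "h \<in> W" "k \<in> W"
    note r = relI[OF hk(1)] relI[OF hk(2)]
    have "\<alpha> *\<^sub>R h + \<beta> *\<^sub>R k \<in> W" using rel_lincomb[OF r] by (simp add: rel_def)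
    from cong[OF relI[OF this] rel_lincomb[OF r]] lin[OF r, of \<alpha> \<beta>]
    show "F (\<lambda>t x. fst (rep (\<alpha> *\<^sub>R h + \<beta> *\<^sub>R k) (t, x)))
        = \<alpha> * F (\<lambda>t x. fst (rep h (t, x))) + \<beta> * F (\<lambda>t x. fst (rep k (t, x)))" by simp
  qed (use bd relI in auto)
  have "F v = inner f h" if "rel h v" for h v
    using cong[OF that relI] f that by (simp add: rel_def)
  then show ?thesis using that by blast
qed

text \<open>The choice is unique by \<open>rel_inj\<close>; the value is junk unless \<open>v\<close> represents an element of \<open>W\<close>.\<close>

definition wd :: "(real \<times> 'a, real \<times> 'a) l2 \<Rightarrow> (real \<Rightarrow> 'a \<Rightarrow> real) \<Rightarrow> real" where
  "wd q v = inner q (SOME h. rel h v)"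

lemma wd: "rel h v \<Longrightarrow> wd q v = inner q h"
  unfolding wd_def using rel_inj[of _ v h] by (metis someI)

lemma in_Wdual_wd: "in_Wdual \<Omega> T (wd q)"
  unfolding in_Wdual_def
proof (intro conjI allI impI exI[of _ "norm q"])
  fix v w \<alpha> \<beta> assume "inW \<Omega> T v" "inW \<Omega> T w"
  then obtain h k where r: "rel h v" "rel k w" by (auto simp: inW_iff)
  show "wd q (\<lambda>t x. \<alpha> * v t x + \<beta> * w t x) = \<alpha> * wd q v + \<beta> * wd q w"
    by (simp add: wd[OF r(1)] wd[OF r(2)] wd[OF rel_lincomb[OF r]] inner_add_right)
next
  fix v G assume "W_grad \<Omega> T v G"
  then obtain h where h: "rel h v" "AE p in lborel. p \<in> cyl T \<Omega> \<longrightarrow> snd (rep h p) = G (fst p) (snd p)"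
    using W_grad_rel by blast
  show "\<bar>wd q v\<bar> \<le> norm q * W_norm \<Omega> T v G"
    unfolding rel_imp_W_grad(2)[OF h] wd[OF h(1)] by (rule Cauchy_Schwarz_ineq2)
qed

end

lemma
  fixes P :: "real \<Rightarrow> bool" and Q :: "'a::euclidean_space \<Rightarrow> bool"
  shows AE_fst: "AE t in lborel. P t \<Longrightarrow> AE p in (lborel :: (real \<times> 'a) measure). P (fst p)"
    and AE_snd: "AE x in lborel. Q x \<Longrightarrow> AE p in (lborel :: (real \<times> 'a) measure). Q (snd p)"
proof -
  show "AE p in (lborel :: (real \<times> 'a) measure). P (fst p)" if P: "AE t in lborel. P t"
  proof -
    have "\<exists>N\<in>null_sets lborel. {x \<in> space lborel. \<not> P x} \<subseteq> N" using P by (simp add: eventually_ae_filter)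
    then obtain N where N: "{x. \<not> P x} \<subseteq> N" "N \<in> null_sets lborel" by auto
    have Nb: "- N \<in> sets borel" using N(2) by (auto simp: null_sets_def)
    have "AE p in (lborel :: (real \<times> 'a) measure). fst p \<notin> N"
    proof (rule AE_pairI)
      have "fst -` (- N) \<inter> space borel \<in> sets (borel :: (real \<times> 'a) measure)"
        by (rule measurable_sets[OF _ Nb]) (intro borel_measurable_continuous_onI continuous_intros)
      then show "{p. fst p \<notin> N} \<in> sets (borel :: (real \<times> 'a) measure)" by (simp add: vimage_def)
      show "AE t in lborel. AE x in lborel. fst (t, x :: 'a) \<notin> N" using AE_not_in[OF N(2)] by eventually_elim simp
    qed
    then show ?thesis by eventually_elim (use N(1) in blast)
  qed
  show "AE p in (lborel :: (real \<times> 'a) measure). Q (snd p)" if Q: "AE x in lborel. Q x"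
  proof -
    have "\<exists>N\<in>null_sets lborel. {x \<in> space lborel. \<not> Q x} \<subseteq> N" using Q by (simp add: eventually_ae_filter)
    then obtain N where N: "{x. \<not> Q x} \<subseteq> N" "N \<in> null_sets lborel" by auto
    have Nb: "- N \<in> sets borel" using N(2) by (auto simp: null_sets_def)
    have "AE p in (lborel :: (real \<times> 'a) measure). snd p \<notin> N"
    proof (rule AE_pairI)
      have "snd -` (- N) \<inter> space borel \<in> sets (borel :: (real \<times> 'a) measure)"
        by (rule measurable_sets[OF _ Nb]) (intro borel_measurable_continuous_onI continuous_intros)
      then show "{p. snd p \<notin> N} \<in> sets (borel :: (real \<times> 'a) measure)" by (simp add: vimage_def)
      show "AE t in lborel. AE x in lborel. snd (t :: real, x :: 'a) \<notin> N" using AE_not_in[OF N(2)] by simp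
    qed
    then show ?thesis by eventually_elim (use N(1) in blast)
  qed
qed

lemma rep_tens_mk:
  fixes f :: "'a::euclidean_space \<Rightarrow> 'e::euclidean_space"
  assumes c: "sqi c" and f: "sqi f" shows "AE p in lborel. rep (tens c (mk f)) p = c (fst p) *\<^sub>R f (snd p)"
  using rep_mk[OF sqi_tens[OF c sqi_rep[of "mk f"]]] AE_snd[OF rep_mk[OF f]]
  unfolding tens_def by eventually_elim simp

lemma rep_tm: assumes "bdm c" shows "AE p in lborel. rep (tm c h) p = c (fst p) *\<^sub>R rep h p"
  unfolding tm_def by (rule rep_mk[OF sqi_tm[OF assms sqi_rep]])

lemma sq_integral_le:
  fixes k :: "('a::euclidean_space, real \<times> 'a) l2"
  assumes \<Omega>: "\<Omega> \<in> sets borel" and f: "AE x in lborel. x \<in> \<Omega> \<longrightarrow> f x = fst (rep k x)"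
  shows "L2 \<Omega> f" "integral\<^sup>L (lebesgue_on \<Omega>) (\<lambda>x. (f x)\<^sup>2) \<le> (norm k)\<^sup>2"
proof -
  note m = rep_fst_snd_meas(1)[of k]
  have m2: "(\<lambda>x. (fst (rep k x))\<^sup>2) \<in> borel_measurable borel" using m by measurable
  have f2: "AE x in lborel. x \<in> \<Omega> \<longrightarrow> (f x)\<^sup>2 = (fst (rep k x))\<^sup>2" using f by eventually_elim simp
  have le: "indicator \<Omega> x *\<^sub>R (fst (rep k x))\<^sup>2 \<le> (norm (rep k x))\<^sup>2" for x
    using norm_Pair_sq[of "fst (rep k x)" "snd (rep k x)"] by (auto simp: indicator_def)
  have i: "integrable lborel (\<lambda>x. indicator \<Omega> x *\<^sub>R (fst (rep k x))\<^sup>2)"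
    by (rule integrable_le_norm_rep[where k=k]) (use \<Omega> m2 le in \<open>auto simp: indicator_def\<close>)
  show "L2 \<Omega> f" unfolding L2_def
    using leb_on_meas[OF \<Omega> m f] leb_on_integrable[OF \<Omega> m2 f2] i by simp
  have "integral\<^sup>L (lebesgue_on \<Omega>) (\<lambda>x. (f x)\<^sup>2) = (LINT x|lborel. indicator \<Omega> x *\<^sub>R (fst (rep k x))\<^sup>2)"
    by (rule leb_on_integral[OF \<Omega> m2 f2])
  also have "\<dots> \<le> (LINT x|lborel. (norm (rep k x))\<^sup>2)"
    by (rule integral_mono[OF i _ le]) (use sqi_rep[of k] in \<open>simp add: sqi_def\<close>)
  finally show "integral\<^sup>L (lebesgue_on \<Omega>) (\<lambda>x. (f x)\<^sup>2) \<le> (norm k)\<^sup>2" by (simp add: norm_l2_sq)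
qed

section \<open>From abstract solutions to weak solutions\<close>

context heat
begin

lemma l_int_eq:
  assumes "AE x in lborel. x \<in> \<Omega> \<longrightarrow> v x = fst (rep k x)" shows "l_int \<Omega> v = inner k (e1 \<Omega>)"
proof -
  have "l_int \<Omega> v = (LINT x|lborel. indicator \<Omega> x *\<^sub>R fst (rep k x))"
    unfolding l_int_def by (rule leb_on_integral[OF \<Omega>_borel rep_fst_snd_meas(1) assms])
  also have "\<dots> = (LINT x|lborel. inner (rep k x) (indicator \<Omega> x, 0))"
    by (simp add: inner_prod_def mult.commute)
  finally show ?thesis unfolding e1_def inner_mk_right[OF sqi_e1[OF \<Omega>_borel \<Omega>_finite]] .
qed

lemma lag_0: "t \<in> {0..T} \<Longrightarrow> lag 0 \<sigma> t = a (\<sigma> t)" by (simp add: lag_def cl_id)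

lemma diffusion_integral:
  assumes \<sigma>: "continuous_on {0..T} \<sigma>" and l: "AE t in lborel. 0 < t \<and> t < T \<longrightarrow> l_int \<Omega> (u t) = \<sigma> t"
    and Gu: "AE p in lborel. p \<in> cyl T \<Omega> \<longrightarrow> snd (rep h p) = Gu (fst p) (snd p)"
    and z: "z \<in> W" and Gv: "AE p in lborel. p \<in> cyl T \<Omega> \<longrightarrow> snd (rep z p) = Gv (fst p) (snd p)"
  shows "integral\<^sup>L (lebesgue_on (cyl T \<Omega>)) (\<lambda>(t, x). a (l_int \<Omega> (u t)) * (Gu t x \<bullet> Gv t x))
    = inner (tm (lag 0 \<sigma>) (P1 h)) z"
proof -
  have b: "bdm (lag 0 \<sigma>)" using coef_lag[OF \<sigma>] by simp
  let ?g = "\<lambda>p. lag 0 \<sigma> (fst p) * inner (snd (rep h p)) (snd (rep z p))"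
  have "lag 0 \<sigma> \<in> borel_measurable borel" using b by (simp add: bdm_def)
  then have gm: "?g \<in> borel_measurable borel"
    using rep_fst_snd_meas(2)[of h] rep_fst_snd_meas(2)[of z] by (intro borel_measurable_times meas_fst borel_measurable_inner)
  have ae: "AE p in lborel. p \<in> cyl T \<Omega> \<longrightarrow> (\<lambda>(t, x). a (l_int \<Omega> (u t)) * (Gu t x \<bullet> Gv t x)) p = ?g p"
    using AE_fst[OF l, where 'a='a] Gu Gv by eventually_elim (auto simp: lag_0)
  have "integral\<^sup>L (lebesgue_on (cyl T \<Omega>)) (\<lambda>(t, x). a (l_int \<Omega> (u t)) * (Gu t x \<bullet> Gv t x))
      = (LINT p|lborel. indicator (cyl T \<Omega>) p *\<^sub>R ?g p)"
    by (rule leb_on_integral[OF cyl_borel gm ae])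
  also have "\<dots> = (LINT p|lborel. inner (rep (tm (lag 0 \<sigma>) (P1 h)) p) (rep z p))"
  proof (rule integral_cong_AE)
    show "(\<lambda>p. indicator (cyl T \<Omega>) p *\<^sub>R ?g p) \<in> borel_measurable lborel"
      using cyl_borel gm by (intro borel_measurable_scaleR borel_measurable_indicator) auto
    show "AE p in lborel. indicator (cyl T \<Omega>) p *\<^sub>R ?g p = inner (rep (tm (lag 0 \<sigma>) (P1 h)) p) (rep z p)"
      using rep_tm[OF b, of "P1 h"] rep_P1[of h] W_zero_outside[OF z]
    proof eventually_elim
      case (elim p)
      then show ?case by (cases "p \<in> cyl T \<Omega>") (auto simp: inner_prod_def)
    qed
  qed measurable
  finally show ?thesis by (simp add: inner_l2)
qed

lemma test_tens:
  assumes \<eta>: "test_fun {0<..<T} \<eta>" and \<phi>: "test_fun \<Omega> \<phi>"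
  shows "rel (tens \<eta> (mk (tpair \<phi>))) (\<lambda>t x. \<eta> t * \<phi> x)"
proof -
  have "\<eta> t = 0" if "\<not> (0 < t \<and> t < T)" for t
  proof -
    have "t \<notin> tsupp \<eta>" using \<eta> that by (auto simp: test_fun_def)
    then show ?thesis using supp_subset_tsupp[of \<eta> t] by blast
  qed
  moreover have "mk (tpair \<phi>) \<in> H10s \<Omega>"
    unfolding H10s_def using \<phi> by (intro subsetD[OF closure_subset]) (auto simp: TF_def)
  ultimately have "tens \<eta> (mk (tpair \<phi>)) \<in> W" by (intro W_tens sqi_test(1)[OF \<eta>])
  moreover have "AE p in lborel. p \<in> cyl T \<Omega> \<longrightarrow> fst (rep (tens \<eta> (mk (tpair \<phi>))) p) = \<eta> (fst p) * \<phi> (snd p)"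
    using rep_tens_mk[OF sqi_test(1)[OF \<eta>] sqi_tpair[OF \<phi>]] by eventually_elim (simp add: tpair_def)
  ultimately show ?thesis by (simp add: rel_def)
qed

text \<open>Moves the integral in the definition of the time derivative to slices, where the
  continuous representative \<open>w\<close> may replace \<open>u\<close>.\<close>

lemma test_integral:
  assumes h: "rel h u" and w: "continuous_on {0..T} w" and ae: "AE t in lborel. 0 < t \<and> t < T \<longrightarrow> w t = P0 (sec h t)"
    and \<eta>: "test_fun {0<..<T} \<eta>" and \<phi>: "test_fun \<Omega> \<phi>"
  shows "integral\<^sup>L (lebesgue_on (cyl T \<Omega>)) (\<lambda>(t, x). u t x * \<phi> x * deriv \<eta> t)
    = (LINT t|lborel. deriv \<eta> t * (indicator {0..T} t * inner (w t) (mk (tpair \<phi>))))"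
proof -
  let ?k = "mk (tpair \<phi>)"
  have hW: "h \<in> W" and v: "AE p in lborel. p \<in> cyl T \<Omega> \<longrightarrow> fst (rep h p) = u (fst p) (snd p)"
    using h by (auto simp: rel_def)
  note d = sqi_test(2)[OF \<eta>]
  have d0: "deriv \<eta> t = 0" if "\<not> (0 < t \<and> t < T)" for t
    by (rule deriv_zero_outside) (use \<eta> that in \<open>auto simp: test_fun_def\<close>)
  have gm: "(\<lambda>p. fst (rep h p) * \<phi> (snd p) * deriv \<eta> (fst p)) \<in> borel_measurable borel"
    using rep_fst_snd_meas(1)[of h] test_fun_meas[OF \<phi>] sqi_meas[OF d]
    by (intro borel_measurable_times meas_fst meas_snd)
  have ae': "AE p in lborel. p \<in> cyl T \<Omega> \<longrightarrow> (\<lambda>(t, x). u t x * \<phi> x * deriv \<eta> t) p = fst (rep h p) * \<phi> (snd p) * deriv \<eta> (fst p)"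
    using v by eventually_elim auto
  have "integral\<^sup>L (lebesgue_on (cyl T \<Omega>)) (\<lambda>(t, x). u t x * \<phi> x * deriv \<eta> t)
      = (LINT p|lborel. indicator (cyl T \<Omega>) p *\<^sub>R (fst (rep h p) * \<phi> (snd p) * deriv \<eta> (fst p)))"
    by (rule leb_on_integral[OF cyl_borel gm ae'])
  also have "\<dots> = (LINT p|lborel. inner (rep (P0 h) p) (rep (tens (deriv \<eta>) ?k) p))"
  proof (rule integral_cong_AE)
    show "(\<lambda>p. indicator (cyl T \<Omega>) p *\<^sub>R (fst (rep h p) * \<phi> (snd p) * deriv \<eta> (fst p))) \<in> borel_measurable lborel"
      using cyl_borel gm by (intro borel_measurable_scaleR borel_measurable_indicator) auto
    show "AE p in lborel. indicator (cyl T \<Omega>) p *\<^sub>R (fst (rep h p) * \<phi> (snd p) * deriv \<eta> (fst p))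
        = inner (rep (P0 h) p) (rep (tens (deriv \<eta>) ?k) p)"
      using rep_P0[of h] rep_tens_mk[OF d sqi_tpair[OF \<phi>]] W_zero_outside[OF hW]
    proof eventually_elim
      case (elim p)
      then show ?case by (cases "p \<in> cyl T \<Omega>") (auto simp: inner_prod_def tpair_def)
    qed
  qed measurable
  also have "\<dots> = inner (P0 h) (tens (deriv \<eta>) ?k)" by (simp add: inner_l2)
  also have "\<dots> = (LINT t|lborel. deriv \<eta> t * inner (sec (P0 h) t) ?k)" by (rule inner_tens(1)[OF d])
  also have "\<dots> = (LINT t|lborel. deriv \<eta> t * (indicator {0..T} t * inner (w t) ?k))"
  proof (rule integral_cong_AE)
    have "(\<lambda>t. indicator {0..T} t *\<^sub>R inner (w t) ?k) \<in> borel_measurable borel"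
      by (rule borel_measurable_continuous_on_indicator) (use w in \<open>auto intro!: continuous_intros\<close>)
    then show "(\<lambda>t. deriv \<eta> t * (indicator {0..T} t * inner (w t) ?k)) \<in> borel_measurable lborel"
      using sqi_meas[OF d] by simp
    show "AE t in lborel. deriv \<eta> t * inner (sec (P0 h) t) ?k = deriv \<eta> t * (indicator {0..T} t * inner (w t) ?k)"
      using sec_P0[of h] ae
    proof eventually_elim
      case (elim t)
      then show ?case using d0[of t] by (cases "0 < t \<and> t < T") auto
    qed
  qed (use sqi_meas[OF d] in measurable)
  finally show ?thesis .
qed

lemma test_primitive:
  assumes \<eta>: "test_fun {0<..<T} \<eta>"
  shows "(LINT t|lborel. deriv \<eta> t * (indicator {0..T} t * inner (Jt q t) k)) = - inner q (tens \<eta> k)"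
proof -
  \<comment> \<open>The product with a fixed \<open>k\<close> need not be integrable over the whole
    line; the cutoff to (0,T), which contains the support of \<eta>, makes it so.\<close>
  define c where "c s = ind T s * inner (sec q s) k" for s
  have c: "integrable lborel c" unfolding c_def by (rule inner_tens(2)) simp
  have z: "\<eta> t = 0" "deriv \<eta> t = 0" if "\<not> (0 < t \<and> t < T)" for t
  proof -
    have "t \<notin> tsupp \<eta>" using \<eta> that by (auto simp: test_fun_def)
    then show "\<eta> t = 0" "deriv \<eta> t = 0"
      using supp_subset_tsupp[of \<eta> t] deriv_zero_outside[of \<eta> t] \<eta> by (auto simp: test_fun_def)
  qed
  have "(LINT t|lborel. deriv \<eta> t * (indicator {0..T} t * inner (Jt q t) k))
      = (LINT t|lborel. deriv \<eta> t * (LINT s|lborel. ind t s * c s))"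
  proof (rule Bochner_Integration.integral_cong[OF refl])
    fix t
    show "deriv \<eta> t * (indicator {0..T} t * inner (Jt q t) k) = deriv \<eta> t * (LINT s|lborel. ind t s * c s)"
    proof (cases "0 < t \<and> t < T")
      case True
      have "inner (Jt q t) k = (LINT s|lborel. ind t s * inner (sec q s) k)"
        using True by (simp add: inner_Jt inner_tens(1))
      also have "\<dots> = (LINT s|lborel. ind t s * c s)"
        by (rule Bochner_Integration.integral_cong) (use True in \<open>auto simp: c_def indicator_def\<close>)
      finally show ?thesis using True by simp
    qed (simp add: z)
  qed
  also have "\<dots> = - (LINT s|lborel. \<eta> s * c s)" by (rule ibp_primitive[OF \<eta> c])
  also have "(LINT s|lborel. \<eta> s * c s) = (LINT s|lborel. \<eta> s * inner (sec q s) k)"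
    by (rule Bochner_Integration.integral_cong) (use z(1) in \<open>force simp: c_def indicator_def\<close>)+
  finally show ?thesis by (simp add: inner_tens(1)[OF sqi_test(1)[OF \<eta>]])
qed

text \<open>Agreement of \<open>w\<close> with the primitive of \<open>q\<close> is asked only in
  pairings with \<open>H10s \<Omega>\<close>, since \<open>q\<close> may have a gradient
  part.\<close>

lemma time_deriv_wd:
  assumes h: "rel h u" and w: "continuous_on {0..T} w" and ae: "AE t in lborel. 0 < t \<and> t < T \<longrightarrow> w t = P0 (sec h t)"
    and q: "\<And>t k. t \<in> {0..T} \<Longrightarrow> k \<in> H10s \<Omega> \<Longrightarrow> inner (w t) k = inner (Jt q t) k"
  shows "time_deriv \<Omega> T u (wd q)"
  unfolding time_deriv_def
proof (intro conjI allI impI in_Wdual_wd)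
  fix \<eta> \<phi> assume \<eta>: "test_fun {0<..<T} \<eta>" and \<phi>: "test_fun \<Omega> \<phi>"
  have k: "mk (tpair \<phi>) \<in> H10s \<Omega>"
    unfolding H10s_def using \<phi> by (intro subsetD[OF closure_subset]) (auto simp: TF_def)
  have "integral\<^sup>L (lebesgue_on (cyl T \<Omega>)) (\<lambda>(t, x). u t x * \<phi> x * deriv \<eta> t)
      = (LINT t|lborel. deriv \<eta> t * (indicator {0..T} t * inner (w t) (mk (tpair \<phi>))))"
    by (rule test_integral[OF h w ae \<eta> \<phi>])
  also have "\<dots> = (LINT t|lborel. deriv \<eta> t * (indicator {0..T} t * inner (Jt q t) (mk (tpair \<phi>))))"
    by (rule Bochner_Integration.integral_cong) (use q[OF _ k] in \<open>auto simp: indicator_def\<close>)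
  also have "\<dots> = - wd q (\<lambda>t x. \<eta> t * \<phi> x)" by (simp add: test_primitive[OF \<eta>] wd[OF test_tens[OF \<eta> \<phi>]])
  finally show "integral\<^sup>L (lebesgue_on (cyl T \<Omega>)) (\<lambda>(t, x). u t x * \<phi> x * deriv \<eta> t) = - wd q (\<lambda>t x. \<eta> t * \<phi> x)" .
qed

lemma zero_initial_rep:
  fixes h :: "(real \<times> 'a, real \<times> 'a) l2"
  assumes w: "continuous_on {0..T} w" "w 0 = 0"
    and ae: "AE t in lborel. 0 < t \<and> t < T \<longrightarrow> w t = P0 (sec h t)"
  shows "zero_initial \<Omega> T (\<lambda>t x. fst (rep h (t, x)))"
proof -
  define good where "good t \<longleftrightarrow> (AE x in lborel. fst (rep h (t, x)) = fst (rep (w t) x))" for t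
  \<comment> \<open>\<open>zero_initial\<close> asks for equality almost everywhere on the cylinder,
    which representatives chosen separately for each \<open>w t\<close> do not guarantee. So the
    slices of \<open>h\<close> are used at good times, and \<open>w t\<close> at the others.\<close>
  define w' where "w' t x = (if good t then fst (rep h (t, x)) else fst (rep (w t) x))" for t x
  have "AE t in lborel. 0 < t \<and> t < T \<longrightarrow> good t" using ae rep_sec[of h]
  proof eventually_elim
    case (elim t)
    show ?case
    proof
      assume t: "0 < t \<and> t < T"
      show "good t" unfolding good_def
        using elim(2) rep_P0[of "sec h t"] by eventually_elim (use elim(1) t in simp)
    qed
  qed
  from AE_fst[OF this, where 'a='a]
  have 1: "AE p in lborel. p \<in> cyl T \<Omega> \<longrightarrow> w' (fst p) (snd p) = fst (rep h (fst p, snd p))"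
    by eventually_elim (auto simp: w'_def)
  have 2: "AE x in lborel. w' t x = fst (rep (w t) x)" for t
    by (cases "good t") (auto simp: w'_def good_def)
  have 3: "AE x in lborel. w' t x - w' s x = fst (rep (w t - w s) x)" for s t
    using 2[of t] 2[of s] rep_diff[of "w t" "w s"] by eventually_elim simp
  have nn: "0 \<le> integral\<^sup>L (lebesgue_on \<Omega>) (\<lambda>x. (g x)\<^sup>2)" for g :: "'a \<Rightarrow> real" by simp
  show ?thesis unfolding zero_initial_def
  proof (intro exI[of _ w'] conjI ballI)
    show "AE p in lebesgue_on (cyl T \<Omega>). w' (fst p) (snd p) = fst (rep h (fst p, snd p))"
      using 1 by (simp add: AE_leb_on[OF cyl_borel])
    show "L2 \<Omega> (w' t)" for t
      by (rule sq_integral_le(1)[OF \<Omega>_borel, where k="w t"]) (use 2[of t] in eventually_elim, simp)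
    show "((\<lambda>t. integral\<^sup>L (lebesgue_on \<Omega>) (\<lambda>x. (w' t x - w' t0 x)\<^sup>2)) \<longlongrightarrow> 0) (at t0 within {0..T})" if t0: "t0 \<in> {0..T}" for t0
    proof (rule Lim_null_comparison)
      have "integral\<^sup>L (lebesgue_on \<Omega>) (\<lambda>x. (w' t x - w' t0 x)\<^sup>2) \<le> (norm (w t - w t0))\<^sup>2" for t
        by (rule sq_integral_le(2)[OF \<Omega>_borel]) (use 3[of t t0] in eventually_elim, simp)
      then show "\<forall>\<^sub>F t in at t0 within {0..T}. norm (integral\<^sup>L (lebesgue_on \<Omega>) (\<lambda>x. (w' t x - w' t0 x)\<^sup>2)) \<le> (norm (w t - w t0))\<^sup>2"
        using nn by simp
      have "(w \<longlongrightarrow> w t0) (at t0 within {0..T})" using w(1) t0 by (simp add: continuous_on)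
      then have "((\<lambda>t. (norm (w t - w t0))\<^sup>2) \<longlongrightarrow> (norm (w t0 - w t0))\<^sup>2) (at t0 within {0..T})" by (intro tendsto_intros)
      then show "((\<lambda>t. (norm (w t - w t0))\<^sup>2) \<longlongrightarrow> 0) (at t0 within {0..T})" by simp
    qed
    have "integral\<^sup>L (lebesgue_on \<Omega>) (\<lambda>x. (w' 0 x)\<^sup>2) \<le> (norm (w 0))\<^sup>2"
      by (rule sq_integral_le(2)[OF \<Omega>_borel]) (use 2[of 0] in eventually_elim, simp)
    then show "integral\<^sup>L (lebesgue_on \<Omega>) (\<lambda>x. (w' 0 x)\<^sup>2) = 0" using nn[of "w' 0"] w(2) by simp
  qed
qed

lemma weak_solution_if_Sol:
  assumes f: "\<And>h v. rel h v \<Longrightarrow> F v = inner f h"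
    and \<sigma>: "continuous_on {0..T} \<sigma>" and S: "Sol (lag 0 \<sigma>) f h w" and o: "\<And>t. t \<in> {0..T} \<Longrightarrow> obs w t = \<sigma> t"
  shows "weak_solution \<Omega> T a F (\<lambda>t x. fst (rep h (t, x)))"
proof -
  note c = coef_lag[OF \<sigma>, of 0]
  note wc = Sol_cont[OF c S] and ae = Sol_AE[OF c S]
  note r = relI[OF Sol_W[OF c S]]
  \<comment> \<open>The time derivative as a vector: what the equation leaves of \<open>f\<close>
    after the diffusion term.\<close>
  define q where "q = f - tm (lag 0 \<sigma>) (P1 h)"
  have "inner (w t) k = inner (Jt q t) k" if "t \<in> {0..T}" "k \<in> H10s \<Omega>" for t k
    using Sol_weak[OF c S, of t k] that by (simp add: inner_Jt q_def inner_diff_left)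
  then have td: "time_deriv \<Omega> T (\<lambda>t x. fst (rep h (t, x))) (wd q)" by (rule time_deriv_wd[OF r wc ae])
  have l: "AE t in lborel. 0 < t \<and> t < T \<longrightarrow> l_int \<Omega> (\<lambda>x. fst (rep h (t, x))) = \<sigma> t" using ae rep_sec[of h]
  proof eventually_elim
    case (elim t)
    show ?case
    proof
      assume t: "0 < t \<and> t < T"
      have "AE x in lborel. x \<in> \<Omega> \<longrightarrow> fst (rep h (t, x)) = fst (rep (w t) x)"
        using elim(2) rep_P0[of "sec h t"] by eventually_elim (use elim(1) t in simp)
      then have "l_int \<Omega> (\<lambda>x. fst (rep h (t, x))) = inner (w t) (e1 \<Omega>)" by (rule l_int_eq)
      then show "l_int \<Omega> (\<lambda>x. fst (rep h (t, x))) = \<sigma> t" using o[of t] t by (simp add: obs_def)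
    qed
  qed
  have eq: "wd q v + integral\<^sup>L (lebesgue_on (cyl T \<Omega>))
       (\<lambda>(t, x). a (l_int \<Omega> (\<lambda>x. fst (rep h (t, x)))) * (snd (rep h (t, x)) \<bullet> Gv t x)) = F v" if v: "W_grad \<Omega> T v Gv" for v Gv
  proof -
    obtain z where z: "rel z v" "AE p in lborel. p \<in> cyl T \<Omega> \<longrightarrow> snd (rep z p) = Gv (fst p) (snd p)"
      using W_grad_rel[OF v] by blast
    have zW: "z \<in> W" using z(1) by (simp add: rel_def)
    have "integral\<^sup>L (lebesgue_on (cyl T \<Omega>))
       (\<lambda>(t, x). a (l_int \<Omega> (\<lambda>x. fst (rep h (t, x)))) * (snd (rep h (t, x)) \<bullet> Gv t x)) = inner (tm (lag 0 \<sigma>) (P1 h)) z"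
      by (rule diffusion_integral[OF \<sigma> l _ zW z(2)]) simp
    then show ?thesis using f[OF z(1)] wd[OF z(1), of q] by (simp add: q_def inner_diff_left)
  qed
  have "inV \<Omega> T (\<lambda>t x. fst (rep h (t, x)))"
    unfolding inV_def using r td zero_initial_rep[OF wc Sol_0[OF c S] ae] inW_iff by blast
  then show ?thesis unfolding weak_solution_def using rel_W_grad(1)[OF r] td eq by blast
qed

end

section \<open>From weak solutions to abstract solutions\<close>

lemma sq_integral_eq:
  fixes k :: "('a::euclidean_space, real \<times> 'a) l2"
  assumes \<Omega>: "\<Omega> \<in> sets borel" and f: "AE x in lborel. rep k x = (if x \<in> \<Omega> then (f x, 0) else 0)"
  shows "integral\<^sup>L (lebesgue_on \<Omega>) (\<lambda>x. (f x)\<^sup>2) = (norm k)\<^sup>2"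
proof -
  have m: "(\<lambda>x. (norm (rep k x))\<^sup>2) \<in> borel_measurable borel" by measurable
  have f2: "AE x in lborel. x \<in> \<Omega> \<longrightarrow> (f x)\<^sup>2 = (norm (rep k x))\<^sup>2"
    using f by eventually_elim (simp add: norm_Pair_sq)
  have "integral\<^sup>L (lebesgue_on \<Omega>) (\<lambda>x. (f x)\<^sup>2) = (LINT x|lborel. indicator \<Omega> x *\<^sub>R (norm (rep k x))\<^sup>2)"
    by (rule leb_on_integral[OF \<Omega> m f2])
  also have "\<dots> = (LINT x|lborel. (norm (rep k x))\<^sup>2)"
  proof (rule integral_cong_AE)
    show "(\<lambda>x. indicator \<Omega> x *\<^sub>R (norm (rep k x))\<^sup>2) \<in> borel_measurable lborel"
      using \<Omega> m by (intro borel_measurable_scaleR borel_measurable_indicator) auto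
    show "AE x in lborel. indicator \<Omega> x *\<^sub>R (norm (rep k x))\<^sup>2 = (norm (rep k x))\<^sup>2"
      using f by eventually_elim (simp add: indicator_def)
  qed (use m in simp)
  finally show ?thesis by (simp add: norm_l2_sq)
qed

lemma continuous_Jt: "continuous_on {0..T} (\<lambda>t. inner (Jt q t) k)"
proof -
  have "continuous_on {0..T} (Jt q)"
    unfolding continuous_on
  proof
    fix s assume s: "s \<in> {0..T}"
    show "(Jt q \<longlongrightarrow> Jt q s) (at s within {0..T})"
    proof (rule LIM_zero_cancel, rule Lim_null_comparison)
      show "\<forall>\<^sub>F t in at s within {0..T}. norm (Jt q t - Jt q s) \<le> sqrt \<bar>t - s\<bar> * norm q"
        unfolding eventually_at_filter
      proof (rule always_eventually, intro allI impI)
        fix t assume "t \<in> {0..T}"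
        then show "norm (Jt q t - Jt q s) \<le> sqrt \<bar>t - s\<bar> * norm q"
          using s norm_Jt_diff[of s t q] norm_Jt_diff[of t s q]
          by (cases "s \<le> t") (auto simp: norm_minus_commute)
      qed
      have "((\<lambda>t. sqrt \<bar>t - s\<bar> * norm q) \<longlongrightarrow> sqrt \<bar>s - s\<bar> * norm q) (at s within {0..T})"
        by (intro tendsto_intros)
      then show "((\<lambda>t. sqrt \<bar>t - s\<bar> * norm q) \<longlongrightarrow> 0) (at s within {0..T})" by simp
    qed
  qed
  then show ?thesis by (intro continuous_intros)
qed

context heat
begin

text \<open>Against a test function in space both sides have the same weak derivative in time, so
  their difference is constant by \<open>du_bois_reymond\<close> and zero at time 0; density of the
  test functions gives all \<open>k\<close>.\<close>

lemma time_deriv_primitive: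
  assumes h: "rel h u" and td: "time_deriv \<Omega> T u U" and q: "\<And>z v. rel z v \<Longrightarrow> U v = inner q z"
    and w: "continuous_on {0..T} w" "w 0 = 0" and ae: "AE t in lborel. 0 < t \<and> t < T \<longrightarrow> w t = P0 (sec h t)"
    and t: "t \<in> {0..T}" and k: "k \<in> H10s \<Omega>"
  shows "inner (w t) k = inner (Jt q t) k"
proof -
  have "inner k (w t) = inner k (Jt q t)"
  proof (rule inner_closure_eq[OF k[unfolded H10s_def]])
    fix s assume "s \<in> TF \<Omega>"
    then obtain \<phi> where \<phi>: "s = mk (tpair \<phi>)" "test_fun \<Omega> \<phi>" by (auto simp: TF_def)
    define B where "B t = inner (w t) s - inner (Jt q t) s" for t
    have wc: "continuous_on {0..T} (\<lambda>t. inner (w t) s)" using w(1) by (intro continuous_intros)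
    have Bc: "continuous_on {0..T} B" unfolding B_def by (intro continuous_on_diff wc continuous_Jt)
    have "B t = B 0"
    proof (rule du_bois_reymond[OF T_pos Bc _ t])
      fix \<eta> :: "real \<Rightarrow> real" assume \<eta>: "test_fun {0<..<T} \<eta>"
      have dc: "continuous_on {0..T} (deriv \<eta>)"
        using real_test_fun(3)[of \<eta>] \<eta> by (auto simp: test_fun_def intro: continuous_on_subset)
      have i: "integrable lborel (\<lambda>t. deriv \<eta> t * (indicator {0..T} t * g t))" if "continuous_on {0..T} g" for g
      proof -
        have "integrable lborel (\<lambda>t. indicator {0..T} t *\<^sub>R (deriv \<eta> t * g t))"
          by (rule borel_integrable_compact[OF compact_Icc continuous_on_mult[OF dc that]])
        then show ?thesis by (simp add: mult.left_commute)
      qed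
      have "(LINT t|lborel. deriv \<eta> t * (indicator {0..T} t * B t))
        = (LINT t|lborel. deriv \<eta> t * (indicator {0..T} t * inner (w t) s) - deriv \<eta> t * (indicator {0..T} t * inner (Jt q t) s))"
        by (simp add: B_def algebra_simps)
      also have "\<dots> = (LINT t|lborel. deriv \<eta> t * (indicator {0..T} t * inner (w t) s))
        - (LINT t|lborel. deriv \<eta> t * (indicator {0..T} t * inner (Jt q t) s))"
        by (rule Bochner_Integration.integral_diff[OF i[OF wc] i[OF continuous_Jt]])
      also have "(LINT t|lborel. deriv \<eta> t * (indicator {0..T} t * inner (w t) s)) = - U (\<lambda>t x. \<eta> t * \<phi> x)"
        using test_integral[OF h w(1) ae \<eta> \<phi>(2)] td \<eta> \<phi> unfolding time_deriv_def by simp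
      also have "U (\<lambda>t x. \<eta> t * \<phi> x) = inner q (tens \<eta> s)" unfolding \<phi>(1) by (rule q[OF test_tens[OF \<eta> \<phi>(2)]])
      also have "(LINT t|lborel. deriv \<eta> t * (indicator {0..T} t * inner (Jt q t) s)) = - inner q (tens \<eta> s)"
        by (rule test_primitive[OF \<eta>])
      finally show "(LINT t|lborel. deriv \<eta> t * (indicator {0..T} t * B t)) = 0" by simp
    qed
    moreover have "inner (Jt q 0) s = 0" using inner_tens(1)[OF sqi_Ioo[of 0 0], of q s] by (simp add: inner_Jt)
    ultimately show "inner s (w t) = inner s (Jt q t)" using w(2) by (simp add: B_def inner_commute)
  qed
  then show ?thesis by (simp add: inner_commute)
qed

text \<open>For elements with zero gradient part the integral over \<Omega> is the squared norm, so
  the continuity in \<open>zero_initial\<close> becomes norm continuity of a curve in the Hilbert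
  space.\<close>

lemma zero_initialE:
  assumes h: "rel h u" and z: "zero_initial \<Omega> T u"
  obtains w where "continuous_on {0..T} w" "w 0 = 0" "AE t in lborel. 0 < t \<and> t < T \<longrightarrow> w t = P0 (sec h t)"
proof -
  obtain w where w: "AE p in lborel. p \<in> cyl T \<Omega> \<longrightarrow> w (fst p) (snd p) = u (fst p) (snd p)"
    "\<forall>t\<in>{0..T}. L2 \<Omega> (w t)"
    "\<forall>s\<in>{0..T}. ((\<lambda>t. integral\<^sup>L (lebesgue_on \<Omega>) (\<lambda>x. (w t x - w s x)\<^sup>2)) \<longlongrightarrow> 0) (at s within {0..T})"
    "integral\<^sup>L (lebesgue_on \<Omega>) (\<lambda>x. (w 0 x)\<^sup>2) = 0"
    using z unfolding zero_initial_def AE_leb_on[OF cyl_borel] by blast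
  have hW: "h \<in> W" and v: "AE p in lborel. p \<in> cyl T \<Omega> \<longrightarrow> fst (rep h p) = u (fst p) (snd p)"
    using h by (auto simp: rel_def)
  have "\<exists>k. t \<in> {0..T} \<longrightarrow> (AE x in lborel. rep k x = (if x \<in> \<Omega> then (w t x, 0 :: 'a) else 0))" for t
  proof (cases "t \<in> {0..T}")
    case True
    then have L: "w t \<in> borel_measurable (lebesgue_on \<Omega>)" "integrable (lebesgue_on \<Omega>) (\<lambda>x. (norm (w t x))\<^sup>2)"
      using w(2) by (auto simp: L2_def)
    obtain k where "AE x in lborel. rep k x = (if x \<in> \<Omega> then (w t x, 0 :: 'a) else 0)"
      by (rule L2_rep[OF \<Omega>_borel, of "\<lambda>x. (w t x, 0 :: 'a)"]) (use L in \<open>auto simp: norm_Pair\<close>)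
    then show ?thesis by blast
  next
    case False
    then show ?thesis by (intro exI impI) (erule notE)
  qed
  then obtain ww where ww0: "\<forall>t. t \<in> {0..T} \<longrightarrow> (AE x in lborel. rep (ww t) x = (if x \<in> \<Omega> then (w t x, 0 :: 'a) else 0))"
    using choice[of "\<lambda>t k. t \<in> {0..T} \<longrightarrow> (AE x in lborel. rep k x = (if x \<in> \<Omega> then (w t x, 0 :: 'a) else 0))"] by blast
  then have ww: "AE x in lborel. rep (ww t) x = (if x \<in> \<Omega> then (w t x, 0 :: 'a) else 0)" if "t \<in> {0..T}" for t
    using that by blast
  have d: "integral\<^sup>L (lebesgue_on \<Omega>) (\<lambda>x. (w t x - w s x)\<^sup>2) = (norm (ww t - ww s))\<^sup>2" if "t \<in> {0..T}" "s \<in> {0..T}" for t s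
    by (rule sq_integral_eq[OF \<Omega>_borel])
      (use ww[OF that(1)] ww[OF that(2)] rep_diff[of "ww t" "ww s"] in \<open>eventually_elim, auto simp: zero_prod_def\<close>)
  show ?thesis
  proof (rule that[of ww])
    show "continuous_on {0..T} ww" unfolding continuous_on
    proof
      fix s assume s: "s \<in> {0..T}"
      have "((\<lambda>t. sqrt (integral\<^sup>L (lebesgue_on \<Omega>) (\<lambda>x. (w t x - w s x)\<^sup>2))) \<longlongrightarrow> sqrt 0) (at s within {0..T})"
        by (rule tendsto_real_sqrt) (use w(3) s in blast)
      moreover have "\<forall>\<^sub>F t in at s within {0..T}. sqrt (integral\<^sup>L (lebesgue_on \<Omega>) (\<lambda>x. (w t x - w s x)\<^sup>2)) = norm (ww t - ww s)"
        unfolding eventually_at_filter by (rule always_eventually) (simp add: d[OF _ s] del: atLeastAtMost_iff)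
      ultimately have "((\<lambda>t. norm (ww t - ww s)) \<longlongrightarrow> sqrt 0) (at s within {0..T})" by (rule Lim_transform_eventually)
      then show "(ww \<longlongrightarrow> ww s) (at s within {0..T})"
        using LIM_zero_cancel[OF tendsto_norm_zero_cancel, of ww "ww s" "at s within {0..T}"] by simp
    qed
    have "(norm (ww 0))\<^sup>2 = 0"
      using sq_integral_eq[OF \<Omega>_borel ww[of 0]] T_pos w(4) by simp
    then show "ww 0 = 0" by simp
    show "AE t in lborel. 0 < t \<and> t < T \<longrightarrow> ww t = P0 (sec h t)"
      using AE_slice[OF w(1)] AE_slice[OF v] rep_sec[of h] AE_slice[OF W_zero_outside[OF hW]]
    proof eventually_elim
      case (elim t)
      show ?case
      proof
        assume t: "0 < t \<and> t < T"
        then have "t \<in> {0..T}" by simp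
        from ww[OF this] show "ww t = P0 (sec h t)"
        proof (intro l2_eqI)
          assume *: "AE x in lborel. rep (ww t) x = (if x \<in> \<Omega> then (w t x, 0 :: 'a) else 0)"
          show "AE x in lborel. rep (ww t) x = rep (P0 (sec h t)) x"
            using * elim rep_P0[of "sec h t"] by eventually_elim (use t in \<open>auto simp: zero_prod_def\<close>)
        qed
      qed
    qed
  qed
qed

text \<open>Taking \<sigma> to be the observable of the continuous representative freezes the
  coefficient, and \<open>weak_imp_Sol\<close> applies to the resulting linear problem. Its
  representative agrees with the given one at every time by continuity.\<close>

lemma Sol_if_weak_solution:
  assumes f: "\<And>h v. rel h v \<Longrightarrow> F v = inner f h" and ws: "weak_solution \<Omega> T a F u"
  obtains \<sigma> h w where "rel h u" "continuous_on {0..T} \<sigma>" "Sol (lag 0 \<sigma>) f h w" "\<And>t. t \<in> {0..T} \<Longrightarrow> obs w t = \<sigma> t"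
proof -
  obtain Gu U where Gu: "W_grad \<Omega> T u Gu" and td: "time_deriv \<Omega> T u U" and zi: "zero_initial \<Omega> T u"
    and eq: "\<And>v Gv. W_grad \<Omega> T v Gv \<Longrightarrow> U v + integral\<^sup>L (lebesgue_on (cyl T \<Omega>))
        (\<lambda>(t, x). a (l_int \<Omega> (u t)) * (Gu t x \<bullet> Gv t x)) = F v"
    using ws unfolding weak_solution_def inV_def by blast
  obtain h where h: "rel h u" and hG: "AE p in lborel. p \<in> cyl T \<Omega> \<longrightarrow> snd (rep h p) = Gu (fst p) (snd p)"
    using W_grad_rel[OF Gu] by blast
  have hW: "h \<in> W" and v: "AE p in lborel. p \<in> cyl T \<Omega> \<longrightarrow> fst (rep h p) = u (fst p) (snd p)"
    using h by (auto simp: rel_def)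
  have "in_Wdual \<Omega> T U" using td by (simp add: time_deriv_def)
  from Wdual_riesz[OF this] obtain q where q: "\<forall>z v. rel z v \<longrightarrow> U v = inner q z" by blast
  from zero_initialE[OF h zi] obtain w where w: "continuous_on {0..T} w" "w 0 = 0"
    and ae: "AE t in lborel. 0 < t \<and> t < T \<longrightarrow> w t = P0 (sec h t)" by blast
  define \<sigma> where "\<sigma> = obs w"
  have \<sigma>: "continuous_on {0..T} \<sigma>" unfolding \<sigma>_def obs_def using w(1) by (intro continuous_intros)
  note c = coef_lag[OF \<sigma>, of 0]
  have l: "AE t in lborel. 0 < t \<and> t < T \<longrightarrow> l_int \<Omega> (u t) = \<sigma> t" using ae rep_sec[of h] AE_slice[OF v]
  proof eventually_elim
    case (elim t)
    show ?case
    proof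
      assume t: "0 < t \<and> t < T"
      have "AE x in lborel. x \<in> \<Omega> \<longrightarrow> u t x = fst (rep (w t) x)"
        using elim(2,3) rep_P0[of "sec h t"] by eventually_elim (use elim(1) t in auto)
      then show "l_int \<Omega> (u t) = \<sigma> t" unfolding \<sigma>_def obs_def by (rule l_int_eq)
    qed
  qed
  have E: "inner q z + inner (tm (lag 0 \<sigma>) (P1 h)) z = inner f z" if z: "z \<in> W" for z
  proof -
    note r = relI[OF z]
    have "integral\<^sup>L (lebesgue_on (cyl T \<Omega>)) (\<lambda>(t, x). a (l_int \<Omega> (u t)) * (Gu t x \<bullet> snd (rep z (t, x))))
        = inner (tm (lag 0 \<sigma>) (P1 h)) z"
      by (rule diffusion_integral[OF \<sigma> l hG z]) simp
    then show ?thesis using eq[OF rel_W_grad(1)[OF r]] q f[OF r] r by simp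
  qed
  obtain w2 where S: "Sol (lag 0 \<sigma>) f h w2" and w2: "AE t in lborel. 0 < t \<and> t < T \<longrightarrow> w2 t = w t"
  proof (rule weak_imp_Sol[OF c hW _ ae])
    fix t k assume t: "t \<in> {0..T}" and k: "k \<in> H10s \<Omega>"
    have "inner (w t) k = inner (Jt q t) k"
      by (rule time_deriv_primitive[OF h td _ w ae t k]) (use q in blast)
    \<comment> \<open>The equation tested with the tensor over (0,t) is the integrated equation at
      time \<open>t\<close>.\<close>
    then show "inner (w t) k + inner (tm (lag 0 \<sigma>) (P1 h)) (tens (ind t) k) = inner f (tens (ind t) k)"
      using E[OF W_tens_Ioo[of 0 t k]] t k by (simp add: inner_Jt)
  qed blast
  have "w2 t = w t" if "t \<in> {0..T}" for t
    by (rule continuous_AE_eq[OF T_pos Sol_cont[OF c S] w(1) w2 that])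
  then have "obs w2 t = \<sigma> t" if "t \<in> {0..T}" for t using that by (simp add: \<sigma>_def obs_def)
  then show ?thesis by (rule that[OF h \<sigma> S])
qed

end

theorem theorem3p1:
  fixes \<Omega> :: "'a::euclidean_space set" and T m M L\<^sub>M :: real
    and a :: "real \<Rightarrow> real" and F :: "(real \<Rightarrow> 'a \<Rightarrow> real) \<Rightarrow> real"
  assumes "lipschitz_domain \<Omega>"
    and "T > 0"
    and "\<forall>s. a s > 0"
    and "0 < m" and "m \<le> M"
    and "\<forall>s. m \<le> a s \<and> a s \<le> M"
    and "L\<^sub>M-lipschitz_on UNIV a"
    and "in_Wdual \<Omega> T F"
  shows "\<exists>u. weak_solution \<Omega> T a F u \<and>
           (\<forall>u'. weak_solution \<Omega> T a F u' \<longrightarrow>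
              (AE p in lebesgue_on (cyl T \<Omega>). u' (fst p) (snd p) = u (fst p) (snd p)))"
proof -
  interpret heat \<Omega> T m M "L\<^sub>M" a
    by unfold_locales (use assms in \<open>auto simp: lipschitz_domain_def\<close>)
  from Wdual_riesz[OF assms(8)] obtain f where "\<forall>h v. rel h v \<longrightarrow> F v = inner f h" by blast
  then have f: "F v = inner f h" if "rel h v" for h v using that by blast
  show ?thesis
  proof (rule fixed_point_exists[of f])
    fix \<sigma> h w assume \<sigma>: "continuous_on {0..T} \<sigma>" and S: "Sol (lag 0 \<sigma>) f h w"
      and o: "\<And>t. t \<in> {0..T} \<Longrightarrow> obs w t = \<sigma> t"
    show ?thesis
    proof (intro exI[of _ "\<lambda>t x. fst (rep h (t, x))"] conjI allI impI)
      show "weak_solution \<Omega> T a F (\<lambda>t x. fst (rep h (t, x)))" by (rule weak_solution_if_Sol[OF f \<sigma> S o])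
      fix u' assume ws: "weak_solution \<Omega> T a F u'"
      show "AE p in lebesgue_on (cyl T \<Omega>). u' (fst p) (snd p) = fst (rep h (fst p, snd p))"
      proof (rule Sol_if_weak_solution[OF f ws])
        fix \<sigma>' h' w' assume r: "rel h' u'" and s: "continuous_on {0..T} \<sigma>'" "Sol (lag 0 \<sigma>') f h' w'"
          "\<And>t. t \<in> {0..T} \<Longrightarrow> obs w' t = \<sigma>' t"
        \<comment> \<open>Both are fixed points for the same \<open>f\<close>; equality of the
          vectors is equality almost everywhere of the functions on the cylinder.\<close>
        have "h' = h" by (rule fixed_point_unique[OF s \<sigma> S o])
        then have "AE p in lborel. p \<in> cyl T \<Omega> \<longrightarrow> fst (rep h p) = u' (fst p) (snd p)" using r by (simp add: rel_def)
        then show ?thesis unfolding AE_leb_on[OF cyl_borel] by eventually_elim simp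
      qed
    qed
  qed
qed

end
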